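(* For any constant $\epsilon>0$, given a balanced list decodable coding scheme with constant list size that tolerates error rate $1/2 - \epsilon$, there is an adaptive unique decoding coding scheme that tolerates error rate $2/7 - 2\epsilon$ and has, up to constant factors, the same round complexity, alphabet size and computational complexity as the given list decodable scheme.
   Context: Interactive coding setting. Coding schemes simulate an $n$-round two-party protocol $\Pi$ (between Alice and Bob) by a protocol $\Pi'$ with $N$ rounds over a constant-size alphabet; an adversary may replace any transmitted symbol arbitrarily (a corruption), and error rate $\rho$ means at most $\rho N$ rounds contain corruptions. In a non-adaptive scheme, which party transmits in a round is fixed in advance, exactly one per round. In an adaptive scheme, each party's decision to transmit or listen may depend on its communication history; if both transmit nothing is delivered, and if both listen the adversary chooses the received symbols without this counting as an error. A scheme is balanced if it is non-adaptive and in any execution both parties transmit equally often. Unique decoding: from any execution with at most a $\rho$ fraction of corruptions, both parties output the transcript of the error-free execution of $\Pi$. $s$-list decoding: each party outputs a list of at most $s$ transcripts containing that transcript. Computational complexity counts computation steps over the $N$ rounds, with each oracle access to $\Pi$ counted as one step. *)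

theory Defs
  imports Complex_Main
begin

subsection \<open>Protocols to be simulated\<close>

datatype party = Alice | Bob

fun peer :: "party \<Rightarrow> party" where
  "peer Alice = Bob"
| "peer Bob = Alice"

datatype action = Listen | Transmit nat

text \<open>
  The symbols of an alphabet of size \<open>q\<close> are the numbers below \<open>q\<close>. \<open>\<Pi> p\<close> is the next-message
  function of party \<open>p\<close>, with the private input of \<open>p\<close> already supplied; statements that range over
  all \<open>\<Pi>\<close> thus range over all protocols and all inputs. Without noise both parties see the same
  symbols, so the history is the list of symbols exchanged so far. Who speaks may depend on that
  history, which includes the case of an order fixed in advance.
\<close>

type_synonym next_message = "nat list \<Rightarrow> action"

definition protocol :: "nat \<Rightarrow> nat \<Rightarrow> (party \<Rightarrow> next_message) \<Rightarrow> bool" where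
  "protocol q n \<Pi> \<longleftrightarrow>
     (\<forall>h. length h < n \<and> set h \<subseteq> {..<q} \<longrightarrow>
        (\<exists>p. \<exists>a<q. \<Pi> p h = Transmit a \<and> \<Pi> (peer p) h = Listen))"

definition sent_symbol :: "(party \<Rightarrow> next_message) \<Rightarrow> nat list \<Rightarrow> nat" where
  "sent_symbol \<Pi> h = (THE a. \<exists>p. \<Pi> p h = Transmit a)"

primrec transcript :: "(party \<Rightarrow> next_message) \<Rightarrow> nat \<Rightarrow> nat list" where
  "transcript \<Pi> 0 = []"
| "transcript \<Pi> (Suc k) = transcript \<Pi> k @ [sent_symbol \<Pi> (transcript \<Pi> k)]"

subsection \<open>Coding schemes and the noisy channel\<close>

text \<open>
  A party knows its own next-message function and what it received in the rounds so far, where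
  \<^term>\<open>None\<close> stands for a round in which it transmitted and hence received nothing. Its own earlier
  transmissions are determined by these data.
\<close>

type_synonym view = "nat option list"

record scheme =
  rounds :: nat
  alphabet :: nat
  act :: "party \<Rightarrow> next_message \<Rightarrow> view \<Rightarrow> action"
  outcome :: "party \<Rightarrow> next_message \<Rightarrow> view \<Rightarrow> nat list list"

definition action_at ::
    "scheme \<Rightarrow> (party \<Rightarrow> next_message) \<Rightarrow> (party \<Rightarrow> view) \<Rightarrow> party \<Rightarrow> nat \<Rightarrow> action" where
  "action_at S \<Pi> v p r = act S p (\<Pi> p) (take r (v p))"

definition transmits ::
    "scheme \<Rightarrow> (party \<Rightarrow> next_message) \<Rightarrow> (party \<Rightarrow> view) \<Rightarrow> party \<Rightarrow> nat \<Rightarrow> bool" where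
  "transmits S \<Pi> v p r \<longleftrightarrow> (\<exists>x. action_at S \<Pi> v p r = Transmit x)"

text \<open>
  A listening party always receives some symbol of the alphabet, possibly altered by the adversary
  if the other party transmits, and chosen by the adversary if the other party listens as well. If
  both transmit, nothing is delivered. Only altering a symbol that is transmitted to a listening
  party counts as a corruption.
\<close>

definition execution :: "scheme \<Rightarrow> (party \<Rightarrow> next_message) \<Rightarrow> (party \<Rightarrow> view) \<Rightarrow> bool" where
  "execution S \<Pi> v \<longleftrightarrow>
     (\<forall>p. length (v p) = rounds S \<and>
        (\<forall>r<rounds S. case action_at S \<Pi> v p r of
            Transmit x \<Rightarrow> v p ! r = None
          | Listen \<Rightarrow> (\<exists>y<alphabet S. v p ! r = Some y)))"

definition corrupted ::
    "scheme \<Rightarrow> (party \<Rightarrow> next_message) \<Rightarrow> (party \<Rightarrow> view) \<Rightarrow> nat \<Rightarrow> bool" where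
  "corrupted S \<Pi> v r \<longleftrightarrow>
     (\<exists>p x. action_at S \<Pi> v p r = Transmit x \<and> action_at S \<Pi> v (peer p) r = Listen \<and>
        v (peer p) ! r \<noteq> Some x)"

definition corruptions :: "scheme \<Rightarrow> (party \<Rightarrow> next_message) \<Rightarrow> (party \<Rightarrow> view) \<Rightarrow> nat" where
  "corruptions S \<Pi> v = card {r. r < rounds S \<and> corrupted S \<Pi> v r}"

text \<open>In general a scheme is adaptive: \<^term>\<open>act\<close> may depend on the view in any way.\<close>

definition coding_scheme :: "nat \<Rightarrow> nat \<Rightarrow> scheme \<Rightarrow> bool" where
  "coding_scheme q n S \<longleftrightarrow> 0 < rounds S \<and> 0 < alphabet S \<and>
     (\<forall>\<Pi> v p r x. protocol q n \<Pi> \<and> execution S \<Pi> v \<and> r < rounds S \<and>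
        action_at S \<Pi> v p r = Transmit x \<longrightarrow> x < alphabet S)"

definition non_adaptive :: "nat \<Rightarrow> nat \<Rightarrow> scheme \<Rightarrow> bool" where
  "non_adaptive q n S \<longleftrightarrow>
     (\<exists>speaker :: nat \<Rightarrow> party. \<forall>\<Pi> v p r. protocol q n \<Pi> \<and> execution S \<Pi> v \<and> r < rounds S \<longrightarrow>
        (transmits S \<Pi> v p r \<longleftrightarrow> speaker r = p))"

definition balanced :: "nat \<Rightarrow> nat \<Rightarrow> scheme \<Rightarrow> bool" where
  "balanced q n S \<longleftrightarrow> non_adaptive q n S \<and>
     (\<forall>\<Pi> v. protocol q n \<Pi> \<and> execution S \<Pi> v \<longrightarrow>
        card {r. r < rounds S \<and> transmits S \<Pi> v Alice r} =
        card {r. r < rounds S \<and> transmits S \<Pi> v Bob r})"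

definition list_decodes :: "nat \<Rightarrow> nat \<Rightarrow> nat \<Rightarrow> real \<Rightarrow> scheme \<Rightarrow> bool" where
  "list_decodes q n s \<rho> S \<longleftrightarrow>
     (\<forall>\<Pi> v p. protocol q n \<Pi> \<and> execution S \<Pi> v \<and>
        real (corruptions S \<Pi> v) \<le> \<rho> * real (rounds S) \<longrightarrow>
        length (outcome S p (\<Pi> p) (v p)) \<le> s \<and>
        transcript \<Pi> n \<in> set (outcome S p (\<Pi> p) (v p)))"

definition uniquely_decodes :: "nat \<Rightarrow> nat \<Rightarrow> real \<Rightarrow> scheme \<Rightarrow> bool" where
  "uniquely_decodes q n \<rho> S \<longleftrightarrow>
     (\<forall>\<Pi> v p. protocol q n \<Pi> \<and> execution S \<Pi> v \<and>
        real (corruptions S \<Pi> v) \<le> \<rho> * real (rounds S) \<longrightarrow>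
        outcome S p (\<Pi> p) (v p) = [transcript \<Pi> n])"

subsection \<open>Computation steps\<close>

text \<open>
  Programs are structured programs of a unit-cost random access machine with addition and
  truncated subtraction, finitely many registers and finitely many arrays (a program mentions only
  finitely many of the numbered ones). \<open>Query x A y\<close> asks the oracle, in one step, for its action on
  the history stored in the first \<open>reg y\<close> cells of array \<open>A\<close>.
\<close>

datatype com =
    Skip
  | Const nat nat
  | Add nat nat nat
  | Sub nat nat nat
  | Load nat nat nat
  | Store nat nat nat
  | Query nat nat nat
  | Seq com com
  | IfLess nat nat com com
  | WhileLess nat nat com

record state =
  reg :: "nat \<Rightarrow> nat"
  arr :: "nat \<Rightarrow> nat \<Rightarrow> nat"

definition set_reg :: "nat \<Rightarrow> nat \<Rightarrow> state \<Rightarrow> state" where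
  "set_reg x k s = s\<lparr>reg := (reg s)(x := k)\<rparr>"

definition set_arr :: "nat \<Rightarrow> nat \<Rightarrow> nat \<Rightarrow> state \<Rightarrow> state" where
  "set_arr A i k s = s\<lparr>arr := (arr s)(A := (arr s A)(i := k))\<rparr>"

fun action_code :: "action \<Rightarrow> nat" where
  "action_code Listen = 0"
| "action_code (Transmit a) = Suc a"

fun received_code :: "nat option \<Rightarrow> nat" where
  "received_code None = 0"
| "received_code (Some a) = Suc a"

text \<open>\<open>exec f c s t s'\<close>: with oracle \<open>f\<close>, the program \<open>c\<close> started in \<open>s\<close> halts in \<open>s'\<close> after \<open>t\<close> steps.\<close>

inductive exec :: "next_message \<Rightarrow> com \<Rightarrow> state \<Rightarrow> nat \<Rightarrow> state \<Rightarrow> bool"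
  for f :: next_message where
  Skip: "exec f Skip s 1 s"
| Const: "exec f (Const x k) s 1 (set_reg x k s)"
| Add: "exec f (Add x y z) s 1 (set_reg x (reg s y + reg s z) s)"
| Sub: "exec f (Sub x y z) s 1 (set_reg x (reg s y - reg s z) s)"
| Load: "exec f (Load x A y) s 1 (set_reg x (arr s A (reg s y)) s)"
| Store: "exec f (Store A x y) s 1 (set_arr A (reg s x) (reg s y) s)"
| Query: "exec f (Query x A y) s 1 (set_reg x (action_code (f (map (arr s A) [0..<reg s y]))) s)"
| Seq: "exec f c1 s t1 s1 \<Longrightarrow> exec f c2 s1 t2 s2 \<Longrightarrow> exec f (Seq c1 c2) s (t1 + t2) s2"
| IfTrue: "reg s x < reg s y \<Longrightarrow> exec f c1 s t s1 \<Longrightarrow> exec f (IfLess x y c1 c2) s (1 + t) s1"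
| IfFalse: "\<not> reg s x < reg s y \<Longrightarrow> exec f c2 s t s1 \<Longrightarrow> exec f (IfLess x y c1 c2) s (1 + t) s1"
| WhileFalse: "\<not> reg s x < reg s y \<Longrightarrow> exec f (WhileLess x y c) s 1 s"
| WhileTrue: "reg s x < reg s y \<Longrightarrow> exec f c s t1 s1 \<Longrightarrow> exec f (WhileLess x y c) s1 t2 s2 \<Longrightarrow>
    exec f (WhileLess x y c) s (1 + t1 + t2) s2"

text \<open>
  A party runs its round program once per round, keeping its memory between rounds, and its output
  program after the last round. Registers 0, 1, 2 initially hold \<open>n\<close>, the number of rounds and the
  alphabet size. Register 3 is set by the channel to the code of what was received, and register 4
  holds the code of the action that the round program chose. The output program leaves the number
  of transcripts in register 5 and the transcripts, each of length \<open>n\<close>, one after the other in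
  array 0.
\<close>

definition initial_state :: "nat \<Rightarrow> scheme \<Rightarrow> state" where
  "initial_state n S =
     \<lparr>reg = (\<lambda>_. 0)(0 := n, 1 := rounds S, 2 := alphabet S), arr = (\<lambda>_ _. 0)\<rparr>"

definition stored_lists :: "nat \<Rightarrow> state \<Rightarrow> nat list list" where
  "stored_lists n s = map (\<lambda>j. map (\<lambda>i. arr s 0 (j * n + i)) [0..<n]) [0..<reg s 5]"

text \<open>
  \<open>reaches f c s0 v s t\<close>: the round program \<open>c\<close>, having received \<open>v\<close>, is in state \<open>s\<close> at the
  beginning of the next round, after \<open>t\<close> steps in total.
\<close>

inductive reaches :: "next_message \<Rightarrow> com \<Rightarrow> state \<Rightarrow> view \<Rightarrow> state \<Rightarrow> nat \<Rightarrow> bool"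
  for f :: next_message and c :: com and s0 :: state where
  start: "reaches f c s0 [] s0 0"
| round: "reaches f c s0 v s t \<Longrightarrow> exec f c s t' s' \<Longrightarrow>
    reaches f c s0 (v @ [x]) (set_reg 3 (received_code x) s') (t + t')"

text \<open>
  The programs are the same for all \<open>n\<close>. The bound \<open>T n\<close> holds for each party in every execution,
  whatever the number of corruptions.
\<close>

definition computable_within :: "nat \<Rightarrow> (nat \<Rightarrow> scheme) \<Rightarrow> (nat \<Rightarrow> nat) \<Rightarrow> bool" where
  "computable_within q S T \<longleftrightarrow>
     (\<exists>round_prog output_prog :: party \<Rightarrow> com. \<forall>n \<Pi> v p.
        protocol q n \<Pi> \<and> execution (S n) \<Pi> v \<longrightarrow>
        (\<forall>r<rounds (S n). \<exists>s t s' t'.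
           reaches (\<Pi> p) (round_prog p) (initial_state n (S n)) (take r (v p)) s t \<and>
           exec (\<Pi> p) (round_prog p) s t' s' \<and>
           reg s' 4 = action_code (action_at (S n) \<Pi> v p r)) \<and>
        (\<exists>s t s' t'.
           reaches (\<Pi> p) (round_prog p) (initial_state n (S n)) (v p) s t \<and>
           exec (\<Pi> p) (output_prog p) s t' s' \<and>
           stored_lists n s' = outcome (S n) p (\<Pi> p) (v p) \<and>
           t + t' \<le> T n))"

end

theory Submission
  imports Defs "HOL-Library.Nat_Bijection"
begin

text \<open>
  Let \<open>N\<close> be the number of rounds of the list decodable scheme \<open>S\<close>. The unique decoding scheme runs \<open>S\<close> in each
  of \<open>6 d\<close> blocks of \<open>N\<close> rounds, where \<open>d\<close> is about \<open>1 / (16 \<epsilon>)\<close>. At the end of a block each party keeps those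
  transcripts of its list that agree with its own next-message function. From then on it attaches to every
  transmitted symbol one symbol of an encoding of each transcript kept so far, and it counts how many received
  symbols support each of its own candidates. Two candidates that are consistent with one party each and
  different from each other have encodings of relative distance close to 1, so a wrong candidate can only be supported
  by corrupted symbols, up to a small loss; spoiling a block costs the adversary \<open>(1 / 2 - \<epsilon>) N\<close> corruptions
  but removes only \<open>N / 2\<close> received symbols of support. After the \<open>6 d\<close> blocks a party with exactly one candidate
  above \<open>d N\<close> is certain. In the last \<open>d N\<close> rounds a certain party only transmits and any other party only
  listens, and every party finally outputs its first candidate with at least \<open>d N\<close> (certain) or \<open>2 d N\<close>
  (not certain) supporting symbols. With at most \<open>(2 - 14 \<epsilon>) d N\<close> corruptions this is the true transcript.

  The encoding needs relative distance close to 1, a constant alphabet and linear time. Such a code comes from \<open>S\<close>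
  itself. The noise-free run of \<open>S\<close> on the protocol in which Bob sends the string \<open>M\<close> is a code word that
  determines \<open>M\<close> up to the list that \<open>S\<close> outputs. The first position where \<open>M\<close> differs from each list entry,
  Hadamard encoded, removes this ambiguity, and the resulting constant distance is amplified by walks on an expander
  on a square torus, whose spectral gap follows from Fourier analysis.
\<close>

section \<open>Programs\<close>

text \<open>The rate \<open>2 / 7\<close> comes from a balance with budget \<open>2 d N\<close>. A
  wrong candidate costs about one corruption per supporting symbol, so keeping both parties
  uncertain at level \<open>d N\<close> would exceed the budget, and even the whole budget cannot
  lift a wrong candidate to \<open>2 d N\<close>. An uncertain party hears \<open>d N\<close>
  symbols in the last phase, which lifts the truth from \<open>d N\<close> to \<open>2 d N\<close>.
  The truth reaches \<open>d N\<close> within the blocks since a party hears half of the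
  \<open>6 d N\<close> rounds and loses about one of them per corruption. The slack
  \<open>14 \<epsilon>\<close> in the budget pays for chance agreements of code words, for the block
  in which the truth is found, and for bad blocks that cost slightly less than \<open>N / 2\<close>.
  The obstacle is cost. Candidates are long, but a round carries constantly many bits and the time
  may grow only by a constant factor, on a machine without multiplication. So a code with distance
  near 1 has to be encoded in linear time by programs that are the same for all \<open>n\<close>,
  and every constant must depend only on \<open>q\<close>, \<open>s\<close>, \<open>\<sigma>\<close>
  and \<open>\<epsilon>\<close>.\<close>

inductive_cases exec_SkipE: "exec f Skip s t s'"
inductive_cases exec_ConstE: "exec f (Const x k) s t s'"
inductive_cases exec_AddE: "exec f (Add x y z) s t s'"
inductive_cases exec_SubE: "exec f (Sub x y z) s t s'"
inductive_cases exec_LoadE: "exec f (Load x A y) s t s'"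
inductive_cases exec_StoreE: "exec f (Store A x y) s t s'"
inductive_cases exec_QueryE: "exec f (Query x A y) s t s'"
inductive_cases exec_SeqE: "exec f (Seq c1 c2) s t s'"
inductive_cases exec_IfE: "exec f (IfLess x y c1 c2) s t s'"
inductive_cases exec_WhileE: "exec f (WhileLess x y c) s t s'"

text \<open>\<open>computable_within\<close> grants each round its own existential run; determinism
  is what identifies these runs with prefixes of a single one.\<close>

lemma exec_deterministic:
  assumes "exec f c s t1 s1" "exec f c s t2 s2"
  shows "t1 = t2 \<and> s1 = s2"
  using assms
proof (induction arbitrary: t2 s2 rule: exec.induct)
  case (Seq c1 s u1 s1 c2 u2 z)
  from Seq.prems show ?case
  proof (rule exec_SeqE)
    fix ta sa tb
    assume "exec f c1 s ta sa" "exec f c2 sa tb s2" "t2 = ta + tb"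
    then show ?thesis using Seq.IH by metis
  qed
next
  case (IfTrue s x y c1 t s1 c2)
  from IfTrue.prems show ?case
    by (rule exec_IfE) (use IfTrue.hyps IfTrue.IH[of "t2 - 1" s2] in fastforce)+
next
  case (IfFalse s x y c2 t s1 c1)
  from IfFalse.prems show ?case
    by (rule exec_IfE) (use IfFalse.hyps IfFalse.IH[of "t2 - 1" s2] in fastforce)+
next
  case (WhileFalse s x y c)
  from WhileFalse.prems show ?case
    by (rule exec_WhileE) (use WhileFalse.hyps in auto)
next
  case (WhileTrue s x y c u1 s1 u2 z)
  from WhileTrue.prems show ?case
  proof (rule exec_WhileE)
    assume "\<not> reg s x < reg s y"
    then show ?thesis using WhileTrue.hyps by simp
  next
    fix ta sa tb
    assume "exec f c s ta sa" "exec f (WhileLess x y c) sa tb s2" "t2 = Suc (ta + tb)"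
    then show ?thesis using WhileTrue.IH by (metis add.assoc plus_1_eq_Suc)
  qed
qed (auto elim: exec_SkipE exec_ConstE exec_AddE exec_SubE exec_LoadE exec_StoreE exec_QueryE)

lemma exec_time_pos: "exec f c s t s' \<Longrightarrow> 1 \<le> t"
  by (induction rule: exec.induct) auto

inductive_cases reaches_NilE: "reaches f c s0 [] s t"
inductive_cases reaches_snocE: "reaches f c s0 (v @ [x]) s t"

lemma reaches_deterministic:
  "reaches f c s0 v s t \<Longrightarrow> reaches f c s0 v s' t' \<Longrightarrow> s = s' \<and> t = t'"
proof (induction arbitrary: s' t' rule: reaches.induct)
  case start
  then show ?case by (auto elim: reaches_NilE)
next
  case (round v s t t'' s'' x)
  from round.prems round.hyps round.IH show ?case
    apply (elim reaches_snocE)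
    using exec_deterministic by blast
qed

text \<open>\<open>st r\<close> is the memory at the beginning of round \<open>r\<close>,
  \<open>st' r\<close> the memory after the round program and before the channel overwrites register
  3, and \<open>tm r\<close> the cost of the round. The intermediate states are kept because a copy
  of the program is later advanced one round at a time.\<close>

definition run_chain ::
    "next_message \<Rightarrow> com \<Rightarrow> state \<Rightarrow> view \<Rightarrow> (nat \<Rightarrow> state) \<Rightarrow> (nat \<Rightarrow> state) \<Rightarrow> (nat \<Rightarrow> nat) \<Rightarrow> bool" where
  "run_chain f c s0 v st st' tm \<longleftrightarrow> st 0 = s0 \<and>
     (\<forall>r<length v. exec f c (st r) (tm r) (st' r) \<and>
        st (Suc r) = set_reg 3 (received_code (v ! r)) (st' r))"

lemma reaches_run_chain:
  "reaches f c s0 v s t \<Longrightarrow>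
   \<exists>st st' tm. run_chain f c s0 v st st' tm \<and> st (length v) = s \<and> t = (\<Sum>r<length v. tm r)"
proof (induction rule: reaches.induct)
  case start
  show ?case by (auto simp: run_chain_def intro!: exI[of _ "\<lambda>_. s0"])
next
  case (round v s t t' s' x)
  then obtain st st' tm where ch: "run_chain f c s0 v st st' tm" "st (length v) = s"
    "t = (\<Sum>r<length v. tm r)" by blast
  let ?l = "length v"
  let ?st = "st(Suc ?l := set_reg 3 (received_code x) s')"
  have "run_chain f c s0 (v @ [x]) ?st (st'(?l := s')) (tm(?l := t'))"
    using ch round.hyps by (auto simp: run_chain_def nth_append less_Suc_eq)
  moreover have "(\<Sum>r<?l. (tm(?l := t')) r) = (\<Sum>r<?l. tm r)"
    by (rule sum.cong) auto
  then have "t + t' = (\<Sum>r<length (v @ [x]). (tm(?l := t')) r)"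
    using ch(3) by simp
  moreover have "?st (length (v @ [x])) = set_reg 3 (received_code x) s'" by simp
  ultimately show ?case by blast
qed

lemma run_chain_reaches:
  assumes "run_chain f c s0 v st st' tm" "r \<le> length v"
  shows "reaches f c s0 (take r v) (st r) (\<Sum>i<r. tm i)"
  using assms(2)
proof (induction r)
  case 0
  then show ?case using assms(1) by (auto simp: run_chain_def intro: reaches.start)
next
  case (Suc r)
  then have "reaches f c s0 (take r v @ [v ! r]) (set_reg 3 (received_code (v ! r)) (st' r))
      ((\<Sum>i<r. tm i) + tm r)"
    using assms(1) by (intro reaches.round) (auto simp: run_chain_def)
  then show ?case
    using assms(1) Suc.prems by (simp add: run_chain_def take_Suc_conv_app_nth)
qed

text \<open>The run that reaches the end fixes the chain. By determinism the runs promised for the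
  single rounds pass through its states, so the chosen actions can be read off
  \<open>st'\<close>.\<close>

lemma run_chain_exists:
  assumes "\<forall>r<length v. \<exists>s t s' t'. reaches f c s0 (take r v) s t \<and> exec f c s t' s' \<and> reg s' 4 = a r"
    and "reaches f c s0 v s t"
  obtains st st' tm where "run_chain f c s0 v st st' tm" "st (length v) = s"
    "t = (\<Sum>r<length v. tm r)" "\<And>r. r < length v \<Longrightarrow> reg (st' r) 4 = a r"
proof -
  obtain st st' tm where ch: "run_chain f c s0 v st st' tm" "st (length v) = s"
    "t = (\<Sum>r<length v. tm r)" using reaches_run_chain[OF assms(2)] by blast
  have "reg (st' r) 4 = a r" if r: "r < length v" for r
  proof -
    obtain s1 t1 s2 t2 where "reaches f c s0 (take r v) s1 t1" "exec f c s1 t2 s2" "reg s2 4 = a r"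
      using assms(1) r by blast
    then show ?thesis
      using run_chain_reaches[OF ch(1), of r] r ch(1) reaches_deterministic exec_deterministic
      unfolding run_chain_def by (metis less_imp_le)
  qed
  with ch show thesis using that by blast
qed

section \<open>Total correctness with time bounds\<close>

text \<open>A Hoare triple for total correctness in which \<open>t\<close> is only an upper bound on
  the steps, so that bounds may be rounded up freely.\<close>

definition runs :: "next_message \<Rightarrow> com \<Rightarrow> state \<Rightarrow> (state \<Rightarrow> bool) \<Rightarrow> nat \<Rightarrow> bool" where
  "runs f c s Q t \<longleftrightarrow> (\<exists>t' s'. exec f c s t' s' \<and> Q s' \<and> t' \<le> t)"

lemma runs_mono: "runs f c s Q t \<Longrightarrow> (\<And>s'. Q s' \<Longrightarrow> Q' s') \<Longrightarrow> t \<le> t' \<Longrightarrow> runs f c s Q' t'"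
  unfolding runs_def by (meson le_trans)

lemma runs_Seq:
  "runs f c1 s Q1 t1 \<Longrightarrow> (\<And>s1. Q1 s1 \<Longrightarrow> runs f c2 s1 Q t2) \<Longrightarrow> runs f (Seq c1 c2) s Q (t1 + t2)"
  unfolding runs_def by (meson add_mono exec.Seq)

lemma runs_If:
  assumes "reg s x < reg s y \<Longrightarrow> runs f c1 s Q t" "\<not> reg s x < reg s y \<Longrightarrow> runs f c2 s Q t"
  shows "runs f (IfLess x y c1 c2) s Q (Suc t)"
  using assms unfolding runs_def
  by (metis IfFalse IfTrue Suc_le_mono plus_1_eq_Suc)

text \<open>The variant \<open>m\<close> bounds the number of passes. A pass costs the body and one
  test; the final failing test costs one more step.\<close>

lemma runs_while:
  assumes "\<And>s. I s \<Longrightarrow> reg s x < reg s y \<Longrightarrow> runs f c s (\<lambda>s'. I s' \<and> m s' < m s) t"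
    and "\<And>s. I s \<Longrightarrow> \<not> reg s x < reg s y \<Longrightarrow> Q s"
    and "I s"
  shows "runs f (WhileLess x y c) s Q (m s * Suc t + 1)"
  using assms(3)
proof (induction "m s" arbitrary: s rule: less_induct)
  case less
  show ?case
  proof (cases "reg s x < reg s y")
    case False
    then show ?thesis
      using assms(2)[OF less.prems] unfolding runs_def by (meson WhileFalse le_add2)
  next
    case True
    then obtain t1 s1 where 1: "exec f c s t1 s1" "I s1" "m s1 < m s" "t1 \<le> t"
      using assms(1)[OF less.prems] unfolding runs_def by blast
    then obtain t2 s2 where 2: "exec f (WhileLess x y c) s1 t2 s2" "Q s2" "t2 \<le> m s1 * Suc t + 1"
      using less.hyps unfolding runs_def by blast
    have "Suc (m s1) * Suc t \<le> m s * Suc t" using 1(3) by (intro mult_right_mono) auto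
    then have "1 + t1 + t2 \<le> m s * Suc t + 1" using 1(4) 2(3) by simp
    then show ?thesis using WhileTrue[OF True 1(1) 2(1)] 2(2) unfolding runs_def by blast
  qed
qed

text \<open>Individual costs \<open>t k\<close> are kept for the simulation of the given scheme,
  whose rounds are controlled only through the sum of their costs.\<close>

lemma runs_for:
  assumes step: "\<And>k s. k < n \<Longrightarrow> I k s \<Longrightarrow> reg s x < reg s y \<and> runs f c s (I (Suc k)) (t k)"
    and fin: "\<And>s. I n s \<Longrightarrow> \<not> reg s x < reg s y \<and> Q s"
    and init: "I 0 s"
  shows "runs f (WhileLess x y c) s Q ((\<Sum>k<n. Suc (t k)) + 1)"
proof -
  have "runs f (WhileLess x y c) s Q ((\<Sum>k=j..<n. Suc (t k)) + 1)" if "j \<le> n" "I j s" for j s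
    using that
  proof (induction j arbitrary: s rule: inc_induct)
    case base
    then show ?case using fin unfolding runs_def by (meson WhileFalse le_add2)
  next
    case (step j)
    then obtain t1 s1 where 1: "reg s x < reg s y" "exec f c s t1 s1" "I (Suc j) s1" "t1 \<le> t j"
      using assms(1) unfolding runs_def by blast
    then obtain t2 s2 where 2: "exec f (WhileLess x y c) s1 t2 s2" "Q s2"
      "t2 \<le> (\<Sum>k=Suc j..<n. Suc (t k)) + 1"
      using step.IH unfolding runs_def by blast
    have "1 + t1 + t2 \<le> (\<Sum>k=j..<n. Suc (t k)) + 1"
      using 1(4) 2(3) step.hyps by (simp add: sum.atLeast_Suc_lessThan)
    then show ?case using WhileTrue[OF 1(1,2) 2(1)] 2(2) unfolding runs_def by blast
  qed
  from this[of 0 s] init show ?thesis by (simp add: atLeast0LessThan)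
qed

lemma runs_for_const:
  assumes "\<And>k s. k < n \<Longrightarrow> I k s \<Longrightarrow> reg s x < reg s y \<and> runs f c s (I (Suc k)) t"
    and "\<And>s. I n s \<Longrightarrow> \<not> reg s x < reg s y \<and> Q s"
    and "I 0 s"
  shows "runs f (WhileLess x y c) s Q (n * Suc t + 1)"
  using runs_for[of n I x y f c "\<lambda>_. t" Q s, OF assms] by simp

text \<open>Symbolic execution of straight-line code by the simplifier. The clause for loops is a
  dummy, excluded by \<open>loop_free\<close>.\<close>

primrec ev :: "next_message \<Rightarrow> com \<Rightarrow> state \<Rightarrow> state" where
  "ev f Skip s = s"
| "ev f (Const x k) s = set_reg x k s"
| "ev f (Add x y z) s = set_reg x (reg s y + reg s z) s"
| "ev f (Sub x y z) s = set_reg x (reg s y - reg s z) s"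
| "ev f (Load x A y) s = set_reg x (arr s A (reg s y)) s"
| "ev f (Store A x y) s = set_arr A (reg s x) (reg s y) s"
| "ev f (Query x A y) s = set_reg x (action_code (f (map (arr s A) [0..<reg s y]))) s"
| "ev f (Seq c1 c2) s = ev f c2 (ev f c1 s)"
| "ev f (IfLess x y c1 c2) s = (if reg s x < reg s y then ev f c1 s else ev f c2 s)"
| "ev f (WhileLess x y c) s = s"

primrec len :: "com \<Rightarrow> nat" where
  "len Skip = 1"
| "len (Const x k) = 1"
| "len (Add x y z) = 1"
| "len (Sub x y z) = 1"
| "len (Load x A y) = 1"
| "len (Store A x y) = 1"
| "len (Query x A y) = 1"
| "len (Seq c1 c2) = len c1 + len c2"
| "len (IfLess x y c1 c2) = 1 + max (len c1) (len c2)"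
| "len (WhileLess x y c) = 1"

primrec loop_free :: "com \<Rightarrow> bool" where
  "loop_free Skip = True"
| "loop_free (Const x k) = True"
| "loop_free (Add x y z) = True"
| "loop_free (Sub x y z) = True"
| "loop_free (Load x A y) = True"
| "loop_free (Store A x y) = True"
| "loop_free (Query x A y) = True"
| "loop_free (Seq c1 c2) = (loop_free c1 \<and> loop_free c2)"
| "loop_free (IfLess x y c1 c2) = (loop_free c1 \<and> loop_free c2)"
| "loop_free (WhileLess x y c) = False"

lemma exec_loop_free: "loop_free c \<Longrightarrow> \<exists>t\<le>len c. exec f c s t (ev f c s)"
proof (induction c arbitrary: s)
  case (Seq c1 c2)
  then obtain t1 t2 where "t1 \<le> len c1" "exec f c1 s t1 (ev f c1 s)"
    "t2 \<le> len c2" "exec f c2 (ev f c1 s) t2 (ev f c2 (ev f c1 s))"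
    by (meson loop_free.simps(8))
  then show ?case by (metis add_mono ev.simps(8) exec.Seq len.simps(8))
next
  case (IfLess x y c1 c2)
  obtain t1 t2 where t: "t1 \<le> len c1" "exec f c1 s t1 (ev f c1 s)"
    "t2 \<le> len c2" "exec f c2 s t2 (ev f c2 s)"
    using IfLess by (meson loop_free.simps(9))
  show ?case
  proof (cases "reg s x < reg s y")
    case True
    then show ?thesis using t IfTrue[OF True t(2)] by (intro exI[of _ "1 + t1"]) auto
  next
    case False
    then show ?thesis using t IfFalse[OF False t(4)] by (intro exI[of _ "1 + t2"]) auto
  qed
qed (auto intro: exec.intros exI[of _ 1] simp del: One_nat_def)

lemma runs_loop_free: "loop_free c \<Longrightarrow> Q (ev f c s) \<Longrightarrow> len c \<le> t \<Longrightarrow> runs f c s Q t"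
  using exec_loop_free unfolding runs_def by (meson le_trans)

lemma reg_set_reg [simp]: "reg (set_reg x k s) y = (if y = x then k else reg s y)"
  and arr_set_reg [simp]: "arr (set_reg x k s) = arr s"
  and reg_set_arr [simp]: "reg (set_arr A i k s) = reg s"
  and arr_set_arr [simp]: "arr (set_arr A i k s) B j = (if B = A \<and> j = i then k else arr s B j)"
  by (auto simp: set_reg_def set_arr_def)

lemma arr_set_arr_other [simp]: "B \<noteq> A \<Longrightarrow> arr (set_arr A i k s) B = arr s B"
  by (auto simp: set_arr_def)

section \<open>Relocated copies of a program inside a larger memory\<close>

text \<open>
  Register and array \<open>x\<close> of the \<open>k\<close>-th copy of a program; these numbers are odd and above 64, and
  the main program uses registers below 65 and even arrays.
\<close>

definition rn :: "nat \<Rightarrow> nat \<Rightarrow> nat" where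
  "rn k x = 2 * prod_encode (k, x) + 65"

definition cp :: "nat \<Rightarrow> state \<Rightarrow> state" where
  "cp k s = \<lparr>reg = (\<lambda>x. reg s (rn k x)), arr = (\<lambda>A. arr s (rn k A))\<rparr>"

lemma rn_eq_iff [simp]: "rn k x = rn k' x' \<longleftrightarrow> k = k' \<and> x = x'"
  by (simp add: rn_def)

lemma rn_ge: "65 \<le> rn k x" and odd_rn: "odd (rn k x)"
  by (auto simp: rn_def)

lemma reg_cp [simp]: "reg (cp k s) x = reg s (rn k x)"
  and arr_cp [simp]: "arr (cp k s) A = arr s (rn k A)"
  by (simp_all add: cp_def)

lemma rn_neq [simp]: "x < 65 \<Longrightarrow> rn k y \<noteq> x" "x < 65 \<Longrightarrow> x \<noteq> rn k y"
  using rn_ge[of k y] by auto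

lemma rn_neq_even [simp]: "even A \<Longrightarrow> rn k y \<noteq> A" "even A \<Longrightarrow> A \<noteq> rn k y"
  using odd_rn[of k y] by auto

lemma cp_set_reg_own [simp]: "x < 65 \<Longrightarrow> cp k (set_reg x v s) = cp k s"
  by (simp add: cp_def)

lemma cp_set_arr_own [simp]: "even A \<Longrightarrow> cp k (set_arr A i v s) = cp k s"
  by (auto simp: cp_def)

lemma cp_set_reg_copy [simp]:
  "cp k (set_reg (rn k' x) v s) = (if k = k' then set_reg x v (cp k s) else cp k s)"
  by (auto simp: cp_def set_reg_def fun_eq_iff)

lemma cp_set_arr_copy [simp]:
  "cp k (set_arr (rn k' A) i v s) = (if k = k' then set_arr A i v (cp k s) else cp k s)"
  by (auto simp: cp_def set_arr_def fun_eq_iff)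

text \<open>Registers and arrays share one numbering, so a single index set delimits the memory of
  copy \<open>k\<close>.\<close>

definition outside :: "nat \<Rightarrow> state \<Rightarrow> state \<Rightarrow> bool" where
  "outside k s s' \<longleftrightarrow> (\<forall>x. x \<notin> range (rn k) \<longrightarrow> reg s' x = reg s x \<and> arr s' x = arr s x)"

lemma outside_refl [simp]: "outside k s s"
  and outside_trans: "outside k s s1 \<Longrightarrow> outside k s1 s2 \<Longrightarrow> outside k s s2"
  by (auto simp: outside_def)

lemma outside_set_reg [simp]: "outside k s (set_reg (rn k x) v s)"
  by (auto simp: outside_def)

lemma outside_set_arr [simp]: "outside k s (set_arr (rn k x) i v s)"
  unfolding outside_def by (metis arr_set_arr_other rangeI reg_set_arr)

lemma outside_reg: "outside k s s' \<Longrightarrow> x < 65 \<Longrightarrow> reg s' x = reg s x"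
  unfolding outside_def by (metis imageE rn_neq(2))

lemma outside_arr: "outside k s s' \<Longrightarrow> x < 65 \<or> even x \<Longrightarrow> arr s' x = arr s x"
  unfolding outside_def by (metis imageE rn_neq(2) rn_neq_even(2))

lemma outside_cp: "outside k s s' \<Longrightarrow> k' \<noteq> k \<Longrightarrow> cp k' s' = cp k' s"
proof -
  assume "outside k s s'" "k' \<noteq> k"
  moreover have "rn k' x \<notin> range (rn k)" for x using \<open>k' \<noteq> k\<close> by auto
  ultimately show ?thesis by (simp add: outside_def cp_def)
qed

text \<open>The translation of an oracle call is a parameter: a copy may ask the real oracle, as in
  the blocks, or be served by code that plays a one-way protocol, as in the encoder.\<close>

primrec tr :: "(nat \<Rightarrow> nat \<Rightarrow> nat \<Rightarrow> com) \<Rightarrow> nat \<Rightarrow> com \<Rightarrow> com" where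
  "tr Qc k Skip = Skip"
| "tr Qc k (Const x j) = Const (rn k x) j"
| "tr Qc k (Add x y z) = Add (rn k x) (rn k y) (rn k z)"
| "tr Qc k (Sub x y z) = Sub (rn k x) (rn k y) (rn k z)"
| "tr Qc k (Load x A y) = Load (rn k x) (rn k A) (rn k y)"
| "tr Qc k (Store A x y) = Store (rn k A) (rn k x) (rn k y)"
| "tr Qc k (Query x A y) = Qc x A y"
| "tr Qc k (Seq c1 c2) = Seq (tr Qc k c1) (tr Qc k c2)"
| "tr Qc k (IfLess x y c1 c2) = IfLess (rn k x) (rn k y) (tr Qc k c1) (tr Qc k c2)"
| "tr Qc k (WhileLess x y c) = WhileLess (rn k x) (rn k y) (tr Qc k c)"

lemma runs_basic: "exec g c s 1 s' \<Longrightarrow> Q s' \<Longrightarrow> 1 \<le> t \<Longrightarrow> runs g c s Q t"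
  unfolding runs_def by blast

text \<open>Every instruction becomes one instruction, except queries; the factor 4 leaves room for
  the code that answers them. The predicate \<open>P\<close> describes memory outside the copy that
  this code reads, and it survives because the copy never writes there.\<close>

lemma runs_tr:
  assumes "exec f c s0 t s1"
    and query: "\<And>s x A y. P s \<Longrightarrow> runs g (Qc x A y) s (\<lambda>s'. s' = set_reg (rn k x)
          (action_code (f (map (arr s (rn k A)) [0..<reg s (rn k y)]))) s) 4"
    and P: "\<And>s s'. P s \<Longrightarrow> outside k s s' \<Longrightarrow> P s'"
    and "cp k s = s0" "P s"
  shows "runs g (tr Qc k c) s (\<lambda>s'. cp k s' = s1 \<and> outside k s s') (4 * t)"
  using assms(1,4,5)
proof (induction arbitrary: s rule: exec.induct)
  case (Skip s')
  then show ?case by (auto intro!: runs_basic exec.intros)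
next
  case (Const x k s)
  then show ?case by (auto intro!: runs_basic[OF exec.Const])
next
  case (Add x y z s)
  then show ?case by (auto intro!: runs_basic[OF exec.Add])
next
  case (Sub x y z s)
  then show ?case by (auto intro!: runs_basic[OF exec.Sub])
next
  case (Load x A y s)
  then show ?case by (auto intro!: runs_basic[OF exec.Load])
next
  case (Store A x y s)
  then show ?case by (auto intro!: runs_basic[OF exec.Store])
next
  case (Query x A y s')
  have "runs g (Qc x A y) s (\<lambda>s'. s' = set_reg (rn k x)
          (action_code (f (map (arr s (rn k A)) [0..<reg s (rn k y)]))) s) 4"
    by (rule query) fact
  then show ?case by simp (erule runs_mono, use Query in auto)
next
  case (Seq c1 s' t1 s1 c2 t2 s2)
  have "runs g (Seq (tr Qc k c1) (tr Qc k c2)) s (\<lambda>s'. cp k s' = s2 \<and> outside k s s') (4 * t1 + 4 * t2)"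
  proof (rule runs_Seq)
    show "runs g (tr Qc k c1) s (\<lambda>s'. cp k s' = s1 \<and> outside k s s') (4 * t1)"
      using Seq by blast
    fix s' assume s': "cp k s' = s1 \<and> outside k s s'"
    then have "runs g (tr Qc k c2) s' (\<lambda>s''. cp k s'' = s2 \<and> outside k s' s'') (4 * t2)"
      using Seq P by blast
    then show "runs g (tr Qc k c2) s' (\<lambda>s'. cp k s' = s2 \<and> outside k s s') (4 * t2)"
      by (rule runs_mono) (use s' outside_trans in auto)
  qed
  then show ?case by (simp add: add_mult_distrib2)
next
  case (IfTrue s' x y c1 t s1 c2)
  have "runs g (IfLess (rn k x) (rn k y) (tr Qc k c1) (tr Qc k c2)) s
      (\<lambda>s'. cp k s' = s1 \<and> outside k s s') (Suc (4 * t))"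
    by (rule runs_If) (use IfTrue in \<open>auto simp: cp_def\<close>)
  then show ?case by simp (erule runs_mono, auto)
next
  case (IfFalse s' x y c2 t s1 c1)
  have "runs g (IfLess (rn k x) (rn k y) (tr Qc k c1) (tr Qc k c2)) s
      (\<lambda>s'. cp k s' = s1 \<and> outside k s s') (Suc (4 * t))"
    by (rule runs_If) (use IfFalse in \<open>auto simp: cp_def\<close>)
  then show ?case by simp (erule runs_mono, auto)
next
  case (WhileFalse s' x y c)
  then show ?case by (auto intro!: runs_basic[OF exec.WhileFalse])
next
  case (WhileTrue s' x y c t1 s1 t2 s2)
  from WhileTrue.IH(1)[OF WhileTrue.prems] obtain t1' s1' where
    1: "exec g (tr Qc k c) s t1' s1'" "cp k s1' = s1" "outside k s s1'" "t1' \<le> 4 * t1"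
    unfolding runs_def by blast
  from WhileTrue.IH(2)[OF 1(2)] P[OF WhileTrue.prems(2) 1(3)] obtain t2' s2' where
    2: "exec g (WhileLess (rn k x) (rn k y) (tr Qc k c)) s1' t2' s2'" "cp k s2' = s2"
      "outside k s1' s2'" "t2' \<le> 4 * t2"
    unfolding runs_def by auto
  have "reg s (rn k x) < reg s (rn k y)" using WhileTrue by auto
  from exec.WhileTrue[OF this 1(1) 2(1)] show ?case
    unfolding runs_def tr.simps
    using 1 2 outside_trans[OF 1(3) 2(3)]
    by (intro exI[of _ "1 + t1' + t2'"] exI[of _ s2']) auto
qed

abbreviation query_copy :: "nat \<Rightarrow> nat \<Rightarrow> nat \<Rightarrow> nat \<Rightarrow> com" where
  "query_copy k x A y \<equiv> Query (rn k x) (rn k A) (rn k y)"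

lemma runs_tr_same_oracle:
  assumes "exec f c s0 t s1" "cp k s = s0"
  shows "runs f (tr (query_copy k) k c) s (\<lambda>s'. cp k s' = s1 \<and> outside k s s') (4 * t)"
proof (rule runs_tr[where P = "\<lambda>_. True", OF assms(1) _ _ assms(2)])
  fix s x A y
  show "runs f (query_copy k x A y) s (\<lambda>s'. s' = set_reg (rn k x)
          (action_code (f (map (arr s (rn k A)) [0..<reg s (rn k y)]))) s) 4"
    by (rule runs_basic[OF exec.Query]) auto
qed auto

section \<open>Expansion on the square torus\<close>

text \<open>As a function of \<open>x\<close>, \<open>chi m (k * x)\<close> is the additive
  character of frequency \<open>k\<close> on the integers modulo \<open>m\<close>.\<close>

definition chi :: "nat \<Rightarrow> int \<Rightarrow> complex" where
  "chi m k = cis (2 * pi * real_of_int k / real m)"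

lemma chi_add: "chi m (a + b) = chi m a * chi m b"
  by (simp add: chi_def cis_mult add_divide_distrib distrib_left)

lemma chi_0 [simp]: "chi m 0 = 1"
  by (simp add: chi_def)

lemma norm_chi [simp]: "cmod (chi m k) = 1"
  by (simp add: chi_def)

lemma cnj_chi: "cnj (chi m k) = chi m (- k)"
  by (simp add: chi_def cis_cnj)

lemma chi_mult_self:
  assumes "0 < m"
  shows "chi m (int m * k) = 1"
proof -
  have "2 * pi * real_of_int (int m * k) / real m = 2 * pi * real_of_int k"
    using assms by simp
  then show ?thesis
    unfolding chi_def by (simp add: cis_multiple_2pi)
qed

lemma chi_mod:
  assumes "0 < m" shows "chi m (k mod int m) = chi m k"
proof -
  have "chi m k = chi m (int m * (k div int m) + k mod int m)" by simp
  also have "\<dots> = chi m (k mod int m)" using chi_mult_self[OF assms] by (simp only: chi_add mult_1)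
  finally show ?thesis by simp
qed

lemma chi_eq_1_imp_dvd:
  assumes "0 < m" "chi m k = 1" shows "int m dvd k"
proof -
  have "cos (2 * pi * real_of_int k / real m) = 1"
    using assms(2) by (simp add: chi_def complex_eq_iff)
  then obtain j :: int where "2 * pi * real_of_int k / real m = real_of_int j * 2 * pi"
    using cos_one_2pi_int by blast
  then have "real_of_int k = real_of_int j * real m"
    using assms(1) by (simp add: field_simps)
  then have "k = j * int m" by (metis of_int_eq_iff of_int_mult of_int_of_nat_eq)
  then show ?thesis by simp
qed

lemma chi_power: "chi m k ^ j = chi m (int j * k)"
  by (induction j) (simp_all add: chi_add[symmetric] algebra_simps)

lemma sum_int_shift:
  fixes g :: "int \<Rightarrow> 'a::comm_monoid_add"
  shows "(\<Sum>k\<in>{a..<a + int m}. g k) = (\<Sum>j<m. g (a + int j))"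
  by (rule sum.reindex_bij_witness[of _ "\<lambda>j. a + int j" "\<lambda>k. nat (k - a)"]) auto

text \<open>Orthogonality of characters, by the geometric sum. The window starts at an arbitrary
  \<open>a\<close>, since the frequencies are later centred at 0 so that their signs make
  sense.\<close>

lemma sum_chi:
  assumes "0 < m"
  shows "(\<Sum>k\<in>{a..<a + int m}. chi m (k * d)) = (if int m dvd d then of_nat m else 0)"
proof -
  have *: "chi m ((a + int j) * d) = chi m (a * d) * chi m d ^ j" for j
    by (simp add: chi_power chi_add[symmetric] algebra_simps)
  have **: "(\<Sum>k\<in>{a..<a + int m}. chi m (k * d)) = chi m (a * d) * (\<Sum>j<m. chi m d ^ j)"
    unfolding sum_int_shift * sum_distrib_left ..
  show ?thesis
  proof (cases "int m dvd d")
    case True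
    then obtain e where e: "d = int m * e" by blast
    have "chi m d = 1" "chi m (a * d) = 1"
      using chi_mult_self[OF assms, of e] chi_mult_self[OF assms, of "a * e"]
      by (simp_all add: e ac_simps)
    then show ?thesis using True ** by simp
  next
    case False
    then have ne: "chi m d \<noteq> 1" using chi_eq_1_imp_dvd assms by blast
    have "chi m d ^ m = 1" using chi_mult_self[OF assms] by (simp add: chi_power)
    then have "(\<Sum>j<m. chi m d ^ j) = 0" using ne by (simp add: geometric_sum)
    then show ?thesis using False ** by simp
  qed
qed

text \<open>Expanding the square gives a sum over pairs \<open>x\<close>, \<open>y\<close>, of which
  orthogonality over the frequencies leaves the diagonal.\<close>

lemma parseval_1d:
  fixes f :: "int \<Rightarrow> complex"
  assumes "0 < m"
  shows "(\<Sum>k\<in>{a..<a + int m}. (cmod (\<Sum>x\<in>{0..<int m}. f x * chi m (k * x)))\<^sup>2)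
       = real m * (\<Sum>x\<in>{0..<int m}. (cmod (f x))\<^sup>2)"
proof -
  let ?X = "{0..<int m}"
  have "complex_of_real (\<Sum>k\<in>{a..<a + int m}. (cmod (\<Sum>x\<in>?X. f x * chi m (k * x)))\<^sup>2)
      = (\<Sum>k\<in>{a..<a + int m}. (\<Sum>x\<in>?X. f x * chi m (k * x)) * cnj (\<Sum>y\<in>?X. f y * chi m (k * y)))"
    by (simp only: of_real_sum complex_norm_square)
  also have "\<dots> = (\<Sum>k\<in>{a..<a + int m}. \<Sum>x\<in>?X. \<Sum>y\<in>?X. f x * cnj (f y) * chi m (k * (x - y)))"
  proof (intro sum.cong refl)
    fix k
    have "f x * chi m (k * x) * (cnj (f y) * chi m (- (k * y))) = f x * cnj (f y) * chi m (k * (x - y))" for x y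
      using chi_add[of m "k * x" "- (k * y)"] by (simp add: right_diff_distrib)
    then show "(\<Sum>x\<in>?X. f x * chi m (k * x)) * cnj (\<Sum>y\<in>?X. f y * chi m (k * y))
        = (\<Sum>x\<in>?X. \<Sum>y\<in>?X. f x * cnj (f y) * chi m (k * (x - y)))"
      by (simp only: sum_product cnj_sum complex_cnj_mult cnj_chi)
  qed
  also have "\<dots> = (\<Sum>x\<in>?X. \<Sum>y\<in>?X. f x * cnj (f y) * (\<Sum>k\<in>{a..<a + int m}. chi m (k * (x - y))))"
    by (subst sum.swap, rule sum.cong[OF refl], subst sum.swap) (simp add: sum_distrib_left)
  also have "\<dots> = (\<Sum>x\<in>?X. \<Sum>y\<in>?X. if y = x then f x * cnj (f x) * of_nat m else 0)"
  proof (intro sum.cong refl)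
    fix x y assume "x \<in> ?X" "y \<in> ?X"
    then have "int m dvd (x - y) \<longleftrightarrow> y = x"
      by (metis atLeastLessThan_iff mod_eq_dvd_iff mod_pos_pos_trivial)
    then show "f x * cnj (f y) * (\<Sum>k\<in>{a..<a + int m}. chi m (k * (x - y)))
        = (if y = x then f x * cnj (f x) * of_nat m else 0)"
      using sum_chi[OF assms, of "x - y" a] by auto
  qed
  also have "\<dots> = complex_of_real (real m * (\<Sum>x\<in>?X. (cmod (f x))\<^sup>2))"
  proof -
    have "(\<Sum>x\<in>?X. \<Sum>y\<in>?X. if y = x then f x * cnj (f x) * of_nat m else 0)
        = (\<Sum>x\<in>?X. of_nat m * (f x * cnj (f x)))" by (simp add: mult.commute)
    then show ?thesis
      by (simp only: of_real_mult of_real_sum complex_norm_square of_real_of_nat_eq sum_distrib_left)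
  qed
  finally show ?thesis using of_real_eq_iff by blast
qed

definition fourier :: "nat \<Rightarrow> (int \<Rightarrow> int \<Rightarrow> complex) \<Rightarrow> int \<Rightarrow> int \<Rightarrow> complex" where
  "fourier m f k l = (\<Sum>x\<in>{0..<int m}. \<Sum>y\<in>{0..<int m}. f x y * chi m (k * x + l * y))"

definition energy :: "nat \<Rightarrow> (int \<Rightarrow> int \<Rightarrow> complex) \<Rightarrow> real" where
  "energy m f = (\<Sum>x\<in>{0..<int m}. \<Sum>y\<in>{0..<int m}. (cmod (f x y))\<^sup>2)"

lemma parseval_2d:
  assumes "0 < m"
  shows "(\<Sum>k\<in>{a..<a + int m}. \<Sum>l\<in>{b..<b + int m}. (cmod (fourier m f k l))\<^sup>2) = (real m)\<^sup>2 * energy m f"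
proof -
  let ?X = "{0..<int m}"
  have F: "fourier m f k l = (\<Sum>y\<in>?X. (\<Sum>x\<in>?X. f x y * chi m (k * x)) * chi m (l * y))" for k l
    unfolding fourier_def by (subst sum.swap) (simp add: chi_add sum_distrib_right mult.assoc)
  have "(\<Sum>k\<in>{a..<a + int m}. \<Sum>l\<in>{b..<b + int m}. (cmod (fourier m f k l))\<^sup>2)
      = (\<Sum>k\<in>{a..<a + int m}. real m * (\<Sum>y\<in>?X. (cmod (\<Sum>x\<in>?X. f x y * chi m (k * x)))\<^sup>2))"
    unfolding F parseval_1d[OF assms] ..
  also have "\<dots> = real m * (\<Sum>y\<in>?X. \<Sum>k\<in>{a..<a + int m}. (cmod (\<Sum>x\<in>?X. f x y * chi m (k * x)))\<^sup>2)"
    by (subst sum.swap) (simp add: sum_distrib_left)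
  also have "\<dots> = real m * (\<Sum>y\<in>?X. real m * (\<Sum>x\<in>?X. (cmod (f x y))\<^sup>2))"
    unfolding parseval_1d[OF assms] ..
  also have "\<dots> = (real m)\<^sup>2 * energy m f"
    unfolding energy_def by (subst sum.swap) (simp add: power2_eq_square sum_distrib_left[symmetric])
  finally show ?thesis .
qed

definition periodic :: "nat \<Rightarrow> (int \<Rightarrow> int \<Rightarrow> 'a) \<Rightarrow> bool" where
  "periodic m f \<longleftrightarrow> (\<forall>x y. f x y = f (x mod int m) (y mod int m))"

lemma sum_periodic_shift:
  fixes g :: "int \<Rightarrow> 'a::comm_monoid_add"
  assumes "0 < m" "\<And>x. g x = g (x mod int m)"
  shows "(\<Sum>x\<in>{0..<int m}. g (x + c)) = (\<Sum>x\<in>{0..<int m}. g x)"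
proof (rule sum.reindex_bij_witness[of _ "\<lambda>x. (x - c) mod int m" "\<lambda>x. (x + c) mod int m"])
  fix x assume "x \<in> {0..<int m}"
  then show "((x + c) mod int m - c) mod int m = x" "((x - c) mod int m + c) mod int m = x"
    by (simp_all add: mod_simps)
next
  fix x assume "x \<in> {0..<int m}"
  show "g ((x + c) mod int m) = g (x + c)" using assms(2)[of "x + c"] by simp
qed (use assms in auto)

text \<open>The maps permute each line of the torus. With \<open>c = 0\<close> they are
  translations, with \<open>d = 0\<close> shears.\<close>

lemma energy_shift:
  assumes "0 < m" "periodic m f"
  shows "energy m (\<lambda>x y. f (x + c * y + d) y) = energy m f"
    and "energy m (\<lambda>x y. f x (y + c * x + d)) = energy m f"
proof -
  have p: "f x y = f (x mod int m) y" "f x y = f x (y mod int m)" for x y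
    using assms(2) unfolding periodic_def by (metis mod_mod_trivial)+
  show "energy m (\<lambda>x y. f (x + c * y + d) y) = energy m f"
  proof -
    have "(\<Sum>x\<in>{0..<int m}. (cmod (f (x + c * y + d) y))\<^sup>2) = (\<Sum>x\<in>{0..<int m}. (cmod (f x y))\<^sup>2)" for y
      using sum_periodic_shift[OF assms(1), of "\<lambda>x. (cmod (f x y))\<^sup>2" "c * y + d"] p(1)[of _ y]
      by (simp add: add.assoc)
    then show ?thesis unfolding energy_def by (subst (1 2) sum.swap) simp
  qed
  show "energy m (\<lambda>x y. f x (y + c * x + d)) = energy m f"
  proof -
    have "(\<Sum>y\<in>{0..<int m}. (cmod (f x (y + c * x + d)))\<^sup>2) = (\<Sum>y\<in>{0..<int m}. (cmod (f x y))\<^sup>2)" for x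
      using sum_periodic_shift[OF assms(1), of "\<lambda>y. (cmod (f x y))\<^sup>2" "c * x + d"] p(2)[of x]
      by (simp add: add.assoc)
    then show ?thesis unfolding energy_def by simp
  qed
qed


text \<open>Substitution in the sum: a shear of the points becomes the transposed inverse shear of
  the frequencies, and a translation becomes multiplication by a character, which preserves the
  modulus.\<close>

lemma fourier_shift:
  assumes "0 < m" "periodic m f"
  shows "fourier m (\<lambda>x y. f (x + c * y + d) y) k l = chi m (- (k * d)) * fourier m f k (l - c * k)"
    and "fourier m (\<lambda>x y. f x (y + c * x + d)) k l = chi m (- (l * d)) * fourier m f (k - c * l) l"
proof -
  let ?X = "{0..<int m}"
  have p: "f x y = f (x mod int m) y" "f x y = f x (y mod int m)" for x y
    using assms(2) unfolding periodic_def by (metis mod_mod_trivial)+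
  have c: "chi m (k * (x mod int m)) = chi m (k * x)" for k x
    using chi_mod[OF assms(1), of "k * (x mod int m)"] chi_mod[OF assms(1), of "k * x"]
    by (simp add: mod_simps)
  have 1: "(\<Sum>x\<in>?X. f (x + c * y + d) y * chi m (k * x + l * y))
      = (\<Sum>x\<in>?X. chi m (- (k * d)) * (f x y * chi m (k * x + (l - c * k) * y)))" for y
  proof -
    have "(\<Sum>x\<in>?X. f (x + c * y + d) y * chi m (k * x + l * y))
       = (\<Sum>x\<in>?X. (\<lambda>x. f x y * chi m (k * x) * chi m (l * y - k * (c * y + d))) (x + (c * y + d)))"
      by (intro sum.cong refl)
         (simp add: chi_add[symmetric] mult.assoc add.assoc, simp add: algebra_simps)
    also have "\<dots> = (\<Sum>x\<in>?X. f x y * chi m (k * x) * chi m (l * y - k * (c * y + d)))"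
      by (rule sum_periodic_shift[OF assms(1)]) (metis p(1) c)
    finally show ?thesis
      by (simp add: chi_add[symmetric] mult.assoc mult.left_commute[of "chi m _"])
         (simp add: algebra_simps)
  qed
  show "fourier m (\<lambda>x y. f (x + c * y + d) y) k l = chi m (- (k * d)) * fourier m f k (l - c * k)"
    unfolding fourier_def
    by (subst (1 2) sum.swap) (simp only: 1 sum_distrib_left)
  have 2: "(\<Sum>y\<in>?X. f x (y + c * x + d) * chi m (k * x + l * y))
      = (\<Sum>y\<in>?X. chi m (- (l * d)) * (f x y * chi m ((k - c * l) * x + l * y)))" for x
  proof -
    have "(\<Sum>y\<in>?X. f x (y + c * x + d) * chi m (k * x + l * y))
       = (\<Sum>y\<in>?X. (\<lambda>y. f x y * chi m (l * y) * chi m (k * x - l * (c * x + d))) (y + (c * x + d)))"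
      by (intro sum.cong refl)
         (simp add: chi_add[symmetric] mult.assoc add.assoc, simp add: algebra_simps)
    also have "\<dots> = (\<Sum>y\<in>?X. f x y * chi m (l * y) * chi m (k * x - l * (c * x + d)))"
      by (rule sum_periodic_shift[OF assms(1)]) (metis p(2) c)
    finally show ?thesis
      by (simp add: chi_add[symmetric] mult.assoc mult.left_commute[of "chi m _"])
         (simp add: algebra_simps)
  qed
  show "fourier m (\<lambda>x y. f x (y + c * x + d)) k l = chi m (- (l * d)) * fourier m f (k - c * l) l"
    unfolding fourier_def by (simp only: 2 sum_distrib_left)
qed

lemma fourier_diff: "fourier m (\<lambda>x y. f x y - g x y) k l = fourier m f k l - fourier m g k l"
  by (simp add: fourier_def left_diff_distrib sum_subtractf)

lemma energy_diff_commute: "energy m (\<lambda>x y. f x y - g x y) = energy m (\<lambda>x y. g x y - f x y)"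
  by (simp add: energy_def norm_minus_commute)

section \<open>A Poincare inequality for shears and translations\<close>

text \<open>From \<open>0 \<le> (a / 2 - 2 * b)\<^sup>2\<close>. The first factor has to stay well
  below 2, because the argument in \<open>poincare\<close> gains exactly a factor 2; the second is
  compensated by the smallness of the perturbation.\<close>

lemma norm_sq_perturb: "(cmod w)\<^sup>2 \<le> 5 / 4 * (cmod u)\<^sup>2 + 5 * (cmod (u - w))\<^sup>2"
proof -
  define a b where "a = cmod u" and "b = cmod (u - w)"
  have "cmod w \<le> a + b" unfolding a_def b_def
    by (metis add.commute diff_add_cancel norm_minus_commute norm_triangle_sub)
  then have "(cmod w)\<^sup>2 \<le> (a + b)\<^sup>2" by (simp add: power_mono)
  also have "\<dots> \<le> 5 / 4 * a\<^sup>2 + 5 * b\<^sup>2"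
    using zero_le_power2[of "a / 2 - 2 * b"] by (simp add: power2_eq_square algebra_simps)
  finally show ?thesis by (simp add: a_def b_def)
qed

text \<open>If \<open>G\<close> hardly changes along \<open>T\<close>, the mass on \<open>X\<close>
  reappears on the image of \<open>X\<close>, up to the factors of
  \<open>norm_sq_perturb\<close>.\<close>

lemma mass_le_image:
  assumes "finite X" "inj_on T X" "(\<Sum>z\<in>X. (cmod (G (T z) - G z))\<^sup>2) \<le> D"
  shows "(\<Sum>z\<in>X. (cmod (G z))\<^sup>2) \<le> 5 / 4 * (\<Sum>z\<in>T ` X. (cmod (G z))\<^sup>2) + 5 * D"
proof -
  have "(\<Sum>z\<in>X. (cmod (G z))\<^sup>2) \<le> (\<Sum>z\<in>X. 5 / 4 * (cmod (G (T z)))\<^sup>2 + 5 * (cmod (G (T z) - G z))\<^sup>2)"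
    by (rule sum_mono) (rule norm_sq_perturb)
  also have "\<dots> = 5 / 4 * (\<Sum>z\<in>X. (cmod (G (T z)))\<^sup>2) + 5 * (\<Sum>z\<in>X. (cmod (G (T z) - G z))\<^sup>2)"
    by (simp add: sum.distrib sum_distrib_left)
  also have "(\<Sum>z\<in>X. (cmod (G (T z)))\<^sup>2) = (\<Sum>z\<in>T ` X. (cmod (G z))\<^sup>2)"
    using assms(2) by (simp add: sum.reindex)
  finally show ?thesis using assms(3) by linarith
qed

text \<open>
  On the Fourier side the two shears act on the frequencies. They send the frequencies of a closed
  quadrant into two disjoint parts of it, so a function that is almost invariant under the shears
  has little mass on low frequencies; almost invariance under the two translations excludes the
  high frequencies.
\<close>

lemma poincare:
  assumes m: "0 < m" and per: "periodic m f" and mean: "fourier m f 0 0 = 0"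
    and tx: "energy m (\<lambda>x y. f (x + 1) y - f x y) \<le> energy m f / 30"
    and ty: "energy m (\<lambda>x y. f x (y + 1) - f x y) \<le> energy m f / 30"
    and sx: "energy m (\<lambda>x y. f (x + y) y - f x y) \<le> energy m f / 30"
    and sy: "energy m (\<lambda>x y. f x (y + x) - f x y) \<le> energy m f / 30"
  shows "energy m f = 0"
proof -
  define F where "F = fourier m f"
  \<comment> \<open>This centres the window at 0: it consists of the \<open>k\<close> with
    \<open>- m < 2 k \<le> m\<close>.\<close>
  define a where "a = (- int m) div 2 + 1"
  define B where "B = {a..<a + int m}"
  define G where "G = (\<lambda>(k, l). F k l)"
  define mass where "mass X = (\<Sum>z\<in>X. (cmod (G z))\<^sup>2)" for X
  define Z where "Z = (real m)\<^sup>2 * energy m f"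
  have B: "k \<in> B \<longleftrightarrow> - int m < 2 * k \<and> 2 * k \<le> int m" for k
    unfolding B_def a_def by auto
  have finB: "finite (B \<times> B)" by (simp add: B_def)
  have BB: "(\<Sum>z\<in>B \<times> B. (cmod (H (fst z) (snd z)))\<^sup>2) = (real m)\<^sup>2 * energy m h"
    if "\<And>k l. H k l = fourier m h k l" for H h
    using parseval_2d[OF m, where a = a and b = a and f = h] that by (simp add: B_def sum.cartesian_product case_prod_beta)
  have Z: "mass (B \<times> B) = Z"
    using BB[of F f] by (simp add: mass_def Z_def G_def F_def case_prod_beta)
  have mono: "mass X \<le> mass Y" if "X \<subseteq> Y" "Y \<subseteq> B \<times> B" for X Y
    unfolding mass_def using that finite_subset[OF that(2) finB] by (intro sum_mono2) auto
  have diff: "(\<Sum>z\<in>X. (cmod (H (fst z) (snd z) - G z))\<^sup>2) \<le> Z / 30"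
    if X: "X \<subseteq> B \<times> B" and H: "\<And>k l. H k l = fourier m h k l"
      and e: "energy m (\<lambda>x y. h x y - f x y) \<le> energy m f / 30" for X H h
  proof -
    have "(\<Sum>z\<in>X. (cmod (H (fst z) (snd z) - G z))\<^sup>2) \<le> (\<Sum>z\<in>B\<times>B. (cmod (H (fst z) (snd z) - G z))\<^sup>2)"
      using X finB by (intro sum_mono2) auto
    also have "\<dots> = (real m)\<^sup>2 * energy m (\<lambda>x y. h x y - f x y)"
      using BB[of "\<lambda>k l. H k l - F k l" "\<lambda>x y. h x y - f x y"] H
      by (simp add: fourier_diff F_def G_def case_prod_beta)
    also have "\<dots> \<le> (real m)\<^sup>2 * (energy m f / 30)" by (rule mult_left_mono[OF e]) simp
    finally show ?thesis by (simp add: Z_def)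
  qed
  have pm: "f (x mod int m) (y mod int m) = f x y" for x y
    using per unfolding periodic_def by simp
  have per_shift: "periodic m (\<lambda>x y. f (x - y) y - f x y)" "periodic m (\<lambda>x y. f x (y - x) - f x y)"
    unfolding periodic_def
    by (metis (no_types, opaque_lifting) mod_diff_eq mod_mod_trivial pm)+
  \<comment> \<open>Energy is invariant under shears, so almost invariance under a shear passes to
    its inverse. The inverse shears act on frequencies by \<open>?T1\<close> and \<open>?T2\<close>,
    the given ones by \<open>?U1\<close> and \<open>?U2\<close>.\<close>
  have sx': "energy m (\<lambda>x y. f (x + -1 * y + 0) y - f x y) \<le> energy m f / 30"
    using energy_shift(1)[OF m per_shift(1), of 1 0] sx
    by (simp add: energy_diff_commute[of m "\<lambda>x y. f x y"])
  have sy': "energy m (\<lambda>x y. f x (y + -1 * x + 0) - f x y) \<le> energy m f / 30"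
    using energy_shift(2)[OF m per_shift(2), of 1 0] sy
    by (simp add: energy_diff_commute[of m "\<lambda>x y. f x y"])
  let ?T1 = "\<lambda>(k, l). (k, l + k)" and ?T2 = "\<lambda>(k, l). (k + l, l)"
  let ?U1 = "\<lambda>(k, l). (k, l - k)" and ?U2 = "\<lambda>(k, l). (k - l, l :: int)"
  have image: "mass X \<le> 5 / 4 * mass (T ` X) + Z / 6"
    if X: "X \<subseteq> B \<times> B" and T: "inj T" "\<And>z. G (T z) = fourier m h (fst z) (snd z)"
      and e: "energy m (\<lambda>x y. h x y - f x y) \<le> energy m f / 30" for X T h
    using mass_le_image[of X T G "Z / 30"] finite_subset[OF X finB] inj_on_subset[OF T(1)]
      diff[OF X refl e] unfolding mass_def by (simp add: T(2))
  have T1: "mass X \<le> 5 / 4 * mass (?T1 ` X) + Z / 6" if "X \<subseteq> B \<times> B" for X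
    by (rule image[OF that _ _ sx'])
       (use fourier_shift(1)[OF m per, of "-1" 0] in \<open>auto simp: F_def G_def inj_on_def split: prod.split\<close>)
  have T2: "mass X \<le> 5 / 4 * mass (?T2 ` X) + Z / 6" if "X \<subseteq> B \<times> B" for X
    by (rule image[OF that _ _ sy'])
       (use fourier_shift(2)[OF m per, of "-1" 0] in \<open>auto simp: F_def G_def inj_on_def split: prod.split\<close>)
  have U1: "mass X \<le> 5 / 4 * mass (?U1 ` X) + Z / 6" if "X \<subseteq> B \<times> B" for X
    by (rule image[OF that _ _ sx])
       (use fourier_shift(1)[OF m per, of 1 0] in \<open>auto simp: F_def G_def inj_on_def split: prod.split\<close>)
  have U2: "mass X \<le> 5 / 4 * mass (?U2 ` X) + Z / 6" if "X \<subseteq> B \<times> B" for X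
    by (rule image[OF that _ _ sy])
       (use fourier_shift(2)[OF m per, of 1 0] in \<open>auto simp: F_def G_def inj_on_def split: prod.split\<close>)

  \<comment> \<open>The axes are divided so that the two images are disjoint: \<open>?T1\<close>
    sends \<open>P\<close> to points with \<open>\<bar>k\<bar> \<le> \<bar>l\<bar>\<close>,
    \<open>?T2\<close> sends it to points with \<open>\<bar>l\<bar> < \<bar>k\<bar>\<close>. The
    frequencies in \<open>Q\<close> are so small that sums of coordinates stay inside the
    window.\<close>
  define P where "P = {(k, l) \<in> B \<times> B. (0 < k \<and> 0 \<le> l) \<or> (k < 0 \<and> l \<le> 0)}"
  define R where "R = {(k, l) \<in> B \<times> B. (k \<le> 0 \<and> 0 < l) \<or> (0 \<le> k \<and> l < 0)}"
  define Q where "Q = {(k, l) \<in> B \<times> B. 4 * \<bar>k\<bar> < int m \<and> 4 * \<bar>l\<bar> < int m}"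
  have sub: "P \<subseteq> B \<times> B" "R \<subseteq> B \<times> B" "Q \<subseteq> B \<times> B" by (auto simp: P_def R_def Q_def)
  have add: "mass (X \<union> Y) = mass X + mass Y" if "X \<inter> Y = {}" "X \<subseteq> B \<times> B" "Y \<subseteq> B \<times> B" for X Y
    unfolding mass_def using that finite_subset[OF _ finB] by (intro sum.union_disjoint) auto
  \<comment> \<open>The gain of a factor 2: both images carry nearly the mass of
    \<open>X \<inter> Q\<close>, and they fit disjointly into \<open>X\<close>.\<close>
  have two: "2 * mass (X \<inter> Q) \<le> 5 / 4 * mass X + Z / 3"
    if "mass (X \<inter> Q) \<le> 5 / 4 * mass Y1 + Z / 6" "mass (X \<inter> Q) \<le> 5 / 4 * mass Y2 + Z / 6"
      "Y1 \<inter> Y2 = {}" "Y1 \<subseteq> X" "Y2 \<subseteq> X" "X \<subseteq> B \<times> B" for X Y1 Y2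
    using that add[of Y1 Y2] mono[of "Y1 \<union> Y2" X] by force
  have P2: "2 * mass (P \<inter> Q) \<le> 5 / 4 * mass P + Z / 3"
    by (rule two[OF T1 T2]) (use sub in \<open>auto simp: P_def Q_def B\<close>)
  have R2: "2 * mass (R \<inter> Q) \<le> 5 / 4 * mass R + Z / 3"
    by (rule two[OF U1 U2]) (use sub in \<open>auto simp: R_def Q_def B\<close>)
  have split: "mass X = mass (X \<inter> Q) + mass (X - Q)" if "X \<subseteq> B \<times> B" for X
    using add[of "X \<inter> Q" "X - Q"] that by (metis Diff_disjoint Int_Diff Int_Diff_Un Int_commute inf.coboundedI2 Diff_subset subset_trans inf_le1)
  \<comment> \<open>Only the origin lies outside \<open>P\<close> and \<open>R\<close>, and its
    coefficient vanishes by \<open>mean\<close>.\<close>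
  have PR: "mass (B \<times> B) = mass P + mass R"
  proof -
    have "z = (0, 0)" if "z \<in> B \<times> B - (P \<union> R)" for z
      using that by (cases z) (auto simp: P_def R_def)
    then have "\<forall>z\<in>B \<times> B - (P \<union> R). (cmod (G z))\<^sup>2 = 0"
      using mean by (auto simp: G_def F_def)
    then have "mass (P \<union> R) = mass (B \<times> B)"
      unfolding mass_def using sub by (intro sum.mono_neutral_left[OF finB]) auto
    moreover have "mass (P \<union> R) = mass P + mass R"
      by (rule add) (use sub in \<open>auto simp: P_def R_def\<close>)
    ultimately show ?thesis by simp
  qed
  \<comment> \<open>For such a frequency the angle lies between \<open>pi / 2\<close> and
    \<open>pi\<close>, so the squared distance of the character value from 1, which is
    \<open>2 - 2 cos\<close>, is at least 2.\<close>
  have high: "2 * (cmod z)\<^sup>2 \<le> (cmod (chi m (- k) * z - z))\<^sup>2" if "k \<in> B" "int m \<le> 4 * \<bar>k\<bar>" for k z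
  proof -
    define t where "t = 2 * pi * \<bar>real_of_int k\<bar> / real m"
    have b: "real m \<le> 4 * \<bar>real_of_int k\<bar>" "2 * \<bar>real_of_int k\<bar> \<le> real m"
    proof -
      have "2 * \<bar>k\<bar> \<le> int m" using that(1) by (auto simp: B)
      then show "2 * \<bar>real_of_int k\<bar> \<le> real m" by linarith
    qed (use that in linarith)
    have "cos (2 * pi * real_of_int k / real m) = cos t"
      unfolding t_def by (cases "k \<ge> 0") (auto simp: abs_if)
    moreover have "pi / 2 \<le> t" "t \<le> pi"
      unfolding t_def using m b pi_gt_zero by (auto simp: field_simps)
    then have "cos t \<le> 0" using cos_monotone_0_pi_le[of "pi / 2" t] by simp
    ultimately have c: "cos (2 * pi * real_of_int k / real m) \<le> 0" by simp
    have "(cmod (chi m (- k) - 1))\<^sup>2 = 2 - 2 * cos (2 * pi * real_of_int k / real m)"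
      using sin_cos_squared_add[of "2 * pi * real_of_int k / real m"]
      unfolding chi_def cmod_power2 by (simp add: power2_eq_square algebra_simps)
    then have "(cmod (chi m (- k) - 1))\<^sup>2 \<ge> 2" using c by linarith
    moreover have "cmod (chi m (- k) * z - z) = cmod (chi m (- k) - 1) * cmod z"
      by (simp add: norm_mult[symmetric] algebra_simps)
    ultimately show ?thesis by (simp add: power_mult_distrib mult_right_mono)
  qed
  have highx: "2 * mass {(k, l) \<in> B \<times> B. int m \<le> 4 * \<bar>k\<bar>} \<le> Z / 30"
  proof -
    let ?X = "{(k, l) \<in> B \<times> B. int m \<le> 4 * \<bar>k\<bar>}"
    have "2 * mass ?X \<le> (\<Sum>z\<in>?X. (cmod (chi m (- fst z) * F (fst z) (snd z) - G z))\<^sup>2)"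
      unfolding mass_def sum_distrib_left by (rule sum_mono) (auto simp: G_def intro: high)
    also have "\<dots> \<le> Z / 30"
      by (rule diff[where h = "\<lambda>x y. f (x + 0 * y + 1) y" and H = "\<lambda>k l. chi m (- k) * F k l"])
         (use tx fourier_shift(1)[OF m per, of 0 1] in \<open>auto simp: F_def\<close>)
    finally show ?thesis .
  qed
  have highy: "2 * mass {(k, l) \<in> B \<times> B. int m \<le> 4 * \<bar>l\<bar>} \<le> Z / 30"
  proof -
    let ?X = "{(k, l) \<in> B \<times> B. int m \<le> 4 * \<bar>l\<bar>}"
    have "2 * mass ?X \<le> (\<Sum>z\<in>?X. (cmod (chi m (- snd z) * F (fst z) (snd z) - G z))\<^sup>2)"
      unfolding mass_def sum_distrib_left by (rule sum_mono) (auto simp: G_def intro: high)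
    also have "\<dots> \<le> Z / 30"
      by (rule diff[where h = "\<lambda>x y. f x (y + 0 * x + 1)" and H = "\<lambda>k l. chi m (- l) * F k l"])
         (use ty fourier_shift(2)[OF m per, of 0 1] in \<open>auto simp: F_def\<close>)
    finally show ?thesis .
  qed
  have "mass (B \<times> B - Q) \<le> mass {(k, l) \<in> B \<times> B. int m \<le> 4 * \<bar>k\<bar>} + mass {(k, l) \<in> B \<times> B. int m \<le> 4 * \<bar>l\<bar>}"
    (is "_ \<le> mass ?X + mass ?Y")
  proof -
    have "B \<times> B - Q = ?X \<union> (?Y - ?X)" by (auto simp: Q_def)
    then have "mass (B \<times> B - Q) = mass ?X + mass (?Y - ?X)"
      using add[of ?X "?Y - ?X"] by auto
    moreover have "mass (?Y - ?X) \<le> mass ?Y" by (rule mono) auto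
    ultimately show ?thesis by simp
  qed
  then have hi: "mass (B \<times> B - Q) \<le> Z / 30" using highx highy by linarith
  have "mass (P - Q) + mass (R - Q) \<le> mass (B \<times> B - Q)"
  proof -
    have "mass (P - Q) + mass (R - Q) = mass ((P - Q) \<union> (R - Q))"
      by (rule add[symmetric]) (use sub in \<open>auto simp: P_def R_def\<close>)
    also have "\<dots> \<le> mass (B \<times> B - Q)" by (rule mono) (use sub in auto)
    finally show ?thesis .
  qed
  \<comment> \<open>Adding up gives \<open>2 Z \<le> (5 / 4 + 2 / 3 + 2 / 30) Z\<close>, where the
    factor on the right is \<open>119 / 60\<close>; this determines the constant 30 in the
    hypotheses.\<close>
  then have "Z \<le> 0"
    using P2 R2 split[OF sub(1)] split[OF sub(2)] PR Z hi by linarith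
  moreover have "0 \<le> energy m f" unfolding energy_def by (simp add: sum_nonneg)
  ultimately show ?thesis using m unfolding Z_def by (simp add: mult_le_0_iff)
qed


section \<open>Expansion of sets of vertices\<close>

text \<open>Vertex \<open>x * m + y\<close> stands for the torus point \<open>(x, y)\<close>. The
  four out-neighbours, two translations and two shears, form a variant of the expander of Margulis
  and of Gabber and Galil; they are computed by additions modulo \<open>m\<close> alone.\<close>

definition nbrs :: "nat \<Rightarrow> nat \<Rightarrow> nat list" where
  "nbrs m v = (let x = v div m; y = v mod m in
     [((x + 1) mod m) * m + y, x * m + (y + 1) mod m, ((x + y) mod m) * m + y, x * m + (x + y) mod m])"

text \<open>If \<open>E\<close> is the set where two words agree, this is where they still agree
  after every vertex has also collected the symbols of its out-neighbours.\<close>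

definition interior :: "nat \<Rightarrow> nat set \<Rightarrow> nat set" where
  "interior m E = {v \<in> E. \<forall>u\<in>set (nbrs m v). u \<in> E}"

lemma sum_grid:
  fixes g :: "int \<Rightarrow> int \<Rightarrow> 'a::comm_monoid_add"
  assumes "0 < m"
  shows "(\<Sum>x\<in>{0..<int m}. \<Sum>y\<in>{0..<int m}. g x y) = (\<Sum>v<m * m. g (int (v div m)) (int (v mod m)))"
proof -
  have "(\<Sum>x\<in>{0..<int m}. \<Sum>y\<in>{0..<int m}. g x y)
      = (\<Sum>z\<in>{0..<int m} \<times> {0..<int m}. g (fst z) (snd z))"
    by (simp add: sum.cartesian_product case_prod_beta)
  also have "\<dots> = (\<Sum>v<m * m. g (int (v div m)) (int (v mod m)))"
  proof (rule sum.reindex_bij_witness[of _ "\<lambda>v. (int (v div m), int (v mod m))" "\<lambda>(x, y). nat x * m + nat y"])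
    fix z assume z: "z \<in> {0..<int m} \<times> {0..<int m}"
    then have y: "nat (snd z) < m" and x: "nat (fst z) < m" by auto
    have "nat (fst z) * m + nat (snd z) < (nat (fst z) + 1) * m" using y by simp
    also have "\<dots> \<le> m * m" using x by (intro mult_right_mono) auto
    finally show "(case z of (x, y) \<Rightarrow> nat x * m + nat y) \<in> {..<m * m}" by (simp add: case_prod_beta)
    show "(int ((case z of (x, y) \<Rightarrow> nat x * m + nat y) div m), int ((case z of (x, y) \<Rightarrow> nat x * m + nat y) mod m)) = z"
      "g (int ((case z of (x, y) \<Rightarrow> nat x * m + nat y) div m)) (int ((case z of (x, y) \<Rightarrow> nat x * m + nat y) mod m)) = g (fst z) (snd z)"
      using z y assms by (auto simp: case_prod_beta)
  qed (use assms in \<open>auto simp: less_mult_imp_div_less\<close>)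
  finally show ?thesis .
qed

text \<open>Apply \<open>poincare\<close> to the indicator of \<open>E\<close> minus its density.
  The energy is \<open>card E\<close> times the density of the complement, hence at least
  \<open>\<gamma> * card E\<close>. Moving the function along one kind of edge changes it by an
  energy of twice the number of points of \<open>E\<close> whose edge leads out of \<open>E\<close>.
  If all four numbers were small, the energy would vanish.\<close>

lemma boundary_ge:
  assumes m: "0 < m" and E: "E \<subseteq> {..<m * m}"
    and g: "0 < \<gamma>" "\<gamma> * real (m * m) \<le> real (m * m - card E)"
  shows "\<exists>i<4. \<gamma> / 60 * real (card E) \<le> real (card {v \<in> E. nbrs m v ! i \<notin> E})"
proof (rule ccontr)
  assume neg: "\<not> ?thesis"
  define \<rho> where "\<rho> = real (card E) / real (m * m)"
  \<comment> \<open>The indicator of \<open>E\<close>, extended periodically to all integer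
    points.\<close>
  define h :: "int \<Rightarrow> int \<Rightarrow> real" where
    "h x y = (if nat (x mod int m) * m + nat (y mod int m) \<in> E then 1 else 0)" for x y
  define f :: "int \<Rightarrow> int \<Rightarrow> complex" where "f x y = complex_of_real (h x y - \<rho>)" for x y
  have finE: "finite E" using E finite_subset by blast
  have cE: "card E \<le> m * m" using card_mono[OF _ E] by simp
  have grid: "nat (int (v div m) mod int m) * m + nat (int (v mod m) mod int m) = v" if "v < m * m" for v
    using that m by (simp add: less_mult_imp_div_less)
  have hv: "h (int (v div m)) (int (v mod m)) = (if v \<in> E then 1 else 0)" if "v < m * m" for v
    unfolding h_def using grid[OF that] by simp
  have nat_mod: "nat ((int a + int b) mod int m) = (a + b) mod m" for a b
    by (metis nat_int of_nat_add zmod_int)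
  have h1: "h (int (v div m) + 1) (int (v mod m)) = (if nbrs m v ! 0 \<in> E then 1 else 0)" if "v < m * m" for v
    unfolding h_def nbrs_def Let_def using nat_mod[of "v div m" 1] m by simp
  have h2: "h (int (v div m)) (int (v mod m) + 1) = (if nbrs m v ! 1 \<in> E then 1 else 0)" if "v < m * m" for v
    unfolding h_def nbrs_def Let_def using nat_mod[of "v mod m" 1] m that by (simp add: less_mult_imp_div_less)
  have h3: "h (int (v div m) + int (v mod m)) (int (v mod m)) = (if nbrs m v ! 2 \<in> E then 1 else 0)" if "v < m * m" for v
    unfolding h_def nbrs_def Let_def using nat_mod[of "v div m" "v mod m"] m by simp
  have h4: "h (int (v div m)) (int (v mod m) + int (v div m)) = (if nbrs m v ! 3 \<in> E then 1 else 0)" if "v < m * m" for v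
    unfolding h_def nbrs_def Let_def using nat_mod[of "v mod m" "v div m"] m that
    by (simp add: less_mult_imp_div_less add.commute)
  have per: "periodic m f" unfolding periodic_def f_def h_def by simp
  have perh: "periodic m (\<lambda>x y. complex_of_real (h x y))" unfolding periodic_def h_def by simp
  have sum_h: "(\<Sum>v<m * m. if v \<in> E then (1::real) else 0) = card E"
  proof -
    have "{..<m * m} \<inter> E = E" using E by blast
    then show ?thesis by (simp add: sum.If_cases)
  qed
  have "fourier m f 0 0 = of_real (\<Sum>v<m * m. h (int (v div m)) (int (v mod m)) - \<rho>)"
    unfolding fourier_def using sum_grid[OF m, of f] by (simp add: f_def)
  also have "(\<Sum>v<m * m. h (int (v div m)) (int (v mod m)) - \<rho>) = (\<Sum>v<m * m. (if v \<in> E then 1 else 0) - \<rho>)"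
    by (rule sum.cong) (simp_all add: hv)
  also have "\<dots> = real (card E) - real (m * m) * \<rho>" by (simp only: sum_subtractf sum_h) simp
  also have "\<dots> = 0" using m by (simp add: \<rho>_def)
  finally have mean: "fourier m f 0 0 = 0" by simp
  have "energy m f = (\<Sum>v<m * m. (h (int (v div m)) (int (v mod m)) - \<rho>)\<^sup>2)"
    unfolding energy_def by (subst sum_grid[OF m]) (simp add: f_def del: of_real_diff)
  also have "\<dots> = (\<Sum>v<m * m. (1 - 2 * \<rho>) * (if v \<in> E then 1 else 0) + \<rho>\<^sup>2)"
    by (rule sum.cong) (auto simp: hv power2_eq_square algebra_simps)
  also have "\<dots> = (1 - 2 * \<rho>) * real (card E) + real (m * m) * \<rho>\<^sup>2"
    by (simp only: sum.distrib sum_distrib_left[symmetric] sum_h) simp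
  also have "\<dots> = real (card E) * (1 - \<rho>)"
    using m by (simp add: \<rho>_def power2_eq_square field_simps)
  finally have en: "energy m f = real (card E) * (1 - \<rho>)" .
  have "real (m * m - card E) = real (m * m) * (1 - \<rho>)"
    using m cE by (simp add: \<rho>_def field_simps of_nat_diff)
  then have "real (m * m) * \<gamma> \<le> real (m * m) * (1 - \<rho>)" using g(2) by (simp add: mult.commute)
  then have g': "\<gamma> \<le> 1 - \<rho>" using m by (simp only: mult_le_cancel_left) simp
  have E0: "card E \<noteq> 0"
  proof
    assume "card E = 0"
    then have "\<gamma> / 60 * real (card E) \<le> real (card {v \<in> E. nbrs m v ! 0 \<notin> E})" by simp
    then show False using neg by (meson zero_less_numeral)
  qed
  have bd: "energy m (\<lambda>x y. f' x y - f x y) \<le> energy m f / 30"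
    if f': "energy m (\<lambda>x y. complex_of_real (h' x y)) = energy m (\<lambda>x y. complex_of_real (h x y))"
      "\<And>x y. f' x y = complex_of_real (h' x y - \<rho>)"
      and i: "i < 4" "\<And>v. v < m * m \<Longrightarrow> h' (int (v div m)) (int (v mod m)) = (if nbrs m v ! i \<in> E then 1 else 0)"
    for f' h' i
  proof -
    have e: "energy m (\<lambda>x y. complex_of_real (h'' x y)) = (\<Sum>v<m * m. (h'' (int (v div m)) (int (v mod m)))\<^sup>2)" for h''
      unfolding energy_def by (subst sum_grid[OF m]) simp
    have "(\<Sum>v<m * m. if nbrs m v ! i \<in> E then 1 else 0) = (\<Sum>v<m * m. (h' (int (v div m)) (int (v mod m)))\<^sup>2)"
      by (rule sum.cong) (auto simp: i)
    also have "\<dots> = (\<Sum>v<m * m. (h (int (v div m)) (int (v mod m)))\<^sup>2)" using f'(1) unfolding e .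
    also have "\<dots> = (\<Sum>v<m * m. if v \<in> E then 1 else 0)" by (rule sum.cong) (auto simp: hv)
    finally have s': "(\<Sum>v<m * m. if nbrs m v ! i \<in> E then (1::real) else 0) = card E" using sum_h by simp
    have "energy m (\<lambda>x y. f' x y - f x y) = energy m (\<lambda>x y. complex_of_real (h' x y - h x y))"
      unfolding f_def f'(2) by simp
    also have "\<dots> = (\<Sum>v<m * m. (h' (int (v div m)) (int (v mod m)) - h (int (v div m)) (int (v mod m)))\<^sup>2)"
      unfolding e ..
    \<comment> \<open>For 0-1 values, \<open>(a - b)\<^sup>2 = a - b + 2 b (1 - a)\<close>. Both
      indicators have the sum \<open>card E\<close>, so only the last term remains.\<close>
    also have "\<dots> = (\<Sum>v<m * m. (if nbrs m v ! i \<in> E then 1 else 0) - (if v \<in> E then 1 else 0)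
        + 2 * (if v \<in> E \<and> nbrs m v ! i \<notin> E then 1 else 0))"
      by (rule sum.cong) (auto simp: hv i)
    also have "\<dots> = 2 * (\<Sum>v<m * m. if v \<in> E \<and> nbrs m v ! i \<notin> E then 1 else 0)"
      by (simp only: sum.distrib sum_subtractf s' sum_h sum_distrib_left[symmetric])
    also have "(\<Sum>v<m * m. if v \<in> E \<and> nbrs m v ! i \<notin> E then (1::real) else 0) = real (card {v \<in> E. nbrs m v ! i \<notin> E})"
    proof -
      have "{..<m * m} \<inter> {v. v \<in> E \<and> nbrs m v ! i \<notin> E} = {v \<in> E. nbrs m v ! i \<notin> E}" using E by blast
      then show ?thesis by (simp add: sum.If_cases)
    qed
    finally have "energy m (\<lambda>x y. f' x y - f x y) \<le> 2 * (\<gamma> / 60 * real (card E))"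
      using neg i(1) by force
    also have "\<dots> \<le> energy m f / 30"
      unfolding en using mult_right_mono[OF g', of "real (card E)"] by (simp add: algebra_simps)
    finally show ?thesis .
  qed
  have "energy m f = 0"
  proof (rule poincare[OF m per mean])
    show "energy m (\<lambda>x y. f (x + 1) y - f x y) \<le> energy m f / 30"
      by (rule bd[where h' = "\<lambda>x y. h (x + 1) y" and i = 0])
         (use energy_shift(1)[OF m perh, of 0 1] h1 in \<open>auto simp: f_def\<close>)
    show "energy m (\<lambda>x y. f x (y + 1) - f x y) \<le> energy m f / 30"
      by (rule bd[where h' = "\<lambda>x y. h x (y + 1)" and i = 1])
         (use energy_shift(2)[OF m perh, of 0 1] h2 in \<open>auto simp: f_def\<close>)
    show "energy m (\<lambda>x y. f (x + y) y - f x y) \<le> energy m f / 30"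
      by (rule bd[where h' = "\<lambda>x y. h (x + y) y" and i = 2])
         (use energy_shift(1)[OF m perh, of 1 0] h3 in \<open>auto simp: f_def\<close>)
    show "energy m (\<lambda>x y. f x (y + x) - f x y) \<le> energy m f / 30"
      by (rule bd[where h' = "\<lambda>x y. h x (y + x)" and i = 3])
         (use energy_shift(2)[OF m perh, of 1 0] h4 in \<open>auto simp: f_def\<close>)
  qed
  then show False using en E0 g' g(1) by simp
qed

lemma card_interior_le:
  assumes m: "0 < m" and E: "E \<subseteq> {..<m * m}"
    and g: "0 < \<gamma>" "\<gamma> * real (m * m) \<le> real (m * m - card E)"
  shows "real (card (interior m E)) \<le> (1 - \<gamma> / 60) * real (card E)"
proof -
  obtain i where i: "i < 4" "\<gamma> / 60 * real (card E) \<le> real (card {v \<in> E. nbrs m v ! i \<notin> E})"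
    using boundary_ge[OF assms] by blast
  have finE: "finite E" using E finite_subset by blast
  have "i < length (nbrs m v)" for v using i by (simp add: nbrs_def Let_def)
  then have "interior m E \<subseteq> E - {v \<in> E. nbrs m v ! i \<notin> E}"
    unfolding interior_def by auto
  then have "card (interior m E) \<le> card (E - {v \<in> E. nbrs m v ! i \<notin> E})"
    using finE by (intro card_mono) auto
  also have "\<dots> = card E - card {v \<in> E. nbrs m v ! i \<notin> E}"
    using finE by (intro card_Diff_subset) auto
  finally have "real (card (interior m E)) \<le> real (card E) - real (card {v \<in> E. nbrs m v ! i \<notin> E})"
    using card_mono[OF finE, of "{v \<in> E. nbrs m v ! i \<notin> E}"] by (auto simp: of_nat_diff)
  then show ?thesis using i(2) by (simp add: algebra_simps)
qed

text \<open>Shrinking \<open>E\<close> only enlarges its complement, so the same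
  \<open>\<gamma>\<close> serves in every step and the size decays geometrically.\<close>

lemma card_interior_funpow_le:
  assumes m: "0 < m" and E: "E \<subseteq> {..<m * m}"
    and g: "0 < \<gamma>" "\<gamma> * real (m * m) \<le> real (m * m - card E)"
  shows "real (card ((interior m ^^ t) E)) \<le> (1 - \<gamma> / 60) ^ t * real (m * m) \<and> (interior m ^^ t) E \<subseteq> E"
proof (induction t)
  case 0
  show ?case using card_mono[OF _ E] by (simp del: of_nat_mult)
next
  case (Suc t)
  let ?E = "(interior m ^^ t) E"
  have sub: "?E \<subseteq> E" "?E \<subseteq> {..<m * m}" using Suc E by auto
  then have "card ?E \<le> card E" using E by (meson card_mono finite_lessThan finite_subset)
  then have "\<gamma> * real (m * m) \<le> real (m * m - card ?E)" using g(2) by linarith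
  from card_interior_le[OF m sub(2) g(1) this]
  have "real (card (interior m ?E)) \<le> (1 - \<gamma> / 60) * real (card ?E)" .
  also have "\<dots> \<le> (1 - \<gamma> / 60) * ((1 - \<gamma> / 60) ^ t * real (m * m))"
  proof (rule mult_left_mono)
    have "\<gamma> * real (m * m) \<le> 1 * real (m * m)" using g(2) by linarith
    then have "\<gamma> \<le> 1" using m mult_le_cancel_right by fastforce
    then show "0 \<le> 1 - \<gamma> / 60" by simp
  qed (use Suc in simp)
  finally have "real (card (interior m ?E)) \<le> (1 - \<gamma> / 60) ^ Suc t * real (m * m)"
    by (simp add: mult.assoc)
  moreover have "interior m ?E \<subseteq> ?E" by (auto simp: interior_def)
  ultimately show ?case using sub(1) by auto
qed

section \<open>A code from a list decodable scheme\<close>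

text \<open>The inner product modulo 2 of the \<open>j\<close> bits of \<open>u\<close> with those
  of \<open>y\<close>, the top bit of \<open>y\<close> being paired with the lowest bit of
  \<open>u\<close>. Appending a low bit to \<open>u\<close> thus keeps the old table as the first
  half of the new one, so that \<open>HAD\<close> can build it in place.\<close>

fun hd_code :: "nat \<Rightarrow> nat \<Rightarrow> nat \<Rightarrow> nat" where
  "hd_code 0 u y = 0"
| "hd_code (Suc j) u y =
     (if y < 2 ^ j then hd_code j (u div 2) y else (hd_code j (u div 2) (y - 2 ^ j) + u) mod 2)"

lemma hd_code_le: "hd_code j u y \<le> 1"
  by (induction j arbitrary: u y) auto

lemma parity_add:
  fixes x y u u' :: nat
  assumes "x \<le> 1" "y \<le> 1"
  shows "(x + u) mod 2 = (y + u') mod 2 \<longleftrightarrow> (x = y \<longleftrightarrow> u mod 2 = u' mod 2)"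
proof -
  have "x = 0 \<or> x = 1" "y = 0 \<or> y = 1" using assms by linarith+
  then show ?thesis by (elim disjE) (simp_all add: parity_cases mod2_eq_if)
qed

text \<open>If the messages differ before the last bit, the first half of the table contributes half
  of its positions by induction, and the second half shows either the same set of differences or its
  complement, according to the last bits. If only the last bits differ, the first halves agree and
  the second halves differ everywhere.\<close>

lemma hd_code_distance:
  assumes "u < 2 ^ j" "u' < 2 ^ j" "u \<noteq> u'"
  shows "2 * card {y. y < 2 ^ j \<and> hd_code j u y \<noteq> hd_code j u' y} = 2 ^ j"
  using assms
proof (induction j arbitrary: u u')
  case 0
  then show ?case by simp
next
  case (Suc j)
  let ?D = "\<lambda>j u u'. {y. y < 2 ^ j \<and> hd_code j u y \<noteq> hd_code j u' y}"
  let ?E = "{y. y < 2 ^ j \<and> (hd_code j (u div 2) y + u) mod 2 \<noteq> (hd_code j (u' div 2) y + u') mod 2}"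
  have fin: "finite (?D j (u div 2) (u' div 2))" "finite ?E" by auto
  have split: "?D (Suc j) u u' = ?D j (u div 2) (u' div 2) \<union> (\<lambda>y. y + 2 ^ j) ` ?E"
  proof (intro set_eqI iffI)
    fix y assume y: "y \<in> ?D (Suc j) u u'"
    show "y \<in> ?D j (u div 2) (u' div 2) \<union> (\<lambda>y. y + 2 ^ j) ` ?E"
    proof (cases "y < 2 ^ j")
      case True
      then show ?thesis using y by simp
    next
      case False
      then have "y = (y - 2 ^ j) + 2 ^ j" "y - 2 ^ j \<in> ?E" using y by auto
      then show ?thesis by blast
    qed
  next
    fix y assume "y \<in> ?D j (u div 2) (u' div 2) \<union> (\<lambda>y. y + 2 ^ j) ` ?E"
    then show "y \<in> ?D (Suc j) u u'" by auto
  qed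
  have card: "card (?D (Suc j) u u') = card (?D j (u div 2) (u' div 2)) + card ?E"
    unfolding split by (subst card_Un_disjoint) (auto simp: card_image)
  show ?case
  proof (cases "u div 2 = u' div 2")
    case True
    then have "u mod 2 \<noteq> u' mod 2" using Suc.prems(3) by (metis div_mult_mod_eq)
    then have "(a + u) mod 2 \<noteq> (a + u') mod 2" for a by presburger
    then have "?E = {y. y < 2 ^ j}" using True by auto
    then have "card ?E = 2 ^ j" by simp
    then show ?thesis using card True by simp
  next
    case False
    have IH: "2 * card (?D j (u div 2) (u' div 2)) = 2 ^ j"
      by (rule Suc.IH) (use Suc.prems False in auto)
    have "2 * card ?E = 2 ^ j"
    proof (cases "u mod 2 = u' mod 2")
      case True
      then have "?E = ?D j (u div 2) (u' div 2)" by (simp add: parity_add[OF hd_code_le hd_code_le])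
      then show ?thesis using IH by simp
    next
      case False
      then have "?E = {..<2 ^ j} - ?D j (u div 2) (u' div 2)"
        by (auto simp add: parity_add[OF hd_code_le hd_code_le])
      moreover have "card ({..<2 ^ j} - ?D j (u div 2) (u' div 2))
          = card {..<(2::nat) ^ j} - card (?D j (u div 2) (u' div 2))"
        by (rule card_Diff_subset) auto
      ultimately have "card ?E = 2 ^ j - card (?D j (u div 2) (u' div 2))" by simp
      then show ?thesis using IH by linarith
    qed
    then show ?thesis using card IH by simp
  qed
qed

text \<open>Horner's rule to base \<open>2 ^ w\<close>, a power of two because the machine
  multiplies by doubling.\<close>

definition pack :: "nat \<Rightarrow> nat \<Rightarrow> nat list \<Rightarrow> nat" where
  "pack w a bs = foldl (\<lambda>a b. 2 ^ w * a + b) a bs"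

lemma pack_inj:
  assumes "length bs = length bs'" "\<forall>b\<in>set bs. b < 2 ^ w" "\<forall>b\<in>set bs'. b < 2 ^ w"
  shows "pack w a bs = pack w a' bs' \<longleftrightarrow> a = a' \<and> bs = bs'"
  using assms
proof (induction bs arbitrary: bs' rule: rev_induct)
  case Nil
  then show ?case by (simp add: pack_def)
next
  case (snoc b bs)
  then obtain cs c where c: "bs' = cs @ [c]" by (metis length_append_singleton length_Suc_conv_rev)
  have "(2 ^ w * x + b = 2 ^ w * y + c) = (x = y \<and> b = c)" for x y :: nat
  proof
    assume e: "2 ^ w * x + b = 2 ^ w * y + c"
    have "(2 ^ w * x + b) div 2 ^ w = x" "(2 ^ w * y + c) div 2 ^ w = y"
      using snoc.prems by (simp_all add: c)
    then show "x = y \<and> b = c" using e by simp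
  qed simp
  moreover have "pack w a bs = pack w a' cs \<longleftrightarrow> a = a' \<and> bs = cs"
    by (rule snoc.IH) (use snoc.prems c in auto)
  ultimately show ?case by (auto simp: c pack_def)
qed

lemma pack_less:
  assumes "a < 2 ^ w" "\<forall>b\<in>set bs. b < 2 ^ w"
  shows "pack w a bs < 2 ^ (w * Suc (length bs))"
  using assms(2)
proof (induction bs rule: rev_induct)
  case Nil
  then show ?case using assms(1) by (simp add: pack_def)
next
  case (snoc b bs)
  then have "Suc (pack w a bs) \<le> 2 ^ (w * Suc (length bs))" "b < 2 ^ w" by auto
  then have "2 ^ w * pack w a bs + b < 2 ^ w * Suc (pack w a bs)" by simp
  also have "\<dots> \<le> 2 ^ w * 2 ^ (w * Suc (length bs))"
    by (rule mult_left_mono) (fact, simp)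
  finally show ?case by (simp add: pack_def power_add[symmetric] algebra_simps)
qed

lemma nbrs_less: "v < m * m \<Longrightarrow> u \<in> set (nbrs m v) \<Longrightarrow> u < m * m"
proof -
  assume v: "v < m * m" and u: "u \<in> set (nbrs m v)"
  then have m: "0 < m" by (cases m) auto
  have "v div m < m" using v by (simp add: less_mult_imp_div_less)
  have *: "a * m + b < m * m" if "a < m" "b < m" for a b
  proof -
    have "a * m + b < Suc a * m" using that by simp
    also have "\<dots> \<le> m * m" using that by (intro mult_right_mono) auto
    finally show ?thesis .
  qed
  show ?thesis using u m \<open>v div m < m\<close> by (auto simp: nbrs_def Let_def intro!: *)
qed

section \<open>Noise-free runs and one-way protocols\<close>

text \<open>Symbols outside the alphabet and rounds in which both listen are replaced by the symbol
  0, so this is an execution of every scheme with a nonempty alphabet, whatever \<open>\<Pi>\<close>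
  is.\<close>

primrec nf :: "scheme \<Rightarrow> (party \<Rightarrow> next_message) \<Rightarrow> nat \<Rightarrow> party \<Rightarrow> view" where
  "nf S \<Pi> 0 = (\<lambda>p. [])"
| "nf S \<Pi> (Suc r) = (\<lambda>p. nf S \<Pi> r p @
     [case act S p (\<Pi> p) (nf S \<Pi> r p) of Transmit x \<Rightarrow> None
      | Listen \<Rightarrow> Some (case act S (peer p) (\<Pi> (peer p)) (nf S \<Pi> r (peer p)) of
            Transmit x \<Rightarrow> if x < alphabet S then x else 0 | Listen \<Rightarrow> 0)])"

lemma length_nf [simp]: "length (nf S \<Pi> r p) = r"
  by (induction r) auto

lemma take_nf: "i \<le> r \<Longrightarrow> take i (nf S \<Pi> r p) = nf S \<Pi> i p"
  by (induction r) (auto simp: le_Suc_eq)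

lemma nth_nf: "i < r \<Longrightarrow> nf S \<Pi> r p ! i =
    (case action_at S \<Pi> (nf S \<Pi> r) p i of Transmit x \<Rightarrow> None
      | Listen \<Rightarrow> Some (case action_at S \<Pi> (nf S \<Pi> r) (peer p) i of
            Transmit x \<Rightarrow> if x < alphabet S then x else 0 | Listen \<Rightarrow> 0))"
proof -
  assume i: "i < r"
  have "nf S \<Pi> r p ! i = take (Suc i) (nf S \<Pi> r p) ! i" by simp
  also have "\<dots> = nf S \<Pi> (Suc i) p ! i" using take_nf[of "Suc i" r] i by simp
  finally have e: "nf S \<Pi> r p ! i = nf S \<Pi> (Suc i) p ! i" .
  have "action_at S \<Pi> (nf S \<Pi> r) p' i = act S p' (\<Pi> p') (nf S \<Pi> i p')" for p'
    using i by (simp add: action_at_def take_nf)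
  then show ?thesis unfolding e by (simp only:) (simp add: nth_append)
qed

lemma execution_nf: "0 < alphabet S \<Longrightarrow> execution S \<Pi> (nf S \<Pi> (rounds S))"
  unfolding execution_def
  by (auto simp: nth_nf split: action.splits)

lemma executionD:
  assumes "execution S \<Pi> v"
  shows "length (v p) = rounds S"
    and "r < rounds S \<Longrightarrow> action_at S \<Pi> v p r = Transmit x \<Longrightarrow> v p ! r = None"
    and "r < rounds S \<Longrightarrow> action_at S \<Pi> v p r = Listen \<Longrightarrow> \<exists>y<alphabet S. v p ! r = Some y"
proof -
  have e: "length (v p) = rounds S \<and> (r < rounds S \<longrightarrow> (case action_at S \<Pi> v p r of
            Transmit x \<Rightarrow> v p ! r = None | Listen \<Rightarrow> (\<exists>y<alphabet S. v p ! r = Some y)))"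
    using assms unfolding execution_def by blast
  then show "length (v p) = rounds S"
    "r < rounds S \<Longrightarrow> action_at S \<Pi> v p r = Transmit x \<Longrightarrow> v p ! r = None"
    "r < rounds S \<Longrightarrow> action_at S \<Pi> v p r = Listen \<Longrightarrow> \<exists>y<alphabet S. v p ! r = Some y"
    by auto
qed

lemma peer_peer [simp]: "peer (peer p) = p"
  by (cases p) auto

lemma peer_neq [simp]: "peer p \<noteq> p" "p \<noteq> peer p"
  by (cases p; simp)+

lemma neq_iff_peer: "p \<noteq> p' \<longleftrightarrow> p' = peer p"
  by (cases p; cases p') auto

definition string :: "nat \<Rightarrow> nat \<Rightarrow> nat list \<Rightarrow> bool" where
  "string q n M \<longleftrightarrow> length M = n \<and> set M \<subseteq> {..<q}"

text \<open>Alice's part does not mention \<open>M\<close>: her output is a function of her view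
  alone, and her view can be combined with a run of Bob on another string.\<close>

definition one_way :: "nat \<Rightarrow> nat list \<Rightarrow> party \<Rightarrow> next_message" where
  "one_way n M p h = (if p = Bob \<and> length h < n then Transmit (M ! length h) else Listen)"

lemma protocol_one_way: "string q n M \<Longrightarrow> protocol q n (one_way n M)"
  unfolding protocol_def string_def one_way_def
  by (auto intro!: exI[of _ Bob] dest: nth_mem)

lemma transcript_one_way: "string q n M \<Longrightarrow> transcript (one_way n M) n = M"
proof -
  assume M: "string q n M"
  have "transcript (one_way n M) k = take k M" if "k \<le> n" for k
    using that
  proof (induction k)
    case (Suc k)
    have "sent_symbol (one_way n M) (take k M) = M ! k"
      unfolding sent_symbol_def
      by (rule the_equality) (use Suc.prems M in \<open>auto simp: one_way_def string_def split: if_splits\<close>)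
    then show ?case using Suc M by (simp add: string_def take_Suc_conv_app_nth)
  qed simp
  then show ?thesis using M by (simp add: string_def)
qed

section \<open>List decoding as a distance property\<close>

text \<open>Up to the bound \<open>1 / 7\<close> the target rate
  \<open>2 / 7 - 2 * \<epsilon>\<close> is non-negative; the bound also gives
  \<open>1 / 4 \<le> 1 / 2 - \<epsilon>\<close>.\<close>

locale list_scheme =
  fixes q n s \<sigma> :: nat and \<epsilon> :: real and S :: scheme
  assumes q2: "2 \<le> q" and eps: "0 < \<epsilon>" "\<epsilon> \<le> 1 / 7"
    and cs: "coding_scheme q n S" and alph: "alphabet S \<le> \<sigma>"
    and bal: "balanced q n S" and ld: "list_decodes q n s (1 / 2 - \<epsilon>) S"
begin

abbreviation N :: nat where "N \<equiv> rounds S"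

lemma N_pos: "0 < N" and A_pos: "0 < alphabet S"
  using cs by (auto simp: coding_scheme_def)

definition speaker :: "nat \<Rightarrow> party" where
  "speaker = (SOME sp. \<forall>\<Pi> v p r. protocol q n \<Pi> \<and> execution S \<Pi> v \<and> r < rounds S \<longrightarrow>
        (transmits S \<Pi> v p r \<longleftrightarrow> sp r = p))"

lemma transmits_iff:
  assumes "protocol q n \<Pi>" "execution S \<Pi> v" "r < N"
  shows "transmits S \<Pi> v p r \<longleftrightarrow> speaker r = p"
proof -
  have "\<exists>sp :: nat \<Rightarrow> party. \<forall>\<Pi> v p r. protocol q n \<Pi> \<and> execution S \<Pi> v \<and> r < rounds S \<longrightarrow>
        (transmits S \<Pi> v p r \<longleftrightarrow> sp r = p)"
    using bal unfolding balanced_def non_adaptive_def by blast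
  from someI_ex[OF this] show ?thesis using assms unfolding speaker_def by blast
qed

lemma symbol_less:
  "protocol q n \<Pi> \<Longrightarrow> execution S \<Pi> v \<Longrightarrow> r < N \<Longrightarrow> action_at S \<Pi> v p r = Transmit x \<Longrightarrow> x < alphabet S"
  using cs unfolding coding_scheme_def by blast

lemma action_speaker:
  assumes "protocol q n \<Pi>" "execution S \<Pi> v" "r < N"
  obtains x where "x < alphabet S" "action_at S \<Pi> v (speaker r) r = Transmit x"
    "action_at S \<Pi> v (peer (speaker r)) r = Listen"
proof -
  obtain x where x: "action_at S \<Pi> v (speaker r) r = Transmit x"
    using transmits_iff[OF assms, of "speaker r"] unfolding transmits_def by blast
  have "\<not> transmits S \<Pi> v (peer (speaker r)) r"
    using transmits_iff[OF assms, of "peer (speaker r)"] by simp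
  then have "action_at S \<Pi> v (peer (speaker r)) r = Listen"
    unfolding transmits_def by (cases "action_at S \<Pi> v (peer (speaker r)) r") auto
  then show thesis using that[OF symbol_less[OF assms x] x] by blast
qed

abbreviation nfv :: "nat list \<Rightarrow> party \<Rightarrow> view" where
  "nfv M \<equiv> nf S (one_way n M) N"

abbreviation nfa :: "nat list \<Rightarrow> party \<Rightarrow> nat \<Rightarrow> action" where
  "nfa M \<equiv> action_at S (one_way n M) (nfv M)"

text \<open>Exactly one party transmits in each round and listening has the code 0, so the sum is
  the code of the transmitted symbol, whoever speaks.\<close>

definition W :: "nat list \<Rightarrow> nat \<Rightarrow> nat" where
  "W M r = action_code (nfa M Alice r) + action_code (nfa M Bob r)"

definition lst :: "nat list \<Rightarrow> nat list list" where
  "lst M = outcome S Alice (one_way n M Alice) (nfv M Alice)"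

lemma nf_speaker:
  assumes "string q n M" "r < N"
  obtains x where "x < alphabet S" "nfa M (speaker r) r = Transmit x"
    "nfa M (peer (speaker r)) r = Listen" "nfv M (speaker r) ! r = None"
    "nfv M (peer (speaker r)) ! r = Some x" "W M r = Suc x"
proof -
  obtain x where x: "x < alphabet S" "nfa M (speaker r) r = Transmit x" "nfa M (peer (speaker r)) r = Listen"
    using action_speaker[OF protocol_one_way[OF assms(1)] execution_nf[OF A_pos] assms(2)] by blast
  moreover have "W M r = Suc x"
    using x unfolding W_def by (cases "speaker r") auto
  ultimately show thesis using that[of x] assms(2) by (simp add: nth_nf)
qed

lemma lst_self:
  assumes "string q n M"
  shows "M \<in> set (lst M) \<and> length (lst M) \<le> s"
proof -
  have "\<not> corrupted S (one_way n M) (nfv M) r" if "r < N" for r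
  proof
    assume "corrupted S (one_way n M) (nfv M) r"
    then obtain p x where px: "nfa M p r = Transmit x" "nfa M (peer p) r = Listen" "nfv M (peer p) ! r \<noteq> Some x"
      unfolding corrupted_def by blast
    then have "transmits S (one_way n M) (nfv M) p r" unfolding transmits_def by blast
    then have "speaker r = p"
      using transmits_iff[OF protocol_one_way[OF assms] execution_nf[OF A_pos] that] by blast
    then show False using nf_speaker[OF assms that] px by (metis action.inject)
  qed
  then have "corruptions S (one_way n M) (nfv M) = 0" unfolding corruptions_def by simp
  then have "real (corruptions S (one_way n M) (nfv M)) \<le> (1 / 2 - \<epsilon>) * real N" using eps by simp
  then show ?thesis
    using ld protocol_one_way[OF assms] execution_nf[OF A_pos] transcript_one_way[OF assms]
    unfolding list_decodes_def lst_def by metis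
qed

text \<open>Counting: each of the \<open>2 ^ n\<close> binary strings occurs in a list of at most
  \<open>s\<close> entries that Alice derives from her view, and there are at most
  \<open>Suc \<sigma> ^ N\<close> views. The bound makes code length and encoding time linear in
  \<open>N\<close>.\<close>

lemma card_views_bound: "n \<le> (s + \<sigma>) * N"
proof -
  let ?X = "{M. set M \<subseteq> {..<2::nat} \<and> length M = n}"
  let ?O = "insert None (Some ` {..<alphabet S})"
  let ?V = "{v :: view. set v \<subseteq> ?O \<and> length v = N}"
  let ?out = "\<lambda>v. set (outcome S Alice (\<lambda>h. Listen) v)"
  have ow: "one_way n M Alice = (\<lambda>h. Listen)" for M by (rule ext) (simp add: one_way_def)
  have str: "string q n M" if "M \<in> ?X" for M using that q2 by (auto simp: string_def)
  have exe: "execution S (one_way n M) (nfv M)" for M by (rule execution_nf[OF A_pos])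
  have dec: "M \<in> ?out (nfv M Alice) \<and> length (outcome S Alice (\<lambda>h. Listen) (nfv M Alice)) \<le> s"
    if "M \<in> ?X" for M
    using lst_self[OF str[OF that]] unfolding lst_def ow .
  have view: "nfv M Alice \<in> ?V" for M
  proof -
    have "nfv M Alice ! r \<in> ?O" if "r < N" for r
      using executionD(2,3)[OF exe that, of M Alice] by (cases "nfa M Alice r") auto
    then have "set (nfv M Alice) \<subseteq> ?O" by (metis in_set_conv_nth length_nf subsetI)
    then show ?thesis by simp
  qed
  have fV: "finite ?V" by (rule finite_lists_length_eq) simp
  \<comment> \<open>The union ranges over the views that occur, since only for these the list is
    known to be short.\<close>
  have "?X \<subseteq> (\<Union>v\<in>(\<lambda>M. nfv M Alice) ` ?X. ?out v)"
    using dec by blast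
  then have "card ?X \<le> card (\<Union>v\<in>(\<lambda>M. nfv M Alice) ` ?X. ?out v)"
    by (intro card_mono finite_UN_I finite_imageI finite_lists_length_eq) auto
  also have "\<dots> \<le> (\<Sum>v\<in>(\<lambda>M. nfv M Alice) ` ?X. card (?out v))"
    by (intro card_UN_le finite_imageI finite_lists_length_eq) simp
  also have "\<dots> \<le> (\<Sum>v\<in>(\<lambda>M. nfv M Alice) ` ?X. s)"
    by (intro sum_mono) (use dec card_length le_trans in blast)
  also have "\<dots> = card ((\<lambda>M. nfv M Alice) ` ?X) * s" by simp
  also have "\<dots> \<le> card ?V * s"
    using view by (intro mult_right_mono card_mono[OF fV] image_subsetI) simp_all
  finally have "2 ^ n \<le> card ?V * s" by (simp add: card_lists_length_eq)
  also have "card ?V = Suc (alphabet S) ^ N"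
    by (simp add: card_lists_length_eq card_insert_if card_image)
  also have "\<dots> \<le> (2 ^ \<sigma>) ^ N"
  proof (rule power_mono)
    show "Suc (alphabet S) \<le> 2 ^ \<sigma>" using alph less_exp[of "\<sigma>"] by linarith
  qed simp
  also have "(2 ^ \<sigma>) ^ N * s \<le> (2 ^ \<sigma>) ^ N * 2 ^ s" by (intro mult_left_mono) (auto simp: less_imp_le)
  finally have "(2::nat) ^ n \<le> 2 ^ (\<sigma> * N + s)" by (simp add: power_mult power_add)
  then have "n \<le> \<sigma> * N + s" by (simp add: power_le_imp_le_exp)
  also have "\<dots> \<le> (s + \<sigma>) * N" using N_pos by (simp add: algebra_simps)
  finally show ?thesis .
qed

text \<open>Splice two noise-free runs: Alice sees the run on \<open>M\<close>, Bob the run on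
  \<open>M'\<close>. As Alice's part of the protocol is the same, this is an execution for
  \<open>M'\<close>, and a round is corrupted only where the two words differ. Few differences
  therefore force \<open>M'\<close> into the list that Alice computes from her view for
  \<open>M\<close>.\<close>

lemma close_in_lst:
  assumes "string q n M" "string q n M'"
    and close: "real (card {r. r < N \<and> W M r \<noteq> W M' r}) \<le> (1 / 2 - \<epsilon>) * real N"
  shows "M' \<in> set (lst M)"
proof -
  let ?v = "\<lambda>p. case p of Alice \<Rightarrow> nfv M Alice | Bob \<Rightarrow> nfv M' Bob"
  let ?\<Pi> = "one_way n M'"
  have ow: "one_way n M' Alice = one_way n M Alice" by (rule ext) (simp add: one_way_def)
  have aA: "action_at S ?\<Pi> ?v Alice r = nfa M Alice r" for r
    by (simp add: action_at_def ow)
  have aB: "action_at S ?\<Pi> ?v Bob r = nfa M' Bob r" for r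
    by (simp add: action_at_def)
  have exe: "execution S ?\<Pi> ?v"
    unfolding execution_def
  proof
    fix p
    show "length (?v p) = N \<and> (\<forall>r<N. case action_at S ?\<Pi> ?v p r of
            Transmit x \<Rightarrow> ?v p ! r = None | Listen \<Rightarrow> (\<exists>y<alphabet S. ?v p ! r = Some y))"
    proof (cases p)
      case Alice
      then show ?thesis
        using execution_nf[OF A_pos, of "one_way n M", unfolded execution_def, THEN spec, of Alice]
        by (simp only: aA party.case) simp
    next
      case Bob
      then show ?thesis
        using execution_nf[OF A_pos, of "one_way n M'", unfolded execution_def, THEN spec, of Bob]
        by (simp only: aB party.case) simp
    qed
  qed
  have "W M r \<noteq> W M' r" if r: "r < N" and c: "corrupted S ?\<Pi> ?v r" for r
  proof -
    obtain p x where px: "action_at S ?\<Pi> ?v p r = Transmit x" "action_at S ?\<Pi> ?v (peer p) r = Listen"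
      "?v (peer p) ! r \<noteq> Some x" using c unfolding corrupted_def by blast
    have sp: "speaker r = p"
      using transmits_iff[OF protocol_one_way[OF assms(2)] exe r, of p] px(1) unfolding transmits_def by blast
    obtain y where y: "nfa M (speaker r) r = Transmit y" "nfv M (peer (speaker r)) ! r = Some y" "W M r = Suc y"
      using nf_speaker[OF assms(1) r] by blast
    obtain z where z: "nfa M' (speaker r) r = Transmit z" "nfv M' (peer (speaker r)) ! r = Some z" "W M' r = Suc z"
      using nf_speaker[OF assms(2) r] by blast
    show ?thesis
    proof (cases p)
      case Alice
      then show ?thesis using px y z sp by (simp add: aA)
    next
      case Bob
      then show ?thesis using px y z sp by (simp add: aB)
    qed
  qed
  then have "corruptions S ?\<Pi> ?v \<le> card {r. r < N \<and> W M r \<noteq> W M' r}"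
    unfolding corruptions_def by (intro card_mono) auto
  then have "real (corruptions S ?\<Pi> ?v) \<le> (1 / 2 - \<epsilon>) * real N" using close by linarith
  then have "transcript ?\<Pi> n \<in> set (outcome S Alice (?\<Pi> Alice) (?v Alice))"
    using ld protocol_one_way[OF assms(2)] exe unfolding list_decodes_def by blast
  then show ?thesis using transcript_one_way[OF assms(2)] by (simp add: lst_def ow)
qed

section \<open>Colours that separate confusable messages\<close>

text \<open>
  Two messages whose noise-free runs are close occur in each other's list. Hence the list of a
  message contains all messages it could be confused with, and recording where it first differs
  from each of them colours the bounded-degree confusion graph properly.
\<close>

definition fdiff :: "nat list \<Rightarrow> nat list \<Rightarrow> nat" where
  "fdiff M x = (LEAST i. i = n \<or> M ! i \<noteq> x ! i)"

lemma fdiff_eqI: "i \<le> n \<Longrightarrow> i = n \<or> M ! i \<noteq> x ! i \<Longrightarrow> (\<And>j. j < i \<Longrightarrow> M ! j = x ! j) \<Longrightarrow> fdiff M x = i"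
  unfolding fdiff_def by (rule Least_equality) (auto simp: not_le[symmetric])

lemma fdiff_less:
  assumes "length M = n" "length x = n" "M \<noteq> x"
  shows "fdiff M x < n" "M ! fdiff M x \<noteq> x ! fdiff M x"
proof -
  obtain i where i: "i < n" "M ! i \<noteq> x ! i" using assms by (metis nth_equalityI)
  then have "fdiff M x \<le> i" unfolding fdiff_def by (intro Least_le) simp
  then show l: "fdiff M x < n" using i(1) by simp
  have "fdiff M x = n \<or> M ! fdiff M x \<noteq> x ! fdiff M x"
    unfolding fdiff_def by (rule LeastI[of _ n]) simp
  then show "M ! fdiff M x \<noteq> x ! fdiff M x" using l by simp
qed

text \<open>Position and symbol are digits to base \<open>2 ^ q\<close>. The successor keeps the
  value 0 for a missing entry or an entry without difference.\<close>

definition color :: "nat list \<Rightarrow> nat \<Rightarrow> nat" where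
  "color M k = (if k < length (lst M) \<and> fdiff M (lst M ! k) < n
     then 2 ^ q * fdiff M (lst M ! k) + Suc (M ! fdiff M (lst M ! k)) else 0)"

lemma string_nth: "string q n M \<Longrightarrow> i < n \<Longrightarrow> Suc (M ! i) < 2 ^ q"
proof -
  assume "string q n M" "i < n"
  then have "M ! i < q" unfolding string_def using nth_mem by blast
  then show ?thesis using less_exp[of q] by linarith
qed

lemma color_less: "string q n M \<Longrightarrow> 0 < n \<Longrightarrow> color M k < 2 ^ q * n"
proof -
  assume M: "string q n M" and n: "0 < n"
  show ?thesis
  proof (cases "k < length (lst M) \<and> fdiff M (lst M ! k) < n")
    case True
    have "color M k < 2 ^ q * Suc (fdiff M (lst M ! k))"
      using string_nth[OF M] True by (simp add: color_def)
    also have "\<dots> \<le> 2 ^ q * n" by (rule mult_left_mono) (use True in auto)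
    finally show ?thesis .
  qed (use n in \<open>auto simp: color_def\<close>)
qed

text \<open>The two lists need not be aligned. Still, equal colours would name the same position and
  the same symbol there, whereas \<open>M\<close> and \<open>M'\<close> differ at the position named
  by the colour of \<open>M\<close>.\<close>

lemma color_neq:
  assumes M: "string q n M" "string q n M'" "M \<noteq> M'" and k: "k < length (lst M)" "lst M ! k = M'"
  shows "color M k \<noteq> color M' k"
proof
  assume e: "color M k = color M' k"
  let ?i = "fdiff M M'" and ?j = "fdiff M' (lst M' ! k)"
  have i: "?i < n" "M ! ?i \<noteq> M' ! ?i" using fdiff_less[of M M'] M by (auto simp: string_def)
  then have c: "color M k = 2 ^ q * ?i + Suc (M ! ?i)" using k by (simp add: color_def)
  then have j: "?j < n" "color M' k = 2 ^ q * ?j + Suc (M' ! ?j)"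
    using e by (auto simp: color_def split: if_splits)
  have "Suc (M ! ?i) < 2 ^ q" "Suc (M' ! ?j) < 2 ^ q"
    using string_nth M i j by blast+
  moreover have "(2 ^ q * a + b) div 2 ^ q = a" if "b < 2 ^ q" for a b :: nat using that by simp
  ultimately have "(2 ^ q * ?i + Suc (M ! ?i)) div 2 ^ q = ?i" "(2 ^ q * ?j + Suc (M' ! ?j)) div 2 ^ q = ?j"
    by blast+
  then have "?i = ?j" using c j(2) e by simp
  then show False using c j(2) e i by simp
qed

section \<open>The code and its amplification\<close>

text \<open>\<open>2 ^ kap\<close> is the length of the Hadamard words, large enough for all colours
  and for \<open>N\<close> rounds; \<open>m\<close> is the side of a torus that holds all these
  positions.\<close>

definition kap :: nat where "kap = (LEAST k. max N (2 ^ q * n) \<le> 2 ^ k)"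
definition m :: nat where "m = (LEAST m. 2 ^ kap \<le> m * m)"

primrec base :: "nat \<Rightarrow> nat list \<Rightarrow> nat \<Rightarrow> nat" where
  "base 0 M v = (if v < N then W M v else 0)"
| "base (Suc k) M v = 2 * base k M v + (if v < 2 ^ kap then hd_code kap (color M k) v else 0)"

definition width :: "nat \<Rightarrow> nat" where
  "width l = 5 ^ l * (\<sigma> + s + 1)"

text \<open>Each level appends the symbols of the four neighbours, so equality at \<open>v\<close>
  on level \<open>l\<close> means equality of the base words on everything reachable from
  \<open>v\<close> in at most \<open>l\<close> steps. The width grows by a factor 5 per level, a
  constant in total since the number of levels is constant.\<close>

primrec amp :: "nat \<Rightarrow> nat list \<Rightarrow> nat \<Rightarrow> nat" where
  "amp 0 M v = base s M v"
| "amp (Suc l) M v = pack (width l) (amp l M v) (map (amp l M) (nbrs m v))"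

lemma kap_ge: "N \<le> 2 ^ kap" "2 ^ q * n \<le> 2 ^ kap"
proof -
  have "max N (2 ^ q * n) \<le> 2 ^ max N (2 ^ q * n)" using less_exp less_imp_le by blast
  then have "max N (2 ^ q * n) \<le> 2 ^ kap" unfolding kap_def by (rule LeastI)
  then show "N \<le> 2 ^ kap" "2 ^ q * n \<le> 2 ^ kap" by simp_all
qed

lemma m_ge: "2 ^ kap \<le> m * m"
  unfolding m_def by (rule LeastI[of _ "2 ^ kap"]) simp

lemma m_pos: "0 < m"
  using m_ge by (cases m) auto

definition cc :: nat where "cc = 8 * (2 ^ q * (s + \<sigma>) + 1)"

text \<open>Rounding up to a power of two costs a factor 2 and rounding up to a square a factor 4,
  whence the 8 in \<open>cc\<close>; \<open>card_views_bound\<close> replaces \<open>n\<close> by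
  \<open>N\<close>.\<close>

lemma m_square_le: "m * m \<le> cc * N"
proof -
  let ?B = "max N (2 ^ q * n)"
  have "2 ^ kap \<le> 2 * ?B"
  proof (cases kap)
    case 0
    then show ?thesis using N_pos by simp
  next
    case (Suc k)
    then have "\<not> ?B \<le> 2 ^ k" using not_less_Least[of k "\<lambda>k. ?B \<le> 2 ^ k"] unfolding kap_def by simp
    then have "2 ^ k \<le> ?B" by linarith
    then show ?thesis using Suc by simp
  qed
  \<comment> \<open>By minimality \<open>(m - 1)\<^sup>2 < 2 ^ kap\<close>, and
    \<open>m \<le> 2 (m - 1)\<close> unless \<open>m = 1\<close>.\<close>
  moreover have "m * m \<le> 4 * 2 ^ kap"
  proof (cases "m = 1")
    case True
    then show ?thesis by simp
  next
    case False
    then obtain m' where m': "m = Suc m'" "0 < m'" using m_pos by (cases m) auto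
    then have "\<not> 2 ^ kap \<le> m' * m'"
      using not_less_Least[of m' "\<lambda>m. 2 ^ kap \<le> m * m"] unfolding m_def by simp
    moreover have "m * m \<le> (2 * m') * (2 * m')" unfolding m'(1) using m'(2) by (intro mult_mono) auto
    ultimately show ?thesis by simp
  qed
  moreover have "?B \<le> (2 ^ q * (s + \<sigma>) + 1) * N"
  proof -
    have "2 ^ q * n \<le> 2 ^ q * ((s + \<sigma>) * N)" using card_views_bound by (rule mult_left_mono) simp
    then show ?thesis by (simp add: algebra_simps)
  qed
  ultimately show ?thesis unfolding cc_def by linarith
qed

lemma base_less: "string q n M \<Longrightarrow> base k M v < 2 ^ (\<sigma> + k + 1)"
proof (induction k)
  case 0
  have "base 0 M v \<le> \<sigma>"
  proof (cases "v < N")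
    case True
    then obtain x where "x < alphabet S" "W M v = Suc x" using nf_speaker[OF 0] by blast
    then show ?thesis using alph by simp
  qed simp
  also have "\<sigma> < 2 ^ \<sigma>" by (rule less_exp)
  also have "(2::nat) ^ \<sigma> \<le> 2 ^ (\<sigma> + 0 + 1)" by simp
  finally show ?case .
next
  case (Suc k)
  then have "Suc (base k M v) \<le> 2 ^ (\<sigma> + k + 1)" by simp
  then show ?case using hd_code_le[of kap "color M k" v] by auto
qed

lemma amp_less: "string q n M \<Longrightarrow> amp l M v < 2 ^ width l"
proof (induction l arbitrary: v)
  case 0
  then show ?case using base_less[of M s v] by (simp add: width_def)
next
  case (Suc l)
  have "amp (Suc l) M v < 2 ^ (width l * Suc (length (map (amp l M) (nbrs m v))))"
    unfolding amp.simps by (rule pack_less) (use Suc in auto)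
  moreover have "width l * Suc (length (map (amp l M) (nbrs m v))) = width (Suc l)"
    by (simp add: nbrs_def Let_def width_def)
  ultimately show ?case by simp
qed

lemma base_eqD:
  "base k M v = base k M' v \<Longrightarrow> (v < N \<longrightarrow> W M v = W M' v) \<and>
    (v < 2 ^ kap \<longrightarrow> (\<forall>i<k. hd_code kap (color M i) v = hd_code kap (color M' i) v))"
proof (induction k)
  case (Suc k)
  let ?b = "\<lambda>M. if v < 2 ^ kap then hd_code kap (color M k) v else 0"
  have "?b M \<le> 1" "?b M' \<le> 1" using hd_code_le by auto
  then have "base k M v = base k M' v" "?b M = ?b M'" using Suc.prems by simp_all presburger+
  then show ?case using Suc.IH by (auto simp: less_Suc_eq)
qed (auto split: if_splits)

text \<open>Either the runs already differ in more than
  \<open>(1 / 2 - \<epsilon>) N \<ge> N / 4\<close> rounds, or \<open>M'\<close> sits in some slot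
  of the list of \<open>M\<close>. In the second case the colours of this slot differ, and so do the
  Hadamard bits in half of the \<open>2 ^ kap \<ge> N\<close> positions.\<close>

lemma base_distance:
  assumes "string q n M" "string q n M'" "M \<noteq> M'"
  shows "N \<le> 4 * card {v. v < m * m \<and> base s M v \<noteq> base s M' v}"
proof -
  let ?D = "{v. v < m * m \<and> base s M v \<noteq> base s M' v}"
  have fin: "finite ?D" by simp
  have n: "0 < n" using assms by (cases n) (auto simp: string_def)
  show ?thesis
  proof (cases "real (card {r. r < N \<and> W M r \<noteq> W M' r}) \<le> (1 / 2 - \<epsilon>) * real N")
    case True
    then have in_lst: "M' \<in> set (lst M)" using close_in_lst assms by blast
    then obtain k where k: "k < length (lst M)" "lst M ! k = M'" by (metis in_set_conv_nth)
    have ks: "k < s" using k lst_self[OF assms(1)] by simp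
    have "color M k \<noteq> color M' k" by (rule color_neq[OF assms k])
    moreover have "color M k < 2 ^ kap" "color M' k < 2 ^ kap"
      using color_less assms n kap_ge(2) by (meson less_le_trans)+
    ultimately have "2 * card {y. y < 2 ^ kap \<and> hd_code kap (color M k) y \<noteq> hd_code kap (color M' k) y} = 2 ^ kap"
      by (intro hd_code_distance)
    moreover have "{y. y < 2 ^ kap \<and> hd_code kap (color M k) y \<noteq> hd_code kap (color M' k) y} \<subseteq> ?D"
    proof
      fix y assume y: "y \<in> {y. y < 2 ^ kap \<and> hd_code kap (color M k) y \<noteq> hd_code kap (color M' k) y}"
      then have "base s M y \<noteq> base s M' y" using base_eqD ks by blast
      then show "y \<in> ?D" using y m_ge by simp
    qed
    then have "card {y. y < 2 ^ kap \<and> hd_code kap (color M k) y \<noteq> hd_code kap (color M' k) y} \<le> card ?D"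
      using fin by (intro card_mono)
    ultimately show ?thesis using kap_ge(1) by linarith
  next
    case False
    have "{r. r < N \<and> W M r \<noteq> W M' r} \<subseteq> ?D"
    proof
      fix r assume r: "r \<in> {r. r < N \<and> W M r \<noteq> W M' r}"
      then have "base s M r \<noteq> base s M' r" using base_eqD by blast
      then show "r \<in> ?D" using r m_ge kap_ge(1) by simp
    qed
    then have "card {r. r < N \<and> W M r \<noteq> W M' r} \<le> card ?D" using fin by (intro card_mono)
    then have "(1 / 2 - \<epsilon>) * real N \<le> real (card ?D)" using False by linarith
    moreover have "1 / 4 * real N \<le> (1 / 2 - \<epsilon>) * real N" using eps by (intro mult_right_mono) auto
    ultimately show ?thesis by linarith
  qed
qed

lemma amp_agreement:
  assumes "string q n M" "string q n M'"
  shows "{v. v < m * m \<and> amp l M v = amp l M' v}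
       = (interior m ^^ l) {v. v < m * m \<and> base s M v = base s M' v}"
proof (induction l)
  case (Suc l)
  have "amp (Suc l) M v = amp (Suc l) M' v \<longleftrightarrow>
      amp l M v = amp l M' v \<and> (\<forall>u\<in>set (nbrs m v). amp l M u = amp l M' u)" for v
    unfolding amp.simps by (subst pack_inj) (use amp_less assms in auto)
  then have "{v. v < m * m \<and> amp (Suc l) M v = amp (Suc l) M' v}
      = interior m {v. v < m * m \<and> amp l M v = amp l M' v}"
    unfolding interior_def using nbrs_less by auto
  then show ?case using Suc by simp
qed simp

text \<open>At least \<open>N / 4\<close> disagreements among \<open>m * m \<le> cc * N\<close>
  vertices leave a complement of density at least \<open>1 / (4 cc)\<close>, and the 60 of the
  expansion bound turns this into 240. Only the first \<open>N\<close> positions are used for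
  transmission; the restriction can only lower the number of agreements.\<close>

lemma amp_distance:
  assumes "string q n M" "string q n M'" "M \<noteq> M'"
  shows "real (card {r. r < N \<and> amp l M r = amp l M' r}) \<le> (1 - 1 / (240 * real cc)) ^ l * (real cc * real N)"
proof -
  let ?E = "{v. v < m * m \<and> base s M v = base s M' v}"
  let ?\<gamma> = "1 / (4 * real cc)"
  have cc: "0 < cc" by (simp add: cc_def)
  have E: "?E \<subseteq> {..<m * m}" by auto
  have "{v. v < m * m \<and> base s M v \<noteq> base s M' v} = {..<m * m} - ?E" by auto
  then have "card {v. v < m * m \<and> base s M v \<noteq> base s M' v} = m * m - card ?E"
    using card_Diff_subset[of ?E "{..<m * m}"] E finite_subset[OF E] by simp
  then have d: "N \<le> 4 * (m * m - card ?E)" using base_distance[OF assms] by simp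
  have "real (m * m) \<le> real (cc * N)" using m_square_le by (simp only: of_nat_le_iff)
  then have "?\<gamma> * real (m * m) \<le> ?\<gamma> * real (cc * N)" by (rule mult_left_mono) simp
  also have "\<dots> = real N / 4" using cc by simp
  also have "\<dots> \<le> real (m * m - card ?E)" using d by linarith
  finally have "real (card ((interior m ^^ l) ?E)) \<le> (1 - ?\<gamma> / 60) ^ l * real (m * m)"
    using card_interior_funpow_le[OF m_pos E, of ?\<gamma>] cc by simp
  also have "\<dots> \<le> (1 - ?\<gamma> / 60) ^ l * real (cc * N)"
    using m_square_le cc by (intro mult_left_mono zero_le_power) (auto simp: field_simps simp del: of_nat_mult)
  finally have "real (card {v. v < m * m \<and> amp l M v = amp l M' v}) \<le> (1 - ?\<gamma> / 60) ^ l * real (cc * N)"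
    unfolding amp_agreement[OF assms(1,2)] .
  moreover have "card {r. r < N \<and> amp l M r = amp l M' r} \<le> card {v. v < m * m \<and> amp l M v = amp l M' v}"
    using kap_ge(1) m_ge by (intro card_mono) auto
  ultimately show ?thesis by simp
qed

end

section \<open>The unique decoding scheme\<close>

lemma card_blocks:
  assumes "0 < N"
  shows "card {i. i < J * N \<and> a \<le> i div N \<and> P (i mod N)} = (J - a) * card {r. r < N \<and> P r}"
proof -
  have "bij_betw (\<lambda>(j, r). j * N + r) ({a..<J} \<times> {r. r < N \<and> P r}) {i. i < J * N \<and> a \<le> i div N \<and> P (i mod N)}"
  proof (rule bij_betw_byWitness[where f' = "\<lambda>i. (i div N, i mod N)"])
    show "(\<lambda>(j, r). j * N + r) ` ({a..<J} \<times> {r. r < N \<and> P r}) \<subseteq> {i. i < J * N \<and> a \<le> i div N \<and> P (i mod N)}"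
    proof (rule image_subsetI)
      fix z assume "z \<in> {a..<J} \<times> {r. r < N \<and> P r}"
      then obtain j r where z: "z = (j, r)" "a \<le> j" "j < J" "r < N" "P r" by auto
      have "j * N + r < Suc j * N" using z by simp
      also have "\<dots> \<le> J * N" using z by (intro mult_right_mono) auto
      finally show "(case z of (j, r) \<Rightarrow> j * N + r) \<in> {i. i < J * N \<and> a \<le> i div N \<and> P (i mod N)}"
        using z by simp
    qed
  qed (use assms in \<open>auto simp: less_mult_imp_div_less\<close>)
  from bij_betw_same_card[OF this] show ?thesis by (simp add: card_cartesian_product)
qed

text \<open>The third claim is why a party's own next-message function is a useful filter: a string
  consistent with both parties is the transcript, so a wrong candidate that is consistent with one
  party is not consistent with the other.\<close>

lemma transcript_properties:
  assumes "protocol q n \<Pi>"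
  shows "string q n (transcript \<Pi> n)"
    and "i < n \<Longrightarrow> \<Pi> p (take i (transcript \<Pi> n)) = Transmit a \<Longrightarrow> transcript \<Pi> n ! i = a"
    and "string q n x \<Longrightarrow> (\<And>p i a. i < n \<Longrightarrow> \<Pi> p (take i x) = Transmit a \<Longrightarrow> x ! i = a) \<Longrightarrow> x = transcript \<Pi> n"
proof -
  let ?t = "transcript \<Pi>"
  have sent: "\<exists>a<q. sent_symbol \<Pi> h = a \<and> (\<forall>p b. \<Pi> p h = Transmit b \<longrightarrow> b = a) \<and> (\<exists>p. \<Pi> p h = Transmit a)"
    if "length h < n" "set h \<subseteq> {..<q}" for h
  proof -
    obtain p a where a: "a < q" "\<Pi> p h = Transmit a" "\<Pi> (peer p) h = Listen"
      using assms \<open>length h < n\<close> \<open>set h \<subseteq> {..<q}\<close> unfolding protocol_def by blast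
    then have "b = a" if "\<Pi> p' h = Transmit b" for p' b
      using that neq_iff_peer[of p p'] by (cases "p' = p") auto
    then show ?thesis unfolding sent_symbol_def using a by (intro exI[of _ a]) blast
  qed
  have len: "length (?t k) = k" for k by (induction k) auto
  have str: "k \<le> n \<Longrightarrow> set (?t k) \<subseteq> {..<q}" for k
  proof (induction k)
    case (Suc k)
    then show ?case using sent[of "?t k"] len[of k] by auto
  qed simp
  have tk: "i \<le> k \<Longrightarrow> take i (?t k) = ?t i" for i k
    by (induction k) (auto simp: le_Suc_eq len)
  have nth: "?t n ! i = sent_symbol \<Pi> (?t i)" if "i < n" for i
  proof -
    have "?t n ! i = take (Suc i) (?t n) ! i" by simp
    also have "\<dots> = ?t (Suc i) ! i" using tk[of "Suc i" n] that by simp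
    finally show ?thesis using len[of i] by (simp add: nth_append)
  qed
  show "string q n (?t n)" using len str by (simp add: string_def)
  show "?t n ! i = a" if "i < n" "\<Pi> p (take i (?t n)) = Transmit a"
    using sent[of "?t i"] len[of i] str[of i] that nth tk[of i n] by force
  assume x: "string q n x" "\<And>p i a. i < n \<Longrightarrow> \<Pi> p (take i x) = Transmit a \<Longrightarrow> x ! i = a"
  have "take k x = ?t k" if "k \<le> n" for k
    using that
  proof (induction k)
    case (Suc k)
    then obtain a p where "sent_symbol \<Pi> (?t k) = a" "\<Pi> p (?t k) = Transmit a"
      using sent[of "?t k"] len[of k] str[of k] by auto
    then have "x ! k = a" using x(2)[of k p a] Suc by simp
    then show ?case using Suc x(1) \<open>sent_symbol \<Pi> (?t k) = a\<close>
      by (simp add: string_def take_Suc_conv_app_nth)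
  qed simp
  from this[of n] show "x = ?t n" using x(1) by (simp add: string_def)
qed

definition consistent :: "nat \<Rightarrow> nat \<Rightarrow> next_message \<Rightarrow> nat list \<Rightarrow> bool" where
  "consistent q n f x \<longleftrightarrow> string q n x \<and> (\<forall>i<n. \<forall>a. f (take i x) = Transmit a \<longrightarrow> x ! i = a)"

primrec tup :: "nat \<Rightarrow> (nat \<Rightarrow> nat) \<Rightarrow> nat \<Rightarrow> nat" where
  "tup g e 0 = 0"
| "tup g e (Suc k) = 2 ^ g * tup g e k + e k"

definition digit :: "nat \<Rightarrow> nat \<Rightarrow> nat \<Rightarrow> nat" where
  "digit g z h = z div 2 ^ (g * h) mod 2 ^ g"

lemma tup_less: "(\<And>h. h < k \<Longrightarrow> e h < 2 ^ g) \<Longrightarrow> tup g e k < 2 ^ (g * k)"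
proof (induction k)
  case (Suc k)
  then have "Suc (tup g e k) \<le> 2 ^ (g * k)" by (simp add: Suc_le_eq)
  have "tup g e (Suc k) < 2 ^ g * Suc (tup g e k)" using Suc.prems[of k] by simp
  also have "\<dots> \<le> 2 ^ g * 2 ^ (g * k)" by (rule mult_left_mono) (fact, simp)
  finally show ?case by (simp add: power_add)
qed simp

lemma digit_tup:
  "(\<And>h. h < k \<Longrightarrow> e h < 2 ^ g) \<Longrightarrow> h < k \<Longrightarrow> digit g (tup g e k) h = e (k - 1 - h)"
proof (induction k arbitrary: h)
  case (Suc k)
  show ?case
  proof (cases h)
    case 0
    then show ?thesis using Suc.prems(1)[of k] by (simp add: digit_def)
  next
    case (Suc h')
    have "tup g e (Suc k) div 2 ^ (g * h) = (2 ^ g * tup g e k + e k) div 2 ^ g div 2 ^ (g * h')"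
      by (simp add: Suc power_add div_mult2_eq)
    also have "(2 ^ g * tup g e k + e k) div 2 ^ g = tup g e k" using Suc.prems(1)[of k] by simp
    finally have "digit g (tup g e (Suc k)) h = digit g (tup g e k) h'" by (simp add: digit_def)
    also have "\<dots> = e (k - 1 - h')" using Suc.IH[of h'] Suc.prems Suc by simp
    finally show ?thesis using Suc by simp
  qed
qed simp

text \<open>The digits come out in reverse order, which is invisible when one only asks whether a
  value occurs.\<close>

lemma ex_digit_tup:
  assumes "\<And>h. h < k \<Longrightarrow> e h < 2 ^ g"
  shows "(\<exists>h<k. digit g (tup g e k) h = y) \<longleftrightarrow> (\<exists>h<k. e h = y)"
proof
  assume "\<exists>h<k. digit g (tup g e k) h = y"
  then obtain h where h: "h < k" "digit g (tup g e k) h = y" by blast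
  then have "k - 1 - h < k" "e (k - 1 - h) = y" using digit_tup[of k e g h, OF assms] by auto
  then show "\<exists>h<k. e h = y" by blast
next
  assume "\<exists>h<k. e h = y"
  then obtain h where h: "h < k" "e h = y" by blast
  then have "k - 1 - h < k" "digit g (tup g e k) (k - 1 - h) = y"
    using digit_tup[of k e g "k - 1 - h", OF assms] by auto
  then show "\<exists>h<k. digit g (tup g e k) h = y" by blast
qed

section \<open>The boosted scheme and its causality\<close>

text \<open>\<open>d\<close> makes the loss of half a block fit into the gap given by
  \<open>\<epsilon>\<close>. \<open>t\<close> makes the chance agreements of one wrong candidate
  with all of up to \<open>6 * d * s\<close> candidates of the peer rarer than
  \<open>\<epsilon>\<close> per round.\<close>

locale boosted = list_scheme +
  fixes d t :: nat
  assumes d: "1 \<le> 16 * \<epsilon> * real d"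
    and t: "real (6 * d * s) * ((1 - 1 / (240 * real cc)) ^ t * real cc) < \<epsilon>"
begin

abbreviation K :: nat where "K \<equiv> 6 * d * s"

text \<open>One more bit than a code symbol, since a slot holds the successor of such a
  symbol.\<close>

definition g :: nat where "g = Suc (width t)"

abbreviation Zs :: nat where "Zs \<equiv> 2 ^ (g * K)"

text \<open>A symbol of the new scheme packs a symbol of \<open>S\<close> and a tuple below
  \<open>Zs\<close>, so division restores what \<open>S\<close> would have received. On an
  unfinished block the result is a prefix of the block.\<close>

definition bview :: "view \<Rightarrow> nat \<Rightarrow> view" where
  "bview w j = map (map_option (\<lambda>y. y div Zs)) (take N (drop (j * N) w))"

text \<open>Slot \<open>h\<close> is reserved for entry \<open>h mod s\<close> of the list from
  block \<open>h div s\<close>; this fixed addressing keeps the number of slots at \<open>K\<close>,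
  whatever the lists are.\<close>

definition raw :: "party \<Rightarrow> next_message \<Rightarrow> view \<Rightarrow> nat \<Rightarrow> nat list option" where
  "raw p f w h = (let xs = outcome S p f (bview w (h div s)) in
     if h mod s < length xs then Some (xs ! (h mod s)) else None)"

text \<open>Only the first occurrence of a string counts, so that \<open>certain\<close> counts
  different strings and all support for a string is collected in one slot.\<close>

definition good :: "party \<Rightarrow> next_message \<Rightarrow> view \<Rightarrow> nat \<Rightarrow> bool" where
  "good p f w h \<longleftrightarrow> (\<exists>x. raw p f w h = Some x \<and> consistent q n f x \<and> (\<forall>h'<h. raw p f w h' \<noteq> Some x))"

definition slotc :: "party \<Rightarrow> next_message \<Rightarrow> view \<Rightarrow> nat \<Rightarrow> nat \<Rightarrow> nat" where
  "slotc p f w h r = (if good p f w h then Suc (amp t (the (raw p f w h)) r) else 0)"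

text \<open>A slot takes part only from the next block on, when its list is known; 0 stands for an
  absent candidate.\<close>

definition entry :: "party \<Rightarrow> next_message \<Rightarrow> view \<Rightarrow> nat \<Rightarrow> nat \<Rightarrow> nat" where
  "entry p f w i h = (if h div s < i div N then slotc p f w h (i mod N) else 0)"

definition tuple :: "party \<Rightarrow> next_message \<Rightarrow> view \<Rightarrow> nat \<Rightarrow> nat" where
  "tuple p f w i = tup g (entry p f w i) K"

text \<open>The slots of the two parties are not aligned, so a match with any digit is
  accepted.\<close>

definition supports :: "nat \<Rightarrow> nat \<Rightarrow> bool" where
  "supports y e \<longleftrightarrow> e \<noteq> 0 \<and> (\<exists>h<K. digit g (y mod Zs) h = e)"

definition cnt :: "party \<Rightarrow> next_message \<Rightarrow> view \<Rightarrow> nat \<Rightarrow> nat \<Rightarrow> nat" where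
  "cnt p f w i0 h = card {i. i < i0 \<and> (\<exists>y. w ! i = Some y \<and> supports y (entry p f w i h))}"

text \<open>The counts are those after exactly \<open>6 * d * N\<close> rounds, so the verdict
  cannot change during the last phase.\<close>

definition certain :: "party \<Rightarrow> next_message \<Rightarrow> view \<Rightarrow> bool" where
  "certain p f w \<longleftrightarrow> card {h. h < K \<and> d * N \<le> cnt p f w (6 * d * N) h} = 1"

definition act' :: "party \<Rightarrow> next_message \<Rightarrow> view \<Rightarrow> action" where
  "act' p f w = (let i = length w in
     if i < 6 * d * N then
       (case act S p f (bview w (i div N)) of Listen \<Rightarrow> Listen
        | Transmit x \<Rightarrow> Transmit (Zs * x + tuple p f w i))
     else if certain p f w then Transmit (tuple p f w i) else Listen)"

definition outcome' :: "party \<Rightarrow> next_message \<Rightarrow> view \<Rightarrow> nat list list" where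
  "outcome' p f w = (let \<theta> = (if certain p f w then d * N else 2 * d * N);
       H = (\<lambda>h. h < K \<and> \<theta> \<le> cnt p f w (7 * d * N) h)
     in if \<exists>h. H h then [the (raw p f w (LEAST h. H h))] else [])"

definition S' :: scheme where
  "S' = \<lparr>rounds = 7 * d * N, alphabet = Zs * alphabet S, act = act', outcome = outcome'\<rparr>"

lemma S'_simps [simp]: "rounds S' = 7 * d * N" "alphabet S' = Zs * alphabet S" "act S' = act'"
  "outcome S' = outcome'"
  by (simp_all add: S'_def)

lemma d_pos: "0 < d"
  using d by (cases d) auto

lemma s_pos: "0 < s"
proof -
  have "string q n (replicate n 0)" using q2 by (auto simp: string_def)
  from lst_self[OF this] show ?thesis by (cases "lst (replicate n 0)") auto
qed

lemma bview_take: "Suc j * N \<le> i \<Longrightarrow> bview (take i w) j = bview w j"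
  unfolding bview_def by (simp add: drop_take min_def)

lemma bview_take_current: "bview (take i w) (i div N) = take (i mod N) (bview w (i div N))"
proof -
  have "i - i div N * N = i mod N" by (simp add: minus_div_mult_eq_mod)
  moreover have "i mod N < N" using N_pos by simp
  ultimately show ?thesis
    unfolding bview_def by (simp add: drop_take take_map[symmetric] min_def)
qed

lemma raw_take: "h div s < i div N \<Longrightarrow> raw p f (take i w) h = raw p f w h"
proof -
  assume "h div s < i div N"
  then have "Suc (h div s) * N \<le> i div N * N" by (intro mult_right_mono) auto
  also have "\<dots> \<le> i" by simp
  finally show ?thesis by (simp add: raw_def bview_take)
qed

lemma good_take: "h div s < i div N \<Longrightarrow> good p f (take i w) h = good p f w h"
proof -
  assume h: "h div s < i div N"
  have "raw p f (take i w) h' = raw p f w h'" if "h' \<le> h" for h'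
    by (rule raw_take) (use h div_le_mono[OF that] in \<open>meson le_less_trans\<close>)
  then show ?thesis unfolding good_def by (simp add: less_imp_le)
qed

text \<open>Causality: what is needed in round \<open>i'\<close> involves only lists of completed
  blocks, hence only the view up to that round.\<close>

lemma entry_take: "i' \<le> i \<Longrightarrow> entry p f (take i w) i' = entry p f w i'"
proof
  fix h assume i': "i' \<le> i"
  show "entry p f (take i w) i' h = entry p f w i' h"
  proof (cases "h div s < i' div N")
    case True
    then have "h div s < i div N" using div_le_mono[OF i'] by (meson less_le_trans)
    then show ?thesis by (simp add: entry_def slotc_def good_take raw_take)
  qed (simp add: entry_def)
qed

lemma tuple_take: "tuple p f (take i w) i = tuple p f w i"
  by (simp add: tuple_def entry_take)

lemma cnt_take: "i0 \<le> i \<Longrightarrow> cnt p f (take i w) i0 h = cnt p f w i0 h"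
  unfolding cnt_def by (rule arg_cong[where f = card]) (auto simp: entry_take)

lemma certain_take: "6 * d * N \<le> i \<Longrightarrow> certain p f (take i w) = certain p f w"
  by (simp add: certain_def cnt_take)

lemma good_string: "good p f w h \<Longrightarrow> string q n (the (raw p f w h))"
  by (auto simp: good_def consistent_def)

lemma slotc_less: "slotc p f w h r < 2 ^ g"
  using amp_less[OF good_string, of p f w h t r] by (auto simp: slotc_def g_def)

lemma entry_less: "entry p f w i h < 2 ^ g"
  by (simp add: entry_def slotc_less)

lemma tuple_less: "tuple p f w i < Zs"
  unfolding tuple_def by (rule tup_less) (rule entry_less)

lemma Zs_div_mod [simp]:
  "(Zs * x + tuple p f w i) div Zs = x" "(Zs * x + tuple p f w i) mod Zs = tuple p f w i"
  "tuple p f w i mod Zs = tuple p f w i"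
  using tuple_less[of p f w i] by simp_all

lemma supports_tuple:
  assumes "y mod Zs = tuple p f w i"
  shows "supports y e \<longleftrightarrow> e \<noteq> 0 \<and> (\<exists>h<K. entry p f w i h = e)"
  unfolding supports_def assms tuple_def by (simp add: ex_digit_tup entry_less)

text \<open>Inside a block the first component behaves exactly as \<open>S\<close> on the extracted
  views, so the hypotheses on \<open>S\<close> apply to each block by itself.\<close>

lemma action_block:
  assumes exe: "execution S' \<Pi> v" and "j < 6 * d" "r < N"
  shows "action_at S' \<Pi> v p (j * N + r) =
     (case action_at S \<Pi> (\<lambda>p. bview (v p) j) p r of Listen \<Rightarrow> Listen
      | Transmit x \<Rightarrow> Transmit (Zs * x + tuple p (\<Pi> p) (v p) (j * N + r)))"
proof -
  let ?i = "j * N + r"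
  have i: "?i < 6 * d * N"
  proof -
    have "?i < Suc j * N" using assms by simp
    also have "\<dots> \<le> 6 * d * N" using assms by (intro mult_right_mono) auto
    finally show ?thesis .
  qed
  have jr: "?i div N = j" "?i mod N = r" using assms by auto
  have len: "length (take ?i (v p)) = ?i" using i executionD(1)[OF exe, of p] by (simp add: mult.assoc)
  have "bview (take ?i (v p)) j = take r (bview (v p) j)"
    using bview_take_current[of ?i "v p"] jr by simp
  then show ?thesis
    unfolding action_at_def S'_simps act'_def Let_def len tuple_take
    using i jr by simp
qed

lemma action_last:
  assumes exe: "execution S' \<Pi> v" and "6 * d * N \<le> i" "i < 7 * d * N"
  shows "action_at S' \<Pi> v p i =
     (if certain p (\<Pi> p) (v p) then Transmit (tuple p (\<Pi> p) (v p) i) else Listen)"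
proof -
  have len: "length (take i (v p)) = i" using assms executionD(1)[OF exe, of p] by simp
  show ?thesis unfolding action_at_def S'_simps act'_def Let_def len tuple_take
    using assms by (simp add: certain_take)
qed

lemma execution_block:
  assumes exe: "execution S' \<Pi> v" and j: "j < 6 * d"
  shows "execution S \<Pi> (\<lambda>p. bview (v p) j)"
  unfolding execution_def
proof (intro allI conjI impI)
  fix p
  let ?V = "\<lambda>p. bview (v p) j"
  have len: "length (v p) = 7 * d * N" using executionD(1)[OF exe] by simp
  have jN: "Suc j * N \<le> 7 * d * N" using j by (intro mult_right_mono) auto
  then show lV: "length (?V p) = N" using len by (simp add: bview_def)
  fix r assume r: "r < N"
  have i: "j * N + r < rounds S'" using jN r by simp
  have nth: "?V p ! r = map_option (\<lambda>y. y div Zs) (v p ! (j * N + r))"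
  proof -
    have "j * N \<le> length (v p)" unfolding len by (rule order_trans[OF _ jN]) simp
    then show ?thesis using lV r len by (simp add: bview_def)
  qed
  show "case action_at S \<Pi> ?V p r of Transmit x \<Rightarrow> ?V p ! r = None
          | Listen \<Rightarrow> (\<exists>y<alphabet S. ?V p ! r = Some y)"
  proof (cases "action_at S \<Pi> ?V p r")
    case Listen
    then have "action_at S' \<Pi> v p (j * N + r) = Listen" by (simp add: action_block[OF exe j r])
    from executionD(3)[OF exe i this] obtain y where "y < Zs * alphabet S" "v p ! (j * N + r) = Some y" by auto
    then show ?thesis using Listen nth by (simp add: less_mult_imp_div_less mult.commute)
  next
    case (Transmit x)
    then have "action_at S' \<Pi> v p (j * N + r) = Transmit (Zs * x + tuple p (\<Pi> p) (v p) (j * N + r))"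
      by (simp add: action_block[OF exe j r])
    from executionD(2)[OF exe i this] show ?thesis using Transmit nth by simp
  qed
qed

lemma coding_scheme_S': "coding_scheme q n S'"
  unfolding coding_scheme_def
proof (intro conjI allI impI)
  show "0 < rounds S'" "0 < alphabet S'" using d_pos N_pos A_pos by simp_all
  fix \<Pi> v p i x
  assume *: "protocol q n \<Pi> \<and> execution S' \<Pi> v \<and> i < rounds S' \<and> action_at S' \<Pi> v p i = Transmit x"
  then have len: "length (v p) = 7 * d * N" and exe: "execution S' \<Pi> v" and i: "i < 7 * d * N"
    using executionD(1)[of S' \<Pi> v p] by auto
  have less: "Zs * y + tuple p (\<Pi> p) (v p) i < Zs * alphabet S" if "y < alphabet S" for y
  proof -
    have "Zs * y + tuple p (\<Pi> p) (v p) i < Zs * Suc y" using tuple_less[of p "\<Pi> p" "v p" i] by simp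
    also have "\<dots> \<le> Zs * alphabet S" using that by (intro mult_left_mono) auto
    finally show ?thesis .
  qed
  show "x < alphabet S'"
  proof (cases "i < 6 * d * N")
    case True
    then have j: "i div N < 6 * d" by (simp add: less_mult_imp_div_less)
    have r: "i mod N < N" using N_pos by simp
    from action_block[OF exe j r] * obtain y where
      y: "action_at S \<Pi> (\<lambda>p. bview (v p) (i div N)) p (i mod N) = Transmit y"
        "x = Zs * y + tuple p (\<Pi> p) (v p) i"
      by (auto split: action.splits)
    then show ?thesis using less symbol_less[OF _ execution_block[OF exe j] r y(1)] * by simp
  next
    case False
    then show ?thesis using action_last[OF exe _ i] * less[OF A_pos] tuple_less[of p "\<Pi> p" "v p" i]
      A_pos less[of 0] by (auto split: if_splits)
  qed
qed

section \<open>Error analysis of one execution\<close>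

context
  fixes \<Pi> :: "party \<Rightarrow> next_message" and v :: "party \<Rightarrow> view"
  assumes pro: "protocol q n \<Pi>" and exe: "execution S' \<Pi> v"
    and err: "real (corruptions S' \<Pi> v) \<le> (2 / 7 - 2 * \<epsilon>) * real (rounds S')"
begin

abbreviation \<tau> :: "nat list" where "\<tau> \<equiv> transcript \<Pi> n"

lemma len_v: "length (v p) = 7 * d * N"
  using executionD(1)[OF exe] by simp

definition Cor :: "nat set" where "Cor = {i. i < 7 * d * N \<and> corrupted S' \<Pi> v i}"

text \<open>Corruptions are charged to the party that hears them.\<close>

definition CorP :: "party \<Rightarrow> nat set" where
  "CorP p = {i \<in> Cor. action_at S' \<Pi> v p i = Listen}"

lemma fin_Cor [simp]: "finite Cor" "finite (CorP p)"
  by (auto simp: Cor_def CorP_def)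

lemma card_Cor: "real (card Cor) \<le> (2 - 14 * \<epsilon>) * (real d * real N)"
  using err unfolding corruptions_def Cor_def by (simp add: algebra_simps)

lemma card_CorP: "card (CorP p) + card (CorP (peer p)) \<le> card Cor"
proof -
  have "CorP p \<inter> CorP (peer p) = {}"
  proof -
    have "\<not> (action_at S' \<Pi> v p i = Listen \<and> action_at S' \<Pi> v (peer p) i = Listen)" if c: "corrupted S' \<Pi> v i" for i
    proof -
      obtain p' x where "action_at S' \<Pi> v p' i = Transmit x" using c unfolding corrupted_def by blast
      then show ?thesis by (cases p; cases p') auto
    qed
    then show ?thesis by (auto simp: CorP_def Cor_def)
  qed
  then have "card (CorP p) + card (CorP (peer p)) = card (CorP p \<union> CorP (peer p))"
    by (simp add: card_Un_disjoint)
  also have "\<dots> \<le> card Cor" by (rule card_mono) (auto simp: CorP_def)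
  finally show ?thesis .
qed

lemma honest:
  assumes i: "i < 7 * d * N" and l: "action_at S' \<Pi> v p i = Listen"
    and tr: "action_at S' \<Pi> v (peer p) i \<noteq> Listen" and nc: "i \<notin> CorP p"
  obtains y where "v p ! i = Some y" "y mod Zs = tuple (peer p) (\<Pi> (peer p)) (v (peer p)) i"
proof -
  obtain x where x: "action_at S' \<Pi> v (peer p) i = Transmit x"
    using tr by (cases "action_at S' \<Pi> v (peer p) i") auto
  have "\<not> corrupted S' \<Pi> v i" using nc i l by (auto simp: CorP_def Cor_def)
  then have v: "v p ! i = Some x" using x l unfolding corrupted_def by (metis peer_peer)
  have "x mod Zs = tuple (peer p) (\<Pi> (peer p)) (v (peer p)) i"
  proof (cases "i < 6 * d * N")
    case True
    then have j: "i div N < 6 * d" by (simp add: less_mult_imp_div_less)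
    have r: "i mod N < N" using N_pos by simp
    from action_block[OF exe j r] x show ?thesis by (auto split: action.splits)
  next
    case False
    then show ?thesis using action_last[OF exe _ i] x by (auto split: if_splits)
  qed
  with v show thesis using that by blast
qed

lemma block_actions:
  assumes "i < 6 * d * N"
  shows "action_at S' \<Pi> v p i = Listen \<longleftrightarrow> speaker (i mod N) = peer p"
proof -
  have j: "i div N < 6 * d" using assms by (simp add: less_mult_imp_div_less)
  have r: "i mod N < N" using N_pos by simp
  have "transmits S \<Pi> (\<lambda>p. bview (v p) (i div N)) p (i mod N) \<longleftrightarrow> speaker (i mod N) = p"
    by (rule transmits_iff[OF pro execution_block[OF exe j] r])
  then show ?thesis
    using action_block[OF exe j r] neq_iff_peer[of p "speaker (i mod N)"]
    unfolding transmits_def by (auto split: action.splits)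
qed

lemma speaker_half: "2 * card {r. r < N \<and> speaker r = p} = N"
proof -
  \<comment> \<open>The order of speaking is common to all executions; the noise-free one serves as
    a witness.\<close>
  have e: "execution S \<Pi> (nf S \<Pi> N)" by (rule execution_nf[OF A_pos])
  have "{r. r < N \<and> transmits S \<Pi> (nf S \<Pi> N) p' r} = {r. r < N \<and> speaker r = p'}" for p'
    using transmits_iff[OF pro e] by blast
  then have eq: "card {r. r < N \<and> speaker r = Alice} = card {r. r < N \<and> speaker r = Bob}"
    using bal pro e unfolding balanced_def by metis
  have "{..<N} = {r. r < N \<and> speaker r = Alice} \<union> {r. r < N \<and> speaker r = Bob}"
    using party.exhaust by auto
  moreover have "card ({r. r < N \<and> speaker r = Alice} \<union> {r. r < N \<and> speaker r = Bob})
      = card {r. r < N \<and> speaker r = Alice} + card {r. r < N \<and> speaker r = Bob}"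
    by (rule card_Un_disjoint) auto
  ultimately have "N = card {r. r < N \<and> speaker r = Alice} + card {r. r < N \<and> speaker r = Bob}"
    by (metis card_lessThan)
  then have "2 * card {r. r < N \<and> speaker r = Alice} = N" "2 * card {r. r < N \<and> speaker r = Bob} = N"
    using eq by linarith+
  then show ?thesis by (cases p) (simp_all only:)
qed

definition good_block :: "nat \<Rightarrow> bool" where
  "good_block j \<longleftrightarrow> real (card {i \<in> Cor. i div N = j}) \<le> (1 / 2 - \<epsilon>) * real N"

text \<open>A corruption of the extracted symbol is also a corruption of the whole symbol, so
  \<open>S\<close> meets at most \<open>(1 / 2 - \<epsilon>) N\<close> corruptions in this
  block.\<close>

lemma good_block_decodes:
  assumes j: "j < 6 * d" and g: "good_block j"
  shows "\<exists>h. h div s = j \<and> raw p (\<Pi> p) (v p) h = Some \<tau>"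
proof -
  let ?V = "\<lambda>p. bview (v p) j"
  have exeV: "execution S \<Pi> ?V" by (rule execution_block[OF exe j])
  have "corruptions S \<Pi> ?V \<le> card {i \<in> Cor. i div N = j}"
    unfolding corruptions_def
  proof (rule card_inj_on_le[of "\<lambda>r. j * N + r"])
    show "(\<lambda>r. j * N + r) ` {r. r < N \<and> corrupted S \<Pi> ?V r} \<subseteq> {i \<in> Cor. i div N = j}"
    proof (rule image_subsetI)
      fix r assume "r \<in> {r. r < N \<and> corrupted S \<Pi> ?V r}"
      then have r: "r < N" "corrupted S \<Pi> ?V r" by auto
      then obtain p x where px: "action_at S \<Pi> ?V p r = Transmit x"
        "action_at S \<Pi> ?V (peer p) r = Listen" "?V (peer p) ! r \<noteq> Some x"
        unfolding corrupted_def by blast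
      have "Suc j * N \<le> 7 * d * N" using j by (intro mult_right_mono) auto
      then have i: "j * N + r < 7 * d * N" using r by simp
      have "?V (peer p) ! r = map_option (\<lambda>y. y div Zs) (v (peer p) ! (j * N + r))"
      proof -
        have "j * N \<le> length (v (peer p))" unfolding len_v using i by (rule add_leD1[OF less_imp_le])
        then show ?thesis using executionD(1)[OF exeV, of "peer p"] r by (simp add: bview_def)
      qed
      then have "v (peer p) ! (j * N + r) \<noteq> Some (Zs * x + tuple p (\<Pi> p) (v p) (j * N + r))"
        using px(3) by auto
      moreover have "action_at S' \<Pi> v p (j * N + r) = Transmit (Zs * x + tuple p (\<Pi> p) (v p) (j * N + r))"
        "action_at S' \<Pi> v (peer p) (j * N + r) = Listen"
        using px(1,2) action_block[OF exe j r(1)] by simp_all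
      ultimately have "corrupted S' \<Pi> v (j * N + r)" unfolding corrupted_def by blast
      then show "j * N + r \<in> {i \<in> Cor. i div N = j}" using i r(1) by (simp add: Cor_def)
    qed
  qed auto
  then have "real (corruptions S \<Pi> ?V) \<le> (1 / 2 - \<epsilon>) * real N"
    using g unfolding good_block_def by linarith
  then have l: "length (outcome S p (\<Pi> p) (?V p)) \<le> s" "\<tau> \<in> set (outcome S p (\<Pi> p) (?V p))"
    using ld pro exeV unfolding list_decodes_def by blast+
  then obtain k where k: "k < length (outcome S p (\<Pi> p) (?V p))" "outcome S p (\<Pi> p) (?V p) ! k = \<tau>"
    by (metis in_set_conv_nth)
  then have "(j * s + k) div s = j" "(j * s + k) mod s = k" using l(1) by auto
  then show ?thesis using k by (intro exI[of _ "j * s + k"]) (simp add: raw_def)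
qed

text \<open>Spoiling all \<open>6 d\<close> blocks would cost at least
  \<open>(3 - 6 \<epsilon>) d N\<close>, beyond the budget of
  \<open>(2 - 14 \<epsilon>) d N\<close>.\<close>

lemma ex_good_block: "\<exists>j<6 * d. good_block j"
proof (rule ccontr)
  assume no: "\<not> ?thesis"
  have "(\<Sum>j<6 * d. real (card {i \<in> Cor. i div N = j})) \<le> real (card Cor)"
  proof -
    have "(\<Sum>j<6 * d. card {i \<in> Cor. i div N = j}) = card (\<Union>j<6 * d. {i \<in> Cor. i div N = j})"
      by (rule card_UN_disjoint[symmetric]) auto
    also have "\<dots> \<le> card Cor" by (rule card_mono) auto
    finally show ?thesis by (simp only: of_nat_sum[symmetric] of_nat_le_iff)
  qed
  moreover have "(\<Sum>j<6 * d. (1 / 2 - \<epsilon>) * real N) \<le> (\<Sum>j<6 * d. real (card {i \<in> Cor. i div N = j}))"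
    by (rule sum_mono) (use no in \<open>auto simp: good_block_def not_le intro: less_imp_le\<close>)
  ultimately have "6 * real d * ((1 / 2 - \<epsilon>) * real N) \<le> (2 - 14 * \<epsilon>) * (real d * real N)"
    using card_Cor by simp
  then have "(3 - 6 * \<epsilon>) * (real d * real N) \<le> (2 - 14 * \<epsilon>) * (real d * real N)" by (simp add: algebra_simps)
  moreover have "0 < real d * real N" using d_pos N_pos by simp
  ultimately have "3 - 6 * \<epsilon> \<le> 2 - 14 * \<epsilon>" by (simp only: mult_le_cancel_right_pos)
  then show False using eps by linarith
qed

definition j0 :: nat where "j0 = (LEAST j. good_block j)"

lemma j0: "j0 < 6 * d" "good_block j0" "j < j0 \<Longrightarrow> \<not> good_block j"
proof -
  obtain j where j: "j < 6 * d" "good_block j" using ex_good_block by blast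
  show "good_block j0" unfolding j0_def using j(2) by (rule LeastI)
  have "j0 \<le> j" unfolding j0_def using j(2) by (rule Least_le)
  then show "j0 < 6 * d" using j(1) by simp
  show "j < j0 \<Longrightarrow> \<not> good_block j" for j unfolding j0_def by (rule not_less_Least)
qed

text \<open>A party may happen to find the transcript in a bad block already, so its slot can belong
  to a block before \<open>j0\<close>, and the two parties may use different slots.\<close>

definition hh :: "party \<Rightarrow> nat" where "hh p = (LEAST h. raw p (\<Pi> p) (v p) h = Some \<tau>)"

lemma hh: "raw p (\<Pi> p) (v p) (hh p) = Some \<tau>" "hh p div s \<le> j0" "hh p < K"
  "good p (\<Pi> p) (v p) (hh p)"
proof -
  obtain h where h: "h div s = j0" "raw p (\<Pi> p) (v p) h = Some \<tau>"
    using good_block_decodes[OF j0(1,2)] by blast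
  show r: "raw p (\<Pi> p) (v p) (hh p) = Some \<tau>" unfolding hh_def using h(2) by (rule LeastI)
  have "hh p \<le> h" unfolding hh_def using h(2) by (rule Least_le)
  then show j: "hh p div s \<le> j0" using h(1) div_le_mono[of "hh p" h s] by simp
  then have "hh p div s < 6 * d" using j0(1) by simp
  then show "hh p < K" using s_pos by (simp add: div_less_iff_less_mult)
  have "consistent q n (\<Pi> p) \<tau>"
    unfolding consistent_def using transcript_properties(1,2)[OF pro] by blast
  moreover have "raw p (\<Pi> p) (v p) h' \<noteq> Some \<tau>" if "h' < hh p" for h'
    using that unfolding hh_def by (rule not_less_Least)
  ultimately show "good p (\<Pi> p) (v p) (hh p)"
    unfolding good_def using r by blast
qed

text \<open>The bad blocks before \<open>j0\<close> and the corruptions after \<open>j0\<close> draw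
  on one budget. Block \<open>j0\<close> itself is left out, since the support of the transcript is
  estimated only from the next block on.\<close>

lemma bad_blocks_cost:
  "real j0 * ((1 / 2 - \<epsilon>) * real N) + real (card {i \<in> Cor. j0 < i div N}) \<le> real (card Cor)"
proof -
  have "(\<Sum>j<j0. (1 / 2 - \<epsilon>) * real N) \<le> (\<Sum>j<j0. real (card {i \<in> Cor. i div N = j}))"
    by (rule sum_mono) (use j0(3) in \<open>auto simp: good_block_def not_le intro: less_imp_le\<close>)
  also have "\<dots> = real (card (\<Union>j<j0. {i \<in> Cor. i div N = j}))"
    by (subst card_UN_disjoint) auto
  finally have "real j0 * ((1 / 2 - \<epsilon>) * real N) \<le> real (card (\<Union>j<j0. {i \<in> Cor. i div N = j}))" by simp
  moreover have "card (\<Union>j<j0. {i \<in> Cor. i div N = j}) + card {i \<in> Cor. j0 < i div N}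
      = card ((\<Union>j<j0. {i \<in> Cor. i div N = j}) \<union> {i \<in> Cor. j0 < i div N})"
    by (subst card_Un_disjoint) auto
  moreover have "\<dots> \<le> card Cor" by (rule card_mono) auto
  ultimately show ?thesis by linarith
qed

text \<open>After block \<open>j0\<close> both parties hold the transcript in some slot and encode
  it identically.\<close>

lemma counted_truth:
  assumes "i < 7 * d * N" "j0 < i div N" "action_at S' \<Pi> v p i = Listen"
    "action_at S' \<Pi> v (peer p) i \<noteq> Listen" "i \<notin> CorP p"
  shows "\<exists>y. v p ! i = Some y \<and> supports y (entry p (\<Pi> p) (v p) i (hh p))"
proof -
  obtain y where y: "v p ! i = Some y" "y mod Zs = tuple (peer p) (\<Pi> (peer p)) (v (peer p)) i"
    using honest[OF assms(1,3,4,5)] by blast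
  have e: "entry p' (\<Pi> p') (v p') i (hh p') = Suc (amp t \<tau> (i mod N))" for p'
    using hh[of p'] assms(2) by (simp add: entry_def slotc_def)
  have "supports y (entry p (\<Pi> p) (v p) i (hh p))"
    unfolding supports_tuple[OF y(2)] using e hh(3)[of "peer p"] by auto
  then show ?thesis using y(1) by blast
qed

text \<open>Each bad block removes \<open>N / 2\<close> symbols that the party could hear but
  consumes \<open>(1 / 2 - \<epsilon>) N\<close> corruptions, so the two effects of
  \<open>j0\<close> nearly cancel. Twice the balance is \<open>(6 d - j0 - 1) N - 2 (2 - 14
  \<epsilon>) d N + j0 (1 - 2 \<epsilon>) N\<close>; with \<open>j0 \<le> 6 d\<close> this exceeds
  \<open>2 d N\<close> by at least \<open>16 \<epsilon> d N - N\<close>, which the choice of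
  \<open>d\<close> makes non-negative.\<close>

lemma truth_count:
  "real (d * N) \<le> real (cnt p (\<Pi> p) (v p) (6 * d * N) (hh p))"
  "(\<And>i. 6 * d * N \<le> i \<Longrightarrow> i < 7 * d * N \<Longrightarrow> action_at S' \<Pi> v p i = Listen \<and> action_at S' \<Pi> v (peer p) i \<noteq> Listen)
    \<Longrightarrow> real (2 * d * N) \<le> real (cnt p (\<Pi> p) (v p) (7 * d * N) (hh p))"
proof -
  let ?X = "{i. i < 6 * d * N \<and> Suc j0 \<le> i div N \<and> speaker (i mod N) = peer p}"
  let ?L = "{i. 6 * d * N \<le> i \<and> i < 7 * d * N}"
  let ?C = "{i \<in> CorP p. j0 < i div N}"
  let ?cs = "\<lambda>i0. {i. i < i0 \<and> (\<exists>y. v p ! i = Some y \<and> supports y (entry p (\<Pi> p) (v p) i (hh p)))}"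
  have "card ?X = (6 * d - Suc j0) * card {r. r < N \<and> speaker r = peer p}"
    by (rule card_blocks[OF N_pos])
  then have "2 * card ?X = (6 * d - Suc j0) * (2 * card {r. r < N \<and> speaker r = peer p})" by simp
  then have X: "2 * card ?X = (6 * d - Suc j0) * N" by (simp only: speaker_half)
  then have X': "2 * real (card ?X) = (6 * real d - real j0 - 1) * real N"
  proof -
    have "real (6 * d - Suc j0) = 6 * real d - real j0 - 1" using j0(1) by (simp add: of_nat_diff)
    then show ?thesis using arg_cong[OF X, of real] by (simp only: of_nat_mult of_nat_numeral)
  qed
  have "card ?C \<le> card {i \<in> Cor. j0 < i div N}" by (rule card_mono) (auto simp: CorP_def)
  then have C: "real (card ?C) \<le> (2 - 14 * \<epsilon>) * (real d * real N) - real j0 * ((1 / 2 - \<epsilon>) * real N)"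
    using bad_blocks_cost card_Cor by linarith
  have "\<epsilon> * real j0 * real N \<le> \<epsilon> * (6 * real d) * real N"
    using j0(1) eps(1) by (intro mult_right_mono mult_left_mono) auto
  moreover have "1 * real N \<le> 16 * \<epsilon> * real d * real N" using d by (intro mult_right_mono) auto
  moreover have "2 * real (card ?X) - 2 * real (card ?C) \<ge> (6 * real d - real j0 - 1) * real N
      - 2 * ((2 - 14 * \<epsilon>) * (real d * real N) - real j0 * ((1 / 2 - \<epsilon>) * real N))"
  proof -
    have "2 * a - 2 * c \<ge> y - 2 * b" if "2 * a = y" "c \<le> b" for a b c y :: real using that by linarith
    from this[OF X' C] show ?thesis .
  qed
  ultimately have XC: "real (d * N) \<le> real (card ?X) - real (card ?C)"
    by (simp add: algebra_simps)
  have lis: "action_at S' \<Pi> v p i = Listen \<and> action_at S' \<Pi> v (peer p) i \<noteq> Listen" if "i \<in> ?X" for i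
    using that block_actions[of i p] block_actions[of i "peer p"] by auto
  have sub: "?X - ?C \<subseteq> ?cs (6 * d * N)"
  proof
    fix i assume i: "i \<in> ?X - ?C"
    then have "i \<notin> CorP p" by auto
    moreover have "i < 7 * d * N" using i by (auto intro: less_le_trans)
    ultimately show "i \<in> ?cs (6 * d * N)" using counted_truth[of i p] lis[of i] i by auto
  qed
  have "card ?X - card ?C \<le> card (?X - ?C)" by (rule diff_card_le_card_Diff) simp
  also have "\<dots> \<le> card (?cs (6 * d * N))" by (rule card_mono[OF _ sub]) simp
  finally show "real (d * N) \<le> real (cnt p (\<Pi> p) (v p) (6 * d * N) (hh p))"
    using XC unfolding cnt_def by linarith
  assume last: "\<And>i. 6 * d * N \<le> i \<Longrightarrow> i < 7 * d * N \<Longrightarrow>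
    action_at S' \<Pi> v p i = Listen \<and> action_at S' \<Pi> v (peer p) i \<noteq> Listen"
  \<comment> \<open>The last phase adds \<open>d N\<close> heard rounds, while its corruptions are
    already contained in \<open>?C\<close>.\<close>
  have sub': "(?X \<union> ?L) - ?C \<subseteq> ?cs (7 * d * N)"
  proof
    fix i assume i: "i \<in> (?X \<union> ?L) - ?C"
    have i7: "i < 7 * d * N" using i by (auto intro: less_le_trans)
    have "j0 < i div N"
    proof (cases "i \<in> ?X")
      case False
      then have "6 * d * N \<le> i" using i by blast
      then have "6 * d * N div N \<le> i div N" by (rule div_le_mono)
      then show ?thesis using j0(1) N_pos by simp
    qed auto
    then show "i \<in> ?cs (7 * d * N)" using counted_truth[OF i7, of p] lis[of i] last[of i] i i7 by auto
  qed
  have "card ?L = d * N"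
  proof -
    have "?L = {6 * d * N..<7 * d * N}" by auto
    then show ?thesis by (simp add: mult.assoc)
  qed
  moreover have "card (?X \<union> ?L) = card ?X + card ?L" by (rule card_Un_disjoint) auto
  moreover have "card (?X \<union> ?L) - card ?C \<le> card ((?X \<union> ?L) - ?C)" by (rule diff_card_le_card_Diff) simp
  moreover have "card ((?X \<union> ?L) - ?C) \<le> card (?cs (7 * d * N))" by (rule card_mono[OF _ sub']) simp
  moreover have "real (2 * d * N) = 2 * real (d * N)" by simp
  ultimately show "real (2 * d * N) \<le> real (cnt p (\<Pi> p) (v p) (7 * d * N) (hh p))"
    using XC unfolding cnt_def by linarith
qed

text \<open>An uncorrupted symbol supports a wrong candidate only if its code word agrees in this
  position with that of a consistent candidate of the peer, and such candidates are different
  strings by \<open>transcript_properties\<close>. The choice of \<open>t\<close> bounds all these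
  positions together by \<open>7 \<epsilon> d N\<close>. The hypothesis on the peer excludes rounds
  in which both listen, where the adversary would choose symbols for free.\<close>

lemma false_count:
  assumes i0: "i0 \<le> 7 * d * N"
    and sp: "\<And>i. i < i0 \<Longrightarrow> action_at S' \<Pi> v p i = Listen \<Longrightarrow> action_at S' \<Pi> v (peer p) i \<noteq> Listen"
    and h: "h < K" "h \<noteq> hh p"
  shows "real (cnt p (\<Pi> p) (v p) i0 h) < real (card (CorP p)) + 7 * \<epsilon> * (real d * real N)"
proof (cases "good p (\<Pi> p) (v p) h")
  case False
  then have "entry p (\<Pi> p) (v p) i h = 0" for i by (simp add: entry_def slotc_def)
  then have "cnt p (\<Pi> p) (v p) i0 h = 0" by (simp add: cnt_def supports_def)
  then show ?thesis using eps d_pos N_pos by (simp add: add_nonneg_pos)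
next
  case True
  then obtain x where x: "raw p (\<Pi> p) (v p) h = Some x" "consistent q n (\<Pi> p) x"
    "\<forall>h'<h. raw p (\<Pi> p) (v p) h' \<noteq> Some x" unfolding good_def by blast
  \<comment> \<open>A good slot is the first one with its string, and the first one with
    \<open>\<tau>\<close> is \<open>hh p\<close>.\<close>
  have xt: "x \<noteq> \<tau>"
  proof
    assume "x = \<tau>"
    then have "hh p = h" unfolding hh_def using x by (intro Least_equality) (auto simp: not_le[symmetric])
    then show False using h(2) by simp
  qed
  let ?\<eta> = "(1 - 1 / (240 * real cc)) ^ t * real cc"
  let ?Q = "{h'. h' < K \<and> good (peer p) (\<Pi> (peer p)) (v (peer p)) h'}"
  let ?y = "\<lambda>h'. the (raw (peer p) (\<Pi> (peer p)) (v (peer p)) h')"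
  let ?A = "\<lambda>h'. {i. i < 7 * d * N \<and> amp t (?y h') (i mod N) = amp t x (i mod N)}"
  have neq: "?y h' \<noteq> x" "string q n (?y h')" if h': "h' \<in> ?Q" for h'
  proof -
    from h' have con: "consistent q n (\<Pi> (peer p)) (?y h')" by (auto simp: good_def)
    then show "string q n (?y h')" by (simp add: consistent_def)
    show "?y h' \<noteq> x"
    proof
      assume "?y h' = x"
      then have "consistent q n (\<Pi> p') x" for p' using con x(2) by (cases p; cases p') auto
      then have "x = \<tau>" unfolding consistent_def by (intro transcript_properties(3)[OF pro]) auto
      then show False using xt by simp
    qed
  qed
  have str: "string q n x" using x(2) by (simp add: consistent_def)
  \<comment> \<open>The code word is repeated in every block, so each of its \<open>N\<close>
    positions is met \<open>7 d\<close> times.\<close>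
  have A: "real (card (?A h')) \<le> 7 * real d * (?\<eta> * real N)" if h': "h' \<in> ?Q" for h'
  proof -
    have "card (?A h') = 7 * d * card {r. r < N \<and> amp t (?y h') r = amp t x r}"
      using card_blocks[OF N_pos, of "7 * d" 0 "\<lambda>r. amp t (?y h') r = amp t x r"] by simp
    then have "real (card (?A h')) = 7 * real d * real (card {r. r < N \<and> amp t (?y h') r = amp t x r})" by simp
    also have "\<dots> \<le> 7 * real d * (?\<eta> * real N)"
      using amp_distance[OF neq(2)[OF h'] str neq(1)[OF h'], of t] by (intro mult_left_mono) (auto simp: mult.assoc)
    finally show ?thesis .
  qed
  have "{i. i < i0 \<and> (\<exists>y. v p ! i = Some y \<and> supports y (entry p (\<Pi> p) (v p) i h))} \<subseteq> CorP p \<union> (\<Union>h'\<in>?Q. ?A h')"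
  proof
    fix i assume "i \<in> {i. i < i0 \<and> (\<exists>y. v p ! i = Some y \<and> supports y (entry p (\<Pi> p) (v p) i h))}"
    then obtain y where i: "i < i0" and y: "v p ! i = Some y" "supports y (entry p (\<Pi> p) (v p) i h)" by blast
    have i7: "i < 7 * d * N" using i i0 by simp
    show "i \<in> CorP p \<union> (\<Union>h'\<in>?Q. ?A h')"
    proof (cases "i \<in> CorP p")
      case False
      have l: "action_at S' \<Pi> v p i = Listen"
        using executionD(2)[OF exe, of i p] i7 y(1) by (cases "action_at S' \<Pi> v p i") auto
      from honest[OF i7 l sp[OF i l] False] y(1)
      have "y mod Zs = tuple (peer p) (\<Pi> (peer p)) (v (peer p)) i" by auto
      from y(2)[unfolded supports_tuple[OF this]] obtain h' where h': "h' < K"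
        "entry (peer p) (\<Pi> (peer p)) (v (peer p)) i h' = entry p (\<Pi> p) (v p) i h"
        "entry p (\<Pi> p) (v p) i h \<noteq> 0" by auto
      then have "h' \<in> ?Q" "i \<in> ?A h'"
        using i7 x(1) by (auto simp: entry_def slotc_def split: if_splits)
      then show ?thesis by blast
    qed simp
  qed
  then have "cnt p (\<Pi> p) (v p) i0 h \<le> card (CorP p \<union> (\<Union>h'\<in>?Q. ?A h'))"
    unfolding cnt_def by (intro card_mono) auto
  also have "\<dots> \<le> card (CorP p) + card (\<Union>h'\<in>?Q. ?A h')" by (rule card_Un_le)
  also have "\<dots> \<le> card (CorP p) + (\<Sum>h'\<in>?Q. card (?A h'))" using card_UN_le[of ?Q ?A] by simp
  finally have "real (cnt p (\<Pi> p) (v p) i0 h) \<le> real (card (CorP p)) + (\<Sum>h'\<in>?Q. real (card (?A h')))"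
    by (simp only: of_nat_sum[symmetric] of_nat_add[symmetric] of_nat_le_iff)
  also have "(\<Sum>h'\<in>?Q. real (card (?A h'))) \<le> (\<Sum>h'\<in>?Q. 7 * real d * (?\<eta> * real N))"
    by (rule sum_mono) (rule A)
  also have "\<dots> = real (card ?Q) * (7 * real d * (?\<eta> * real N))" by simp
  also have "\<dots> \<le> real K * (7 * real d * (?\<eta> * real N))"
  proof (rule mult_right_mono)
    have "card ?Q \<le> card {..<K}" by (rule card_mono) auto
    then show "real (card ?Q) \<le> real K" by (simp only: of_nat_le_iff card_lessThan)
    have "1 \<le> cc" by (simp add: cc_def)
    then show "0 \<le> 7 * real d * (?\<eta> * real N)" by (intro mult_nonneg_nonneg zero_le_power) (auto simp: field_simps)
  qed
  also have "\<dots> = (real K * ?\<eta>) * (7 * real d * real N)" by (simp add: algebra_simps)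
  also have "\<dots> < \<epsilon> * (7 * real d * real N)"
    using t d_pos N_pos by (intro mult_strict_right_mono) auto
  finally show ?thesis by (simp add: algebra_simps)
qed

text \<open>One of the parties is hit by at most half of the corruptions, that is
  \<open>(1 - 7 \<epsilon>) d N\<close>. For this party every wrong candidate stays below
  \<open>d N\<close>, while the transcript reaches \<open>d N\<close>.\<close>

lemma peer_certain:
  assumes "\<not> certain p (\<Pi> p) (v p)"
  shows "certain (peer p) (\<Pi> (peer p)) (v (peer p))"
proof -
  have sp: "action_at S' \<Pi> v (peer p') i \<noteq> Listen"
    if "i < 6 * d * N" "action_at S' \<Pi> v p' i = Listen" for i p'
    using block_actions[OF that(1), of p'] block_actions[OF that(1), of "peer p'"] that(2) by auto
  have cert: "certain p' (\<Pi> p') (v p')" if c: "2 * card (CorP p') \<le> card Cor" for p'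
  proof -
    have "cnt p' (\<Pi> p') (v p') (6 * d * N) h < d * N" if "h < K" "h \<noteq> hh p'" for h
    proof -
      have "real (cnt p' (\<Pi> p') (v p') (6 * d * N) h) < real (card (CorP p')) + 7 * \<epsilon> * (real d * real N)"
        by (rule false_count[OF _ sp that]) auto
      also have "\<dots> \<le> real (d * N)" using c card_Cor by (simp add: algebra_simps)
      finally show ?thesis by linarith
    qed
    then have "{h. h < K \<and> d * N \<le> cnt p' (\<Pi> p') (v p') (6 * d * N) h} = {hh p'}"
      using truth_count(1)[of p'] hh(3)[of p'] by (auto simp: not_less[symmetric] simp del: of_nat_mult)
    then show ?thesis unfolding certain_def by simp
  qed
  have "2 * card (CorP p) \<le> card Cor \<or> 2 * card (CorP (peer p)) \<le> card Cor"
    using card_CorP[of p] by linarith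
  then show ?thesis using cert[of p] cert[of "peer p"] assms by blast
qed

text \<open>A certain party hears nothing in the last phase, so its counts are frozen and its only
  candidate is the transcript. For an uncertain party the peer is certain and speaks throughout the
  last phase, which lifts the transcript to \<open>2 d N\<close>.\<close>

lemma outcome_correct: "outcome' p (\<Pi> p) (v p) = [\<tau>]"
proof -
  define \<theta> where "\<theta> = (if certain p (\<Pi> p) (v p) then d * N else 2 * d * N)"
  have "h < K \<and> \<theta> \<le> cnt p (\<Pi> p) (v p) (7 * d * N) h \<longleftrightarrow> h = hh p" for h
  proof (cases "certain p (\<Pi> p) (v p)")
    case True
    have "cnt p (\<Pi> p) (v p) (7 * d * N) h = cnt p (\<Pi> p) (v p) (6 * d * N) h" for h
    proof -
      have "v p ! i = None" if "6 * d * N \<le> i" "i < 7 * d * N" for i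
        using executionD(2)[OF exe, of i p] action_last[OF exe that] True that by simp
      then have "i < 6 * d * N" if "i < 7 * d * N" "v p ! i = Some y" for i y
        using that by (metis not_le option.distinct(1))
      moreover have "6 * d * N \<le> 7 * d * N" by simp
      ultimately have "i < 7 * d * N \<and> (\<exists>y. v p ! i = Some y \<and> supports y (entry p (\<Pi> p) (v p) i h)) \<longleftrightarrow>
          i < 6 * d * N \<and> (\<exists>y. v p ! i = Some y \<and> supports y (entry p (\<Pi> p) (v p) i h))" for i
        by (meson less_le_trans)
      then show ?thesis unfolding cnt_def by (simp only:)
    qed
    then have e: "h < K \<and> \<theta> \<le> cnt p (\<Pi> p) (v p) (7 * d * N) h \<longleftrightarrow>
        h \<in> {h. h < K \<and> d * N \<le> cnt p (\<Pi> p) (v p) (6 * d * N) h}" for h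
      using True by (simp add: \<theta>_def)
    obtain h1 where h1: "{h. h < K \<and> d * N \<le> cnt p (\<Pi> p) (v p) (6 * d * N) h} = {h1}"
      using True unfolding certain_def by (rule card_1_singletonE)
    moreover have "hh p \<in> {h. h < K \<and> d * N \<le> cnt p (\<Pi> p) (v p) (6 * d * N) h}"
      using truth_count(1)[of p] hh(3)[of p] by (simp del: of_nat_mult)
    ultimately show ?thesis using e by auto
  next
    case False
    then have pc: "certain (peer p) (\<Pi> (peer p)) (v (peer p))" by (rule peer_certain)
    have last: "action_at S' \<Pi> v p i = Listen \<and> action_at S' \<Pi> v (peer p) i \<noteq> Listen"
      if "6 * d * N \<le> i" "i < 7 * d * N" for i
      using action_last[OF exe that] False pc by simp
    have sp: "action_at S' \<Pi> v (peer p) i \<noteq> Listen" if "i < 7 * d * N" "action_at S' \<Pi> v p i = Listen" for i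
      using block_actions[of i p] block_actions[of i "peer p"] that last[of i] by (cases "i < 6 * d * N") auto
    have "cnt p (\<Pi> p) (v p) (7 * d * N) h < 2 * d * N" if "h < K" "h \<noteq> hh p" for h
    proof -
      have "real (cnt p (\<Pi> p) (v p) (7 * d * N) h) < real (card (CorP p)) + 7 * \<epsilon> * (real d * real N)"
        by (rule false_count[OF _ sp that]) auto
      \<comment> \<open>Now the whole budget may be directed at this party; it still suffices that
        \<open>2 - 14 \<epsilon> + 7 \<epsilon> < 2\<close>.\<close>
      also have "card (CorP p) \<le> card Cor" by (rule card_mono) (auto simp: CorP_def)
      then have "real (card (CorP p)) + 7 * \<epsilon> * (real d * real N) \<le> real (2 * d * N) - 7 * \<epsilon> * (real d * real N)"
        using card_Cor by (simp add: algebra_simps)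
      also have "\<dots> \<le> real (2 * d * N)" using eps by simp
      finally show ?thesis by linarith
    qed
    moreover have "2 * d * N \<le> cnt p (\<Pi> p) (v p) (7 * d * N) (hh p)"
      using truth_count(2)[OF last] by (simp del: of_nat_mult)
    ultimately show ?thesis using False hh(3)[of p] by (auto simp: \<theta>_def not_less[symmetric])
  qed
  then have H: "(\<lambda>h. h < K \<and> \<theta> \<le> cnt p (\<Pi> p) (v p) (7 * d * N) h) = (\<lambda>h. h = hh p)" by (rule ext)
  have "(LEAST h. h = hh p) = hh p" by (rule Least_equality) auto
  then show ?thesis unfolding outcome'_def Let_def \<theta>_def[symmetric] H using hh(1)[of p] by simp
qed

end

lemma uniquely_decodes_S': "uniquely_decodes q n (2 / 7 - 2 * \<epsilon>) S'"
  unfolding uniquely_decodes_def S'_simps(4) using outcome_correct by blast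

end

section \<open>Implementation\<close>

lemma runs_time: "runs f c s Q t \<Longrightarrow> t \<le> t' \<Longrightarrow> runs f c s Q t'"
  unfolding runs_def by (meson le_trans)

text \<open>The frame condition of all programs below: \<open>R\<close> and \<open>AS\<close> are
  the registers and arrays that may change.\<close>

definition only :: "nat set \<Rightarrow> nat set \<Rightarrow> state \<Rightarrow> state \<Rightarrow> bool" where
  "only R AS s s' \<longleftrightarrow> (\<forall>x. x \<notin> R \<longrightarrow> reg s' x = reg s x) \<and> (\<forall>A. A \<notin> AS \<longrightarrow> arr s' A = arr s A)"

lemma only_refl [simp]: "only R AS s s"
  by (simp add: only_def)

lemma only_trans: "only R AS s s1 \<Longrightarrow> only R' AS' s1 s2 \<Longrightarrow> R \<subseteq> Q \<Longrightarrow> R' \<subseteq> Q \<Longrightarrow> AS \<subseteq> B \<Longrightarrow> AS' \<subseteq> B \<Longrightarrow> only Q B s s2"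
  unfolding only_def by (metis subsetD)

lemma only_mono: "only R AS s s' \<Longrightarrow> R \<subseteq> Q \<Longrightarrow> AS \<subseteq> B \<Longrightarrow> only Q B s s'"
  unfolding only_def by blast

lemma only_set_reg [simp]: "x \<in> R \<Longrightarrow> only R AS s (set_reg x v s') = only R AS s s'"
  unfolding only_def by auto

lemma only_set_arr [simp]: "A \<in> AS \<Longrightarrow> only R AS s (set_arr A i v s') = only R AS s s'"
  unfolding only_def by (metis arr_set_arr_other reg_set_arr)

lemma only_reg: "only R AS s s' \<Longrightarrow> x \<notin> R \<Longrightarrow> reg s' x = reg s x"
  and only_arr: "only R AS s s' \<Longrightarrow> A \<notin> AS \<Longrightarrow> arr s' A = arr s A"
  by (auto simp: only_def)

lemma rn_notin [simp]: "x < 65 \<Longrightarrow> x \<notin> range (rn k)" "even x \<Longrightarrow> x \<notin> range (rn k)"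
  using rn_neq rn_neq_even by (metis imageE)+

lemma only_cp: "only R AS s s' \<Longrightarrow> (\<And>x. rn k x \<notin> R) \<Longrightarrow> (\<And>x. rn k x \<notin> AS) \<Longrightarrow> cp k s' = cp k s"
  by (simp add: only_def cp_def)

lemma outside_only: "outside k s s' \<Longrightarrow> only (range (rn k)) (range (rn k)) s s'"
  by (simp add: outside_def only_def)

lemma set_reg_same [simp]: "set_reg x (reg s x) s = s"
  by (simp add: set_reg_def)

lemma set_reg_twice [simp]: "set_reg x a (set_reg x b s) = set_reg x a s"
  by (simp add: set_reg_def)

text \<open>Multiplication by a power of two, the reason why all packings use such bases.\<close>

primrec dblc :: "nat \<Rightarrow> nat \<Rightarrow> com" where
  "dblc x 0 = Skip"
| "dblc x (Suc k) = Seq (Add x x x) (dblc x k)"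

lemma dblc [simp]: "loop_free (dblc x k)" "ev f (dblc x k) s = set_reg x (2 ^ k * reg s x) s"
  by (induction k arbitrary: s) (simp_all add: mult_2[symmetric] mult.assoc mult.left_commute)

primrec addn :: "nat \<Rightarrow> nat \<Rightarrow> nat \<Rightarrow> com" where
  "addn z y 0 = Skip"
| "addn z y (Suc c) = Seq (Add z z y) (addn z y c)"

lemma loop_free_addn [simp]: "loop_free (addn z y c)"
  by (induction c) auto

lemma ev_addn [simp]: "z \<noteq> y \<Longrightarrow> ev f (addn z y c) s = set_reg z (reg s z + c * reg s y) s"
  by (induction c arbitrary: s) (simp_all add: add.assoc)

text \<open>Division by repeated subtraction; the test is strict, hence the comparison with
  \<open>c - 1\<close>. The linear cost is paid only for dividends bounded by a constant, and once
  for the number of rounds.\<close>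

definition divc :: "nat \<Rightarrow> com" where
  "divc c = Seq (Seq (Const 21 c) (Seq (Const 22 0) (Const 23 (c - 1))))
     (WhileLess 23 20 (Seq (Sub 20 20 21) (Add 22 22 6)))"

lemma runs_divc:
  assumes "reg s 6 = 1" "0 < c"
  shows "runs f (divc c) s (\<lambda>s'. only {20..<24} {} s s' \<and> reg s' 20 = reg s 20 mod c \<and>
    reg s' 22 = reg s 20 div c) (3 * reg s 20 + 4)"
proof -
  let ?I = "\<lambda>s'. only {20..<24} {} s s' \<and> reg s' 21 = c \<and> reg s' 23 = c - 1 \<and>
    reg s 20 = reg s' 22 * c + reg s' 20"
  have "runs f (divc c) s (\<lambda>s'. only {20..<24} {} s s' \<and> reg s' 20 = reg s 20 mod c \<and>
    reg s' 22 = reg s 20 div c) (3 + (reg s 20 * Suc 2 + 1))"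
    unfolding divc_def
  proof (rule runs_Seq)
    show "runs f (Seq (Const 21 c) (Seq (Const 22 0) (Const 23 (c - 1)))) s
      (\<lambda>s1. ?I s1 \<and> reg s1 20 = reg s 20) 3"
      by (rule runs_loop_free) simp_all
  next
    fix s1 assume s1: "?I s1 \<and> reg s1 20 = reg s 20"
    then have e: "reg s1 20 = reg s 20" by blast
    have "runs f (WhileLess 23 20 (Seq (Sub 20 20 21) (Add 22 22 6))) s1
       (\<lambda>s'. only {20..<24} {} s s' \<and> reg s' 20 = reg s 20 mod c \<and> reg s' 22 = reg s 20 div c)
       (reg s1 20 * Suc 2 + 1)"
    proof (rule runs_while[where I = ?I and m = "\<lambda>s. reg s 20"])
      fix s' assume I: "?I s'" "reg s' 23 < reg s' 20"
      then have o: "reg s' 6 = 1" using only_reg[of "{20..<24}" "{}" s s' 6] assms by simp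
      show "runs f (Seq (Sub 20 20 21) (Add 22 22 6)) s' (\<lambda>s''. ?I s'' \<and> reg s'' 20 < reg s' 20) 2"
        by (rule runs_loop_free) (use I o assms in \<open>auto simp: add_mult_distrib\<close>)
    next
      fix s' assume I: "?I s'" "\<not> reg s' 23 < reg s' 20"
      then have "reg s' 20 < c" using assms by auto
      then show "only {20..<24} {} s s' \<and> reg s' 20 = reg s 20 mod c \<and> reg s' 22 = reg s 20 div c"
        using I by auto
    qed (use s1 in blast)
    then show "runs f (WhileLess 23 20 (Seq (Sub 20 20 21) (Add 22 22 6))) s1
       (\<lambda>s'. only {20..<24} {} s s' \<and> reg s' 20 = reg s 20 mod c \<and> reg s' 22 = reg s 20 div c)
       (reg s 20 * Suc 2 + 1)" by (simp only: e)
  qed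
  then show ?thesis by (rule runs_mono) auto
qed

section \<open>Subroutines of the encoder\<close>

context boosted
begin

text \<open>Constants shared by all subroutines. Registers 6 and 7 hold 1 and 0, so that increments
  and copies are single additions; array 10 replaces the multiplication by \<open>m\<close>.\<close>

definition env :: "state \<Rightarrow> bool" where
  "env z \<longleftrightarrow> reg z 0 = n \<and> reg z 6 = 1 \<and> reg z 7 = 0 \<and> reg z 8 = N \<and> reg z 9 = alphabet S \<and>
     reg z 10 = 2 ^ kap \<and> reg z 11 = m \<and> reg z 12 = m * m \<and> (\<forall>i<m. arr z 10 i = i * m)"

lemma envD: "env z \<Longrightarrow> reg z 0 = n" "env z \<Longrightarrow> reg z 6 = 1"
  "env z \<Longrightarrow> reg z 7 = 0" "env z \<Longrightarrow> reg z 8 = N" "env z \<Longrightarrow> reg z 9 = alphabet S"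
  "env z \<Longrightarrow> reg z 10 = 2 ^ kap" "env z \<Longrightarrow> reg z 11 = m" "env z \<Longrightarrow> reg z 12 = m * m"
  by (simp_all add: env_def)

lemma env_only:
  assumes "env z" "only R AS z z'" "{0, 6, 7, 8, 9, 10, 11, 12} \<inter> R = {}" "10 \<notin> AS"
  shows "env z'"
proof -
  have "reg z' x = reg z x" if "x \<in> {0, 6, 7, 8, 9, 10, 11, 12}" for x
  proof -
    have "x \<notin> R" using that assms(3) by blast
    then show ?thesis by (rule only_reg[OF assms(2)])
  qed
  moreover have "arr z' 10 = arr z 10" by (rule only_arr[OF assms(2,4)])
  ultimately show ?thesis using assms(1) by (simp add: env_def)
qed

text \<open>The language has no jump out of a loop, so a difference ends the loop by setting its
  bound in register 44 to 0.\<close>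

definition FD :: "nat \<Rightarrow> com" where
  "FD B = Seq (Seq (Const 42 0) (Add 44 0 7)) (WhileLess 42 44
     (Seq (Load 45 12 42) (Seq (Add 46 41 42) (Seq (Load 47 B 46)
       (IfLess 45 47 (Const 44 0) (IfLess 47 45 (Const 44 0) (Add 42 42 6)))))))"

lemma runs_FD:
  assumes env: "env z" and M: "\<And>i. i < n \<Longrightarrow> arr z 12 i = M ! i"
    and x: "\<And>i. i < n \<Longrightarrow> arr z B (reg z 41 + i) = x ! i"
  shows "runs f (FD B) z (\<lambda>z'. only {42..<48} {} z z' \<and> reg z' 42 = fdiff M x) (7 * n + 3)"
proof -
  let ?I = "\<lambda>z'. only {42..<48} {} z z' \<and> (\<forall>j<reg z' 42. M ! j = x ! j) \<and> reg z' 42 \<le> n \<and>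
    (reg z' 44 = n \<or> reg z' 44 = 0 \<and> reg z' 42 < n \<and> M ! reg z' 42 \<noteq> x ! reg z' 42)"
  let ?b = "Seq (Load 45 12 42) (Seq (Add 46 41 42) (Seq (Load 47 B 46)
       (IfLess 45 47 (Const 44 0) (IfLess 47 45 (Const 44 0) (Add 42 42 6)))))"
  have "runs f (FD B) z (\<lambda>z'. only {42..<48} {} z z' \<and> reg z' 42 = fdiff M x) (2 + (n * Suc 6 + 1))"
    unfolding FD_def
  proof (rule runs_Seq)
    show "runs f (Seq (Const 42 0) (Add 44 0 7)) z (\<lambda>s1. ?I s1 \<and> reg s1 44 - reg s1 42 = n) 2"
      by (rule runs_loop_free) (use envD[OF env] in simp_all)
  next
    fix s1 assume s1: "?I s1 \<and> reg s1 44 - reg s1 42 = n"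
    then have e: "reg s1 44 - reg s1 42 = n" by blast
    have "runs f (WhileLess 42 44 ?b) s1 (\<lambda>z'. only {42..<48} {} z z' \<and> reg z' 42 = fdiff M x)
        ((reg s1 44 - reg s1 42) * Suc 6 + 1)"
    proof (rule runs_while[where I = ?I and m = "\<lambda>z. reg z 44 - reg z 42"])
      fix z' assume I: "?I z'" "reg z' 42 < reg z' 44"
      then have k: "reg z' 42 < n" "reg z' 44 = n" by auto
      have r: "reg z' 6 = 1" "reg z' 41 = reg z 41" "arr z' = arr z"
        using I(1) only_reg[of "{42..<48}" "{}" z z'] only_arr[of "{42..<48}" "{}" z z'] envD[OF env]
        by auto
      show "runs f ?b z' (\<lambda>z''. ?I z'' \<and> reg z'' 44 - reg z'' 42 < reg z' 44 - reg z' 42) 6"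
        by (rule runs_loop_free) (use I k r M x in \<open>auto simp: less_Suc_eq\<close>)
    next
      fix z' assume I: "?I z'" "\<not> reg z' 42 < reg z' 44"
      then show "only {42..<48} {} z z' \<and> reg z' 42 = fdiff M x"
        using fdiff_eqI[of "reg z' 42" M x] by auto
    qed (use s1 in blast)
    then show "runs f (WhileLess 42 44 ?b) s1 (\<lambda>z'. only {42..<48} {} z z' \<and> reg z' 42 = fdiff M x)
        (n * Suc 6 + 1)" by (simp only: e)
  qed
  then show ?thesis by (rule runs_mono) auto
qed

definition had_body :: com where
  "had_body = Seq (Load 35 16 33) (Seq (Add 35 35 34) (Seq (IfLess 6 35 (Const 35 0) Skip)
     (Seq (Add 37 33 32) (Seq (Store 16 37 35) (Add 33 33 6)))))"

definition HAD :: com where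
  "HAD = Seq (Seq (Add 31 30 7) (Seq (Const 32 1) (Seq (Const 33 0) (Store 16 33 33))))
    (WhileLess 32 10 (Seq (Seq (Add 31 31 31) (Seq (IfLess 31 10 (Const 34 0) (Seq (Const 34 1) (Sub 31 31 10)))
        (Const 33 0)))
      (Seq (WhileLess 33 32 had_body) (Add 32 32 32))))"

lemma sum_two_powers: "(\<Sum>j<k. 2 ^ j) + 1 = (2::nat) ^ k"
  by (induction k) auto

text \<open>After \<open>j\<close> passes \<open>u\<close> consists of the top \<open>j\<close> bits
  of the message, and register 31 holds the other bits moved to the top of a word of
  \<open>kap\<close> bits; so the next bit is found by one doubling and one comparison with
  \<open>2 ^ kap\<close>. The passes double in length, and their costs form a geometric sum.\<close>

lemma runs_HAD:
  assumes env: "env z" and x: "reg z 30 = u0" "u0 < 2 ^ kap"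
  shows "runs f HAD z (\<lambda>z'. only {31..<40} {16} z z' \<and> (\<forall>y<2 ^ kap. arr z' 16 y = hd_code kap u0 y))
    (30 * 2 ^ kap)"
proof -
  let ?R = "only {31..<40} {16} z"
  let ?I = "\<lambda>j z'. ?R z' \<and> reg z' 32 = 2 ^ j \<and> (\<exists>u. u0 * 2 ^ j = u * 2 ^ kap + reg z' 31 \<and>
     reg z' 31 < 2 ^ kap \<and> (\<forall>y<2 ^ j. arr z' 16 y = hd_code j u y))"
  let ?pre = "Seq (Add 31 31 31) (Seq (IfLess 31 10 (Const 34 0) (Seq (Const 34 1) (Sub 31 31 10))) (Const 33 0))"
  have ro: "reg z' 6 = 1" "reg z' 10 = 2 ^ kap" if "?R z'" for z'
    using only_reg[OF that] envD[OF env] by simp_all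
  have "runs f HAD z (\<lambda>z'. ?R z' \<and> (\<forall>y<2 ^ kap. arr z' 16 y = hd_code kap u0 y))
    (4 + ((\<Sum>j<kap. Suc (5 + ((2 ^ j * Suc 7 + 1) + 1))) + 1))"
    unfolding HAD_def
  proof (rule runs_Seq)
    show "runs f (Seq (Add 31 30 7) (Seq (Const 32 1) (Seq (Const 33 0) (Store 16 33 33)))) z (?I 0) 4"
      by (rule runs_loop_free) (use envD[OF env] x in \<open>auto intro!: exI[of _ 0]\<close>)
  next
    fix s1 assume s1: "?I 0 s1"
    show "runs f (WhileLess 32 10 (Seq ?pre (Seq (WhileLess 33 32 had_body) (Add 32 32 32)))) s1
        (\<lambda>z'. ?R z' \<and> (\<forall>y<2 ^ kap. arr z' 16 y = hd_code kap u0 y))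
        ((\<Sum>j<kap. Suc (5 + ((2 ^ j * Suc 7 + 1) + 1))) + 1)"
    proof (rule runs_for[where I = ?I])
      fix j s2 assume j: "j < kap" and I: "?I j s2"
      then obtain u where u: "u0 * 2 ^ j = u * 2 ^ kap + reg s2 31" "reg s2 31 < 2 ^ kap"
        "\<forall>y<2 ^ j. arr s2 16 y = hd_code j u y" by blast
      \<comment> \<open>The bit that leaves the word when register 31 is doubled.\<close>
      define b where "b = (if 2 * reg s2 31 < 2 ^ kap then 0 else 1 :: nat)"
      let ?P = "\<lambda>k z'. ?R z' \<and> reg z' 32 = 2 ^ j \<and> reg z' 34 = b \<and> reg z' 33 = k \<and>
        u0 * 2 ^ Suc j = (2 * u + b) * 2 ^ kap + reg z' 31 \<and> reg z' 31 < 2 ^ kap \<and>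
        (\<forall>y<2 ^ j. arr z' 16 y = hd_code j u y) \<and>
        (\<forall>y<k. arr z' 16 (2 ^ j + y) = (hd_code j u y + b) mod 2)"
      have "runs f (Seq ?pre (Seq (WhileLess 33 32 had_body) (Add 32 32 32))) s2 (?I (Suc j))
          (5 + ((2 ^ j * Suc 7 + 1) + 1))"
      proof (rule runs_Seq)
        show "runs f ?pre s2 (?P 0) 5"
          by (rule runs_loop_free)
             (use I u ro[of s2] in \<open>auto simp: b_def algebra_simps\<close>)
      next
        fix s3 assume s3: "?P 0 s3"
        show "runs f (Seq (WhileLess 33 32 had_body) (Add 32 32 32)) s3 (?I (Suc j)) ((2 ^ j * Suc 7 + 1) + 1)"
        proof (rule runs_Seq)
          show "runs f (WhileLess 33 32 had_body) s3 (?P (2 ^ j)) (2 ^ j * Suc 7 + 1)"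
          proof (rule runs_for_const[where I = ?P])
            fix k s4 assume k: "k < 2 ^ j" and P: "?P k s4"
            have h: "arr s4 16 k = hd_code j u k" "hd_code j u k \<le> 1" "b \<le> 1"
              using P k hd_code_le by (auto simp: b_def)
            then have "arr s4 16 k + b = 0 \<or> arr s4 16 k + b = 1 \<or> arr s4 16 k + b = 2" by linarith
            then have m2: "(hd_code j u k + b) mod 2 = (if 1 < arr s4 16 k + b then 0 else arr s4 16 k + b)"
              using h(1) by auto
            have "runs f had_body s4 (?P (Suc k)) 7"
              unfolding had_body_def
              by (rule runs_loop_free) (use P k ro[of s4] m2 in \<open>auto simp: less_Suc_eq add.commute\<close>)
            then show "reg s4 33 < reg s4 32 \<and> runs f had_body s4 (?P (Suc k)) 7" using P k by simp
          next
            fix s4 assume "?P (2 ^ j) s4"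
            then show "\<not> reg s4 33 < reg s4 32 \<and> ?P (2 ^ j) s4" by simp
          qed (use s3 in blast)
        next
          fix s4 assume P: "?P (2 ^ j) s4"
          have h: "arr s4 16 y = hd_code (Suc j) (2 * u + b) y" if "y < 2 ^ Suc j" for y
          proof -
            have d: "(2 * u + b) div 2 = u" by (simp add: b_def)
            show ?thesis
            proof (cases "y < 2 ^ j")
              case True
              then show ?thesis using P d by simp
            next
              case False
              then have "y = 2 ^ j + (y - 2 ^ j)" "y - 2 ^ j < 2 ^ j" using that by auto
              then have "arr s4 16 y = (hd_code j u (y - 2 ^ j) + b) mod 2" using P by metis
              also have "\<dots> = (hd_code j u (y - 2 ^ j) + (2 * u + b)) mod 2" by presburger
              finally show ?thesis using False d by simp
            qed
          qed
          show "runs f (Add 32 32 32) s4 (?I (Suc j)) 1"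
            by (rule runs_loop_free) (use P h in \<open>auto intro!: exI[of _ "2 * u + b"]\<close>)
        qed
      qed
      moreover have "reg s2 32 < reg s2 10" using I j ro[of s2] by simp
      ultimately show "reg s2 32 < reg s2 10 \<and>
          runs f (Seq ?pre (Seq (WhileLess 33 32 had_body) (Add 32 32 32))) s2 (?I (Suc j))
          (5 + ((2 ^ j * Suc 7 + 1) + 1))" by blast
    next
      fix s2 assume I: "?I kap s2"
      then obtain u where u: "u0 * 2 ^ kap = u * 2 ^ kap + reg s2 31" "reg s2 31 < 2 ^ kap"
        "\<forall>y<2 ^ kap. arr s2 16 y = hd_code kap u y" by blast
      then have "u0 = u"
        by (metis add.commute div_mult_self1 div_less div_mult_self_is_m mult_0_right add_0 pos2 zero_less_power div_mult_self3)
      then show "\<not> reg s2 32 < reg s2 10 \<and> ?R s2 \<and> (\<forall>y<2 ^ kap. arr s2 16 y = hd_code kap u0 y)"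
        using I u ro[of s2] by simp
    qed (use s1 in blast)
  qed
  moreover have "4 + ((\<Sum>j<kap. Suc (5 + ((2 ^ j * Suc 7 + 1) + 1))) + 1) \<le> 30 * 2 ^ kap"
  proof -
    have "(\<Sum>j<kap. Suc (5 + ((2 ^ j * Suc 7 + 1) + 1))) = 8 * (\<Sum>j<kap. 2 ^ j) + 8 * kap"
      by (simp add: sum.distrib sum_distrib_left[symmetric] algebra_simps)
    moreover have "kap < 2 ^ kap" by (rule less_exp)
    ultimately show ?thesis using sum_two_powers[of kap] by linarith
  qed
  ultimately show ?thesis by (rule runs_time)
qed

end

text \<open>Merges the branches of a test into one assignment, so that symbolic execution does not
  split the goal.\<close>

lemma if_state [simp]:
  "(if b then s else set_reg x v s) = set_reg x (if b then reg s x else v) s"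
  "(if b then set_reg x v s else s) = set_reg x (if b then v else reg s x) s"
  "(if b then set_reg x u s else set_reg x v s) = set_reg x (if b then u else v) s"
  "x \<noteq> y \<Longrightarrow> (if b then s else set_reg x v (set_reg y u s)) =
     set_reg x (if b then reg s x else v) (set_reg y (if b then reg s y else u) s)"
  by (auto simp: set_reg_def)

primrec wr :: "com \<Rightarrow> nat set" where
  "wr Skip = {}"
| "wr (Const x k) = {x}"
| "wr (Add x y z) = {x}"
| "wr (Sub x y z) = {x}"
| "wr (Load x A y) = {x}"
| "wr (Store A x y) = {}"
| "wr (Query x A y) = {x}"
| "wr (Seq c1 c2) = wr c1 \<union> wr c2"
| "wr (IfLess x y c1 c2) = wr c1 \<union> wr c2"
| "wr (WhileLess x y c) = {}"

primrec wa :: "com \<Rightarrow> nat set" where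
  "wa Skip = {}"
| "wa (Const x k) = {}"
| "wa (Add x y z) = {}"
| "wa (Sub x y z) = {}"
| "wa (Load x A y) = {}"
| "wa (Store A x y) = {A}"
| "wa (Query x A y) = {}"
| "wa (Seq c1 c2) = wa c1 \<union> wa c2"
| "wa (IfLess x y c1 c2) = wa c1 \<union> wa c2"
| "wa (WhileLess x y c) = {}"

text \<open>A frame condition read off from the syntax, for code that is too long to be executed
  symbolically in one piece.\<close>

lemma only_ev: "wr c \<subseteq> R \<Longrightarrow> wa c \<subseteq> AS \<Longrightarrow> only R AS s (ev f c s)"
proof (induction c arbitrary: s)
  case (Seq c1 c2)
  have 1: "only R AS s (ev f c1 s)" and 2: "only R AS (ev f c1 s) (ev f c2 (ev f c1 s))"
    using Seq.prems by (auto intro!: Seq.IH)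
  show ?case unfolding ev.simps by (rule only_trans[OF 1 2]) auto
next
  case (IfLess x y c1 c2)
  have "only R AS s (ev f c1 s)" "only R AS s (ev f c2 s)"
    using IfLess.prems by (auto intro!: IfLess.IH)
  then show ?case by (cases "reg s x < reg s y") (simp_all only: ev.simps if_True if_False)
qed auto

lemma wr_dblc [simp]: "wr (dblc x k) \<subseteq> {x}" "wa (dblc x k) = {}"
  by (induction k) auto

text \<open>For a sum of two residues, one conditional subtraction yields the remainder.\<close>

definition wrap :: "nat \<Rightarrow> nat \<Rightarrow> nat" where "wrap a m = (if a < m then a else a - m)"

lemma add_wrap: "a < m \<Longrightarrow> b < m \<Longrightarrow> wrap (a + b) m = (a + b) mod m"
  by (simp add: wrap_def le_mod_geq)

lemma Suc_wrap: "a < m \<Longrightarrow> wrap (Suc a) m = Suc a mod m"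
  by (cases "Suc a = m") (auto simp: wrap_def)

context boosted
begin

definition initx_body :: com where
  "initx_body = Seq (IfLess 30 8 (Load 31 14 30) (Const 31 0)) (Seq (Store 20 30 31) (Add 30 30 6))"

definition INITX :: com where
  "INITX = Seq (Const 30 0) (WhileLess 30 12 initx_body)"

lemma runs_INITX:
  assumes env: "env z" and W: "\<And>r. r < N \<Longrightarrow> arr z 14 r = W M r"
  shows "runs f INITX z (\<lambda>z'. only {30..<32} {20} z z' \<and> (\<forall>v<m * m. arr z' 20 v = base 0 M v))
    (1 + (m * m * Suc (len initx_body) + 1))"
proof -
  let ?R = "only {30..<32} {20} z"
  let ?I = "\<lambda>k z'. ?R z' \<and> reg z' 30 = k \<and> (\<forall>v<k. arr z' 20 v = base 0 M v)"
  have ro: "reg z' 6 = 1" "reg z' 8 = N" "reg z' 12 = m * m" "arr z' 14 = arr z 14" if "?R z'" for z'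
    using only_reg[OF that] only_arr[OF that] envD[OF env] by simp_all
  show ?thesis unfolding INITX_def
  proof (rule runs_Seq)
    show "runs f (Const 30 0) z (?I 0) 1" by (rule runs_loop_free) simp_all
  next
    fix s1 assume s1: "?I 0 s1"
    show "runs f (WhileLess 30 12 initx_body) s1 (\<lambda>z'. ?R z' \<and> (\<forall>v<m * m. arr z' 20 v = base 0 M v))
      (m * m * Suc (len initx_body) + 1)"
    proof (rule runs_for_const[where I = ?I])
      fix k s2 assume k: "k < m * m" and I: "?I k s2"
      have "runs f initx_body s2 (?I (Suc k)) (len initx_body)"
        by (rule runs_loop_free)
           (use I k ro[of s2] W[of k] in \<open>auto simp: initx_body_def less_Suc_eq\<close>)
      then show "reg s2 30 < reg s2 12 \<and> runs f initx_body s2 (?I (Suc k)) (len initx_body)"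
        using I k ro[of s2] by simp
    next
      fix s2 assume "?I (m * m) s2"
      then show "\<not> reg s2 30 < reg s2 12 \<and> ?R s2 \<and> (\<forall>v<m * m. arr s2 20 v = base 0 M v)"
        using ro[of s2] by simp
    qed (use s1 in blast)
  qed
qed

definition mix_body :: com where
  "mix_body = Seq (Load 32 20 31) (Seq (Add 32 32 32) (Seq (IfLess 31 10 (Load 33 16 31) (Const 33 0))
     (Seq (Add 32 32 33) (Seq (Store 20 31 32) (Add 31 31 6)))))"

definition MIX :: com where
  "MIX = Seq (Const 31 0) (WhileLess 31 12 mix_body)"

lemma runs_MIX:
  assumes env: "env z" and b: "\<And>v. v < m * m \<Longrightarrow> arr z 20 v = base k0 M v"
    and h: "\<And>y. y < 2 ^ kap \<Longrightarrow> arr z 16 y = hd_code kap (color M k0) y"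
  shows "runs f MIX z (\<lambda>z'. only {31..<34} {20} z z' \<and> (\<forall>v<m * m. arr z' 20 v = base (Suc k0) M v))
    (1 + (m * m * Suc (len mix_body) + 1))"
proof -
  let ?R = "only {31..<34} {20} z"
  let ?I = "\<lambda>k z'. ?R z' \<and> reg z' 31 = k \<and> (\<forall>v<k. arr z' 20 v = base (Suc k0) M v) \<and>
    (\<forall>v. k \<le> v \<longrightarrow> v < m * m \<longrightarrow> arr z' 20 v = base k0 M v)"
  have ro: "reg z' 6 = 1" "reg z' 10 = 2 ^ kap" "reg z' 12 = m * m" "arr z' 16 = arr z 16" if "?R z'" for z'
    using only_reg[OF that] only_arr[OF that] envD[OF env] by simp_all
  show ?thesis unfolding MIX_def
  proof (rule runs_Seq)
    show "runs f (Const 31 0) z (?I 0) 1" by (rule runs_loop_free) (use b in simp_all)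
  next
    fix s1 assume s1: "?I 0 s1"
    show "runs f (WhileLess 31 12 mix_body) s1 (\<lambda>z'. ?R z' \<and> (\<forall>v<m * m. arr z' 20 v = base (Suc k0) M v))
      (m * m * Suc (len mix_body) + 1)"
    proof (rule runs_for_const[where I = ?I])
      fix k s2 assume k: "k < m * m" and I: "?I k s2"
      have "runs f mix_body s2 (?I (Suc k)) (len mix_body)"
        by (rule runs_loop_free)
           (use I k ro[of s2] h[of k] in \<open>auto simp: mix_body_def less_Suc_eq\<close>)
      then show "reg s2 31 < reg s2 12 \<and> runs f mix_body s2 (?I (Suc k)) (len mix_body)"
        using I k ro[of s2] by simp
    next
      fix s2 assume "?I (m * m) s2"
      then show "\<not> reg s2 31 < reg s2 12 \<and> ?R s2 \<and> (\<forall>v<m * m. arr s2 20 v = base (Suc k0) M v)"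
        using ro[of s2] by simp
    qed (use s1 in blast)
  qed
qed

definition wrapm :: "nat \<Rightarrow> com" where "wrapm a = IfLess a 11 Skip (Sub a a 11)"

lemma ev_wrapm: "ev f (wrapm a) z = set_reg a (wrap (reg z a) (reg z 11)) z"
  by (simp add: wrapm_def wrap_def)

definition amp_load :: "nat \<Rightarrow> com" where
  "amp_load A = Seq (Load 40 A 30) (
     Seq (Add 34 31 6) (Seq (wrapm 34) (Seq (Load 34 10 34) (Seq (Add 34 34 32) (Seq (Load 41 A 34) (
     Seq (Add 35 32 6) (Seq (wrapm 35) (Seq (Add 36 33 35) (Seq (Load 42 A 36) (
     Seq (Add 37 31 32) (Seq (wrapm 37) (Seq (Load 38 10 37) (Seq (Add 38 38 32) (Seq (Load 43 A 38) (
     Seq (Add 38 33 37) (Load 44 A 38))))))))))))))))"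

definition amp_pack :: "nat \<Rightarrow> com" where
  "amp_pack w = Seq (dblc 40 w) (Seq (Add 40 40 41) (Seq (dblc 40 w) (Seq (Add 40 40 42) (Seq (dblc 40 w) (Seq (Add 40 40 43)
      (Seq (dblc 40 w) (Add 40 40 44)))))))"

text \<open>The coordinates are advanced incrementally, since dividing every vertex number by
  \<open>m\<close> would be too slow. Register 35 is the next column; the row and its multiple of
  \<open>m\<close> move on when the column returns to 0.\<close>

definition amp_next :: "nat \<Rightarrow> com" where
  "amp_next B = Seq (Store B 30 40) (Seq (Add 30 30 6) (
     Seq (IfLess 7 35 Skip (Seq (Add 31 31 6) (Add 33 33 11))) (Add 32 35 7)))"

definition amp_body :: "nat \<Rightarrow> com" where
  "amp_body l = Seq (amp_load (20 + 2 * l)) (Seq (amp_pack (width l)) (amp_next (22 + 2 * l)))"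

definition AMP :: "nat \<Rightarrow> com" where
  "AMP l = Seq (Seq (Const 30 0) (Seq (Const 31 0) (Seq (Const 32 0) (Const 33 0))))
     (WhileLess 30 12 (amp_body l))"

text \<open>The new level goes to an array of its own, since the neighbours read may lie before or
  behind the current vertex.\<close>

lemma runs_AMP:
  assumes env: "env z" and a: "\<And>v. v < m * m \<Longrightarrow> arr z (20 + 2 * l) v = amp l M v"
  shows "runs f (AMP l) z (\<lambda>z'. only {30..<45} {22 + 2 * l} z z' \<and> (\<forall>v<m * m. arr z' (22 + 2 * l) v = amp (Suc l) M v))
    (4 + (m * m * Suc (len (amp_body l)) + 1))"
proof -
  let ?R = "only {30..<45} {22 + 2 * l} z"
  let ?I = "\<lambda>k z'. ?R z' \<and> reg z' 30 = k \<and> reg z' 31 = k div m \<and> reg z' 32 = k mod m \<and>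
    reg z' 33 = k div m * m \<and> (\<forall>v<k. arr z' (22 + 2 * l) v = amp (Suc l) M v)"
  have ro: "reg z' 6 = 1" "reg z' 7 = 0" "reg z' 11 = m" "reg z' 12 = m * m"
    "arr z' (20 + 2 * l) = arr z (20 + 2 * l)" "arr z' 10 = arr z 10" if "?R z'" for z'
    using only_reg[OF that] only_arr[OF that] envD[OF env] by simp_all
  have row: "\<And>i. i < m \<Longrightarrow> arr z 10 i = i * m" using env by (simp add: env_def)
  show ?thesis unfolding AMP_def
  proof (rule runs_Seq)
    show "runs f (Seq (Const 30 0) (Seq (Const 31 0) (Seq (Const 32 0) (Const 33 0)))) z (?I 0) 4"
      by (rule runs_loop_free) simp_all
  next
    fix s1 assume s1: "?I 0 s1"
    show "runs f (WhileLess 30 12 (amp_body l)) s1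
      (\<lambda>z'. ?R z' \<and> (\<forall>v<m * m. arr z' (22 + 2 * l) v = amp (Suc l) M v)) (m * m * Suc (len (amp_body l)) + 1)"
    proof (rule runs_for_const[where I = ?I])
      fix k s2 assume k: "k < m * m" and I: "?I k s2"
      define x y where "x = k div m" and "y = k mod m"
      have xm: "x < m" "y < m" using k m_pos by (simp_all add: x_def y_def less_mult_imp_div_less)
      note x1 = Suc_wrap[OF xm(1)] and y1 = Suc_wrap[OF xm(2)] and z1 = add_wrap[OF xm]
      have nb: "nbrs m k = [(x + 1) mod m * m + y, x * m + (y + 1) mod m, (x + y) mod m * m + y, x * m + (x + y) mod m]"
        by (simp add: nbrs_def Let_def x_def y_def)
      have lt: "u < m * m" if "u \<in> set (nbrs m k)" for u using nbrs_less[OF k that] .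
      have "amp (Suc l) M k = 2 ^ width l * (2 ^ width l * (2 ^ width l * (2 ^ width l * amp l M k
          + amp l M ((x + 1) mod m * m + y)) + amp l M (x * m + (y + 1) mod m))
          + amp l M ((x + y) mod m * m + y)) + amp l M (x * m + (x + y) mod m)"
        unfolding amp.simps nb by (simp add: pack_def)
      then have val: "amp (Suc l) M k = 2 ^ width l * (2 ^ width l * (2 ^ width l * (2 ^ width l * arr z (20 + 2 * l) k
          + arr z (20 + 2 * l) ((x + 1) mod m * m + y)) + arr z (20 + 2 * l) (x * m + (y + 1) mod m))
          + arr z (20 + 2 * l) ((x + y) mod m * m + y)) + arr z (20 + 2 * l) (x * m + (x + y) mod m)"
        using a k lt by (simp add: nb)
      have rows: "arr z 10 ((x + 1) mod m) = (x + 1) mod m * m" "arr z 10 ((x + y) mod m) = (x + y) mod m * m"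
        using row m_pos by simp_all
      define s3 where "s3 = ev f (amp_body l) s2"
      have I': "?R s2" "reg s2 30 = k" "reg s2 31 = x" "reg s2 32 = y" "reg s2 33 = x * m" using I by (simp_all add: x_def y_def)
      note simps = I' ro[OF I'(1)] x1 y1 z1 rows[simplified]
      have next_xy: "Suc k mod m = Suc y mod m" "Suc k div m = (if Suc y mod m = 0 then Suc x else x)"
        by (simp_all add: mod_Suc div_Suc x_def y_def)
      let ?A = "20 + 2 * l" and ?w = "2 ^ width l"
      define sa where "sa = ev f (amp_load ?A) s2"
      define sb where "sb = ev f (amp_pack (width l)) sa"
      have s3: "s3 = ev f (amp_next (22 + 2 * l)) sb" by (simp add: s3_def sa_def sb_def amp_body_def)
      have oa: "only {34..<45} {} s2 sa" unfolding sa_def by (rule only_ev) (auto simp: amp_load_def wrapm_def)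
      have ob: "only {40} {} sa sb"
        unfolding sb_def by (rule only_ev) (use wr_dblc(1)[of 40 "width l"] in \<open>auto simp: amp_pack_def\<close>)
      have oc: "only {30..<34} {22 + 2 * l} sb s3"
        unfolding s3 by (rule only_ev) (auto simp: amp_next_def)
      have R3: "?R s3"
        by (rule only_trans[OF only_trans[OF only_trans[OF I'(1) oa] ob] oc]) auto
      have la: "reg sa 40 = arr z ?A k" "reg sa 41 = arr z ?A (Suc x mod m * m + y)"
        "reg sa 42 = arr z ?A (x * m + Suc y mod m)"
        "reg sa 43 = arr z ?A ((x + y) mod m * m + y)"
        "reg sa 44 = arr z ?A (x * m + (x + y) mod m)" "reg sa 35 = Suc y mod m"
        unfolding sa_def amp_load_def by (simp_all add: simps ev_wrapm split del: if_split)
      have ra: "reg sa 30 = k" "reg sa 31 = x" "reg sa 33 = x * m" "arr sa = arr s2"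
        "reg sa 6 = 1" "reg sa 7 = 0" "reg sa 11 = m"
        using only_reg[OF oa] only_arr[OF oa] by (auto simp: simps)
      have lb: "reg sb 40 = amp (Suc l) M k"
        unfolding sb_def amp_pack_def val by (simp add: la)
      have rb: "reg sb 30 = k" "reg sb 31 = x" "reg sb 33 = x * m" "arr sb = arr s2"
        "reg sb 6 = 1" "reg sb 7 = 0" "reg sb 11 = m" "reg sb 35 = Suc y mod m"
        using only_reg[OF ob] only_arr[OF ob] by (auto simp: ra la)
      have regs3: "reg s3 30 = Suc k" "reg s3 32 = Suc y mod m"
        "reg s3 31 = (if Suc y mod m = 0 then Suc x else x)"
        "reg s3 33 = (if Suc y mod m = 0 then Suc x else x) * m"
        unfolding s3 amp_next_def by (simp_all add: rb)
      have arr3: "arr s3 (22 + 2 * l) v = (if v = k then amp (Suc l) M k else arr s2 (22 + 2 * l) v)" for v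
        unfolding s3 amp_next_def by (simp add: rb lb)
      have I3: "?I (Suc k) s3" using R3 regs3 arr3 I next_xy by (simp add: less_Suc_eq)
      have lf: "loop_free (amp_body l)"
        by (simp add: amp_body_def amp_load_def amp_pack_def amp_next_def wrapm_def)
      have "runs f (amp_body l) s2 (?I (Suc k)) (len (amp_body l))"
      proof (rule runs_loop_free[OF lf])
        show "?I (Suc k) (ev f (amp_body l) s2)" using I3 unfolding s3_def .
      qed simp
      then show "reg s2 30 < reg s2 12 \<and> runs f (amp_body l) s2 (?I (Suc k)) (len (amp_body l))"
        using I k ro[of s2] by simp
    next
      fix s2 assume "?I (m * m) s2"
      then show "\<not> reg s2 30 < reg s2 12 \<and> ?R s2 \<and> (\<forall>v<m * m. arr s2 (22 + 2 * l) v = amp (Suc l) M v)"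
        using ro[of s2] by simp
    qed (use s1 in blast)
  qed
qed

text \<open>The successor is stored since 0 is reserved for an absent candidate.\<close>

definition fin_body :: com where
  "fin_body = Seq (Load 32 (20 + 2 * t) 30) (Seq (Add 32 32 6) (Seq (Store 4 31 32) (Seq (Add 31 31 6) (Add 30 30 6))))"

definition FIN :: "nat \<Rightarrow> com" where
  "FIN h = Seq (Seq (Const 30 0) (Seq (Const 31 0) (addn 31 8 h))) (WhileLess 30 8 fin_body)"

lemma runs_FIN:
  assumes env: "env z" and a: "\<And>v. v < m * m \<Longrightarrow> arr z (20 + 2 * t) v = amp t M v"
  shows "runs f (FIN h) z (\<lambda>z'. only {30..<33} {4} z z' \<and>
     (\<forall>i. arr z' 4 i = (if h * N \<le> i \<and> i < h * N + N then Suc (amp t M (i - h * N)) else arr z 4 i)))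
    (2 + len (addn 31 8 h) + (N * Suc (len fin_body) + 1))"
proof -
  let ?R = "only {30..<33} {4} z"
  let ?I = "\<lambda>k z'. ?R z' \<and> reg z' 30 = k \<and> reg z' 31 = h * N + k \<and>
    (\<forall>i. arr z' 4 i = (if h * N \<le> i \<and> i < h * N + k then Suc (amp t M (i - h * N)) else arr z 4 i))"
  have ro: "reg z' 6 = 1" "reg z' 8 = N" "arr z' (20 + 2 * t) = arr z (20 + 2 * t)" if "?R z'" for z'
    using only_reg[OF that] only_arr[OF that] envD[OF env] by simp_all
  show ?thesis unfolding FIN_def
  proof (rule runs_Seq)
    show "runs f (Seq (Const 30 0) (Seq (Const 31 0) (addn 31 8 h))) z (?I 0) (2 + len (addn 31 8 h))"
      by (rule runs_loop_free) (use envD[OF env] in simp_all)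
  next
    fix s1 assume s1: "?I 0 s1"
    show "runs f (WhileLess 30 8 fin_body) s1 (\<lambda>z'. ?R z' \<and>
     (\<forall>i. arr z' 4 i = (if h * N \<le> i \<and> i < h * N + N then Suc (amp t M (i - h * N)) else arr z 4 i)))
      (N * Suc (len fin_body) + 1)"
    proof (rule runs_for_const[where I = ?I])
      fix k s2 assume k: "k < N" and I: "?I k s2"
      have "k < m * m" using k kap_ge(1) m_ge by linarith
      then have "arr z (20 + 2 * t) k = amp t M k" using a by blast
      then have "runs f fin_body s2 (?I (Suc k)) (len fin_body)"
        by (intro runs_loop_free) (use I k ro[of s2] in \<open>auto simp: fin_body_def less_Suc_eq\<close>)
      then show "reg s2 30 < reg s2 8 \<and> runs f fin_body s2 (?I (Suc k)) (len fin_body)"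
        using I k ro[of s2] by simp
    next
      fix s2 assume "?I N s2"
      then show "\<not> reg s2 30 < reg s2 8 \<and> ?R s2 \<and>
       (\<forall>i. arr s2 4 i = (if h * N \<le> i \<and> i < h * N + N then Suc (amp t M (i - h * N)) else arr z 4 i))"
        using ro[of s2] by simp
    qed (use s1 in blast)
  qed
qed

end

lemma rn_not_less [simp]: "c \<le> 65 \<Longrightarrow> \<not> rn k x < c"
  using rn_ge[of k x] by linarith

lemma stored_listsD:
  assumes "stored_lists n z = xs"
  shows "reg z 5 = length xs" "j < length xs \<Longrightarrow> length (xs ! j) = n"
    "j < length xs \<Longrightarrow> i < n \<Longrightarrow> arr z 0 (j * n + i) = xs ! j ! i"
  using assms by (auto simp: stored_lists_def)

section \<open>Running both parties of the given scheme\<close>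

text \<open>\<open>cw\<close> is the body of \<open>computable_within\<close> for the fixed
  \<open>n\<close>, with \<open>TT\<close> in place of \<open>T n\<close>.\<close>

locale machine = boosted +
  fixes rp ou :: "party \<Rightarrow> com" and TT :: nat
  assumes cw: "protocol q n \<Pi> \<Longrightarrow> execution S \<Pi> v \<Longrightarrow>
    (\<forall>r<N. \<exists>z t z' t'. reaches (\<Pi> p) (rp p) (initial_state n S) (take r (v p)) z t \<and>
           exec (\<Pi> p) (rp p) z t' z' \<and> reg z' 4 = action_code (action_at S \<Pi> v p r)) \<and>
    (\<exists>z t z' t'. reaches (\<Pi> p) (rp p) (initial_state n S) (v p) z t \<and>
           exec (\<Pi> p) (ou p) z t' z' \<and> stored_lists n z' = outcome S p (\<Pi> p) (v p) \<and> t + t' \<le> TT)"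
begin

abbreviation z0 :: state where "z0 \<equiv> initial_state n S"

lemma chain:
  assumes "protocol q n \<Pi>" "execution S \<Pi> v"
  obtains st st' tm fin tf where "run_chain (\<Pi> p) (rp p) z0 (v p) st st' tm"
    "\<forall>r<N. reg (st' r) 4 = action_code (action_at S \<Pi> v p r)"
    "exec (\<Pi> p) (ou p) (st N) tf fin" "stored_lists n fin = outcome S p (\<Pi> p) (v p)"
    "(\<Sum>r<N. tm r) + tf \<le> TT"
proof -
  have len: "length (v p) = N" using executionD(1)[OF assms(2)] .
  obtain z t z' t' where f: "reaches (\<Pi> p) (rp p) z0 (v p) z t" "exec (\<Pi> p) (ou p) z t' z'"
    "stored_lists n z' = outcome S p (\<Pi> p) (v p)" "t + t' \<le> TT"
    using cw[OF assms, of p] by blast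
  have "\<forall>r<length (v p). \<exists>s t s' t'. reaches (\<Pi> p) (rp p) z0 (take r (v p)) s t \<and>
      exec (\<Pi> p) (rp p) s t' s' \<and> reg s' 4 = action_code (action_at S \<Pi> v p r)"
    using cw[OF assms, of p] len by simp
  from run_chain_exists[OF this f(1)] obtain st st' tm where
    c: "run_chain (\<Pi> p) (rp p) z0 (v p) st st' tm" "st (length (v p)) = z"
      "t = (\<Sum>r<length (v p). tm r)"
      "\<And>r. r < length (v p) \<Longrightarrow> reg (st' r) 4 = action_code (action_at S \<Pi> v p r)" by blast
  show thesis
  proof (rule that[OF c(1)])
    show "\<forall>r<N. reg (st' r) 4 = action_code (action_at S \<Pi> v p r)" using c(4) len by simp
    show "exec (\<Pi> p) (ou p) (st N) t' z'" using f(2) c(2) len by simp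
    show "stored_lists n z' = outcome S p (\<Pi> p) (v p)" by (rule f(3))
    show "(\<Sum>r<N. tm r) + t' \<le> TT" using c(3) f(4) len by simp
  qed
qed

text \<open>Every round takes at least one step, so a constant amount of extra work per round is
  covered by the given time.\<close>

lemma N_le_TT: "N \<le> TT"
proof -
  have pr: "protocol q n (one_way n (replicate n 0))"
    by (rule protocol_one_way) (use q2 in \<open>auto simp: string_def\<close>)
  obtain st st' tm fin tf where c: "run_chain (one_way n (replicate n 0) Alice) (rp Alice) z0 (nfv (replicate n 0) Alice) st st' tm"
    "(\<Sum>r<N. tm r) + tf \<le> TT"
    using chain[OF pr execution_nf[OF A_pos], of Alice] by metis
  have "(\<Sum>r<N. 1) \<le> (\<Sum>r<N. tm r)"
    by (rule sum_mono) (use c(1) exec_time_pos in \<open>auto simp: run_chain_def Suc_le_eq\<close>)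
  then show ?thesis using c(2) by simp
qed

text \<open>A common unit of cost: the work at a block boundary is bounded by a constant times
  \<open>E\<close>, and \<open>E_le\<close> bounds \<open>E\<close> by a constant times
  \<open>TT\<close>.\<close>

definition E :: nat where "E = m * m + n + 1 + TT"

lemma E_ge: "1 \<le> E" "m * m \<le> E" "n \<le> E" "N \<le> E" "TT \<le> E" "2 ^ kap \<le> E"
  using N_le_TT m_ge by (auto simp: E_def)

text \<open>The usual shape of a loop cost: set-up \<open>a\<close>, then \<open>x\<close> passes of
  length \<open>L\<close>, then a rest \<open>b\<close>.\<close>

lemma time_bound: "x \<le> E \<Longrightarrow> a + (x * L + b) \<le> (a + b + L) * E"
proof -
  assume "x \<le> E"
  then have "x * L \<le> E * L" by (rule mult_right_mono) simp
  then have "x * L \<le> L * E" by (simp only: mult.commute)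
  moreover have "a \<le> a * E" "b \<le> b * E" using E_ge(1) by simp_all
  ultimately show ?thesis unfolding add_mult_distrib by linarith
qed

lemma time_const: "a \<le> a * E"
  using E_ge(1) by simp

text \<open>Every slot owns a fresh pair of copies for the noise-free run behind its encoding, so
  used memory never has to be cleared. The numbers below \<open>6 * d\<close> belong to the
  blocks.\<close>

abbreviation ka :: "nat \<Rightarrow> nat" where "ka h \<equiv> 6 * d + 2 * h"
abbreviation kb :: "nat \<Rightarrow> nat" where "kb h \<equiv> Suc (6 * d + 2 * h)"

abbreviation RR :: "nat \<Rightarrow> nat set" where "RR h \<equiv> range (rn (ka h)) \<union> range (rn (kb h))"

text \<open>\<open>qa\<close> and \<open>qb\<close> answer the queries of Alice and Bob in the
  one-way protocol for the string in array 12. Alice always listens, which has code 0; Bob's answer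
  depends only on the length of the history.\<close>

definition qa :: "nat \<Rightarrow> nat \<Rightarrow> nat \<Rightarrow> nat \<Rightarrow> com" where
  "qa k x A y = Const (rn k x) 0"

definition qb :: "nat \<Rightarrow> nat \<Rightarrow> nat \<Rightarrow> nat \<Rightarrow> com" where
  "qb k x A y = IfLess (rn k y) 0 (Seq (Load (rn k x) 12 (rn k y)) (Add (rn k x) (rn k x) 6)) (Const (rn k x) 0)"

lemma runs_sim_alice:
  assumes "exec (one_way n M Alice) c (cp k z) t1 z1"
  shows "runs f (tr (qa k) k c) z (\<lambda>z'. cp k z' = z1 \<and> outside k z z') (4 * t1)"
proof (rule runs_tr[where P = "\<lambda>_. True", OF assms])
  fix z :: state and x A y
  show "runs f (qa k x A y) z (\<lambda>z'. z' = set_reg (rn k x)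
      (action_code (one_way n M Alice (map (arr z (rn k A)) [0..<reg z (rn k y)]))) z) 4"
    by (rule runs_loop_free) (simp_all add: qa_def one_way_def)
qed simp_all

text \<open>The string and the constants read by \<open>qb\<close> lie outside the copy; they form
  the invariant \<open>P\<close> of \<open>runs_tr\<close>.\<close>

lemma runs_sim_bob:
  assumes "exec (one_way n M Bob) c (cp k z) t1 z1"
    and "reg z 0 = n" "reg z 6 = 1" "\<And>i. i < n \<Longrightarrow> arr z 12 i = M ! i"
  shows "runs f (tr (qb k) k c) z (\<lambda>z'. cp k z' = z1 \<and> outside k z z') (4 * t1)"
proof (rule runs_tr[where P = "\<lambda>z. reg z 0 = n \<and> reg z 6 = 1 \<and> (\<forall>i<n. arr z 12 i = M ! i)", OF assms(1)])
  fix z :: state and x A y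
  assume "reg z 0 = n \<and> reg z 6 = 1 \<and> (\<forall>i<n. arr z 12 i = M ! i)"
  then show "runs f (qb k x A y) z (\<lambda>z'. z' = set_reg (rn k x)
      (action_code (one_way n M Bob (map (arr z (rn k A)) [0..<reg z (rn k y)]))) z) 4"
    by (intro runs_loop_free) (simp_all add: qb_def one_way_def)
next
  fix z z' :: state assume "reg z 0 = n \<and> reg z 6 = 1 \<and> (\<forall>i<n. arr z 12 i = M ! i)" "outside k z z'"
  then show "reg z' 0 = n \<and> reg z' 6 = 1 \<and> (\<forall>i<n. arr z' 12 i = M ! i)"
    using outside_reg[of k z z'] outside_arr[of k z z' 12] by simp
qed (use assms in simp_all)

definition sim_tail :: "nat \<Rightarrow> com" where
  "sim_tail h = Seq (Add 30 (rn (ka h) 4) (rn (kb h) 4)) (Seq (Store 14 31 30)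
     (Seq (Add (rn (ka h) 3) (rn (kb h) 4) 7) (Seq (Add (rn (kb h) 3) (rn (ka h) 4) 7) (Add 31 31 6))))"

definition sim_body :: "nat \<Rightarrow> com" where
  "sim_body h = Seq (tr (qa (ka h)) (ka h) (rp Alice)) (Seq (tr (qb (kb h)) (kb h) (rp Bob)) (sim_tail h))"

definition SIM :: "nat \<Rightarrow> com" where
  "SIM h = Seq (Seq (Const 31 0) (WhileLess 31 8 (sim_body h))) (tr (qa (ka h)) (ka h) (ou Alice))"

text \<open>The two copies advance in lockstep. A sent symbol and a received one have the same code,
  and so have listening and receiving nothing; hence without noise the channel just hands the action
  code of each party to the other, and the sum of the codes is \<open>W\<close>. Only Alice's output
  program is run, as \<open>lst\<close> is her list.\<close>

lemma runs_SIM: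
  assumes env: "env z" and M: "string q n M" "\<And>i. i < n \<Longrightarrow> arr z 12 i = M ! i"
    and cpz: "cp (ka h) z = z0" "cp (kb h) z = z0"
  shows "runs f (SIM h) z (\<lambda>z'. only ({30, 31} \<union> RR h) ({14} \<union> RR h) z z' \<and>
      stored_lists n (cp (ka h) z') = lst M \<and> (\<forall>r<N. arr z' 14 r = W M r)) (18 * E)"
proof -
  let ?a = "ka h" and ?b = "kb h"
  let ?R = "only ({30, 31} \<union> RR h) ({14} \<union> RR h) z"
  have pr: "protocol q n (one_way n M)" by (rule protocol_one_way[OF M(1)])
  have ex: "execution S (one_way n M) (nfv M)" by (rule execution_nf[OF A_pos])
  obtain sa sa' ta fa tfa where A: "run_chain (one_way n M Alice) (rp Alice) z0 (nfv M Alice) sa sa' ta"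
    "\<forall>r<N. reg (sa' r) 4 = action_code (nfa M Alice r)"
    "exec (one_way n M Alice) (ou Alice) (sa N) tfa fa"
    "stored_lists n fa = outcome S Alice (one_way n M Alice) (nfv M Alice)"
    "(\<Sum>r<N. ta r) + tfa \<le> TT" by (rule chain[OF pr ex, where p = Alice]) (rule that)
  obtain sb sb' tb fb tfb where B: "run_chain (one_way n M Bob) (rp Bob) z0 (nfv M Bob) sb sb' tb"
    "\<forall>r<N. reg (sb' r) 4 = action_code (nfa M Bob r)"
    "exec (one_way n M Bob) (ou Bob) (sb N) tfb fb"
    "stored_lists n fb = outcome S Bob (one_way n M Bob) (nfv M Bob)"
    "(\<Sum>r<N. tb r) + tfb \<le> TT" by (rule chain[OF pr ex, where p = Bob]) (rule that)
  have rc: "received_code (nfv M Alice ! r) = action_code (nfa M Bob r)"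
    "received_code (nfv M Bob ! r) = action_code (nfa M Alice r)" if r: "r < N" for r
  proof -
    obtain x where "nfa M (speaker r) r = Transmit x" "nfa M (peer (speaker r)) r = Listen"
      "nfv M (speaker r) ! r = None" "nfv M (peer (speaker r)) ! r = Some x"
      using nf_speaker[OF M(1) r] by blast
    then show "received_code (nfv M Alice ! r) = action_code (nfa M Bob r)"
      "received_code (nfv M Bob ! r) = action_code (nfa M Alice r)"
      by (cases "speaker r"; simp)+
  qed
  have stepA: "exec (one_way n M Alice) (rp Alice) (sa r) (ta r) (sa' r)"
    "sa (Suc r) = set_reg 3 (action_code (nfa M Bob r)) (sa' r)" if "r < N" for r
    using A(1) that rc(1)[OF that] by (simp_all add: run_chain_def)
  have stepB: "exec (one_way n M Bob) (rp Bob) (sb r) (tb r) (sb' r)"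
    "sb (Suc r) = set_reg 3 (action_code (nfa M Alice r)) (sb' r)" if "r < N" for r
    using B(1) that rc(2)[OF that] by (simp_all add: run_chain_def)
  have init: "sa 0 = z0" "sb 0 = z0" using A(1) B(1) by (simp_all add: run_chain_def)
  let ?I = "\<lambda>r z'. ?R z' \<and> reg z' 31 = r \<and> cp ?a z' = sa r \<and> cp ?b z' = sb r \<and> (\<forall>i<r. arr z' 14 i = W M i)"
  have ro: "reg z' 0 = n" "reg z' 6 = 1" "reg z' 7 = 0" "reg z' 8 = N" "arr z' 12 = arr z 12" if "?R z'" for z'
    using only_reg[OF that] only_arr[OF that] envD[OF env] by simp_all
  have "runs f (SIM h) z (\<lambda>z'. ?R z' \<and> stored_lists n (cp ?a z') = lst M \<and> (\<forall>r<N. arr z' 14 r = W M r))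
    (1 + ((\<Sum>r<N. Suc (4 * ta r + (4 * tb r + 5))) + 1) + 4 * tfa)"
    unfolding SIM_def
  proof (rule runs_Seq)
    show "runs f (Seq (Const 31 0) (WhileLess 31 8 (sim_body h))) z (?I N) (1 + ((\<Sum>r<N. Suc (4 * ta r + (4 * tb r + 5))) + 1))"
    proof (rule runs_Seq)
      show "runs f (Const 31 0) z (?I 0) 1"
        by (rule runs_loop_free) (use cpz init in simp_all)
    next
      fix z1 assume z1: "?I 0 z1"
      show "runs f (WhileLess 31 8 (sim_body h)) z1 (?I N) ((\<Sum>r<N. Suc (4 * ta r + (4 * tb r + 5))) + 1)"
      proof (rule runs_for[where I = ?I])
        fix r z2 assume r: "r < N" and I: "?I r z2"
        have R2: "?R z2" and cp2: "cp ?a z2 = sa r" "cp ?b z2 = sb r" and w2: "\<forall>i<r. arr z2 14 i = W M i"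
          and r2: "reg z2 31 = r" using I by blast+
        have "runs f (sim_body h) z2 (?I (Suc r)) (4 * ta r + (4 * tb r + 5))"
          unfolding sim_body_def
        proof (rule runs_Seq)
          show "runs f (tr (qa ?a) ?a (rp Alice)) z2 (\<lambda>z'. cp ?a z' = sa' r \<and> outside ?a z2 z') (4 * ta r)"
            by (rule runs_sim_alice) (use stepA(1)[OF r] cp2 in simp)
        next
          fix z3 assume z3: "cp ?a z3 = sa' r \<and> outside ?a z2 z3"
          have R3: "?R z3"
            by (rule only_trans[OF R2 outside_only[OF conjunct2[OF z3]]]) auto
          have cp3: "cp ?b z3 = sb r" using outside_cp[OF conjunct2[OF z3], of ?b] cp2 by simp
          show "runs f (Seq (tr (qb ?b) ?b (rp Bob)) (sim_tail h)) z3 (?I (Suc r)) (4 * tb r + 5)"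
          proof (rule runs_Seq)
            show "runs f (tr (qb ?b) ?b (rp Bob)) z3 (\<lambda>z'. cp ?b z' = sb' r \<and> outside ?b z3 z') (4 * tb r)"
              by (rule runs_sim_bob) (use stepB(1)[OF r] cp3 ro[OF R3] M(2) in simp_all)
          next
            fix z4 assume z4: "cp ?b z4 = sb' r \<and> outside ?b z3 z4"
            have R4: "?R z4"
              by (rule only_trans[OF R3 outside_only[OF conjunct2[OF z4]]]) auto
            have a4: "cp ?a z4 = sa' r" using outside_cp[OF conjunct2[OF z4], of ?a] z3 by simp
            have b4: "cp ?b z4 = sb' r" using z4 by blast
            have v4: "reg z4 (rn ?a 4) = action_code (nfa M Alice r)" "reg z4 (rn ?b 4) = action_code (nfa M Bob r)"
              using arg_cong[OF a4, of "\<lambda>z. reg z 4"] arg_cong[OF b4, of "\<lambda>z. reg z 4"] A(2) B(2) r by simp_all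
            have r4: "reg z4 31 = r"
              using outside_reg[OF conjunct2[OF z4], of 31] outside_reg[OF conjunct2[OF z3], of 31] r2 by simp
            have w4: "arr z4 14 = arr z2 14"
              using outside_arr[OF conjunct2[OF z4], of 14] outside_arr[OF conjunct2[OF z3], of 14] by simp
            have "?I (Suc r) (ev f (sim_tail h) z4)"
              using R4 a4 b4 v4 r4 w4 w2 ro[OF R4] stepA(2)[OF r] stepB(2)[OF r]
              by (simp add: sim_tail_def W_def less_Suc_eq)
            then show "runs f (sim_tail h) z4 (?I (Suc r)) 5"
              by (intro runs_loop_free) (simp_all add: sim_tail_def)
          qed
        qed
        then show "reg z2 31 < reg z2 8 \<and> runs f (sim_body h) z2 (?I (Suc r)) (4 * ta r + (4 * tb r + 5))"
          using r r2 ro[OF R2] by simp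
      next
        fix z2 assume I: "?I N z2"
        then have "reg z2 8 = N" using ro by blast
        then show "\<not> reg z2 31 < reg z2 8 \<and> ?I N z2" using I by simp
      qed (rule z1)
    qed
  next
    fix z1 assume I: "?I N z1"
    have "runs f (tr (qa ?a) ?a (ou Alice)) z1 (\<lambda>z'. cp ?a z' = fa \<and> outside ?a z1 z') (4 * tfa)"
      by (rule runs_sim_alice) (use A(3) I in simp)
    then show "runs f (tr (qa ?a) ?a (ou Alice)) z1
      (\<lambda>z'. ?R z' \<and> stored_lists n (cp ?a z') = lst M \<and> (\<forall>r<N. arr z' 14 r = W M r)) (4 * tfa)"
    proof (rule runs_mono)
      fix z' assume z': "cp ?a z' = fa \<and> outside ?a z1 z'"
      have "?R z'" by (rule only_trans[OF conjunct1[OF I] outside_only[OF conjunct2[OF z']]]) auto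
      moreover have "arr z' 14 = arr z1 14" using outside_arr[OF conjunct2[OF z'], of 14] by simp
      ultimately show "?R z' \<and> stored_lists n (cp ?a z') = lst M \<and> (\<forall>r<N. arr z' 14 r = W M r)"
        using z' I A(4) by (simp add: lst_def)
    qed simp
  qed
  moreover have "1 + ((\<Sum>r<N. Suc (4 * ta r + (4 * tb r + 5))) + 1) + 4 * tfa \<le> 18 * E"
  proof -
    have "(\<Sum>r<N. Suc (4 * ta r + (4 * tb r + 5))) = 4 * (\<Sum>r<N. ta r) + 4 * (\<Sum>r<N. tb r) + 6 * N"
      by (simp add: sum.distrib sum_distrib_left[symmetric] sum_Suc)
    then show ?thesis using A(5) B(5) E_ge by linarith
  qed
  ultimately show ?thesis by (rule runs_time)
qed

section \<open>Colours, levels and the complete encoder\<close>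

definition col_tail :: com where
  "col_tail = IfLess 42 0 (Seq (Load 43 12 42) (Seq (Add 43 43 6) (Seq (Add 30 42 7) (Seq (dblc 30 q) (Add 30 30 43))))) Skip"

text \<open>The list of the simulated run lies in array 0 of copy \<open>ka h\<close>, where entry
  \<open>k\<close> starts at \<open>k * n\<close>; this offset is formed by additions, because
  \<open>k\<close> is a constant of the program.\<close>

definition COL :: "nat \<Rightarrow> nat \<Rightarrow> com" where
  "COL h k = Seq (Seq (Const 30 0) (Const 40 k)) (IfLess 40 (rn (ka h) 5)
     (Seq (Seq (Const 41 0) (addn 41 0 k)) (Seq (FD (rn (ka h) 0)) col_tail)) Skip)"

definition cCOL :: "nat \<Rightarrow> nat" where
  "cCOL k = 14 + len (addn 41 0 k) + len col_tail"

lemma runs_COL: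
  assumes env: "env z" and M: "\<And>i. i < n \<Longrightarrow> arr z 12 i = M ! i"
    and st: "stored_lists n (cp (ka h) z) = lst M"
  shows "runs f (COL h k) z (\<lambda>z'. only {30..<48} {} z z' \<and> reg z' 30 = color M k) (cCOL k * E)"
proof -
  have l5: "reg z (rn (ka h) 5) = length (lst M)" using stored_listsD(1)[OF st] by simp
  have ar: "arr z (rn (ka h) 0) (k * n + i) = lst M ! k ! i" if "k < length (lst M)" "i < n" for i
    using stored_listsD(3)[OF st that] by simp
  let ?Q = "\<lambda>z'. only {30..<48} {} z z' \<and> reg z' 30 = color M k"
  have "runs f (COL h k) z ?Q (2 + Suc (1 + len (addn 41 0 k) + (7 * n + 3 + len col_tail)))"
    unfolding COL_def
  proof (rule runs_Seq)
    show "runs f (Seq (Const 30 0) (Const 40 k)) z (\<lambda>z1. only {30..<48} {} z z1 \<and> reg z1 30 = 0 \<and> reg z1 40 = k) 2"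
      by (rule runs_loop_free) simp_all
  next
    fix z1 assume z1: "only {30..<48} {} z z1 \<and> reg z1 30 = 0 \<and> reg z1 40 = k"
    have o1: "only {30..<48} {} z z1" using z1 by blast
    have r5: "reg z1 (rn (ka h) 5) = length (lst M)"
      using only_reg[OF o1, of "rn (ka h) 5"] l5 rn_ge[of "ka h" 5] by simp
    have ar1: "arr z1 = arr z" by (rule ext) (use only_arr[OF o1] in simp)
    have env1: "env z1" by (rule env_only[OF env o1]) simp_all
    show "runs f (IfLess 40 (rn (ka h) 5) (Seq (Seq (Const 41 0) (addn 41 0 k)) (Seq (FD (rn (ka h) 0)) col_tail)) Skip) z1 ?Q
        (Suc (1 + len (addn 41 0 k) + (7 * n + 3 + len col_tail)))"
    proof (rule runs_If)
      assume "reg z1 40 < reg z1 (rn (ka h) 5)"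
      then have k: "k < length (lst M)" using z1 r5 by simp
      show "runs f (Seq (Seq (Const 41 0) (addn 41 0 k)) (Seq (FD (rn (ka h) 0)) col_tail)) z1 ?Q
          (1 + len (addn 41 0 k) + (7 * n + 3 + len col_tail))"
      proof (rule runs_Seq)
        show "runs f (Seq (Const 41 0) (addn 41 0 k)) z1
            (\<lambda>z2. only {30..<48} {} z z2 \<and> reg z2 30 = 0 \<and> reg z2 41 = k * n) (1 + len (addn 41 0 k))"
          by (rule runs_loop_free) (use z1 envD(1)[OF env1] in simp_all)
      next
        fix z2 assume z2: "only {30..<48} {} z z2 \<and> reg z2 30 = 0 \<and> reg z2 41 = k * n"
        have o2: "only {30..<48} {} z z2" using z2 by blast
        have ar2: "arr z2 = arr z" by (rule ext) (use only_arr[OF o2] in simp)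
        have env2: "env z2" by (rule env_only[OF env o2]) simp_all
        show "runs f (Seq (FD (rn (ka h) 0)) col_tail) z2 ?Q (7 * n + 3 + len col_tail)"
        proof (rule runs_Seq)
          show "runs f (FD (rn (ka h) 0)) z2 (\<lambda>z'. only {42..<48} {} z2 z' \<and> reg z' 42 = fdiff M (lst M ! k)) (7 * n + 3)"
            by (rule runs_FD[OF env2]) (use M ar k z2 ar2 in simp_all)
        next
          fix z3 assume z3: "only {42..<48} {} z2 z3 \<and> reg z3 42 = fdiff M (lst M ! k)"
          have o3: "only {42..<48} {} z2 z3" using z3 by blast
          have o3': "only {30..<48} {} z z3" by (rule only_trans[OF o2 o3]) auto
          have ar3: "arr z3 = arr z" by (rule ext) (use only_arr[OF o3'] in simp)
          have r3: "reg z3 30 = 0" using only_reg[OF o3, of 30] z2 by simp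
          have env3: "env z3" by (rule env_only[OF env o3']) simp_all
          have f3: "reg z3 42 = fdiff M (lst M ! k)" using z3 by blast
          show "runs f col_tail z3 ?Q (len col_tail)"
          proof (cases "fdiff M (lst M ! k) < n")
            case True
            then have c: "color M k = 2 ^ q * fdiff M (lst M ! k) + Suc (M ! fdiff M (lst M ! k))"
              using k by (simp add: color_def)
            show ?thesis
              by (rule runs_loop_free) (use True o3' f3 envD[OF env3] ar3 M c in \<open>simp_all add: col_tail_def\<close>)
          next
            case False
            then have c: "color M k = 0" by (simp add: color_def)
            show ?thesis
              by (rule runs_loop_free) (use False o3' f3 r3 envD[OF env3] c in \<open>simp_all add: col_tail_def\<close>)
          qed
        qed
      qed
    next
      assume "\<not> reg z1 40 < reg z1 (rn (ka h) 5)"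
      then have "color M k = 0" using z1 r5 by (simp add: color_def)
      then show "runs f Skip z1 ?Q (1 + len (addn 41 0 k) + (7 * n + 3 + len col_tail))"
        by (intro runs_loop_free) (use z1 in simp_all)
    qed
  qed
  moreover have "2 + Suc (1 + len (addn 41 0 k) + (7 * n + 3 + len col_tail)) \<le> cCOL k * E"
  proof -
    have "(7 + len (addn 41 0 k) + len col_tail) + (n * 7 + 0) \<le> (7 + len (addn 41 0 k) + len col_tail + 0 + 7) * E"
      by (rule time_bound) (rule E_ge)
    moreover have "7 + len (addn 41 0 k) + len col_tail + 0 + 7 = cCOL k" by (simp add: cCOL_def)
    ultimately show ?thesis by simp
  qed
  ultimately show ?thesis by (rule runs_time)
qed

text \<open>The number of list slots is constant, so the loop over them is unrolled in the program
  text.\<close>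

primrec COLS :: "nat \<Rightarrow> nat \<Rightarrow> com" where
  "COLS h 0 = Skip"
| "COLS h (Suc k) = Seq (COLS h k) (Seq (COL h k) (Seq HAD MIX))"

definition cCOLS :: "nat \<Rightarrow> nat" where
  "cCOLS k = 1 + (\<Sum>i<k. cCOL i + (30 + (3 + len mix_body)))"

lemma runs_COLS:
  assumes env: "env z" and str: "string q n M" and M: "\<And>i. i < n \<Longrightarrow> arr z 12 i = M ! i"
    and st: "stored_lists n (cp (ka h) z) = lst M" and b: "\<And>v. v < m * m \<Longrightarrow> arr z 20 v = base 0 M v"
  shows "runs f (COLS h k) z (\<lambda>z'. only {30..<48} {16, 20} z z' \<and> (\<forall>v<m * m. arr z' 20 v = base k M v)) (cCOLS k * E)"
proof (induction k)
  case 0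
  show ?case by (rule runs_loop_free) (use b E_ge(1) in \<open>simp_all add: cCOLS_def\<close>)
next
  case (Suc k)
  let ?Q = "\<lambda>k z'. only {30..<48} {16, 20} z z' \<and> (\<forall>v<m * m. arr z' 20 v = base k M v)"
  have "runs f (COLS h (Suc k)) z (?Q (Suc k)) (cCOLS k * E + (cCOL k * E + (30 * 2 ^ kap + (1 + (m * m * Suc (len mix_body) + 1)))))"
    unfolding COLS.simps
  proof (rule runs_Seq[OF Suc])
    fix z1 assume z1: "?Q k z1"
    have o1: "only {30..<48} {16, 20} z z1" using z1 by blast
    have env1: "env z1" by (rule env_only[OF env o1]) simp_all
    have a12: "arr z1 12 = arr z 12" using only_arr[OF o1, of 12] by simp
    have cp1: "cp (ka h) z1 = cp (ka h) z"
      by (rule only_cp[OF o1]) auto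
    show "runs f (Seq (COL h k) (Seq HAD MIX)) z1 (?Q (Suc k)) (cCOL k * E + (30 * 2 ^ kap + (1 + (m * m * Suc (len mix_body) + 1))))"
    proof (rule runs_Seq)
      show "runs f (COL h k) z1 (\<lambda>z'. only {30..<48} {} z1 z' \<and> reg z' 30 = color M k) (cCOL k * E)"
        by (rule runs_COL[OF env1]) (use M a12 st cp1 in simp_all)
    next
      fix z2 assume z2: "only {30..<48} {} z1 z2 \<and> reg z2 30 = color M k"
      have o2: "only {30..<48} {} z1 z2" using z2 by blast
      have env2: "env z2" by (rule env_only[OF env1 o2]) simp_all
      have "color M k < 2 ^ kap"
      proof (cases "n = 0")
        case True
        then show ?thesis unfolding color_def by simp
      next
        case False
        then show ?thesis using color_less[OF str, of k] kap_ge(2) by linarith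
      qed
      show "runs f (Seq HAD MIX) z2 (?Q (Suc k)) (30 * 2 ^ kap + (1 + (m * m * Suc (len mix_body) + 1)))"
      proof (rule runs_Seq)
        show "runs f HAD z2 (\<lambda>z'. only {31..<40} {16} z2 z' \<and> (\<forall>y<2 ^ kap. arr z' 16 y = hd_code kap (color M k) y)) (30 * 2 ^ kap)"
          by (rule runs_HAD[OF env2]) (use z2 \<open>color M k < 2 ^ kap\<close> in simp_all)
      next
        fix z3 assume z3: "only {31..<40} {16} z2 z3 \<and> (\<forall>y<2 ^ kap. arr z3 16 y = hd_code kap (color M k) y)"
        have o3: "only {31..<40} {16} z2 z3" using z3 by blast
        have env3: "env z3" by (rule env_only[OF env2 o3]) simp_all
        have a20: "arr z3 20 = arr z1 20" using only_arr[OF o3, of 20] only_arr[OF o2, of 20] by simp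
        have o13: "only {30..<48} {16, 20} z z3"
        proof (rule only_trans[OF _ o3])
          show "only {30..<48} {16, 20} z z2" by (rule only_trans[OF o1 o2]) auto
        qed auto
        have "runs f MIX z3 (\<lambda>z'. only {31..<34} {20} z3 z' \<and> (\<forall>v<m * m. arr z' 20 v = base (Suc k) M v)) (1 + (m * m * Suc (len mix_body) + 1))"
          by (rule runs_MIX[OF env3]) (use z3 z1 a20 in simp_all)
        then show "runs f MIX z3 (?Q (Suc k)) (1 + (m * m * Suc (len mix_body) + 1))"
        proof (rule runs_mono)
          fix z4 assume z4: "only {31..<34} {20} z3 z4 \<and> (\<forall>v<m * m. arr z4 20 v = base (Suc k) M v)"
          have "only {30..<48} {16, 20} z z4" by (rule only_trans[OF o13 conjunct1[OF z4]]) auto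
          then show "?Q (Suc k) z4" using z4 by blast
        qed simp
      qed
    qed
  qed
  moreover have "cCOLS k * E + (cCOL k * E + (30 * 2 ^ kap + (1 + (m * m * Suc (len mix_body) + 1)))) \<le> cCOLS (Suc k) * E"
  proof -
    have "1 + (m * m * Suc (len mix_body) + 1) \<le> (3 + len mix_body) * E"
      by (rule order_trans[OF time_bound[OF E_ge(2)]]) (simp add: add_mult_distrib)
    moreover have "30 * 2 ^ kap \<le> 30 * E" using E_ge(6) by simp
    ultimately show ?thesis unfolding cCOLS_def sum.lessThan_Suc add_mult_distrib by linarith
  qed
  ultimately show ?case by (rule runs_time)
qed

primrec AMPS :: "nat \<Rightarrow> com" where
  "AMPS 0 = Skip"
| "AMPS (Suc l) = Seq (AMPS l) (AMP l)"

definition cAMPS :: "nat \<Rightarrow> nat" where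
  "cAMPS k = 1 + (\<Sum>l<k. 6 + len (amp_body l))"

lemma runs_AMPS:
  assumes env: "env z" and b: "\<And>v. v < m * m \<Longrightarrow> arr z 20 v = base s M v"
  shows "runs f (AMPS l) z (\<lambda>z'. only {30..<48} {A. even A \<and> 20 \<le> A} z z' \<and> (\<forall>v<m * m. arr z' (20 + 2 * l) v = amp l M v)) (cAMPS l * E)"
proof (induction l)
  case 0
  show ?case by (rule runs_loop_free) (use b E_ge(1) in \<open>simp_all add: cAMPS_def\<close>)
next
  case (Suc l)
  let ?Q = "\<lambda>l z'. only {30..<48} {A. even A \<and> 20 \<le> A} z z' \<and> (\<forall>v<m * m. arr z' (20 + 2 * l) v = amp l M v)"
  have "runs f (AMPS (Suc l)) z (?Q (Suc l)) (cAMPS l * E + (4 + (m * m * Suc (len (amp_body l)) + 1)))"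
    unfolding AMPS.simps
  proof (rule runs_Seq[OF Suc])
    fix z1 assume z1: "?Q l z1"
    have o1: "only {30..<48} {A. even A \<and> 20 \<le> A} z z1" using z1 by blast
    have env1: "env z1" by (rule env_only[OF env o1]) simp_all
    have "runs f (AMP l) z1 (\<lambda>z'. only {30..<45} {22 + 2 * l} z1 z' \<and> (\<forall>v<m * m. arr z' (22 + 2 * l) v = amp (Suc l) M v))
      (4 + (m * m * Suc (len (amp_body l)) + 1))"
      by (rule runs_AMP[OF env1]) (use z1 in blast)
    then show "runs f (AMP l) z1 (?Q (Suc l)) (4 + (m * m * Suc (len (amp_body l)) + 1))"
    proof (rule runs_mono)
      fix z2 assume z2: "only {30..<45} {22 + 2 * l} z1 z2 \<and> (\<forall>v<m * m. arr z2 (22 + 2 * l) v = amp (Suc l) M v)"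
      have "only {30..<48} {A. even A \<and> 20 \<le> A} z z2" by (rule only_trans[OF o1 conjunct1[OF z2]]) auto
      moreover have "20 + 2 * Suc l = 22 + 2 * l" by simp
      ultimately show "?Q (Suc l) z2" using z2 by metis
    qed simp
  qed
  moreover have "cAMPS l * E + (4 + (m * m * Suc (len (amp_body l)) + 1)) \<le> cAMPS (Suc l) * E"
  proof -
    have "4 + (m * m * Suc (len (amp_body l)) + 1) \<le> (6 + len (amp_body l)) * E"
      by (rule order_trans[OF time_bound[OF E_ge(2)]]) (simp add: add_mult_distrib)
    then show ?thesis unfolding cAMPS_def sum.lessThan_Suc add_mult_distrib by linarith
  qed
  ultimately show ?case by (rule runs_time)
qed

definition ENC :: "nat \<Rightarrow> com" where
  "ENC h = Seq (SIM h) (Seq INITX (Seq (COLS h s) (Seq (AMPS t) (FIN h))))"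

definition cENC :: "nat \<Rightarrow> nat" where
  "cENC h = 18 + (3 + len initx_body) + cCOLS s + cAMPS t + (4 + len (addn 31 8 h) + len fin_body)"

definition ER :: "nat \<Rightarrow> nat set" where "ER h = {30..<48} \<union> RR h"
definition EA :: "nat \<Rightarrow> nat set" where "EA h = insert 4 {A. even A \<and> 14 \<le> A} \<union> RR h"

lemma runs_ENC:
  assumes env: "env z" and str: "string q n M" and M: "\<And>i. i < n \<Longrightarrow> arr z 12 i = M ! i"
    and cpz: "cp (ka h) z = z0" "cp (kb h) z = z0"
  shows "runs f (ENC h) z (\<lambda>z'. only (ER h) (EA h) z z' \<and>
     (\<forall>i. arr z' 4 i = (if h * N \<le> i \<and> i < h * N + N then Suc (amp t M (i - h * N)) else arr z 4 i))) (cENC h * E)"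
proof -
  let ?F = "\<lambda>z'. only (ER h) (EA h) z z'"
  let ?Q = "\<lambda>z'. ?F z' \<and> (\<forall>i. arr z' 4 i = (if h * N \<le> i \<and> i < h * N + N then Suc (amp t M (i - h * N)) else arr z 4 i))"
  have sub: "{30, 31} \<union> RR h \<subseteq> ER h" "{14} \<union> RR h \<subseteq> EA h" "{30..<32} \<subseteq> ER h" "{20} \<subseteq> EA h" "{30..<48} \<subseteq> ER h"
    "{16, 20} \<subseteq> EA h" "{A. even A \<and> 20 \<le> A} \<subseteq> EA h" "{30..<33} \<subseteq> ER h" "{4} \<subseteq> EA h"
    by (auto simp: ER_def EA_def)
  have "runs f (ENC h) z ?Q (18 * E + ((1 + (m * m * Suc (len initx_body) + 1)) + (cCOLS s * E + (cAMPS t * E +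
      (2 + len (addn 31 8 h) + (N * Suc (len fin_body) + 1))))))"
    unfolding ENC_def
  proof (rule runs_Seq[OF runs_SIM[OF env str M cpz]])
    fix z1 assume z1: "only ({30, 31} \<union> RR h) ({14} \<union> RR h) z z1 \<and> stored_lists n (cp (ka h) z1) = lst M \<and> (\<forall>r<N. arr z1 14 r = W M r)"
    have o1: "only ({30, 31} \<union> RR h) ({14} \<union> RR h) z z1" using z1 by blast
    have F1: "?F z1" by (rule only_mono[OF o1 sub(1,2)])
    have env1: "env z1" by (rule env_only[OF env o1]) simp_all
    have a1: "arr z1 12 = arr z 12" "arr z1 4 = arr z 4" using only_arr[OF o1, of 12] only_arr[OF o1, of 4] by simp_all
    show "runs f (Seq INITX (Seq (COLS h s) (Seq (AMPS t) (FIN h)))) z1 ?Q ((1 + (m * m * Suc (len initx_body) + 1)) + (cCOLS s * E + (cAMPS t * E +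
      (2 + len (addn 31 8 h) + (N * Suc (len fin_body) + 1)))))"
    proof (rule runs_Seq[OF runs_INITX[OF env1]])
      show "\<And>r. r < N \<Longrightarrow> arr z1 14 r = W M r" using z1 by blast
      fix z2 assume z2: "only {30..<32} {20} z1 z2 \<and> (\<forall>v<m * m. arr z2 20 v = base 0 M v)"
      have o2: "only {30..<32} {20} z1 z2" using z2 by blast
      have F2: "?F z2" by (rule only_trans[OF F1 o2 order_refl sub(3) order_refl sub(4)])
      have env2: "env z2" by (rule env_only[OF env1 o2]) simp_all
      have a2: "arr z2 12 = arr z 12" "arr z2 4 = arr z 4" using only_arr[OF o2, of 12] only_arr[OF o2, of 4] a1 by simp_all
      have cp2: "cp (ka h) z2 = cp (ka h) z1"
        by (rule only_cp[OF o2]) auto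
      show "runs f (Seq (COLS h s) (Seq (AMPS t) (FIN h))) z2 ?Q (cCOLS s * E + (cAMPS t * E +
        (2 + len (addn 31 8 h) + (N * Suc (len fin_body) + 1))))"
      proof (rule runs_Seq[OF runs_COLS[OF env2 str]])
        show "\<And>i. i < n \<Longrightarrow> arr z2 12 i = M ! i" using M a2 by simp
        show "stored_lists n (cp (ka h) z2) = lst M" using cp2 z1 by simp
        show "\<And>v. v < m * m \<Longrightarrow> arr z2 20 v = base 0 M v" using z2 by blast
        fix z3 assume z3: "only {30..<48} {16, 20} z2 z3 \<and> (\<forall>v<m * m. arr z3 20 v = base s M v)"
        have o3: "only {30..<48} {16, 20} z2 z3" using z3 by blast
        have F3: "?F z3" by (rule only_trans[OF F2 o3 order_refl sub(5) order_refl sub(6)])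
        have env3: "env z3" by (rule env_only[OF env2 o3]) simp_all
        have a3: "arr z3 4 = arr z 4" using only_arr[OF o3, of 4] a2 by simp
        show "runs f (Seq (AMPS t) (FIN h)) z3 ?Q (cAMPS t * E + (2 + len (addn 31 8 h) + (N * Suc (len fin_body) + 1)))"
        proof (rule runs_Seq[OF runs_AMPS[OF env3]])
          show "\<And>v. v < m * m \<Longrightarrow> arr z3 20 v = base s M v" using z3 by blast
          fix z4 assume z4: "only {30..<48} {A. even A \<and> 20 \<le> A} z3 z4 \<and> (\<forall>v<m * m. arr z4 (20 + 2 * t) v = amp t M v)"
          have o4: "only {30..<48} {A. even A \<and> 20 \<le> A} z3 z4" using z4 by blast
          have F4: "?F z4" by (rule only_trans[OF F3 o4 order_refl sub(5) order_refl sub(7)])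
          have env4: "env z4" by (rule env_only[OF env3 o4]) simp_all
          have a4: "arr z4 4 = arr z 4" using only_arr[OF o4, of 4] a3 by simp
          have "runs f (FIN h) z4 (\<lambda>z'. only {30..<33} {4} z4 z' \<and>
            (\<forall>i. arr z' 4 i = (if h * N \<le> i \<and> i < h * N + N then Suc (amp t M (i - h * N)) else arr z4 4 i)))
            (2 + len (addn 31 8 h) + (N * Suc (len fin_body) + 1))"
            by (rule runs_FIN[OF env4]) (use z4 in blast)
          then show "runs f (FIN h) z4 ?Q (2 + len (addn 31 8 h) + (N * Suc (len fin_body) + 1))"
          proof (rule runs_mono)
            fix z5 assume z5: "only {30..<33} {4} z4 z5 \<and>
            (\<forall>i. arr z5 4 i = (if h * N \<le> i \<and> i < h * N + N then Suc (amp t M (i - h * N)) else arr z4 4 i))"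
            have "?F z5" by (rule only_trans[OF F4 conjunct1[OF z5] order_refl sub(8) order_refl sub(9)])
            then show "?Q z5" using z5 a4 by simp
          qed simp
        qed
      qed
    qed
  qed
  moreover have "18 * E + ((1 + (m * m * Suc (len initx_body) + 1)) + (cCOLS s * E + (cAMPS t * E +
      (2 + len (addn 31 8 h) + (N * Suc (len fin_body) + 1))))) \<le> cENC h * E"
  proof -
    have "1 + (m * m * Suc (len initx_body) + 1) \<le> (3 + len initx_body) * E"
      by (rule order_trans[OF time_bound[OF E_ge(2)]]) (simp add: add_mult_distrib)
    moreover have "2 + len (addn 31 8 h) + (N * Suc (len fin_body) + 1) \<le> (4 + len (addn 31 8 h) + len fin_body) * E"
      by (rule order_trans[OF time_bound[OF E_ge(4)]]) (simp add: add_mult_distrib)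
    ultimately show ?thesis unfolding cENC_def add_mult_distrib by linarith
  qed
  ultimately show ?thesis by (rule runs_time)
qed


section \<open>Processing the candidates of a block\<close>

text \<open>Slots below \<open>b\<close> are final, the others blank. The occupied mark in array 8
  refers to \<open>raw\<close> and not to \<open>good\<close>: rejected entries are kept, since
  \<open>good\<close> compares with all earlier raw entries. Blank and rejected slots have the
  encoding 0.\<close>

definition slots :: "party \<Rightarrow> next_message \<Rightarrow> view \<Rightarrow> nat \<Rightarrow> state \<Rightarrow> bool" where
  "slots p f w b z \<longleftrightarrow> (\<forall>h<K.
     (h < b \<longrightarrow> arr z 8 h = (if raw p f w h = None then 0 else 1) \<and>
        (\<forall>x i. raw p f w h = Some x \<longrightarrow> i < n \<longrightarrow> arr z 2 (h * n + i) = x ! i) \<and>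
        (\<forall>r<N. arr z 4 (h * N + r) = slotc p f w h r)) \<and>
     (b \<le> h \<longrightarrow> arr z 8 h = 0 \<and> (\<forall>r<N. arr z 4 (h * N + r) = 0)))"

lemma slots_cong:
  "slots p f w b z \<Longrightarrow> arr z' 8 = arr z 8 \<Longrightarrow> arr z' 2 = arr z 2 \<Longrightarrow> arr z' 4 = arr z 4 \<Longrightarrow> slots p f w b z'"
  by (simp add: slots_def)

text \<open>Register 52 holds the verdict on the current candidate; a test can only clear
  it.\<close>

definition fail_ge :: com where "fail_ge = IfLess 32 53 Skip (Const 52 0)"
definition fail_ne :: com where
  "fail_ne = IfLess 7 33 (IfLess 33 34 (Const 52 0) (IfLess 34 33 (Const 52 0) Skip)) Skip"

lemma ev_fail:
  "ev f fail_ge z = set_reg 52 (if reg z 32 < reg z 53 then reg z 52 else 0) z"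
  "ev f fail_ne z = set_reg 52 (if reg z 7 < reg z 33 \<and> reg z 33 \<noteq> reg z 34 then 0 else reg z 52) z"
  by (auto simp: fail_ge_def fail_ne_def)

definition chk1 :: "nat \<Rightarrow> com" where
  "chk1 j = Seq (Add 31 41 30) (Seq (Load 32 (rn j 0) 31) (Seq (Store 12 30 32) (Seq (Add 31 51 30) (Store 2 31 32))))"
definition chk2 :: com where
  "chk2 = Seq fail_ge (Seq (Add 34 32 6) (Seq fail_ne (Add 30 30 6)))"
definition chk_body :: "nat \<Rightarrow> com" where
  "chk_body j = Seq (chk1 j) (Seq (Query 33 12 30) chk2)"

definition okp :: "next_message \<Rightarrow> nat list \<Rightarrow> nat \<Rightarrow> bool" where
  "okp f x k \<longleftrightarrow> (\<forall>i<k. x ! i < q \<and> (\<forall>a. f (take i x) = Transmit a \<longrightarrow> x ! i = a))"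

lemma okp_consistent: "length x = n \<Longrightarrow> okp f x n \<longleftrightarrow> consistent q n f x"
  unfolding okp_def consistent_def string_def by (auto simp: set_conv_nth)

abbreviation hs :: "nat \<Rightarrow> nat \<Rightarrow> nat" where "hs j k \<equiv> j * s + k"

text \<open>In step \<open>k\<close> the oracle is asked about the first \<open>k\<close> symbols
  collected in array 12 and its answer is compared with symbol \<open>k\<close>; the answer 0, for
  listening, imposes no condition. The same pass copies the candidate to its slot in array 2 and
  leaves it in array 12 for the encoder.\<close>

lemma runs_CHK:
  assumes env: "env z" and x: "length x = n" "\<And>i. i < n \<Longrightarrow> arr z (rn j 0) (reg z 41 + i) = x ! i"
    and r: "reg z 51 = h * n" "reg z 52 = 1" "reg z 53 = q" "reg z 30 = 0"
  shows "runs f (WhileLess 30 0 (chk_body j)) z (\<lambda>z'. only ({30..<35} \<union> {52}) {2, 12} z z' \<and>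
      (\<forall>i<n. arr z' 12 i = x ! i) \<and>
      (\<forall>i. arr z' 2 i = (if h * n \<le> i \<and> i < h * n + n then x ! (i - h * n) else arr z 2 i)) \<and>
      reg z' 52 = (if consistent q n f x then 1 else 0)) (n * Suc (len (chk_body j)) + 1)"
proof -
  let ?R = "only ({30..<35} \<union> {52}) {2, 12} z"
  let ?I = "\<lambda>k z'. ?R z' \<and> reg z' 30 = k \<and> (\<forall>i<k. arr z' 12 i = x ! i) \<and>
      (\<forall>i. arr z' 2 i = (if h * n \<le> i \<and> i < h * n + k then x ! (i - h * n) else arr z 2 i)) \<and>
      reg z' 52 = (if okp f x k then 1 else 0)"
  have ro: "reg z' 0 = n" "reg z' 6 = 1" "reg z' 7 = 0" "reg z' 41 = reg z 41" "reg z' 51 = h * n" "reg z' 53 = q"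
    "arr z' (rn j 0) = arr z (rn j 0)" if "?R z'" for z'
    using only_reg[OF that] only_arr[OF that] envD[OF env] r by simp_all
  show ?thesis
  proof (rule runs_for_const[where I = ?I])
    fix k z1 assume k: "k < n" and I: "?I k z1"
    have R1: "?R z1" and I1: "reg z1 30 = k" "\<forall>i<k. arr z1 12 i = x ! i"
      "\<forall>i. arr z1 2 i = (if h * n \<le> i \<and> i < h * n + k then x ! (i - h * n) else arr z 2 i)"
      "reg z1 52 = (if okp f x k then 1 else 0)" using I by blast+
    define za where "za = ev f (chk1 j) z1"
    define zb where "zb = ev f (Query 33 12 30) za"
    define zc where "zc = ev f chk2 zb"
    have fa: "?R za" unfolding za_def chk1_def using R1 by simp
    have a: "reg za 30 = k" "reg za 32 = x ! k" "reg za 52 = (if okp f x k then 1 else 0)"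
      "arr za 12 i = (if i = k then x ! k else arr z1 12 i)"
      "arr za 2 i = (if i = h * n + k then x ! k else arr z1 2 i)" for i
      unfolding za_def chk1_def using I1 ro[OF R1] x(2)[OF k] by simp_all
    have "map (arr za 12) [0..<k] = take k x"
      by (rule nth_equalityI) (use k x(1) a I1 in auto)
    then have b: "zb = set_reg 33 (action_code (f (take k x))) za"
      unfolding zb_def using a by simp
    have fb: "?R zb" unfolding b using fa by simp
    have c: "zc = set_reg 30 (Suc k) (set_reg 52 (if 0 < action_code (f (take k x)) \<and> action_code (f (take k x)) \<noteq> Suc (x ! k)
        then 0 else if x ! k < q then reg za 52 else 0) (set_reg 34 (Suc (x ! k)) (set_reg 52 (if x ! k < q then reg za 52 else 0) zb)))"
      unfolding zc_def chk2_def using ro[OF fb] a by (simp add: ev_fail b)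
    have fc: "?R zc" unfolding c using fb by simp
    have ok: "okp f x (Suc k) \<longleftrightarrow> okp f x k \<and> x ! k < q \<and> \<not> (0 < action_code (f (take k x)) \<and> action_code (f (take k x)) \<noteq> Suc (x ! k))"
      unfolding okp_def by (cases "f (take k x)") (auto simp: less_Suc_eq)
    have "reg zc 30 = Suc k" "reg zc 52 = (if okp f x (Suc k) then 1 else 0)" "arr zc = arr za"
      unfolding c b by (auto simp: ok a(3))
    then have Ic: "?I (Suc k) zc" using fc I1(2,3) a(4,5) by (auto simp: less_Suc_eq)
    have e: "ev f (chk_body j) z1 = zc" by (simp only: zc_def zb_def za_def chk_body_def ev.simps(8))
    have lf: "loop_free (chk_body j)" by (simp add: chk_body_def chk1_def chk2_def fail_ge_def fail_ne_def)
    have "runs f (chk_body j) z1 (?I (Suc k)) (len (chk_body j))"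
    proof (rule runs_loop_free[OF lf])
      show "?I (Suc k) (ev f (chk_body j) z1)" unfolding e by (rule Ic)
    qed simp
    then show "reg z1 30 < reg z1 0 \<and> runs f (chk_body j) z1 (?I (Suc k)) (len (chk_body j))"
      using I1(1) k ro(1)[OF R1] by simp
  next
    fix z1 assume I: "?I n z1"
    have "?R z1" using I by blast
    from ro(1)[OF this] show "\<not> reg z1 30 < reg z1 0 \<and> ?R z1 \<and> (\<forall>i<n. arr z1 12 i = x ! i) \<and>
      (\<forall>i. arr z1 2 i = (if h * n \<le> i \<and> i < h * n + n then x ! (i - h * n) else arr z 2 i)) \<and>
      reg z1 52 = (if consistent q n f x then 1 else 0)"
      using I okp_consistent[OF x(1), of f] by simp
  next
    show "?I 0 z" using r by (simp add: okp_def)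
  qed
qed

definition dd_tail :: com where "dd_tail = IfLess 42 0 Skip (Const 52 0)"

text \<open>An unoccupied slot is skipped, since its cells in array 2 need not hold a
  transcript.\<close>

definition dd :: "nat \<Rightarrow> com" where
  "dd h' = Seq (Seq (Const 54 h') (Load 55 8 54)) (IfLess 7 55
     (Seq (Seq (Const 41 0) (addn 41 0 h')) (Seq (FD 2) dd_tail)) Skip)"

definition cdd :: "nat \<Rightarrow> nat" where "cdd h' = 16 + len (addn 41 0 h')"

lemma fdiff_less_iff: "length x = n \<Longrightarrow> length y = n \<Longrightarrow> fdiff x y < n \<longleftrightarrow> x \<noteq> y"
  using fdiff_less(1)[of x y] fdiff_eqI[of n x y] by auto

lemma runs_dd:
  assumes env: "env z" and x: "length x = n" "\<And>i. i < n \<Longrightarrow> arr z 12 i = x ! i"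
    and y: "arr z 8 h' = (if y = None then 0 else 1)"
      "\<And>y'. y = Some y' \<Longrightarrow> length y' = n \<and> (\<forall>i<n. arr z 2 (h' * n + i) = y' ! i)"
  shows "runs f (dd h') z (\<lambda>z'. only {41..<56} {} z z' \<and> reg z' 52 = (if y = Some x then 0 else reg z 52)) (cdd h' * E)"
proof -
  let ?Q = "\<lambda>z'. only {41..<56} {} z z' \<and> reg z' 52 = (if y = Some x then 0 else reg z 52)"
  have "runs f (dd h') z ?Q (2 + Suc (1 + len (addn 41 0 h') + (7 * n + 3 + 2)))"
    unfolding dd_def
  proof (rule runs_Seq)
    show "runs f (Seq (Const 54 h') (Load 55 8 54)) z (\<lambda>z1. only {41..<56} {} z z1 \<and> reg z1 52 = reg z 52 \<and>
        reg z1 55 = (if y = None then 0 else 1)) 2"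
      by (rule runs_loop_free) (use y(1) in simp_all)
  next
    fix z1 assume z1: "only {41..<56} {} z z1 \<and> reg z1 52 = reg z 52 \<and> reg z1 55 = (if y = None then 0 else 1)"
    have o1: "only {41..<56} {} z z1" using z1 by blast
    have env1: "env z1" by (rule env_only[OF env o1]) simp_all
    show "runs f (IfLess 7 55 (Seq (Seq (Const 41 0) (addn 41 0 h')) (Seq (FD 2) dd_tail)) Skip) z1 ?Q
       (Suc (1 + len (addn 41 0 h') + (7 * n + 3 + 2)))"
    proof (rule runs_If)
      assume "reg z1 7 < reg z1 55"
      then have "y \<noteq> None" using z1 envD(3)[OF env1] by (auto split: if_splits)
      then obtain y' where y': "y = Some y'" by blast
      show "runs f (Seq (Seq (Const 41 0) (addn 41 0 h')) (Seq (FD 2) dd_tail)) z1 ?Q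
         (1 + len (addn 41 0 h') + (7 * n + 3 + 2))"
      proof (rule runs_Seq)
        show "runs f (Seq (Const 41 0) (addn 41 0 h')) z1
            (\<lambda>z2. only {41..<56} {} z z2 \<and> reg z2 52 = reg z 52 \<and> reg z2 41 = h' * n) (1 + len (addn 41 0 h'))"
          by (rule runs_loop_free) (use z1 envD(1)[OF env1] in simp_all)
      next
        fix z2 assume z2: "only {41..<56} {} z z2 \<and> reg z2 52 = reg z 52 \<and> reg z2 41 = h' * n"
        have o2: "only {41..<56} {} z z2" using z2 by blast
        have ar2: "arr z2 = arr z" by (rule ext) (use only_arr[OF o2] in simp)
        have env2: "env z2" by (rule env_only[OF env o2]) simp_all
        show "runs f (Seq (FD 2) dd_tail) z2 ?Q (7 * n + 3 + 2)"
        proof (rule runs_Seq)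
          show "runs f (FD 2) z2 (\<lambda>z'. only {42..<48} {} z2 z' \<and> reg z' 42 = fdiff x y') (7 * n + 3)"
            by (rule runs_FD[OF env2]) (use x y(2)[OF y'] z2 ar2 in simp_all)
        next
          fix z3 assume z3: "only {42..<48} {} z2 z3 \<and> reg z3 42 = fdiff x y'"
          have o3: "only {42..<48} {} z2 z3" using z3 by blast
          have o3': "only {41..<56} {} z z3" by (rule only_trans[OF o2 o3]) auto
          have r3: "reg z3 52 = reg z 52" using only_reg[OF o3, of 52] z2 by simp
          have env3: "env z3" by (rule env_only[OF env o3']) simp_all
          have e: "ev f dd_tail z3 = set_reg 52 (if fdiff x y' < n then reg z3 52 else 0) z3"
            using z3 envD(1)[OF env3] by (simp add: dd_tail_def)
          have iff: "fdiff x y' < n \<longleftrightarrow> x \<noteq> y'" using fdiff_less_iff x(1) y(2)[OF y'] by blast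
          show "runs f dd_tail z3 ?Q 2"
          proof (rule runs_loop_free)
            show "?Q (ev f dd_tail z3)" unfolding e iff using o3' r3 y' by auto
          qed (simp_all add: dd_tail_def)
        qed
      qed
    next
      assume "\<not> reg z1 7 < reg z1 55"
      then have "y = None" using z1 envD(3)[OF env1] by (auto split: if_splits)
      then show "runs f Skip z1 ?Q (1 + len (addn 41 0 h') + (7 * n + 3 + 2))"
        by (intro runs_loop_free) (use z1 in simp_all)
    qed
  qed
  moreover have "2 + Suc (1 + len (addn 41 0 h') + (7 * n + 3 + 2)) \<le> cdd h' * E"
  proof -
    have "(9 + len (addn 41 0 h')) + (n * 7 + 0) \<le> cdd h' * E"
      by (rule order_trans[OF time_bound[OF E_ge(3)]]) (simp add: cdd_def add_mult_distrib)
    then show ?thesis by simp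
  qed
  ultimately show ?thesis by (rule runs_time)
qed

primrec DDs :: "nat \<Rightarrow> com" where
  "DDs 0 = Skip"
| "DDs (Suc i) = Seq (DDs i) (dd i)"

definition cDDs :: "nat \<Rightarrow> nat" where "cDDs h = 1 + (\<Sum>i<h. cdd i)"

lemma runs_DDs:
  assumes env: "env z" and x: "length x = n" "\<And>i. i < n \<Longrightarrow> arr z 12 i = x ! i"
    and y: "\<And>h'. h' < h \<Longrightarrow> arr z 8 h' = (if Y h' = None then 0 else 1)"
      "\<And>h' y'. h' < h \<Longrightarrow> Y h' = Some y' \<Longrightarrow> length y' = n \<and> (\<forall>i<n. arr z 2 (h' * n + i) = y' ! i)"
  shows "i \<le> h \<Longrightarrow> runs f (DDs i) z (\<lambda>z'. only {41..<56} {} z z' \<and>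
     reg z' 52 = (if \<exists>h'<i. Y h' = Some x then 0 else reg z 52)) (cDDs i * E)"
proof (induction i)
  case 0
  show ?case by (rule runs_loop_free) (use E_ge(1) in \<open>simp_all add: cDDs_def\<close>)
next
  case (Suc i)
  let ?Q = "\<lambda>i z'. only {41..<56} {} z z' \<and> reg z' 52 = (if \<exists>h'<i. Y h' = Some x then 0 else reg z 52)"
  have ih: "runs f (DDs i) z (?Q i) (cDDs i * E)" using Suc by simp
  have "runs f (DDs (Suc i)) z (?Q (Suc i)) (cDDs i * E + cdd i * E)"
    unfolding DDs.simps
  proof (rule runs_Seq[OF ih])
    fix z1 assume z1: "?Q i z1"
    have o1: "only {41..<56} {} z z1" using z1 by blast
    have env1: "env z1" by (rule env_only[OF env o1]) simp_all
    have ar1: "arr z1 = arr z" by (rule ext) (use only_arr[OF o1] in simp)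
    have "runs f (dd i) z1 (\<lambda>z'. only {41..<56} {} z1 z' \<and> reg z' 52 = (if Y i = Some x then 0 else reg z1 52)) (cdd i * E)"
      by (rule runs_dd[OF env1 x(1)]) (use x(2) y[of i] Suc.prems ar1 in simp_all)
    then show "runs f (dd i) z1 (?Q (Suc i)) (cdd i * E)"
    proof (rule runs_mono)
      fix z2 assume z2: "only {41..<56} {} z1 z2 \<and> reg z2 52 = (if Y i = Some x then 0 else reg z1 52)"
      have "only {41..<56} {} z z2" by (rule only_trans[OF o1 conjunct1[OF z2]]) auto
      then show "?Q (Suc i) z2" using z1 z2 by (auto simp: less_Suc_eq)
    qed simp
  qed
  moreover have "cDDs i * E + cdd i * E \<le> cDDs (Suc i) * E"
    unfolding cDDs_def sum.lessThan_Suc add_mult_distrib by linarith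
  ultimately show ?case by (rule runs_time)
qed

definition proc_pre :: "nat \<Rightarrow> nat \<Rightarrow> com" where
  "proc_pre h k = Seq (Const 41 0) (Seq (addn 41 0 k) (Seq (Const 51 0) (Seq (addn 51 0 h)
     (Seq (Const 52 1) (Seq (Const 53 q) (Const 30 0))))))"

definition PROC :: "nat \<Rightarrow> nat \<Rightarrow> com" where
  "PROC j k = Seq (Const 50 k) (IfLess 50 (rn j 5) (Seq (proc_pre (hs j k) k) (Seq (WhileLess 30 0 (chk_body j))
     (Seq (DDs (hs j k)) (Seq (Seq (Const 54 (hs j k)) (Store 8 54 6)) (IfLess 7 52 (ENC (hs j k)) Skip))))) Skip)"

definition cPROC :: "nat \<Rightarrow> nat \<Rightarrow> nat" where
  "cPROC j k = 6 + len (proc_pre (hs j k) k) + (2 + len (chk_body j)) + cDDs (hs j k) + cENC (hs j k)"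

definition PR :: "nat \<Rightarrow> nat set" where "PR h = {20..<65} \<union> RR h"
definition PA :: "nat \<Rightarrow> nat set" where "PA h = {2, 4, 8} \<union> {A. even A \<and> 12 \<le> A} \<union> RR h"

lemma in_block: "i < (b::nat) \<Longrightarrow> (h * b \<le> h' * b + i \<and> h' * b + i < h * b + b) \<longleftrightarrow> h = h'"
proof
  assume i: "i < b" "h * b \<le> h' * b + i \<and> h' * b + i < h * b + b"
  have "(h' * b + i) div b = h'" using i(1) by simp
  moreover have "(h' * b + i) div b = h"
  proof (rule div_nat_eqI)
    show "b * h \<le> h' * b + i" "h' * b + i < b * Suc h" using i(2) by (simp_all add: mult.commute)
  qed
  ultimately show "h = h'" by simp
qed auto

lemma runs_PROC:
  assumes env: "env z" and sl: "slots p f w (hs j k) z"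
    and st: "stored_lists n (cp j z) = outcome S p f (bview w j)"
    and jk: "j < 6 * d" "k < s"
    and cpz: "cp (ka (hs j k)) z = z0" "cp (kb (hs j k)) z = z0"
    and lens: "\<And>h y. h < K \<Longrightarrow> raw p f w h = Some y \<Longrightarrow> length y = n"
  shows "runs f (PROC j k) z (\<lambda>z'. only (PR (hs j k)) (PA (hs j k)) z z' \<and> slots p f w (Suc (hs j k)) z') (cPROC j k * E)"
proof -
  let ?h = "hs j k" and ?R = "only (PR (hs j k)) (PA (hs j k)) z"
  let ?Q = "\<lambda>z'. ?R z' \<and> slots p f w (Suc ?h) z'"
  let ?out = "outcome S p f (bview w j)"
  have hK: "?h < K"
  proof -
    have "?h < Suc j * s" using jk by simp
    also have "\<dots> \<le> 6 * d * s" using jk by (intro mult_right_mono) auto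
    finally show ?thesis .
  qed
  have raw: "raw p f w ?h = (if k < length ?out then Some (?out ! k) else None)"
    using jk by (simp add: raw_def)
  have l5: "reg z (rn j 5) = length ?out" using stored_listsD(1)[OF st] by simp
  have Rown: "only R AS z z' \<Longrightarrow> ?R z'" if "R \<subseteq> {20..<65}" "AS \<subseteq> {2, 4, 8} \<union> {A. even A \<and> 12 \<le> A}" for R AS z'
    by (erule only_mono) (use that in \<open>auto simp: PR_def PA_def\<close>)
  have envR: "env z'" if "?R z'" for z'
    by (rule env_only[OF env that]) (simp_all add: PR_def PA_def)
  have "runs f (PROC j k) z ?Q (1 + Suc (len (proc_pre ?h k) + ((n * Suc (len (chk_body j)) + 1) + (cDDs ?h * E + (2 + Suc (cENC ?h * E))))))"
    unfolding PROC_def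
  proof (rule runs_Seq)
    show "runs f (Const 50 k) z (\<lambda>z1. z1 = set_reg 50 k z) 1" by (rule runs_loop_free) simp_all
  next
    fix z1 assume z1: "z1 = set_reg 50 k z"
    have o1: "only {50} {} z z1" using z1 by simp
    have R1: "?R z1" by (rule Rown[OF _ _ o1]) auto
    have env1: "env z1" by (rule envR[OF R1])
    show "runs f (IfLess 50 (rn j 5) (Seq (proc_pre ?h k) (Seq (WhileLess 30 0 (chk_body j))
      (Seq (DDs ?h) (Seq (Seq (Const 54 ?h) (Store 8 54 6)) (IfLess 7 52 (ENC ?h) Skip))))) Skip) z1 ?Q
      (Suc (len (proc_pre ?h k) + ((n * Suc (len (chk_body j)) + 1) + (cDDs ?h * E + (2 + Suc (cENC ?h * E))))))"
    proof (rule runs_If)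
      assume "reg z1 50 < reg z1 (rn j 5)"
      then have k: "k < length ?out" using z1 l5 by simp
      define x where "x = ?out ! k"
      have rx: "raw p f w ?h = Some x" using raw k by (simp add: x_def)
      have lx: "length x = n" by (rule lens[OF hK rx])
      have xi: "arr z (rn j 0) (k * n + i) = x ! i" if "i < n" for i
        using stored_listsD(3)[OF st k that] by (simp add: x_def)
      show "runs f (Seq (proc_pre ?h k) (Seq (WhileLess 30 0 (chk_body j))
        (Seq (DDs ?h) (Seq (Seq (Const 54 ?h) (Store 8 54 6)) (IfLess 7 52 (ENC ?h) Skip))))) z1 ?Q
        (len (proc_pre ?h k) + ((n * Suc (len (chk_body j)) + 1) + (cDDs ?h * E + (2 + Suc (cENC ?h * E)))))"
      proof (rule runs_Seq)
        show "runs f (proc_pre ?h k) z1 (\<lambda>z2. only ({20..<65}) {} z z2 \<and> reg z2 41 = k * n \<and> reg z2 51 = ?h * n \<and>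
           reg z2 52 = 1 \<and> reg z2 53 = q \<and> reg z2 30 = 0) (len (proc_pre ?h k))"
          by (rule runs_loop_free) (use envD(1)[OF env1] z1 in \<open>simp_all add: proc_pre_def\<close>)
      next
        fix z2 assume z2: "only ({20..<65}) {} z z2 \<and> reg z2 41 = k * n \<and> reg z2 51 = ?h * n \<and>
           reg z2 52 = 1 \<and> reg z2 53 = q \<and> reg z2 30 = 0"
        have o2: "only ({20..<65}) {} z z2" using z2 by blast
        have R2: "?R z2" by (rule Rown[OF _ _ o2]) auto
        have ar2: "arr z2 = arr z" by (rule ext) (use only_arr[OF o2] in simp)
        show "runs f (Seq (WhileLess 30 0 (chk_body j)) (Seq (DDs ?h) (Seq (Seq (Const 54 ?h) (Store 8 54 6))
           (IfLess 7 52 (ENC ?h) Skip)))) z2 ?Q ((n * Suc (len (chk_body j)) + 1) + (cDDs ?h * E + (2 + Suc (cENC ?h * E))))"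
        proof (rule runs_Seq[OF runs_CHK[OF envR[OF R2] lx]])
          show "\<And>i. i < n \<Longrightarrow> arr z2 (rn j 0) (reg z2 41 + i) = x ! i" using xi z2 ar2 by simp
          show "reg z2 51 = ?h * n" "reg z2 52 = 1" "reg z2 53 = q" "reg z2 30 = 0" using z2 by simp_all
          fix z3 assume z3: "only ({30..<35} \<union> {52}) {2, 12} z2 z3 \<and> (\<forall>i<n. arr z3 12 i = x ! i) \<and>
            (\<forall>i. arr z3 2 i = (if ?h * n \<le> i \<and> i < ?h * n + n then x ! (i - ?h * n) else arr z2 2 i)) \<and>
            reg z3 52 = (if consistent q n f x then 1 else 0)"
          have o3: "only ({30..<35} \<union> {52}) {2, 12} z2 z3" using z3 by blast
          have R3: "?R z3" by (rule only_trans[OF R2 o3]) (auto simp: PR_def PA_def)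
          have a3: "arr z3 8 = arr z 8" "arr z3 4 = arr z 4"
            using only_arr[OF o3, of 8] only_arr[OF o3, of 4] ar2 by simp_all
          have c3: "arr z3 2 (h' * n + i) = (if h' = ?h then x ! i else arr z 2 (h' * n + i))" if "i < n" for h' i
          proof (cases "h' = ?h")
            case True
            then show ?thesis using z3 that by simp
          next
            case False
            then have "\<not> (?h * n \<le> h' * n + i \<and> h' * n + i < ?h * n + n)" using in_block[OF that, of ?h h'] by auto
            then show ?thesis using z3 False ar2 by auto
          qed
          show "runs f (Seq (DDs ?h) (Seq (Seq (Const 54 ?h) (Store 8 54 6)) (IfLess 7 52 (ENC ?h) Skip))) z3 ?Q
            (cDDs ?h * E + (2 + Suc (cENC ?h * E)))"
          proof (rule runs_Seq[OF runs_DDs[OF envR[OF R3] lx, where Y = "raw p f w" and h = ?h]])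
            show "\<And>i. i < n \<Longrightarrow> arr z3 12 i = x ! i" using z3 by blast
            show "\<And>h'. h' < ?h \<Longrightarrow> arr z3 8 h' = (if raw p f w h' = None then 0 else 1)"
              using sl hK unfolding a3 slots_def by auto
            show "length y' = n \<and> (\<forall>i<n. arr z3 2 (h' * n + i) = y' ! i)" if h': "h' < ?h" "raw p f w h' = Some y'" for h' y'
            proof -
              have "h' < K" using h' hK by simp
              then have "\<forall>i<n. arr z 2 (h' * n + i) = y' ! i" using sl h' unfolding slots_def by blast
              then show ?thesis using lens[OF \<open>h' < K\<close> h'(2)] c3 h'(1) by simp
            qed
            show "?h \<le> ?h" by simp
            fix z4 assume z4: "only {41..<56} {} z3 z4 \<and> reg z4 52 = (if \<exists>h'<?h. raw p f w h' = Some x then 0 else reg z3 52)"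
            have o4: "only {41..<56} {} z3 z4" using z4 by blast
            have R4: "?R z4" by (rule only_trans[OF R3 o4]) (auto simp: PR_def PA_def)
            have ar4: "arr z4 = arr z3" by (rule ext) (use only_arr[OF o4] in simp)
            have g: "good p f w ?h \<longleftrightarrow> consistent q n f x \<and> \<not> (\<exists>h'<?h. raw p f w h' = Some x)"
              unfolding good_def rx by auto
            have r4: "reg z4 52 = (if good p f w ?h then 1 else 0)" using z4 z3 unfolding g by auto
            show "runs f (Seq (Seq (Const 54 ?h) (Store 8 54 6)) (IfLess 7 52 (ENC ?h) Skip)) z4 ?Q (2 + Suc (cENC ?h * E))"
            proof (rule runs_Seq)
              show "runs f (Seq (Const 54 ?h) (Store 8 54 6)) z4 (\<lambda>z5. z5 = set_arr 8 ?h 1 (set_reg 54 ?h z4)) 2"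
                by (rule runs_loop_free) (use envD(2)[OF envR[OF R4]] in simp_all)
            next
              fix z5 assume z5: "z5 = set_arr 8 ?h 1 (set_reg 54 ?h z4)"
              have R5: "?R z5" unfolding z5 using R4 by (simp add: PR_def PA_def)
              have env5: "env z5" by (rule envR[OF R5])
              have r5: "reg z5 52 = (if good p f w ?h then 1 else 0)" using r4 z5 by simp
              have ar5: "arr z5 8 i = (if i = ?h then 1 else arr z 8 i)" "arr z5 2 = arr z3 2" "arr z5 4 = arr z 4"
                "arr z5 12 = arr z3 12" for i
                unfolding z5 using ar4 a3 by simp_all
              \<comment> \<open>Common end of both branches: only the encoding in array 4 remains to
                be settled.\<close>
              have fin: "slots p f w (Suc ?h) z'"
                if "arr z' 8 = arr z5 8" "arr z' 2 = arr z5 2"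
                  and y4: "\<And>i. arr z' 4 i = (if ?h * N \<le> i \<and> i < ?h * N + N then slotc p f w ?h (i - ?h * N) else arr z 4 i)" for z'
                unfolding slots_def
              proof (intro allI impI)
                fix h' assume h': "h' < K"
                have y': "arr z' 4 (h' * N + r) = (if h' = ?h then slotc p f w ?h r else arr z 4 (h' * N + r))" if "r < N" for r
                  using y4[of "h' * N + r"] in_block[OF that, of ?h h'] by auto
                have sl': "(h' < ?h \<longrightarrow> arr z 8 h' = (if raw p f w h' = None then 0 else 1) \<and>
                  (\<forall>x i. raw p f w h' = Some x \<longrightarrow> i < n \<longrightarrow> arr z 2 (h' * n + i) = x ! i) \<and>
                  (\<forall>r<N. arr z 4 (h' * N + r) = slotc p f w h' r)) \<and>
                  (?h \<le> h' \<longrightarrow> arr z 8 h' = 0 \<and> (\<forall>r<N. arr z 4 (h' * N + r) = 0))"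
                  using sl h' unfolding slots_def by blast
                have e8: "arr z' 8 h' = (if h' = ?h then 1 else arr z 8 h')" using that(1) ar5(1) by simp
                have e2: "arr z' 2 (h' * n + i) = (if h' = ?h then x ! i else arr z 2 (h' * n + i))" if "i < n" for i
                  using \<open>arr z' 2 = arr z5 2\<close> ar5(2) c3[OF that] by simp
                show "(h' < Suc ?h \<longrightarrow> arr z' 8 h' = (if raw p f w h' = None then 0 else 1) \<and>
                  (\<forall>x i. raw p f w h' = Some x \<longrightarrow> i < n \<longrightarrow> arr z' 2 (h' * n + i) = x ! i) \<and>
                  (\<forall>r<N. arr z' 4 (h' * N + r) = slotc p f w h' r)) \<and>
                  (Suc ?h \<le> h' \<longrightarrow> arr z' 8 h' = 0 \<and> (\<forall>r<N. arr z' 4 (h' * N + r) = 0))"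
                proof (cases "h' = ?h")
                  case True
                  then show ?thesis using e8 e2 y' rx by simp
                next
                  case False
                  then show ?thesis using e8 e2 y' sl' by (simp add: less_Suc_eq)
                qed
              qed
              show "runs f (IfLess 7 52 (ENC ?h) Skip) z5 ?Q (Suc (cENC ?h * E))"
              proof (rule runs_If)
                assume "reg z5 7 < reg z5 52"
                then have gd: "good p f w ?h" using r5 envD(3)[OF env5] by (auto split: if_splits)
                have str: "string q n x" using good_string[OF gd] rx by simp
                have cp5: "cp (ka ?h) z5 = z0" "cp (kb ?h) z5 = z0"
                proof -
                  have o5: "only {20..<65} ({2, 8} \<union> {12}) z z5"
                  proof -
                    have "only {20..<65} ({2, 8} \<union> {12}) z z3" by (rule only_trans[OF o2 o3]) auto
                    from only_trans[OF this o4, of "{20..<65}" "{2, 8} \<union> {12}"]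
                    have "only {20..<65} ({2, 8} \<union> {12}) z z4" by auto
                    then show ?thesis unfolding z5 by simp
                  qed
                  have "cp k' z5 = cp k' z" for k' by (rule only_cp[OF o5]) auto
                  then show "cp (ka ?h) z5 = z0" "cp (kb ?h) z5 = z0" using cpz by simp_all
                qed
                have "runs f (ENC ?h) z5 (\<lambda>z'. only (ER ?h) (EA ?h) z5 z' \<and>
                  (\<forall>i. arr z' 4 i = (if ?h * N \<le> i \<and> i < ?h * N + N then Suc (amp t x (i - ?h * N)) else arr z5 4 i))) (cENC ?h * E)"
                  by (rule runs_ENC[OF env5 str _ cp5]) (use ar5(4) z3 in simp)
                then show "runs f (ENC ?h) z5 ?Q (cENC ?h * E)"
                proof (rule runs_mono)
                  fix z6 assume z6: "only (ER ?h) (EA ?h) z5 z6 \<and>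
                  (\<forall>i. arr z6 4 i = (if ?h * N \<le> i \<and> i < ?h * N + N then Suc (amp t x (i - ?h * N)) else arr z5 4 i))"
                  have o6: "only (ER ?h) (EA ?h) z5 z6" using z6 by blast
                  have R6: "?R z6" by (rule only_trans[OF R5 o6]) (auto simp: PR_def PA_def ER_def EA_def)
                  have "slots p f w (Suc ?h) z6"
                  proof (rule fin)
                    show "arr z6 8 = arr z5 8" "arr z6 2 = arr z5 2"
                      using only_arr[OF o6, of 8] only_arr[OF o6, of 2] by (simp_all add: EA_def)
                    show "\<And>i. arr z6 4 i = (if ?h * N \<le> i \<and> i < ?h * N + N then slotc p f w ?h (i - ?h * N) else arr z 4 i)"
                      using z6 gd rx ar5(3) by (simp add: slotc_def)
                  qed
                  then show "?Q z6" using R6 by blast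
                qed simp
              next
                assume "\<not> reg z5 7 < reg z5 52"
                then have gd: "\<not> good p f w ?h" using r5 envD(3)[OF env5] by (auto split: if_splits)
                \<comment> \<open>For a rejected candidate nothing is written: the slot was blank,
                  and \<open>slotc\<close> is 0.\<close>
                have "slots p f w (Suc ?h) z5"
                proof (rule fin)
                  show "arr z5 4 i = (if ?h * N \<le> i \<and> i < ?h * N + N then slotc p f w ?h (i - ?h * N) else arr z 4 i)" for i
                  proof (cases "?h * N \<le> i \<and> i < ?h * N + N")
                    case True
                    then obtain r where r: "i = ?h * N + r" "r < N" by (metis add_less_cancel_left le_Suc_ex)
                    have "arr z 4 (?h * N + r) = 0" using sl hK r(2) unfolding slots_def by blast
                    then show ?thesis using r True gd ar5(3) by (simp add: slotc_def)
                  next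
                    case False
                    show ?thesis unfolding if_not_P[OF False] ar5(3) ..
                  qed
                qed simp_all
                moreover have "1 \<le> cENC ?h * E" using E_ge(1) by (simp add: cENC_def)
                ultimately show "runs f Skip z5 ?Q (cENC ?h * E)"
                  using R5 by (intro runs_loop_free) simp_all
              qed
            qed
          qed
        qed
      qed
    next
      assume "\<not> reg z1 50 < reg z1 (rn j 5)"
      then have "raw p f w ?h = None" using z1 l5 raw by simp
      then have n: "raw p f w ?h = None" "slotc p f w ?h r = 0" for r by (simp_all add: slotc_def good_def)
      have "slots p f w (Suc ?h) z1"
        unfolding slots_def
      proof (intro allI impI)
        fix h' assume h': "h' < K"
        have "(h' < ?h \<longrightarrow> arr z 8 h' = (if raw p f w h' = None then 0 else 1) \<and>
                  (\<forall>x i. raw p f w h' = Some x \<longrightarrow> i < n \<longrightarrow> arr z 2 (h' * n + i) = x ! i) \<and>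
                  (\<forall>r<N. arr z 4 (h' * N + r) = slotc p f w h' r)) \<and>
                  (?h \<le> h' \<longrightarrow> arr z 8 h' = 0 \<and> (\<forall>r<N. arr z 4 (h' * N + r) = 0))"
          using sl h' unfolding slots_def by blast
        then show "(h' < Suc ?h \<longrightarrow> arr z1 8 h' = (if raw p f w h' = None then 0 else 1) \<and>
                  (\<forall>x i. raw p f w h' = Some x \<longrightarrow> i < n \<longrightarrow> arr z1 2 (h' * n + i) = x ! i) \<and>
                  (\<forall>r<N. arr z1 4 (h' * N + r) = slotc p f w h' r)) \<and>
                  (Suc ?h \<le> h' \<longrightarrow> arr z1 8 h' = 0 \<and> (\<forall>r<N. arr z1 4 (h' * N + r) = 0))"
          using z1 n by (cases "h' = ?h") (simp_all add: less_Suc_eq)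
      qed
      then show "runs f Skip z1 ?Q (len (proc_pre ?h k) + ((n * Suc (len (chk_body j)) + 1) + (cDDs ?h * E + (2 + Suc (cENC ?h * E)))))"
        using R1 by (intro runs_loop_free) simp_all
    qed
  qed
  moreover have "1 + Suc (len (proc_pre ?h k) + ((n * Suc (len (chk_body j)) + 1) + (cDDs ?h * E + (2 + Suc (cENC ?h * E))))) \<le> cPROC j k * E"
  proof -
    have "(5 + len (proc_pre ?h k)) + (n * Suc (len (chk_body j)) + 1) \<le> (6 + len (proc_pre ?h k) + (2 + len (chk_body j))) * E"
      by (rule order_trans[OF time_bound[OF E_ge(3)]]) (simp add: add_mult_distrib)
    then show ?thesis unfolding cPROC_def add_mult_distrib by linarith
  qed
  ultimately show ?thesis by (rule runs_time)
qed

primrec PRS :: "nat \<Rightarrow> nat \<Rightarrow> com" where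
  "PRS j 0 = Skip"
| "PRS j (Suc k) = Seq (PRS j k) (PROC j k)"

definition cPRS :: "nat \<Rightarrow> nat \<Rightarrow> nat" where "cPRS j k = 1 + (\<Sum>i<k. cPROC j i)"

definition UR :: "nat \<Rightarrow> nat \<Rightarrow> nat set" where "UR j k = (\<Union>i<k. RR (hs j i))"
definition BR :: "nat \<Rightarrow> nat \<Rightarrow> nat set" where "BR j k = {20..<65} \<union> UR j k"
definition BA :: "nat \<Rightarrow> nat \<Rightarrow> nat set" where "BA j k = {2, 4, 8} \<union> {A. even A \<and> 12 \<le> A} \<union> UR j k"

lemma rn_UR: "rn k' x \<in> UR j k \<longleftrightarrow> (\<exists>i<k. k' = ka (hs j i) \<or> k' = kb (hs j i))"
  by (auto simp: UR_def)

lemma own_UR [simp]: "x < 65 \<Longrightarrow> x \<notin> UR j k" "even x \<Longrightarrow> x \<notin> UR j k"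
  by (auto simp: UR_def)

lemma cp_BR:
  assumes "only (BR j k) (BA j k) z z'" "\<And>i. i < k \<Longrightarrow> k' \<noteq> ka (hs j i) \<and> k' \<noteq> kb (hs j i)"
  shows "cp k' z' = cp k' z"
  by (rule only_cp[OF assms(1)]) (use assms(2) in \<open>auto simp: BR_def BA_def rn_UR\<close>)

lemma runs_PRS:
  assumes env: "env z" and sl: "slots p f w (j * s) z"
    and st: "stored_lists n (cp j z) = outcome S p f (bview w j)"
    and j: "j < 6 * d"
    and cpz: "\<And>i. i < s \<Longrightarrow> cp (ka (hs j i)) z = z0 \<and> cp (kb (hs j i)) z = z0"
    and lens: "\<And>h y. h < K \<Longrightarrow> raw p f w h = Some y \<Longrightarrow> length y = n"
  shows "k \<le> s \<Longrightarrow> runs f (PRS j k) z (\<lambda>z'. only (BR j k) (BA j k) z z' \<and> slots p f w (hs j k) z') (cPRS j k * E)"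
proof (induction k)
  case 0
  show ?case by (rule runs_loop_free) (use sl E_ge(1) in \<open>simp_all add: cPRS_def\<close>)
next
  case (Suc k)
  have ih: "runs f (PRS j k) z (\<lambda>z'. only (BR j k) (BA j k) z z' \<and> slots p f w (hs j k) z') (cPRS j k * E)"
    using Suc by simp
  let ?Q = "\<lambda>z'. only (BR j (Suc k)) (BA j (Suc k)) z z' \<and> slots p f w (hs j (Suc k)) z'"
  have "runs f (PRS j (Suc k)) z ?Q (cPRS j k * E + cPROC j k * E)"
    unfolding PRS.simps
  proof (rule runs_Seq[OF ih])
    fix z1 assume z1: "only (BR j k) (BA j k) z z1 \<and> slots p f w (hs j k) z1"
    have o1: "only (BR j k) (BA j k) z z1" using z1 by blast
    have env1: "env z1" by (rule env_only[OF env o1]) (simp_all add: BR_def BA_def)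
    \<comment> \<open>The copies of the slots have numbers from \<open>6 * d\<close> on, so the list
      in copy \<open>j\<close> survives while its entries are processed.\<close>
    have cpj: "cp j z1 = cp j z" by (rule cp_BR[OF o1]) (use j in auto)
    have cpk: "cp (ka (hs j k)) z1 = z0" "cp (kb (hs j k)) z1 = z0"
      using cp_BR[OF o1, of "ka (hs j k)"] cp_BR[OF o1, of "kb (hs j k)"] cpz[of k] Suc.prems by (force, force)
    have "runs f (PROC j k) z1 (\<lambda>z'. only (PR (hs j k)) (PA (hs j k)) z1 z' \<and> slots p f w (Suc (hs j k)) z') (cPROC j k * E)"
      by (rule runs_PROC[OF env1 conjunct2[OF z1] _ j _ cpk lens]) (use st cpj Suc.prems in simp_all)
    then show "runs f (PROC j k) z1 ?Q (cPROC j k * E)"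
    proof (rule runs_mono)
      fix z2 assume z2: "only (PR (hs j k)) (PA (hs j k)) z1 z2 \<and> slots p f w (Suc (hs j k)) z2"
      have "only (BR j (Suc k)) (BA j (Suc k)) z z2"
        by (rule only_trans[OF o1 conjunct1[OF z2]]) (auto simp: BR_def BA_def PR_def PA_def UR_def less_Suc_eq)
      then show "?Q z2" using z2 by simp
    qed simp
  qed
  moreover have "cPRS j k * E + cPROC j k * E \<le> cPRS j (Suc k) * E"
    unfolding cPRS_def sum.lessThan_Suc add_mult_distrib by linarith
  ultimately show ?case by (rule runs_time)
qed

end

text \<open>Register numbers are fixed in the program text, so each copy has code of its own; a
  chain of tests selects it by the block number in register 13.\<close>

primrec disp :: "(nat \<Rightarrow> com) \<Rightarrow> nat \<Rightarrow> com" where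
  "disp P 0 = Skip"
| "disp P (Suc k) = Seq (Const 45 k) (IfLess 13 45 (disp P k) (P k))"

lemma runs_disp:
  "reg z 13 = j \<Longrightarrow> j < k \<Longrightarrow> (\<And>z1. only {45} {} z z1 \<Longrightarrow> runs f (P j) z1 Q u) \<Longrightarrow> runs f (disp P k) z Q (2 * k + u)"
proof (induction k arbitrary: z)
  case (Suc k)
  have "runs f (disp P (Suc k)) z Q (1 + Suc (2 * k + u))"
    unfolding disp.simps
  proof (rule runs_Seq)
    show "runs f (Const 45 k) z (\<lambda>z1. z1 = set_reg 45 k z) 1" by (rule runs_loop_free) simp_all
  next
    fix z1 assume z1: "z1 = set_reg 45 k z"
    have o1: "only {45} {} z z1" unfolding z1 by simp
    have r1: "reg z1 13 = j" "reg z1 45 = k" using Suc.prems(1) z1 by simp_all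
    show "runs f (IfLess 13 45 (disp P k) (P k)) z1 Q (Suc (2 * k + u))"
    proof (rule runs_If)
      assume "reg z1 13 < reg z1 45"
      then have "j < k" using r1 by simp
      then show "runs f (disp P k) z1 Q (2 * k + u)"
      proof (rule Suc.IH[OF r1(1)])
        fix z2 assume o2: "only {45} {} z1 z2"
        have "only {45} {} z z2" by (rule only_trans[OF o1 o2]) auto
        then show "runs f (P j) z2 Q u" by (rule Suc.prems(3))
      qed
    next
      assume "\<not> reg z1 13 < reg z1 45"
      then have "k = j" using r1 Suc.prems(2) by simp
      then show "runs f (P k) z1 Q (2 * k + u)" using runs_time[OF Suc.prems(3)[OF o1]] by simp
    qed
  qed
  then show ?case by simp
qed simp

section \<open>Tuples, support counts and certainty\<close>

context machine
begin

definition tup_body :: com where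
  "tup_body = Seq (dblc 23 g) (Seq (Load 27 4 26) (Seq (Add 23 23 27) (Seq (Add 26 26 8) (Add 24 24 6))))"

definition TUP :: com where
  "TUP = Seq (Seq (Const 23 0) (Seq (Const 24 0) (Seq (Add 26 14 7) (Const 25 K)))) (WhileLess 24 25 tup_body)"

lemma runs_TUP:
  assumes env: "env z" and e: "\<And>h. h < K \<Longrightarrow> arr z 4 (h * N + reg z 14) = e h"
  shows "runs f TUP z (\<lambda>z'. only {23..<28} {} z z' \<and> reg z' 23 = tup g e K) (4 + (K * Suc (len tup_body) + 1))"
proof -
  let ?R = "only {23..<28} {} z"
  let ?I = "\<lambda>k z'. ?R z' \<and> reg z' 24 = k \<and> reg z' 25 = K \<and> reg z' 26 = k * N + reg z 14 \<and> reg z' 23 = tup g e k"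
  have ro: "reg z' 6 = 1" "reg z' 8 = N" "arr z' 4 = arr z 4" if "?R z'" for z'
    using only_reg[OF that] only_arr[OF that] envD[OF env] by simp_all
  show ?thesis unfolding TUP_def
  proof (rule runs_Seq)
    show "runs f (Seq (Const 23 0) (Seq (Const 24 0) (Seq (Add 26 14 7) (Const 25 K)))) z (?I 0) 4"
      by (rule runs_loop_free) (use envD[OF env] in simp_all)
  next
    fix z1 assume z1: "?I 0 z1"
    show "runs f (WhileLess 24 25 tup_body) z1 (\<lambda>z'. ?R z' \<and> reg z' 23 = tup g e K) (K * Suc (len tup_body) + 1)"
    proof (rule runs_for_const[where I = ?I])
      fix k z2 assume k: "k < K" and I: "?I k z2"
      have R2: "?R z2" using I by blast
      have "runs f tup_body z2 (?I (Suc k)) (len tup_body)"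
        by (rule runs_loop_free) (use I ro[OF R2] e[OF k] in \<open>simp_all add: tup_body_def\<close>)
      then show "reg z2 24 < reg z2 25 \<and> runs f tup_body z2 (?I (Suc k)) (len tup_body)" using I k by simp
    next
      fix z2 assume "?I K z2"
      then show "\<not> reg z2 24 < reg z2 25 \<and> ?R z2 \<and> reg z2 23 = tup g e K" by simp
    qed (rule z1)
  qed
qed

definition dig_body :: com where
  "dig_body = Seq (divc (2 ^ g)) (Seq (Store 18 24 20) (Seq (Add 20 22 7) (Add 24 24 6)))"

text \<open>Extracting digits destroys the tuple in register 20, so all digits are tabulated before
  the slots are compared with them.\<close>

definition DIGS :: com where
  "DIGS = Seq (Seq (Const 24 0) (Const 25 K)) (WhileLess 24 25 dig_body)"

definition tDIGS :: nat where "tDIGS = 2 + (K * Suc (3 * Zs + 4 + 3) + 1)"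

lemma runs_DIGS:
  assumes env: "env z" and y: "reg z 20 = y" "y < Zs"
  shows "runs f DIGS z (\<lambda>z'. only {20..<26} {18} z z' \<and> reg z' 25 = K \<and> (\<forall>i<K. arr z' 18 i = digit g y i)) tDIGS"
proof -
  let ?R = "only {20..<26} {18} z"
  let ?I = "\<lambda>k z'. ?R z' \<and> reg z' 24 = k \<and> reg z' 25 = K \<and> reg z' 20 = y div 2 ^ (g * k) \<and> (\<forall>i<k. arr z' 18 i = digit g y i)"
  have ro: "reg z' 6 = 1" "reg z' 7 = 0" if "?R z'" for z'
    using only_reg[OF that] envD[OF env] by simp_all
  show ?thesis unfolding DIGS_def tDIGS_def
  proof (rule runs_Seq)
    show "runs f (Seq (Const 24 0) (Const 25 K)) z (?I 0) 2" by (rule runs_loop_free) (use y in simp_all)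
  next
    fix z1 assume z1: "?I 0 z1"
    show "runs f (WhileLess 24 25 dig_body) z1 (\<lambda>z'. ?R z' \<and> reg z' 25 = K \<and> (\<forall>i<K. arr z' 18 i = digit g y i)) (K * Suc (3 * Zs + 4 + 3) + 1)"
    proof (rule runs_for_const[where I = ?I])
      fix k z2 assume k: "k < K" and I: "?I k z2"
      have R2: "?R z2" using I by blast
      have "reg z2 20 \<le> y" using I by simp
      then have le: "3 * reg z2 20 + 4 \<le> 3 * Zs + 4" using y(2) by linarith
      have "runs f dig_body z2 (?I (Suc k)) (3 * Zs + 4 + 3)"
        unfolding dig_body_def
      proof (rule runs_Seq[OF runs_time[OF runs_divc[OF ro(1)[OF R2]] le]])
        show "(0::nat) < 2 ^ g" by simp
        fix z3 assume z3: "only {20..<24} {} z2 z3 \<and> reg z3 20 = reg z2 20 mod 2 ^ g \<and> reg z3 22 = reg z2 20 div 2 ^ g"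
        have o3: "only {20..<24} {} z2 z3" using z3 by blast
        have R3: "?R z3" by (rule only_trans[OF R2 o3]) auto
        have a3: "arr z3 = arr z2" by (rule ext) (use only_arr[OF o3] in simp)
        have r3: "reg z3 24 = k" "reg z3 25 = K" using only_reg[OF o3, of 24] only_reg[OF o3, of 25] I by simp_all
        have v3: "reg z3 20 = digit g y k" "reg z3 22 = y div 2 ^ (g * Suc k)"
          using z3 I by (simp_all add: digit_def div_mult2_eq[symmetric] power_add[symmetric] add.commute mult.commute)
        show "runs f (Seq (Store 18 24 20) (Seq (Add 20 22 7) (Add 24 24 6))) z3 (?I (Suc k)) 3"
          by (rule runs_loop_free) (use R3 r3 v3 ro[OF R3] a3 I in \<open>simp_all add: less_Suc_eq\<close>)
      qed
      then show "reg z2 24 < reg z2 25 \<and> runs f dig_body z2 (?I (Suc k)) (3 * Zs + 4 + 3)" using I k by simp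
    next
      fix z2 assume "?I K z2"
      then show "\<not> reg z2 24 < reg z2 25 \<and> ?R z2 \<and> reg z2 25 = K \<and> (\<forall>i<K. arr z2 18 i = digit g y i)" by simp
    qed (rule z1)
  qed
qed

definition hit_test :: com where "hit_test = IfLess 30 28 Skip (IfLess 28 30 Skip (Const 29 1))"

lemma ev_hit_test: "ev f hit_test z = set_reg 29 (if reg z 30 = reg z 28 then 1 else reg z 29) z"
  by (auto simp: hit_test_def)

definition hit_body :: com where
  "hit_body = Seq (Load 30 18 24) (Seq hit_test (Add 24 24 6))"

definition cnt_tail :: com where
  "cnt_tail = Seq (Load 31 6 26) (Seq (Add 31 31 29) (Seq (Store 6 26 31) (Seq (Add 27 27 8) (Add 26 26 6))))"

text \<open>The test of register 28 skips absent candidates, whose symbol 0 may well occur among the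
  digits.\<close>

definition cnt_body :: com where
  "cnt_body = Seq (Seq (Load 28 4 27) (Seq (Const 29 0) (Const 24 0)))
     (Seq (IfLess 7 28 (WhileLess 24 25 hit_body) Skip) cnt_tail)"

definition CNTS :: com where
  "CNTS = Seq (Seq (Const 26 0) (Add 27 14 7)) (WhileLess 26 25 cnt_body)"

definition tcb :: nat where "tcb = 3 + (Suc (K * Suc (len hit_body) + 1) + 5)"

lemma runs_CNTS:
  assumes env: "env z" and K: "reg z 25 = K" and D: "\<And>i. i < K \<Longrightarrow> arr z 18 i = digit g (y mod Zs) i"
    and e: "\<And>h. h < K \<Longrightarrow> arr z 4 (h * N + reg z 14) = e h"
  shows "runs f CNTS z (\<lambda>z'. only {20..<65} {6} z z' \<and>
     (\<forall>h<K. arr z' 6 h = arr z 6 h + (if supports y (e h) then 1 else 0))) (2 + (K * Suc tcb + 1))"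
proof -
  let ?R = "only {20..<65} {6} z"
  let ?I = "\<lambda>k z'. ?R z' \<and> reg z' 26 = k \<and> reg z' 25 = K \<and> reg z' 27 = k * N + reg z 14 \<and>
    (\<forall>h. arr z' 6 h = arr z 6 h + (if h < k \<and> supports y (e h) then 1 else 0))"
  have ro: "reg z' 6 = 1" "reg z' 7 = 0" "reg z' 8 = N" "arr z' 4 = arr z 4" "arr z' 18 = arr z 18" if "?R z'" for z'
    using only_reg[OF that] only_arr[OF that] envD[OF env] by simp_all
  show ?thesis unfolding CNTS_def
  proof (rule runs_Seq)
    show "runs f (Seq (Const 26 0) (Add 27 14 7)) z (?I 0) 2"
      by (rule runs_loop_free) (use envD[OF env] K in simp_all)
  next
    fix z1 assume z1: "?I 0 z1"
    show "runs f (WhileLess 26 25 cnt_body) z1 (\<lambda>z'. ?R z' \<and>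
      (\<forall>h<K. arr z' 6 h = arr z 6 h + (if supports y (e h) then 1 else 0))) (K * Suc tcb + 1)"
    proof (rule runs_for_const[where I = ?I])
      fix k z2 assume k: "k < K" and I: "?I k z2"
      have R2: "?R z2" using I by blast
      let ?J = "\<lambda>i z'. only {20..<65} {} z2 z' \<and> reg z' 26 = k \<and> reg z' 25 = K \<and> reg z' 27 = k * N + reg z 14 \<and>
         reg z' 28 = e k \<and> reg z' 24 = i \<and> reg z' 29 = (if \<exists>h<i. digit g (y mod Zs) h = e k then 1 else 0)"
      have sup: "supports y (e k) \<longleftrightarrow> e k \<noteq> 0 \<and> (\<exists>h<K. digit g (y mod Zs) h = e k)" by (simp add: supports_def)
      have RJ: "?R z'" if "only {20..<65} {} z2 z'" for z' by (rule only_trans[OF R2 that]) auto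
      have aJ: "arr z' = arr z2" if "only {20..<65} {} z2 z'" for z' by (rule ext) (use only_arr[OF that] in simp)
      have "runs f cnt_body z2 (?I (Suc k)) tcb"
        unfolding cnt_body_def tcb_def
      proof (rule runs_Seq)
        show "runs f (Seq (Load 28 4 27) (Seq (Const 29 0) (Const 24 0))) z2 (?J 0) 3"
          by (rule runs_loop_free) (use I ro[OF R2] e[OF k] in simp_all)
      next
        fix z3 assume J: "?J 0 z3"
        have o3: "only {20..<65} {} z2 z3" using J by blast
        let ?L = "\<lambda>z'. only {20..<65} {} z2 z' \<and> reg z' 26 = k \<and> reg z' 25 = K \<and> reg z' 27 = k * N + reg z 14 \<and>
         reg z' 29 = (if supports y (e k) then 1 else 0)"
        show "runs f (Seq (IfLess 7 28 (WhileLess 24 25 hit_body) Skip) cnt_tail) z3 (?I (Suc k)) (Suc (K * Suc (len hit_body) + 1) + 5)"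
        proof (rule runs_Seq)
          show "runs f (IfLess 7 28 (WhileLess 24 25 hit_body) Skip) z3 ?L (Suc (K * Suc (len hit_body) + 1))"
          proof (rule runs_If)
            assume "reg z3 7 < reg z3 28"
            then have ek: "e k \<noteq> 0" using J ro(2)[OF RJ[OF o3]] by simp
            show "runs f (WhileLess 24 25 hit_body) z3 ?L (K * Suc (len hit_body) + 1)"
            proof (rule runs_for_const[where I = ?J])
              fix i z4 assume i: "i < K" and J4: "?J i z4"
              have o4: "only {20..<65} {} z2 z4" using J4 by blast
              have d4: "arr z4 18 i = digit g (y mod Zs) i" using D[OF i] ro(5)[OF RJ[OF o4]] by simp
              have ex: "(\<exists>h<Suc i. P h) \<longleftrightarrow> (\<exists>h<i. P h) \<or> P i" for P by (auto simp: less_Suc_eq)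
              have "runs f hit_body z4 (?J (Suc i)) (len hit_body)"
                by (rule runs_loop_free)
                   (use J4 d4 ro(1)[OF RJ[OF o4]] in \<open>simp_all add: hit_body_def ev_hit_test ex hit_test_def[THEN arg_cong[where f = loop_free]]\<close>)
              then show "reg z4 24 < reg z4 25 \<and> runs f hit_body z4 (?J (Suc i)) (len hit_body)" using J4 i by simp
            next
              fix z4 assume "?J K z4"
              then show "\<not> reg z4 24 < reg z4 25 \<and> ?L z4" using sup ek by simp
            qed (rule J)
          next
            assume "\<not> reg z3 7 < reg z3 28"
            then have "e k = 0" using J ro(2)[OF RJ[OF o3]] by simp
            then show "runs f Skip z3 ?L (K * Suc (len hit_body) + 1)"
              by (intro runs_loop_free) (use J sup in simp_all)
          qed
        next
          fix z4 assume L: "?L z4"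
          have o4: "only {20..<65} {} z2 z4" using L by blast
          show "runs f cnt_tail z4 (?I (Suc k)) 5"
            by (rule runs_loop_free) (use L I RJ[OF o4] aJ[OF o4] ro[OF RJ[OF o4]] in \<open>simp_all add: cnt_tail_def less_Suc_eq\<close>)
        qed
      qed
      then show "reg z2 26 < reg z2 25 \<and> runs f cnt_body z2 (?I (Suc k)) tcb" using I k by simp
    next
      fix z2 assume "?I K z2"
      then show "\<not> reg z2 26 < reg z2 25 \<and> ?R z2 \<and> (\<forall>h<K. arr z2 6 h = arr z 6 h + (if supports y (e h) then 1 else 0))" by simp
    qed (rule z1)
  qed
qed

text \<open>One division splits the received symbol: the quotient goes, as a code, to register 16
  for the copy of \<open>S\<close>, and the remainder, the tuple of the peer, is left in register
  20. The dividends are bounded in terms of \<open>Zs\<close> and \<open>\<sigma>\<close>, so the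
  time is constant.\<close>

definition GET :: com where
  "GET = IfLess 7 3 (Seq (Sub 20 3 6) (Seq (divc Zs) (Seq (Add 16 22 6) (Seq DIGS CNTS)))) (Const 16 0)"

definition tGET :: nat where
  "tGET = Suc (1 + ((3 * (Zs * \<sigma>) + 4) + (1 + (tDIGS + (2 + (K * Suc tcb + 1))))))"

lemma runs_GET:
  assumes env: "env z" and y: "reg z 3 = received_code y" "\<And>y'. y = Some y' \<Longrightarrow> y' < Zs * alphabet S"
    and e: "\<And>h. h < K \<Longrightarrow> arr z 4 (h * N + reg z 14) = e h"
  shows "runs f GET z (\<lambda>z'. only ({16} \<union> {20..<65}) {6, 18} z z' \<and>
     reg z' 16 = received_code (map_option (\<lambda>y. y div Zs) y) \<and>
     (\<forall>h<K. arr z' 6 h = arr z 6 h + (if \<exists>y'. y = Some y' \<and> supports y' (e h) then 1 else 0))) tGET"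
proof -
  let ?R = "only ({16} \<union> {20..<65}) {6, 18} z"
  let ?Q = "\<lambda>z'. ?R z' \<and> reg z' 16 = received_code (map_option (\<lambda>y. y div Zs) y) \<and>
     (\<forall>h<K. arr z' 6 h = arr z 6 h + (if \<exists>y'. y = Some y' \<and> supports y' (e h) then 1 else 0))"
  have envR: "env z'" if "?R z'" for z' by (rule env_only[OF env that]) simp_all
  show ?thesis unfolding GET_def tGET_def
  proof (rule runs_If)
    assume "reg z 7 < reg z 3"
    then obtain y' where y': "y = Some y'" using y(1) envD(3)[OF env] by (cases y) auto
    have yl: "y' < Zs * \<sigma>"
    proof -
      have "Zs * alphabet S \<le> Zs * \<sigma>" by (rule mult_left_mono[OF alph]) simp
      then show ?thesis using y(2)[OF y'] by linarith
    qed
    show "runs f (Seq (Sub 20 3 6) (Seq (divc Zs) (Seq (Add 16 22 6) (Seq DIGS CNTS)))) z ?Q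
      (1 + ((3 * (Zs * \<sigma>) + 4) + (1 + (tDIGS + (2 + (K * Suc tcb + 1))))))"
    proof (rule runs_Seq)
      show "runs f (Sub 20 3 6) z (\<lambda>z1. z1 = set_reg 20 y' z) 1"
        by (rule runs_loop_free) (use envD[OF env] y y' in simp_all)
    next
      fix z1 assume z1: "z1 = set_reg 20 y' z"
      have R1: "?R z1" unfolding z1 by simp
      have le: "3 * reg z1 20 + 4 \<le> 3 * (Zs * \<sigma>) + 4" using yl z1 by simp
      show "runs f (Seq (divc Zs) (Seq (Add 16 22 6) (Seq DIGS CNTS))) z1 ?Q
        ((3 * (Zs * \<sigma>) + 4) + (1 + (tDIGS + (2 + (K * Suc tcb + 1)))))"
      proof (rule runs_Seq[OF runs_time[OF runs_divc[OF envD(2)[OF envR[OF R1]]] le]])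
        show "0 < Zs" by simp
        fix z2 assume z2: "only {20..<24} {} z1 z2 \<and> reg z2 20 = reg z1 20 mod Zs \<and> reg z2 22 = reg z1 20 div Zs"
        have o2: "only {20..<24} {} z1 z2" using z2 by blast
        have R2: "?R z2" by (rule only_trans[OF R1 o2]) auto
        have a2: "arr z2 = arr z" by (rule ext) (use only_arr[OF o2] z1 in simp)
        show "runs f (Seq (Add 16 22 6) (Seq DIGS CNTS)) z2 ?Q (1 + (tDIGS + (2 + (K * Suc tcb + 1))))"
        proof (rule runs_Seq)
          show "runs f (Add 16 22 6) z2 (\<lambda>z3. z3 = set_reg 16 (Suc (y' div Zs)) z2) 1"
            by (rule runs_loop_free) (use z2 z1 envD(2)[OF envR[OF R2]] in simp_all)
        next
          fix z3 assume z3: "z3 = set_reg 16 (Suc (y' div Zs)) z2"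
          have R3: "?R z3" unfolding z3 using R2 by simp
          have r3: "reg z3 20 = y' mod Zs" "reg z3 16 = Suc (y' div Zs)" using z3 z2 z1 by simp_all
          show "runs f (Seq DIGS CNTS) z3 ?Q (tDIGS + (2 + (K * Suc tcb + 1)))"
          proof (rule runs_Seq[OF runs_DIGS[OF envR[OF R3] r3(1)]])
            show "y' mod Zs < Zs" by simp
            fix z4 assume z4: "only {20..<26} {18} z3 z4 \<and> reg z4 25 = K \<and> (\<forall>i<K. arr z4 18 i = digit g (y' mod Zs) i)"
            have o4: "only {20..<26} {18} z3 z4" using z4 by blast
            have R4: "?R z4" by (rule only_trans[OF R3 o4]) auto
            have a4: "arr z4 6 = arr z 6" "arr z4 4 = arr z 4"
              using only_arr[OF o4, of 6] only_arr[OF o4, of 4] z3 a2 by simp_all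
            have r4: "reg z4 16 = Suc (y' div Zs)" using only_reg[OF o4, of 16] r3 by simp
            have r14: "reg z4 14 = reg z 14" using only_reg[OF R4, of 14] by simp
            have "runs f CNTS z4 (\<lambda>z'. only {20..<65} {6} z4 z' \<and>
              (\<forall>h<K. arr z' 6 h = arr z4 6 h + (if supports y' (e h) then 1 else 0))) (2 + (K * Suc tcb + 1))"
              by (rule runs_CNTS[OF envR[OF R4]]) (use z4 e a4 r14 in simp_all)
            then show "runs f CNTS z4 ?Q (2 + (K * Suc tcb + 1))"
            proof (rule runs_mono)
              fix z5 assume z5: "only {20..<65} {6} z4 z5 \<and> (\<forall>h<K. arr z5 6 h = arr z4 6 h + (if supports y' (e h) then 1 else 0))"
              have o5: "only {20..<65} {6} z4 z5" using z5 by blast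
              have R5: "?R z5" by (rule only_trans[OF R4 o5]) auto
              have "reg z5 16 = Suc (y' div Zs)" using only_reg[OF o5, of 16] r4 by simp
              then show "?Q z5" using R5 z5 a4 y' by simp
            qed simp
          qed
        qed
      qed
    qed
  next
    assume "\<not> reg z 7 < reg z 3"
    then have "y = None" using y(1) envD(3)[OF env] by (cases y) auto
    then show "runs f (Const 16 0) z ?Q (1 + ((3 * (Zs * \<sigma>) + 4) + (1 + (tDIGS + (2 + (K * Suc tcb + 1))))))"
      by (intro runs_loop_free) simp_all
  qed
qed

definition cert_test :: com where "cert_test = IfLess 24 23 Skip (Add 21 21 6)"
lemma ev_cert_test: "ev f cert_test z = set_reg 21 (if reg z 24 < reg z 23 then reg z 21 else reg z 21 + reg z 6) z"
  by (auto simp: cert_test_def)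
definition cert_body :: com where "cert_body = Seq (Load 24 6 22) (Seq cert_test (Add 22 22 6))"
definition cert_fin :: com where "cert_fin = Seq (Const 15 0) (IfLess 7 21 (IfLess 6 21 Skip (Const 15 1)) Skip)"
definition cert_pre :: com where
  "cert_pre = Seq (Const 21 0) (Seq (Const 22 0) (Seq (Const 25 K) (Seq (Const 23 0) (addn 23 8 d))))"
definition CERTP :: com where
  "CERTP = Seq cert_pre (Seq (WhileLess 22 25 cert_body) cert_fin)"
definition tCERT :: nat where "tCERT = len cert_pre + ((K * Suc (len cert_body) + 1) + len cert_fin)"

lemma runs_CERTP:
  assumes env: "env z"
  shows "runs f CERTP z (\<lambda>z'. only ({15} \<union> {20..<65}) {} z z' \<and>
     reg z' 15 = (if card {h. h < K \<and> d * N \<le> arr z 6 h} = 1 then 1 else 0)) tCERT"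
proof -
  let ?R = "only {20..<65} {} z"
  let ?I = "\<lambda>k z'. ?R z' \<and> reg z' 22 = k \<and> reg z' 25 = K \<and> reg z' 23 = d * N \<and> reg z' 21 = card {h. h < k \<and> d * N \<le> arr z 6 h}"
  have ro: "reg z' 6 = 1" "reg z' 7 = 0" "arr z' 6 = arr z 6" if "?R z'" for z'
    using only_reg[OF that] only_arr[OF that] envD[OF env] by simp_all
  show ?thesis unfolding CERTP_def tCERT_def
  proof (rule runs_Seq)
    show "runs f cert_pre z (?I 0) (len cert_pre)"
      by (rule runs_loop_free) (use envD[OF env] in \<open>simp_all add: cert_pre_def\<close>)
  next
    fix z1 assume z1: "?I 0 z1"
    show "runs f (Seq (WhileLess 22 25 cert_body) cert_fin) z1 (\<lambda>z'. only ({15} \<union> {20..<65}) {} z z' \<and>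
     reg z' 15 = (if card {h. h < K \<and> d * N \<le> arr z 6 h} = 1 then 1 else 0)) ((K * Suc (len cert_body) + 1) + len cert_fin)"
    proof (rule runs_Seq)
      show "runs f (WhileLess 22 25 cert_body) z1 (?I K) (K * Suc (len cert_body) + 1)"
      proof (rule runs_for_const[where I = ?I])
        fix k z2 assume k: "k < K" and I: "?I k z2"
        have R2: "?R z2" using I by blast
        have "{h. h < Suc k \<and> d * N \<le> arr z 6 h} = (if d * N \<le> arr z 6 k then insert k {h. h < k \<and> d * N \<le> arr z 6 h} else {h. h < k \<and> d * N \<le> arr z 6 h})"
          by (auto simp: less_Suc_eq)
        then have c: "card {h. h < Suc k \<and> d * N \<le> arr z 6 h} = (if arr z 6 k < d * N then card {h. h < k \<and> d * N \<le> arr z 6 h} else Suc (card {h. h < k \<and> d * N \<le> arr z 6 h}))"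
          by simp
        have "runs f cert_body z2 (?I (Suc k)) (len cert_body)"
        proof (rule runs_loop_free)
          show "?I (Suc k) (ev f cert_body z2)" using I ro[OF R2] c by (simp add: cert_body_def ev_cert_test)
        qed (simp_all add: cert_body_def cert_test_def)
        then show "reg z2 22 < reg z2 25 \<and> runs f cert_body z2 (?I (Suc k)) (len cert_body)" using I k by simp
      next
        fix z2 assume I: "?I K z2"
        then have "\<not> reg z2 22 < reg z2 25" by simp
        then show "\<not> reg z2 22 < reg z2 25 \<and> ?I K z2" using I by blast
      qed (rule z1)
    next
      fix z2 assume I: "?I K z2"
      have R2: "?R z2" using I by blast
      have R2': "only ({15} \<union> {20..<65}) {} z z2" by (rule only_mono[OF R2]) auto
      have e: "ev f cert_fin z2 = set_reg 15 (if reg z2 21 = 1 then 1 else 0) z2"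
        unfolding cert_fin_def using ro[OF R2] by (auto simp: set_reg_def)
      show "runs f cert_fin z2 (\<lambda>z'. only ({15} \<union> {20..<65}) {} z z' \<and>
         reg z' 15 = (if card {h. h < K \<and> d * N \<le> arr z 6 h} = 1 then 1 else 0)) (len cert_fin)"
      proof (rule runs_loop_free)
        have "reg z2 21 = card {h. h < K \<and> d * N \<le> arr z 6 h}" using I by blast
        then show "only ({15} \<union> {20..<65}) {} z (ev f cert_fin z2) \<and>
         reg (ev f cert_fin z2) 15 = (if card {h. h < K \<and> d * N \<le> arr z 6 h} = 1 then 1 else 0)"
          unfolding e using R2' by simp
      qed (simp_all add: cert_fin_def)
    qed
  qed
qed


section \<open>Initialization and output\<close>

abbreviation Kc :: nat where "Kc \<equiv> 6 * d + 2 * K"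

text \<open>A copy has to look like the initial memory of \<open>S\<close>: its parameters in
  registers 0, 1, 2 and zeros elsewhere.\<close>

definition CPY :: "nat \<Rightarrow> com" where
  "CPY k = Seq (Add (rn k 0) 0 7) (Seq (Add (rn k 1) 8 7) (Add (rn k 2) 9 7))"

primrec CPS :: "nat \<Rightarrow> com" where
  "CPS 0 = Skip"
| "CPS (Suc k) = Seq (CPS k) (CPY k)"

definition CR :: "nat \<Rightarrow> nat set" where "CR c = (\<Union>k<c. range (rn k))"

lemma own_CR [simp]: "x < 65 \<Longrightarrow> x \<notin> CR c"
  by (auto simp: CR_def)

lemma runs_CPS:
  assumes r: "reg z 0 = n" "reg z 7 = 0" "reg z 8 = N" "reg z 9 = alphabet S"
    and cpz: "\<And>k. cp k z = \<lparr>reg = \<lambda>_. 0, arr = \<lambda>_ _. 0\<rparr>"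
  shows "runs f (CPS c) z (\<lambda>z'. only (CR c) {} z z' \<and> (\<forall>k<c. cp k z' = z0)) (1 + 3 * c)"
proof (induction c)
  case 0
  show ?case by (rule runs_loop_free) simp_all
next
  case (Suc c)
  have "runs f (CPS (Suc c)) z (\<lambda>z'. only (CR (Suc c)) {} z z' \<and> (\<forall>k<Suc c. cp k z' = z0)) ((1 + 3 * c) + 3)"
    unfolding CPS.simps
  proof (rule runs_Seq[OF Suc])
    fix z1 assume z1: "only (CR c) {} z z1 \<and> (\<forall>k<c. cp k z1 = z0)"
    have o1: "only (CR c) {} z z1" using z1 by blast
    have r1: "reg z1 0 = n" "reg z1 7 = 0" "reg z1 8 = N" "reg z1 9 = alphabet S"
      using only_reg[OF o1] r by simp_all
    have c1: "cp c z1 = \<lparr>reg = \<lambda>_. 0, arr = \<lambda>_ _. 0\<rparr>"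
    proof -
      have "cp c z1 = cp c z" by (rule only_cp[OF o1]) (auto simp: CR_def)
      then show ?thesis using cpz by simp
    qed
    define z2 where "z2 = ev f (CPY c) z1"
    have z2: "z2 = set_reg (rn c 2) (alphabet S) (set_reg (rn c 1) N (set_reg (rn c 0) n z1))"
      unfolding z2_def CPY_def using r1 by simp
    have o12: "only (range (rn c)) {} z1 z2" unfolding z2 by simp
    have o2: "only (CR (Suc c)) {} z z2"
      by (rule only_trans[OF o1 o12]) (auto simp: CR_def less_Suc_eq)
    have "cp c z2 = z0"
    proof -
      have "cp c z2 = set_reg 2 (alphabet S) (set_reg 1 N (set_reg 0 n (cp c z1)))" unfolding z2 by simp
      then show ?thesis unfolding c1 by (simp add: initial_state_def set_reg_def)
    qed
    moreover have "cp k z2 = cp k z1" if "k < c" for k by (rule only_cp[OF o12]) (use that in auto)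
    ultimately have "\<forall>k<Suc c. cp k z2 = z0" using z1 by (auto simp: less_Suc_eq)
    then have "only (CR (Suc c)) {} z (ev f (CPY c) z1) \<and> (\<forall>k<Suc c. cp k (ev f (CPY c) z1) = z0)"
      using o2 unfolding z2_def by blast
    then show "runs f (CPY c) z1 (\<lambda>z'. only (CR (Suc c)) {} z z' \<and> (\<forall>k<Suc c. cp k z' = z0)) 3"
      by (intro runs_loop_free) (simp_all only: CPY_def, simp_all)
  qed
  then show ?case by simp
qed

definition init1 :: com where "init1 = Seq (Const 6 1) (Seq (Const 17 1) (Add 20 1 7))"
definition init2 :: com where "init2 = Seq (Add 8 22 7) (Add 20 2 7)"
definition bmax :: com where "bmax = IfLess 30 8 (Add 30 8 7) Skip"
definition init3 :: com where
  "init3 = Seq (Add 9 22 7) (Seq (Add 30 0 7) (Seq (dblc 30 q) (Seq bmax (Const 10 1))))"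
definition sq_body :: com where "sq_body = Seq (Add 12 12 11) (Seq (Add 12 12 11) (Seq (Add 12 12 6) (Add 11 11 6)))"
definition row_body :: com where "row_body = Seq (Store 10 31 32) (Seq (Add 32 32 11) (Add 31 31 6))"

text \<open>The memory provides only the parameters of the new scheme, so \<open>N\<close> and the
  alphabet size of \<open>S\<close> are recovered by division. Doubling finds
  \<open>2 ^ kap\<close>, and \<open>m\<close> is found by counting up with
  \<open>(c + 1)\<^sup>2 = c\<^sup>2 + 2 c + 1\<close>.\<close>

definition INIT :: com where
  "INIT = Seq init1 (Seq (divc (7 * d)) (Seq init2 (Seq (divc Zs) (Seq init3
     (Seq (WhileLess 10 30 (Add 10 10 10)) (Seq (Seq (Const 11 0) (Const 12 0)) (Seq (WhileLess 12 10 sq_body)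
     (Seq (Seq (Const 31 0) (Const 32 0)) (Seq (WhileLess 31 11 row_body) (CPS Kc))))))))))"

definition cINIT :: nat where
  "cINIT = 3 + (21 * d + 4) + 2 + (3 * (Zs * \<sigma>) + 4) + len init3 + 3 + 2 + 6 + 2 + 5 + (1 + 3 * Kc)"

definition IR :: "nat set" where "IR = {6, 8, 9, 10, 11, 12, 17} \<union> {20..<65}"

lemma runs_INIT:
  assumes z: "z = initial_state n S'"
  shows "runs f INIT z (\<lambda>z'. only (IR \<union> CR Kc) {10} z z' \<and> env z' \<and> reg z' 17 = 1 \<and> (\<forall>k<Kc. cp k z' = z0)) (cINIT * E)"
proof -
  let ?Q = "\<lambda>z'. only (IR \<union> CR Kc) {10} z z' \<and> env z' \<and> reg z' 17 = 1 \<and> (\<forall>k<Kc. cp k z' = z0)"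
  have zr: "reg z 0 = n" "reg z 1 = 7 * d * N" "reg z 2 = Zs * alphabet S" "reg z 7 = 0"
    using z by (simp_all add: initial_state_def)
  have cpz: "cp k z = \<lparr>reg = \<lambda>_. 0, arr = \<lambda>_ _. 0\<rparr>" for k
    unfolding z cp_def initial_state_def by simp
  have IR: "x \<in> IR" if "x \<in> {20..<65}" for x using that by (simp add: IR_def)
  have Za: "Zs * alphabet S \<le> Zs * \<sigma>" by (rule mult_left_mono[OF alph]) simp
  let ?B = "max N (2 ^ q * n)"
  let ?R = "only IR {10} z"
  let ?P1 = "\<lambda>z'. ?R z' \<and> reg z' 6 = 1 \<and> reg z' 17 = 1"
  let ?P2 = "\<lambda>z'. ?P1 z' \<and> reg z' 8 = N"
  let ?P3 = "\<lambda>z'. ?P2 z' \<and> reg z' 9 = alphabet S"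
  let ?P4 = "\<lambda>z'. ?P3 z' \<and> reg z' 10 = 2 ^ kap"
  let ?P5 = "\<lambda>z'. ?P4 z' \<and> reg z' 11 = m \<and> reg z' 12 = m * m"
  have r7: "reg z' 7 = 0" "reg z' 0 = n" "reg z' 2 = Zs * alphabet S" if "?R z'" for z'
    using only_reg[OF that] zr by (simp_all add: IR_def)
  have Rt: "?R z2" if "?R z1" "only {20..<24} {} z1 z2" for z1 z2
    by (rule only_trans[OF that]) (auto simp: IR_def)
  have "runs f INIT z ?Q (3 + ((3 * (7 * d * N) + 4) + (2 + ((3 * (Zs * \<sigma>) + 4) + (len init3 +
     ((E * 2 + 1) + (2 + ((E * 5 + 1) + (2 + ((m * 4 + 1) + (1 + 3 * Kc)))))))))))"
    unfolding INIT_def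
  proof (rule runs_Seq)
    show "runs f init1 z (\<lambda>z1. ?P1 z1 \<and> reg z1 20 = 7 * d * N) 3"
      by (rule runs_loop_free) (use zr in \<open>simp_all add: init1_def IR_def\<close>)
  next
    fix z1 assume z1: "?P1 z1 \<and> reg z1 20 = 7 * d * N"
    have le1: "3 * reg z1 20 + 4 \<le> 3 * (7 * d * N) + 4" using z1 by simp
    show "runs f (Seq (divc (7 * d)) (Seq init2 (Seq (divc Zs) (Seq init3
     (Seq (WhileLess 10 30 (Add 10 10 10)) (Seq (Seq (Const 11 0) (Const 12 0)) (Seq (WhileLess 12 10 sq_body)
     (Seq (Seq (Const 31 0) (Const 32 0)) (Seq (WhileLess 31 11 row_body) (CPS Kc)))))))))) z1 ?Q
     ((3 * (7 * d * N) + 4) + (2 + ((3 * (Zs * \<sigma>) + 4) + (len init3 +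
     ((E * 2 + 1) + (2 + ((E * 5 + 1) + (2 + ((m * 4 + 1) + (1 + 3 * Kc))))))))))"
    proof (rule runs_Seq[OF runs_time[OF runs_divc le1]])
      show "reg z1 6 = 1" using z1 by blast
      show "0 < 7 * d" using d_pos by simp
      fix z2 assume z2: "only {20..<24} {} z1 z2 \<and> reg z2 20 = reg z1 20 mod (7 * d) \<and> reg z2 22 = reg z1 20 div (7 * d)"
      have o2: "only {20..<24} {} z1 z2" using z2 by blast
      have P2: "?P1 z2" using Rt[OF _ o2] z1 only_reg[OF o2, of 6] only_reg[OF o2, of 17] by simp
      have v2: "reg z2 22 = N" using z2 z1 d_pos by simp
      show "runs f (Seq init2 (Seq (divc Zs) (Seq init3
         (Seq (WhileLess 10 30 (Add 10 10 10)) (Seq (Seq (Const 11 0) (Const 12 0)) (Seq (WhileLess 12 10 sq_body)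
         (Seq (Seq (Const 31 0) (Const 32 0)) (Seq (WhileLess 31 11 row_body) (CPS Kc))))))))) z2 ?Q
         (2 + ((3 * (Zs * \<sigma>) + 4) + (len init3 +
         ((E * 2 + 1) + (2 + ((E * 5 + 1) + (2 + ((m * 4 + 1) + (1 + 3 * Kc)))))))))"
      proof (rule runs_Seq)
        show "runs f init2 z2 (\<lambda>z3. ?P2 z3 \<and> reg z3 20 = Zs * alphabet S) 2"
          by (rule runs_loop_free) (use P2 v2 r7[of z2] in \<open>simp_all add: init2_def IR_def\<close>)
      next
        fix z3 assume z3: "?P2 z3 \<and> reg z3 20 = Zs * alphabet S"
        have le3: "3 * reg z3 20 + 4 \<le> 3 * (Zs * \<sigma>) + 4" using z3 Za by simp
        show "runs f (Seq (divc Zs) (Seq init3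
           (Seq (WhileLess 10 30 (Add 10 10 10)) (Seq (Seq (Const 11 0) (Const 12 0)) (Seq (WhileLess 12 10 sq_body)
           (Seq (Seq (Const 31 0) (Const 32 0)) (Seq (WhileLess 31 11 row_body) (CPS Kc)))))))) z3 ?Q
           ((3 * (Zs * \<sigma>) + 4) + (len init3 +
           ((E * 2 + 1) + (2 + ((E * 5 + 1) + (2 + ((m * 4 + 1) + (1 + 3 * Kc))))))))"
        proof (rule runs_Seq[OF runs_time[OF runs_divc le3]])
          show "reg z3 6 = 1" using z3 by blast
          show "0 < Zs" by simp
          fix z4 assume z4: "only {20..<24} {} z3 z4 \<and> reg z4 20 = reg z3 20 mod Zs \<and> reg z4 22 = reg z3 20 div Zs"
          have o4: "only {20..<24} {} z3 z4" using z4 by blast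
          have P4: "?P2 z4" using Rt[OF _ o4] z3 only_reg[OF o4, of 6] only_reg[OF o4, of 17] only_reg[OF o4, of 8] by simp
          have v4: "reg z4 22 = alphabet S" using z4 z3 by simp
          have evb: "ev f bmax z' = set_reg 30 (if reg z' 30 < reg z' 8 then reg z' 8 + reg z' 7 else reg z' 30) z'" for z'
            by (simp add: bmax_def)
          show "runs f (Seq init3 (Seq (WhileLess 10 30 (Add 10 10 10)) (Seq (Seq (Const 11 0) (Const 12 0)) (Seq (WhileLess 12 10 sq_body)
             (Seq (Seq (Const 31 0) (Const 32 0)) (Seq (WhileLess 31 11 row_body) (CPS Kc))))))) z4 ?Q
             (len init3 + ((E * 2 + 1) + (2 + ((E * 5 + 1) + (2 + ((m * 4 + 1) + (1 + 3 * Kc)))))))"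
          proof (rule runs_Seq)
            show "runs f init3 z4 (\<lambda>z5. ?P3 z5 \<and> reg z5 30 = ?B \<and> reg z5 10 = 1) (len init3)"
            proof (rule runs_loop_free)
              show "?P3 (ev f init3 z4) \<and> reg (ev f init3 z4) 30 = ?B \<and> reg (ev f init3 z4) 10 = 1"
                using P4 v4 r7[of z4] by (simp add: init3_def evb IR_def max_def)
            qed (simp_all add: init3_def bmax_def)
          next
            fix z5 assume z5: "?P3 z5 \<and> reg z5 30 = ?B \<and> reg z5 10 = 1"
            let ?I = "\<lambda>z'. ?P3 z' \<and> reg z' 30 = ?B \<and> (\<exists>k\<le>kap. reg z' 10 = 2 ^ k)"
            have I5: "?I z5" using z5 by (auto intro!: exI[of _ 0])
            have BE: "?B \<le> 2 ^ kap" using kap_ge by simp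
            have w1: "runs f (WhileLess 10 30 (Add 10 10 10)) z5 ?P4 ((reg z5 30 - reg z5 10) * Suc 1 + 1)"
            proof (rule runs_while[where I = ?I and m = "\<lambda>z. reg z 30 - reg z 10"])
              fix z' assume I: "?I z'" and lt: "reg z' 10 < reg z' 30"
              then obtain k where k: "k \<le> kap" "reg z' 10 = 2 ^ k" by blast
              have "k \<noteq> kap" using lt k BE I by auto
              then have k': "Suc k \<le> kap" using k by simp
              have dec: "?B - (reg z' 10 + reg z' 10) < ?B - reg z' 10"
                by (rule diff_less_mono2) (use lt k(2) I in simp_all)
              have "?I (ev f (Add 10 10 10) z') \<and> reg (ev f (Add 10 10 10) z') 30 - reg (ev f (Add 10 10 10) z') 10 < reg z' 30 - reg z' 10"
                using I dec by (simp add: IR_def) (use k(2) k' in \<open>auto simp: mult_2 intro!: exI[of _ "Suc k"]\<close>)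
              note fact = this
              show "runs f (Add 10 10 10) z' (\<lambda>z''. ?I z'' \<and> reg z'' 30 - reg z'' 10 < reg z' 30 - reg z' 10) 1"
                by (rule runs_loop_free) (simp, rule fact, simp)
            next
              fix z' assume I: "?I z'" and ge: "\<not> reg z' 10 < reg z' 30"
              then obtain k where k: "k \<le> kap" "reg z' 10 = 2 ^ k" by blast
              have "reg z' 30 = ?B" using I by blast
              then have "?B \<le> 2 ^ k" using ge k(2) by linarith
              then have "kap \<le> k" unfolding kap_def by (rule Least_le)
              then show "?P4 z'" using I k by simp
            qed (rule I5)
            have "reg z5 30 = ?B" using z5 by blast
            then have "reg z5 30 \<le> E" using BE E_ge(6) by linarith
            then have "reg z5 30 - reg z5 10 \<le> E" by linarith
            then have "(reg z5 30 - reg z5 10) * Suc 1 + 1 \<le> E * 2 + 1" by simp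
            note w1' = runs_time[OF w1 this]
            show "runs f (Seq (WhileLess 10 30 (Add 10 10 10)) (Seq (Seq (Const 11 0) (Const 12 0)) (Seq (WhileLess 12 10 sq_body)
             (Seq (Seq (Const 31 0) (Const 32 0)) (Seq (WhileLess 31 11 row_body) (CPS Kc)))))) z5 ?Q
             ((E * 2 + 1) + (2 + ((E * 5 + 1) + (2 + ((m * 4 + 1) + (1 + 3 * Kc))))))"
            proof (rule runs_Seq[OF w1'])
              fix z6 assume z6: "?P4 z6"
              show "runs f (Seq (Seq (Const 11 0) (Const 12 0)) (Seq (WhileLess 12 10 sq_body)
                 (Seq (Seq (Const 31 0) (Const 32 0)) (Seq (WhileLess 31 11 row_body) (CPS Kc))))) z6 ?Q
                 (2 + ((E * 5 + 1) + (2 + ((m * 4 + 1) + (1 + 3 * Kc)))))"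
              proof (rule runs_Seq)
                show "runs f (Seq (Const 11 0) (Const 12 0)) z6 (\<lambda>z7. ?P4 z7 \<and> reg z7 11 = 0 \<and> reg z7 12 = 0) 2"
                  by (rule runs_loop_free) (use z6 in \<open>simp_all add: IR_def\<close>)
              next
                fix z7 assume z7: "?P4 z7 \<and> reg z7 11 = 0 \<and> reg z7 12 = 0"
                let ?J = "\<lambda>z'. ?P4 z' \<and> reg z' 11 \<le> m \<and> reg z' 12 = reg z' 11 * reg z' 11"
                \<comment> \<open>Each pass raises the square by at least 1, so there are at most
                  \<open>2 ^ kap\<close> passes; this crude bound is good enough for a cost linear
                  in \<open>E\<close>.\<close>
                have w2: "runs f (WhileLess 12 10 sq_body) z7 ?P5 ((2 ^ kap - reg z7 12) * Suc 4 + 1)"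
                proof (rule runs_while[where I = ?J and m = "\<lambda>z. 2 ^ kap - reg z 12"])
                  fix z' assume J: "?J z'" and lt: "reg z' 12 < reg z' 10"
                  define c where "c = reg z' 11"
                  have c: "reg z' 11 = c" "reg z' 12 = c * c" "c \<le> m" "c * c < 2 ^ kap" using J lt by (simp_all add: c_def)
                  have "c \<noteq> m" using c m_ge by auto
                  then have cm: "Suc c \<le> m" using c by simp
                  have "?J (ev f sq_body z') \<and> 2 ^ kap - reg (ev f sq_body z') 12 < 2 ^ kap - reg z' 12"
                    using J c cm by (simp add: sq_body_def IR_def)
                  note fact = this
                  show "runs f sq_body z' (\<lambda>z''. ?J z'' \<and> 2 ^ kap - reg z'' 12 < 2 ^ kap - reg z' 12) 4"
                    by (rule runs_loop_free) (simp add: sq_body_def, rule fact, simp add: sq_body_def)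
                next
                  fix z' assume J: "?J z'" and ge: "\<not> reg z' 12 < reg z' 10"
                  then have "2 ^ kap \<le> reg z' 11 * reg z' 11" by simp
                  then have "m \<le> reg z' 11" unfolding m_def by (rule Least_le)
                  then have "reg z' 11 = m" using J by simp
                  then show "?P5 z'" using J by simp
                qed (use z7 in simp)
                have "(2 ^ kap - reg z7 12) * Suc 4 + 1 \<le> E * 5 + 1" using E_ge(6) by simp
                note w2' = runs_time[OF w2 this]
                show "runs f (Seq (WhileLess 12 10 sq_body) (Seq (Seq (Const 31 0) (Const 32 0)) (Seq (WhileLess 31 11 row_body) (CPS Kc)))) z7 ?Q
                   ((E * 5 + 1) + (2 + ((m * 4 + 1) + (1 + 3 * Kc))))"
                proof (rule runs_Seq[OF w2'])
                  fix z8 assume z8: "?P5 z8"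
                  show "runs f (Seq (Seq (Const 31 0) (Const 32 0)) (Seq (WhileLess 31 11 row_body) (CPS Kc))) z8 ?Q
                     (2 + ((m * 4 + 1) + (1 + 3 * Kc)))"
                  proof (rule runs_Seq)
                    show "runs f (Seq (Const 31 0) (Const 32 0)) z8 (\<lambda>z9. ?P5 z9 \<and> reg z9 31 = 0 \<and> reg z9 32 = 0) 2"
                      by (rule runs_loop_free) (use z8 in \<open>simp_all add: IR_def\<close>)
                  next
                    fix z9 assume z9: "?P5 z9 \<and> reg z9 31 = 0 \<and> reg z9 32 = 0"
                    let ?L = "\<lambda>k z'. ?P5 z' \<and> reg z' 31 = k \<and> reg z' 32 = k * m \<and> (\<forall>i<k. arr z' 10 i = i * m)"
                    show "runs f (Seq (WhileLess 31 11 row_body) (CPS Kc)) z9 ?Q ((m * 4 + 1) + (1 + 3 * Kc))"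
                    proof (rule runs_Seq)
                      have "runs f (WhileLess 31 11 row_body) z9 (?L m) (m * Suc 3 + 1)"
                      proof (rule runs_for_const[where I = ?L])
                        fix k z' assume k: "k < m" and L: "?L k z'"
                        have "?L (Suc k) (ev f row_body z')" using L by (simp add: row_body_def IR_def less_Suc_eq)
                        note fact = this
                        have "runs f row_body z' (?L (Suc k)) 3"
                          by (rule runs_loop_free) (simp add: row_body_def, rule fact, simp add: row_body_def)
                        then show "reg z' 31 < reg z' 11 \<and> runs f row_body z' (?L (Suc k)) 3" using L k by simp
                      next
                        fix z' assume L: "?L m z'"
                        then have "\<not> reg z' 31 < reg z' 11" by simp
                        then show "\<not> reg z' 31 < reg z' 11 \<and> ?L m z'" using L by blast
                      qed (use z9 in simp)
                      then show "runs f (WhileLess 31 11 row_body) z9 (?L m) (m * 4 + 1)" by simp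
                    next
                      fix zb assume L: "?L m zb"
                      have Rb: "?R zb" using L by blast
                      have cpb: "cp k zb = \<lparr>reg = \<lambda>_. 0, arr = \<lambda>_ _. 0\<rparr>" for k
                        using only_cp[OF Rb, of k] cpz[of k] by (simp add: IR_def)
                      have "runs f (CPS Kc) zb (\<lambda>z'. only (CR Kc) {} zb z' \<and> (\<forall>k<Kc. cp k z' = z0)) (1 + 3 * Kc)"
                        by (rule runs_CPS) (use L r7[OF Rb] cpb in simp_all)
                      then show "runs f (CPS Kc) zb ?Q (1 + 3 * Kc)"
                      proof (rule runs_mono)
                        fix zc assume zc: "only (CR Kc) {} zb zc \<and> (\<forall>k<Kc. cp k zc = z0)"
                        have oc: "only (CR Kc) {} zb zc" using zc by blast
                        have "only (IR \<union> CR Kc) {10} z zc" by (rule only_trans[OF Rb oc]) auto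
                        moreover have "env zb" unfolding env_def using L r7[OF Rb] by simp
                        then have "env zc" by (rule env_only[OF _ oc]) simp_all
                        moreover have "reg zc 17 = 1" using only_reg[OF oc, of 17] L by simp
                        ultimately show "?Q zc" using zc by blast
                      qed simp
                    qed
                  qed
                qed
              qed
            qed
          qed
        qed
      qed
    qed
  qed
  moreover have "3 + ((3 * (7 * d * N) + 4) + (2 + ((3 * (Zs * \<sigma>) + 4) + (len init3 +
     ((E * 2 + 1) + (2 + ((E * 5 + 1) + (2 + ((m * 4 + 1) + (1 + 3 * Kc)))))))))) \<le> cINIT * E"
  proof -
    have "m * 1 \<le> m * m" using m_pos by (intro mult_left_mono) auto
    then have "m \<le> E" using E_ge(2) by linarith
    moreover have "3 * (7 * d * N) \<le> 21 * d * E" using E_ge(4) by simp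
    moreover have "3 + 4 + 2 + (3 * (Zs * \<sigma>) + 4) + len init3 + 7 + (1 + 3 * Kc) \<le> (3 + 4 + 2 + (3 * (Zs * \<sigma>) + 4) + len init3 + 7 + (1 + 3 * Kc)) * E"
      by (rule time_const)
    ultimately show ?thesis unfolding cINIT_def add_mult_distrib by linarith
  qed
  ultimately show ?thesis by (rule runs_time)
qed

definition out_sel :: com where
  "out_sel = IfLess 7 15 (Seq (Const 23 0) (addn 23 8 d)) (Seq (Const 23 0) (addn 23 8 (2 * d)))"
definition out_pre :: com where
  "out_pre = Seq out_sel (Seq (Const 22 0) (Seq (Const 25 K) (Seq (Const 26 0) (Const 5 0))))"
text \<open>A hit sets the bound in register 25 to 0, which ends the search at the least index;
  register 26 then holds the position of the transcript in array 2.\<close>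

definition out_body :: com where
  "out_body = Seq (Load 24 6 22) (IfLess 24 23 (Seq (Add 22 22 6) (Add 26 26 0)) (Seq (Const 5 1) (Const 25 0)))"
definition copy_body :: com where
  "copy_body = Seq (Add 31 26 30) (Seq (Load 32 2 31) (Seq (Store 0 30 32) (Add 30 30 6)))"
definition OUT :: com where
  "OUT = Seq out_pre (Seq (WhileLess 22 25 out_body) (IfLess 7 5 (Seq (Const 30 0) (WhileLess 30 0 copy_body)) Skip))"

definition cOUT :: nat where "cOUT = len out_pre + (K * Suc (len out_body) + 1) + 8"

lemma runs_OUT:
  assumes env: "env z" and c: "reg z 15 = (if b then 1 else 0)"
    and th: "\<theta> = (if b then d * N else 2 * d * N)"
    and x: "\<And>h. h < K \<Longrightarrow> \<theta> \<le> arr z 6 h \<Longrightarrow> length (X h) = n \<and> (\<forall>i<n. arr z 2 (h * n + i) = X h ! i)"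
  shows "runs f OUT z (\<lambda>z'. stored_lists n z' =
     (if \<exists>h. h < K \<and> \<theta> \<le> arr z 6 h then [X (LEAST h. h < K \<and> \<theta> \<le> arr z 6 h)] else [])) (cOUT * E)"
proof -
  let ?P = "\<lambda>h. h < K \<and> \<theta> \<le> arr z 6 h"
  let ?R = "only ({5} \<union> {20..<65}) {} z"
  let ?Q = "\<lambda>z'. stored_lists n z' = (if \<exists>h. ?P h then [X (LEAST h. ?P h)] else [])"
  let ?I = "\<lambda>z'. ?R z' \<and> reg z' 23 = \<theta> \<and> reg z' 26 = reg z' 22 * n \<and> (\<forall>h<reg z' 22. \<not> ?P h) \<and> reg z' 22 \<le> K \<and>
    (reg z' 5 = 0 \<and> reg z' 25 = K \<or> reg z' 5 = 1 \<and> reg z' 25 = 0 \<and> ?P (reg z' 22))"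
  have ro: "reg z' 0 = n" "reg z' 6 = 1" "reg z' 7 = 0" "arr z' = arr z" if "?R z'" for z'
  proof -
    show "arr z' = arr z" by (rule ext) (use only_arr[OF that] in simp)
  qed (use only_reg[OF that] envD[OF env] in simp_all)
  have "runs f OUT z ?Q (len out_pre + ((K * Suc (len out_body) + 1) + Suc (1 + (n * Suc 4 + 1))))"
    unfolding OUT_def
  proof (rule runs_Seq)
    have es: "ev f out_sel z = set_reg 23 \<theta> z"
      using c envD[OF env] by (simp add: out_sel_def th)
    show "runs f out_pre z (\<lambda>z1. ?I z1 \<and> reg z1 25 - reg z1 22 = K) (len out_pre)"
    proof (rule runs_loop_free)
      show "?I (ev f out_pre z) \<and> reg (ev f out_pre z) 25 - reg (ev f out_pre z) 22 = K"
        by (simp add: out_pre_def es)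
    qed (simp_all add: out_pre_def out_sel_def)
  next
    fix z1 assume z1: "?I z1 \<and> reg z1 25 - reg z1 22 = K"
    have w: "runs f (WhileLess 22 25 out_body) z1 (\<lambda>z'. ?R z' \<and> (if \<exists>h. ?P h then reg z' 5 = 1 \<and> reg z' 26 = (LEAST h. ?P h) * n else reg z' 5 = 0))
      ((reg z1 25 - reg z1 22) * Suc (len out_body) + 1)"
    proof (rule runs_while[where I = ?I and m = "\<lambda>z. reg z 25 - reg z 22"])
      fix z' assume I: "?I z'" and lt: "reg z' 22 < reg z' 25"
      then have R': "?R z'" and k: "reg z' 25 = K" "reg z' 5 = 0" "reg z' 22 < K" by auto
      define h where "h = reg z' 22"
      have hh: "reg z' 22 = h" "reg z' 26 = h * n" "\<forall>h'<h. \<not> ?P h'" "h < K" using I k by (simp_all add: h_def)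
      have "?I (ev f out_body z') \<and> reg (ev f out_body z') 25 - reg (ev f out_body z') 22 < reg z' 25 - reg z' 22"
      proof (cases "arr z 6 h < \<theta>")
        case True
        then show ?thesis using I hh k ro[OF R'] R' by (simp add: out_body_def less_Suc_eq)
      next
        case False
        then show ?thesis using I hh k ro[OF R'] R' by (simp add: out_body_def)
      qed
      note fact = this
      show "runs f out_body z' (\<lambda>z''. ?I z'' \<and> reg z'' 25 - reg z'' 22 < reg z' 25 - reg z' 22) (len out_body)"
        by (rule runs_loop_free) (simp add: out_body_def, rule fact, simp)
    next
      fix z' assume I: "?I z'" and ge: "\<not> reg z' 22 < reg z' 25"
      show "?R z' \<and> (if \<exists>h. ?P h then reg z' 5 = 1 \<and> reg z' 26 = (LEAST h. ?P h) * n else reg z' 5 = 0)"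
      proof (cases "reg z' 5 = 0")
        case True
        then have "reg z' 22 = K" using I ge by auto
        then have "\<not> (\<exists>h. ?P h)" using I by auto
        then show ?thesis using I True by simp
      next
        case False
        then have P: "?P (reg z' 22)" "reg z' 5 = 1" using I by auto
        then have "(LEAST h. ?P h) = reg z' 22" using I by (intro Least_equality) (auto simp: not_le[symmetric])
        then show ?thesis using I P by auto
      qed
    qed (use z1 in blast)
    have e: "reg z1 25 - reg z1 22 = K" using z1 by blast
    show "runs f (Seq (WhileLess 22 25 out_body) (IfLess 7 5 (Seq (Const 30 0) (WhileLess 30 0 copy_body)) Skip)) z1 ?Q
      ((K * Suc (len out_body) + 1) + Suc (1 + (n * Suc 4 + 1)))"
    proof (rule runs_Seq[OF w[unfolded e]])
      fix z2 assume z2: "?R z2 \<and> (if \<exists>h. ?P h then reg z2 5 = 1 \<and> reg z2 26 = (LEAST h. ?P h) * n else reg z2 5 = 0)"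
      have R2: "?R z2" using z2 by blast
      show "runs f (IfLess 7 5 (Seq (Const 30 0) (WhileLess 30 0 copy_body)) Skip) z2 ?Q (Suc (1 + (n * Suc 4 + 1)))"
      proof (rule runs_If)
        assume "reg z2 7 < reg z2 5"
        then have ex: "\<exists>h. ?P h" using z2 ro(3)[OF R2] by (auto split: if_splits)
        define h where "h = (LEAST h. ?P h)"
        have ph: "?P h" unfolding h_def using ex by (rule LeastI_ex)
        have r2: "reg z2 5 = 1" "reg z2 26 = h * n" using z2 ex by (simp_all add: h_def)
        have xh: "length (X h) = n" "\<forall>i<n. arr z 2 (h * n + i) = X h ! i" using x ph by blast+
        let ?L = "\<lambda>k z'. only {30..<33} {0} z2 z' \<and> reg z' 30 = k \<and> (\<forall>i<k. arr z' 0 i = X h ! i)"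
        show "runs f (Seq (Const 30 0) (WhileLess 30 0 copy_body)) z2 ?Q (1 + (n * Suc 4 + 1))"
        proof (rule runs_Seq)
          show "runs f (Const 30 0) z2 (?L 0) 1" by (rule runs_loop_free) simp_all
        next
          fix z3 assume z3: "?L 0 z3"
          show "runs f (WhileLess 30 0 copy_body) z3 ?Q (n * Suc 4 + 1)"
          proof (rule runs_for_const[where I = ?L])
            fix k z4 assume k: "k < n" and L: "?L k z4"
            have o4: "only {30..<33} {0} z2 z4" using L by blast
            have r4: "reg z4 0 = n" "reg z4 6 = 1" "reg z4 26 = h * n" "arr z4 2 = arr z 2"
              using only_reg[OF o4] only_arr[OF o4, of 2] ro[OF R2] r2 by simp_all
            have "?L (Suc k) (ev f copy_body z4)" using L r4 xh(2) k by (simp add: copy_body_def less_Suc_eq)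
            note fact = this
            have "runs f copy_body z4 (?L (Suc k)) 4"
              by (rule runs_loop_free) (simp add: copy_body_def, rule fact, simp add: copy_body_def)
            then show "reg z4 30 < reg z4 0 \<and> runs f copy_body z4 (?L (Suc k)) 4" using L k r4 by simp
          next
            fix z4 assume L: "?L n z4"
            have o4: "only {30..<33} {0} z2 z4" using L by blast
            have r4: "reg z4 0 = n" "reg z4 5 = 1" using only_reg[OF o4] ro[OF R2] r2 by simp_all
            have "map (\<lambda>i. arr z4 0 i) [0..<n] = X h" by (rule nth_equalityI) (use L xh in simp_all)
            then have "stored_lists n z4 = [X h]" using r4 by (simp add: stored_lists_def)
            then show "\<not> reg z4 30 < reg z4 0 \<and> ?Q z4" using L r4 ex by (simp add: h_def)
          qed (rule z3)
        qed
      next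
        assume "\<not> reg z2 7 < reg z2 5"
        then have ex: "\<not> (\<exists>h. ?P h)" "reg z2 5 = 0" using z2 ro(3)[OF R2] by (auto split: if_splits)
        then have "?Q z2" unfolding if_not_P[OF ex(1)] by (simp add: stored_lists_def)
        then show "runs f Skip z2 ?Q (1 + (n * Suc 4 + 1))" by (intro runs_loop_free) simp_all
      qed
    qed
  qed
  moreover have "len out_pre + ((K * Suc (len out_body) + 1) + Suc (1 + (n * Suc 4 + 1))) \<le> cOUT * E"
  proof -
    have "(len out_pre + (K * Suc (len out_body) + 1) + 2) + (n * 5 + 1) \<le> cOUT * E"
      by (rule order_trans[OF time_bound[OF E_ge(3)]]) (simp add: cOUT_def add_mult_distrib)
    then show ?thesis by simp
  qed
  ultimately show ?thesis by (rule runs_time)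
qed

end

section \<open>The complete programs and their invariant\<close>

lemma sum_lessThan_add: "(\<Sum>k<a + b. F k) = (\<Sum>k<a. F k) + (\<Sum>r<b. F (a + r :: nat) :: nat)"
  by (induction b) simp_all

context machine
begin

text \<open>
  Memory layout: registers 13 and 14 hold the current block and the round in it, 15 tells whether the party is
  certain, 16 is the code of the symbol of \<open>S\<close> received last, and 17 is set after initialization; registers from
  20 on are scratch. Array 2 stores the candidate transcripts, 4 their encodings, 6 their counts, 8 which slots are
  occupied, and 10 the multiples of \<open>m\<close>. Copy \<open>j < 6 d\<close> runs \<open>S\<close> in block \<open>j\<close>; the further copies simulate the
  noise-free runs of \<open>S\<close> for the encodings.
\<close>

definition RUN :: "party \<Rightarrow> nat \<Rightarrow> com" where
  "RUN p j = Seq (Add (rn j 3) 16 7) (Seq (tr (query_copy j) j (rp p)) (Add 21 (rn j 4) 7))"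

definition BE :: "party \<Rightarrow> nat \<Rightarrow> com" where
  "BE p j = Seq (Add (rn j 3) 16 7) (Seq (tr (query_copy j) j (ou p)) (PRS j s))"

definition send_tail :: com where
  "send_tail = Seq (Sub 22 21 6) (Seq (dblc 22 (g * K)) (Seq (Add 4 22 23) (Add 4 4 6)))"

definition CA :: "party \<Rightarrow> com" where
  "CA p = Seq (Const 20 (6 * d)) (IfLess 13 20
     (Seq (disp (RUN p) (6 * d)) (IfLess 7 21 (Seq TUP send_tail) (Const 4 0)))
     (IfLess 7 15 (Seq TUP (Add 4 23 6)) (Const 4 0)))"

definition tTUP :: nat where "tTUP = 4 + (K * Suc (len tup_body) + 1)"

definition cCA :: nat where "cCA = 5 + 12 * d + tTUP + len send_tail"

definition BEND :: "party \<Rightarrow> com" where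
  "BEND p = Seq (Const 20 (6 * d)) (IfLess 13 20 (disp (BE p) (6 * d)) Skip)"

definition NEXT :: com where "NEXT = Seq (Const 16 0) (Seq (Const 14 0) (Add 13 13 6))"

text \<open>Two strict tests single out block \<open>6 * d\<close>: certainty is decided once, when
  exactly the first \<open>6 * d * N\<close> rounds have been counted.\<close>

definition CERTQ :: com where
  "CERTQ = Seq (Const 20 (6 * d)) (IfLess 13 20 Skip (IfLess 20 13 Skip CERTP))"

definition RECV :: "party \<Rightarrow> com" where
  "RECV p = Seq GET (Seq (Add 14 14 6) (IfLess 14 8 Skip (Seq (BEND p) (Seq NEXT CERTQ))))"

definition cBIG :: nat where
  "cBIG = 12 * d + 20 + tCERT + (\<Sum>j<6 * d. cPRS j s) + cINIT"

text \<open>A symbol is delivered between two calls, so a call first digests the previous round and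
  then chooses its action; the symbol of the last round is left to \<open>OP\<close>. Register 17,
  initially 0, tells the first call apart.\<close>

definition RP :: "party \<Rightarrow> com" where "RP p = Seq (IfLess 7 17 (RECV p) INIT) (CA p)"
definition OP :: "party \<Rightarrow> com" where "OP p = Seq (IfLess 7 17 (RECV p) INIT) OUT"

lemma slots_set_reg [simp]: "slots p f w b (set_reg x u z) = slots p f w b z"
  by (simp add: slots_def)

lemma env_set_reg [simp]: "x \<notin> {0, 6, 7, 8, 9, 10, 11, 12} \<Longrightarrow> env (set_reg x u z) = env z"
  by (simp add: env_def)

lemma slots_all: "slots p f w b z \<Longrightarrow> K \<le> b \<Longrightarrow> K \<le> b' \<Longrightarrow> slots p f w b' z"
  unfolding slots_def by auto

context
  fixes \<Pi> v p and st st' :: "nat \<Rightarrow> nat \<Rightarrow> state" and tm :: "nat \<Rightarrow> nat \<Rightarrow> nat" and fin tf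
  assumes pro: "protocol q n \<Pi>" and exe: "execution S' \<Pi> v"
    and ch: "\<And>j. j < 6 * d \<Longrightarrow> run_chain (\<Pi> p) (rp p) z0 (bview (v p) j) (st j) (st' j) (tm j)"
    and c4: "\<And>j r. j < 6 * d \<Longrightarrow> r < N \<Longrightarrow> reg (st' j r) 4 = action_code (action_at S \<Pi> (\<lambda>p. bview (v p) j) p r)"
    and cf: "\<And>j. j < 6 * d \<Longrightarrow> exec (\<Pi> p) (ou p) (st j N) (tf j) (fin j)"
    and co: "\<And>j. j < 6 * d \<Longrightarrow> stored_lists n (fin j) = outcome S p (\<Pi> p) (bview (v p) j)"
    and ct: "\<And>j. j < 6 * d \<Longrightarrow> (\<Sum>r<N. tm j r) + tf j \<le> TT"
begin

abbreviation (input) F :: next_message where "F \<equiv> \<Pi> p"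
abbreviation (input) V :: view where "V \<equiv> v p"

lemma length_bview: "j < 6 * d \<Longrightarrow> length (bview V j) = N"
  using executionD(1)[OF execution_block[OF exe]] .

lemma chain_step:
  assumes "j < 6 * d" "r < N"
  shows "exec F (rp p) (st j r) (tm j r) (st' j r)"
    and "st j (Suc r) = set_reg 3 (received_code (map_option (\<lambda>y. y div Zs) (V ! (j * N + r)))) (st' j r)"
proof -
  have "Suc j * N \<le> 7 * d * N" using assms by (intro mult_right_mono) auto
  then have "j * N + r < length V" using assms executionD(1)[OF exe, of p] by simp
  then have "bview V j ! r = map_option (\<lambda>y. y div Zs) (V ! (j * N + r))"
    using assms by (simp add: bview_def)
  then show "exec F (rp p) (st j r) (tm j r) (st' j r)"
    "st j (Suc r) = set_reg 3 (received_code (map_option (\<lambda>y. y div Zs) (V ! (j * N + r)))) (st' j r)"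
    using ch[OF assms(1)] length_bview[OF assms(1)] assms(2) by (simp_all add: run_chain_def)
qed

lemma chain_start: "j < 6 * d \<Longrightarrow> st j 0 = z0"
  using ch by (simp add: run_chain_def)

lemma raw_length:
  assumes "h < K" "raw p F V h = Some y"
  shows "length y = n"
proof -
  have "h div s < 6 * d" using assms(1) s_pos by (simp add: less_mult_imp_div_less)
  from stored_listsD(2)[OF co[OF this]] show ?thesis
    using assms(2) by (auto simp: raw_def Let_def split: if_splits)
qed

text \<open>\<open>J\<close> and \<open>R\<close> are the block and the round in it,
  \<open>c\<close> is the certainty flag and \<open>i\<close> the number of rounds counted.
  \<open>B\<close> is the number of blocks whose lists are processed; it is separate from
  \<open>J\<close> because it advances first when a block ends. The last clauses keep the copies
  still to be used in their initial state.\<close>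

definition inv :: "nat \<Rightarrow> nat \<Rightarrow> nat \<Rightarrow> bool \<Rightarrow> nat \<Rightarrow> state \<Rightarrow> bool" where
  "inv J B R c i z \<longleftrightarrow> env z \<and> reg z 13 = J \<and> reg z 14 = R \<and> reg z 15 = (if c then 1 else 0) \<and> reg z 17 = 1 \<and>
     (\<forall>h<K. arr z 6 h = cnt p F V i h) \<and> slots p F V (B * s) z \<and>
     (\<forall>h<K. B * s \<le> h \<longrightarrow> cp (ka h) z = z0 \<and> cp (kb h) z = z0) \<and> (\<forall>j<6 * d. J < j \<longrightarrow> cp j z = z0)"

lemma inv_only:
  assumes "inv J B R c i z" "only Q AS z z'" "{0, 6, 7, 8, 9, 10, 11, 12, 13, 14, 15, 17} \<inter> Q = {}"
    "{2, 4, 6, 8, 10} \<inter> AS = {}" "\<And>k x. J < k \<or> 6 * d \<le> k \<Longrightarrow> rn k x \<notin> Q \<and> rn k x \<notin> AS"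
  shows "inv J B R c i z'"
proof -
  have "env z'" by (rule env_only[OF _ assms(2)]) (use assms(1,3,4) in \<open>auto simp: inv_def\<close>)
  moreover have "reg z' x = reg z x" if "x \<in> {13, 14, 15, 17}" for x
    by (rule only_reg[OF assms(2)]) (use that assms(3) in auto)
  moreover have ar: "arr z' A = arr z A" if "A \<in> {2, 4, 6, 8}" for A
    by (rule only_arr[OF assms(2)]) (use that assms(4) in auto)
  moreover have cpe: "cp k z' = cp k z" if "J < k \<or> 6 * d \<le> k" for k
    by (rule only_cp[OF assms(2)]) (use assms(5)[OF that] in auto)
  moreover have "slots p F V (B * s) z'"
    by (rule slots_cong[of _ _ _ _ z]) (use assms(1) ar in \<open>simp_all add: inv_def\<close>)
  ultimately show ?thesis using assms(1) by (simp add: inv_def)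
qed

lemma inv_entry:
  assumes "inv J (i div N) (i mod N) c i' z" "h < K"
  shows "arr z 4 (h * N + i mod N) = entry p F V i h"
proof -
  have "h div s < i div N \<longleftrightarrow> h < i div N * s" using s_pos by (simp add: div_less_iff_less_mult)
  moreover have "i mod N < N" using N_pos by simp
  moreover have "slots p F V (i div N * s) z" using assms(1) by (simp add: inv_def)
  ultimately show ?thesis using assms(2) unfolding slots_def entry_def by auto
qed

definition cmn :: "nat \<Rightarrow> state \<Rightarrow> bool" where
  "cmn i z \<longleftrightarrow> inv (i div N) (i div N) (i mod N) (6 * d \<le> i div N \<and> certain p F V) i z"

text \<open>\<open>MI i\<close> holds before the action of round \<open>i\<close> is chosen,
  \<open>MC i\<close> afterwards. The last symbol for the copy waits in register 16, so the copy
  matches the chain only once that symbol is put into its register 3.\<close>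

definition MI :: "nat \<Rightarrow> state \<Rightarrow> bool" where
  "MI i z \<longleftrightarrow> cmn i z \<and> (i div N < 6 * d \<longrightarrow> set_reg 3 (reg z 16) (cp (i div N) z) = st (i div N) (i mod N))"

definition MC :: "nat \<Rightarrow> state \<Rightarrow> bool" where
  "MC i z \<longleftrightarrow> cmn i z \<and> (i div N < 6 * d \<longrightarrow> cp (i div N) z = st' (i div N) (i mod N)) \<and>
     reg z 4 = action_code (action_at S' \<Pi> v p i)"

lemma cmn_own:
  assumes "cmn i z" "only ({3, 4, 16} \<union> {20..<65}) {} z z'"
  shows "cmn i z'"
  using assms(1) unfolding cmn_def by (rule inv_only[OF _ assms(2)]) simp_all

lemma cp_own: "only ({3, 4, 16} \<union> {20..<65}) {} z z' \<Longrightarrow> cp k z' = cp k z"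
  by (erule only_cp) simp_all

lemma cmn_env: "cmn i z \<Longrightarrow> env z"
  by (simp add: cmn_def inv_def)

lemma runs_tuple:
  assumes "cmn i z"
  shows "runs F TUP z (\<lambda>z'. only {23..<28} {} z z' \<and> reg z' 23 = tuple p F V i) tTUP"
  unfolding tuple_def tTUP_def
proof (rule runs_TUP[OF cmn_env[OF assms]])
  have "reg z 14 = i mod N" using assms by (simp add: cmn_def inv_def)
  then show "arr z 4 (h * N + reg z 14) = entry p F V i h" if "h < K" for h
    using inv_entry[OF _ that] assms unfolding cmn_def by metis
qed

lemma runs_RUN:
  assumes c: "cmn i z" and J: "i div N < 6 * d"
    and cpJ: "set_reg 3 (reg z 16) (cp (i div N) z) = st (i div N) (i mod N)"
  shows "runs F (RUN p (i div N)) z (\<lambda>z'. cmn i z' \<and> cp (i div N) z' = st' (i div N) (i mod N) \<and>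
     reg z' 21 = reg (st' (i div N) (i mod N)) 4) (1 + (4 * tm (i div N) (i mod N) + 1))"
  unfolding RUN_def
proof (rule runs_Seq)
  let ?J = "i div N" and ?r = "i mod N"
  have r: "?r < N" using N_pos by simp
  have r7: "reg z 7 = 0" using envD(3)[OF cmn_env[OF c]] .
  show "runs F (Add (rn ?J 3) 16 7) z (\<lambda>z1. z1 = set_reg (rn ?J 3) (reg z 16) z) 1"
    by (rule runs_loop_free) (use r7 in simp_all)
  fix z1 assume z1: "z1 = set_reg (rn ?J 3) (reg z 16) z"
  have cp1: "cp ?J z1 = st ?J ?r" unfolding z1 using cpJ by simp
  have o1: "only (range (rn ?J)) (range (rn ?J)) z z1" unfolding z1 by simp
  show "runs F (Seq (tr (query_copy ?J) ?J (rp p)) (Add 21 (rn ?J 4) 7)) z1 (\<lambda>z'. cmn i z' \<and> cp ?J z' = st' ?J ?r \<and>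
     reg z' 21 = reg (st' ?J ?r) 4) (4 * tm ?J ?r + 1)"
  proof (rule runs_Seq[OF runs_tr_same_oracle[OF chain_step(1)[OF J r] cp1]])
    fix z2 assume z2: "cp ?J z2 = st' ?J ?r \<and> outside ?J z1 z2"
    have o2: "only (range (rn ?J)) (range (rn ?J)) z1 z2" by (rule outside_only) (use z2 in blast)
    have oz: "only (range (rn ?J)) (range (rn ?J)) z z2" by (rule only_trans[OF o1 o2]) auto
    have c2: "cmn i z2" unfolding cmn_def
      by (rule inv_only[OF c[unfolded cmn_def] oz]) (use J in \<open>auto simp: disjoint_iff\<close>)
    have r72: "reg z2 7 = 0" using envD(3)[OF cmn_env[OF c2]] .
    have "reg z2 (rn ?J 4) = reg (cp ?J z2) 4" by simp
    then have v: "reg z2 (rn ?J 4) = reg (st' ?J ?r) 4" using z2 by simp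
    have e: "ev F (Add 21 (rn ?J 4) 7) z2 = set_reg 21 (reg (st' ?J ?r) 4) z2" using v r72 by simp
    have c3: "cmn i (set_reg 21 (reg (st' ?J ?r) 4) z2)" by (rule cmn_own[OF c2]) simp
    show "runs F (Add 21 (rn ?J 4) 7) z2 (\<lambda>z'. cmn i z' \<and> cp ?J z' = st' ?J ?r \<and> reg z' 21 = reg (st' ?J ?r) 4) 1"
      by (rule runs_loop_free) (simp, unfold e, use c3 z2 in simp, simp)
  qed
qed

lemma runs_CA:
  assumes M: "MI i z" and i: "i < 7 * d * N"
  shows "runs F (CA p) z (MC i) (cCA + (if i div N < 6 * d then 4 * tm (i div N) (i mod N) else 0))"
proof -
  let ?J = "i div N" and ?r = "i mod N"
  have r: "?r < N" using N_pos by simp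
  have ij: "?J * N + ?r = i" by simp
  have c: "cmn i z" using M by (simp add: MI_def)
  let ?T = "(if ?J < 6 * d then 4 * tm ?J ?r else 0)"
  let ?U = "(2 * (6 * d) + (1 + (4 * tm ?J ?r + 1))) + Suc (tTUP + len send_tail)"
  let ?u = "if ?J < 6 * d then ?U else Suc (tTUP + 1)"
  have "runs F (CA p) z (MC i) (1 + Suc ?u)"
    unfolding CA_def
  proof (rule runs_Seq)
    show "runs F (Const 20 (6 * d)) z (\<lambda>z1. z1 = set_reg 20 (6 * d) z) 1" by (rule runs_loop_free) simp_all
    fix z1 assume z1: "z1 = set_reg 20 (6 * d) z"
    have o1: "only ({3, 4, 16} \<union> {20..<65}) {} z z1" unfolding z1 by simp
    have c1: "cmn i z1" by (rule cmn_own[OF c o1])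
    have r1: "reg z1 13 = ?J" "reg z1 20 = 6 * d" "reg z1 16 = reg z 16"
      using c unfolding z1 cmn_def inv_def by simp_all
    show "runs F (IfLess 13 20 (Seq (disp (RUN p) (6 * d)) (IfLess 7 21 (Seq TUP send_tail) (Const 4 0)))
     (IfLess 7 15 (Seq TUP (Add 4 23 6)) (Const 4 0))) z1 (MC i) (Suc ?u)"
    proof (rule runs_If)
      assume "reg z1 13 < reg z1 20"
      then have J: "?J < 6 * d" using r1 by simp
      have a: "action_at S' \<Pi> v p i = (case action_at S \<Pi> (\<lambda>p. bview (v p) ?J) p ?r of Listen \<Rightarrow> Listen
        | Transmit x \<Rightarrow> Transmit (Zs * x + tuple p F V i))"
        using action_block[OF exe J r, of p] by (simp only: ij)
      let ?P = "\<lambda>z'. cmn i z' \<and> cp ?J z' = st' ?J ?r \<and> reg z' 21 = reg (st' ?J ?r) 4"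
      have "runs F (Seq (disp (RUN p) (6 * d)) (IfLess 7 21 (Seq TUP send_tail) (Const 4 0))) z1 (MC i) ?U"
      proof (rule runs_Seq)
        show "runs F (disp (RUN p) (6 * d)) z1 ?P (2 * (6 * d) + (1 + (4 * tm ?J ?r + 1)))"
        proof (rule runs_disp[OF r1(1) J])
          fix z2 assume o: "only {45} {} z1 z2"
          have o2: "only ({3, 4, 16} \<union> {20..<65}) {} z1 z2" by (rule only_mono[OF o]) auto
          have "cp ?J z2 = cp ?J z" using cp_own[OF o1] cp_own[OF o2] by simp
          moreover have "reg z2 16 = reg z 16" using only_reg[OF o, of 16] r1 by simp
          ultimately show "runs F (RUN p ?J) z2 ?P (1 + (4 * tm ?J ?r + 1))"
            using M J by (intro runs_RUN[OF cmn_own[OF c1 o2] J]) (simp add: MI_def)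
        qed
        fix z3 assume z3: "?P z3"
        have c3: "cmn i z3" using z3 by blast
        have a3: "reg z3 21 = action_code (action_at S \<Pi> (\<lambda>p. bview (v p) ?J) p ?r)" using z3 c4[OF J r] by simp
        have fin: "MC i z'" if "only ({3, 4, 16} \<union> {20..<65}) {} z3 z'" "reg z' 4 = action_code (action_at S' \<Pi> v p i)" for z'
          using cmn_own[OF c3 that(1)] cp_own[OF that(1)] z3 that(2) by (simp add: MC_def)
        show "runs F (IfLess 7 21 (Seq TUP send_tail) (Const 4 0)) z3 (MC i) (Suc (tTUP + len send_tail))"
        proof (rule runs_If)
          assume "reg z3 7 < reg z3 21"
          then obtain x where x: "action_at S \<Pi> (\<lambda>p. bview (v p) ?J) p ?r = Transmit x" "reg z3 21 = Suc x"
            using a3 by (cases "action_at S \<Pi> (\<lambda>p. bview (v p) ?J) p ?r") auto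
          show "runs F (Seq TUP send_tail) z3 (MC i) (tTUP + len send_tail)"
          proof (rule runs_Seq[OF runs_tuple[OF c3]])
            fix z4 assume z4: "only {23..<28} {} z3 z4 \<and> reg z4 23 = tuple p F V i"
            have o4: "only {23..<28} {} z3 z4" using z4 by blast
            have o4': "only ({3, 4, 16} \<union> {20..<65}) {} z3 z4" by (rule only_mono[OF o4]) auto
            have r4: "reg z4 21 = Suc x" "reg z4 6 = 1" "reg z4 23 = tuple p F V i"
              using only_reg[OF o4] x(2) envD(2)[OF cmn_env[OF c3]] z4 by simp_all
            have "MC i (ev F send_tail z4)"
              by (rule fin) (use o4' r4 a x(1) in \<open>simp_all add: send_tail_def\<close>)
            then show "runs F send_tail z4 (MC i) (len send_tail)"
              by (intro runs_loop_free) (simp_all add: send_tail_def)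
          qed
        next
          assume "\<not> reg z3 7 < reg z3 21"
          then have "reg z3 21 = 0" using envD(3)[OF cmn_env[OF c3]] by simp
          then have l: "action_at S \<Pi> (\<lambda>p. bview (v p) ?J) p ?r = Listen"
            using a3 by (cases "action_at S \<Pi> (\<lambda>p. bview (v p) ?J) p ?r") auto
          have "MC i (ev F (Const 4 0) z3)" by (rule fin) (use a l in simp_all)
          then show "runs F (Const 4 0) z3 (MC i) (tTUP + len send_tail)"
            by (intro runs_loop_free) (simp_all add: tTUP_def)
        qed
      qed
      then show "runs F (Seq (disp (RUN p) (6 * d)) (IfLess 7 21 (Seq TUP send_tail) (Const 4 0))) z1 (MC i) ?u"
        using J by simp
    next
      assume "\<not> reg z1 13 < reg z1 20"
      then have J: "6 * d \<le> ?J" using r1 by simp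
      then have "6 * d * N \<le> ?J * N" by simp
      also have "\<dots> \<le> i" by simp
      finally have a: "action_at S' \<Pi> v p i = (if certain p F V then Transmit (tuple p F V i) else Listen)"
        using action_last[OF exe _ i, of p] by simp
      have r15: "reg z1 15 = (if certain p F V then 1 else 0)" using c1 J by (simp add: cmn_def inv_def)
      have fin: "MC i z'" if "only ({3, 4, 16} \<union> {20..<65}) {} z1 z'" "reg z' 4 = action_code (action_at S' \<Pi> v p i)" for z'
        using cmn_own[OF c1 that(1)] that(2) J by (simp add: MC_def)
      have "runs F (IfLess 7 15 (Seq TUP (Add 4 23 6)) (Const 4 0)) z1 (MC i) (Suc (tTUP + 1))"
      proof (rule runs_If)
        assume "reg z1 7 < reg z1 15"
        then have ce: "certain p F V" using r15 by (auto split: if_splits)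
        show "runs F (Seq TUP (Add 4 23 6)) z1 (MC i) (tTUP + 1)"
        proof (rule runs_Seq[OF runs_tuple[OF c1]])
          fix z4 assume z4: "only {23..<28} {} z1 z4 \<and> reg z4 23 = tuple p F V i"
          have o4: "only {23..<28} {} z1 z4" using z4 by blast
          have o4': "only ({3, 4, 16} \<union> {20..<65}) {} z1 z4" by (rule only_mono[OF o4]) auto
          have r4: "reg z4 6 = 1" "reg z4 23 = tuple p F V i"
            using only_reg[OF o4] envD(2)[OF cmn_env[OF c1]] z4 by simp_all
          have "MC i (ev F (Add 4 23 6) z4)" by (rule fin) (use o4' r4 a ce in simp_all)
          then show "runs F (Add 4 23 6) z4 (MC i) 1" by (intro runs_loop_free) simp_all
        qed
      next
        assume "\<not> reg z1 7 < reg z1 15"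
        then have ce: "\<not> certain p F V" using r15 envD(3)[OF cmn_env[OF c1]] by (auto split: if_splits)
        have "MC i (ev F (Const 4 0) z1)" by (rule fin) (use a ce in simp_all)
        then show "runs F (Const 4 0) z1 (MC i) (tTUP + 1)" by (intro runs_loop_free) simp_all
      qed
      then show "runs F (IfLess 7 15 (Seq TUP (Add 4 23 6)) (Const 4 0)) z1 (MC i) ?u" using J by simp
    qed
  qed
  moreover have "1 + Suc ?u \<le> cCA + ?T" by (simp add: cCA_def)
  ultimately show ?thesis by (rule runs_time)
qed

text \<open>The copy still lacks the last symbol of the block, which is delivered before the output
  program runs.\<close>

lemma runs_BE:
  assumes I: "inv J J R c i z" and J: "J < 6 * d"
    and cpJ: "set_reg 3 (reg z 16) (cp J z) = st J N"
  shows "runs F (BE p J) z (inv J (Suc J) R c i) (1 + (4 * tf J + cPRS J s * E))"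
  unfolding BE_def
proof (rule runs_Seq)
  have r7: "reg z 7 = 0" using I by (simp add: inv_def env_def)
  have J1: "Suc J * s \<le> K" using J by (intro mult_right_mono) auto
  show "runs F (Add (rn J 3) 16 7) z (\<lambda>z1. z1 = set_reg (rn J 3) (reg z 16) z) 1"
    by (rule runs_loop_free) (use r7 in simp_all)
  fix z1 assume z1: "z1 = set_reg (rn J 3) (reg z 16) z"
  have cp1: "cp J z1 = st J N" unfolding z1 using cpJ by simp
  have o1: "only (range (rn J)) (range (rn J)) z z1" unfolding z1 by simp
  show "runs F (Seq (tr (query_copy J) J (ou p)) (PRS J s)) z1 (inv J (Suc J) R c i) (4 * tf J + cPRS J s * E)"
  proof (rule runs_Seq[OF runs_tr_same_oracle[OF cf[OF J] cp1]])
    fix z2 assume z2: "cp J z2 = fin J \<and> outside J z1 z2"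
    have o2: "only (range (rn J)) (range (rn J)) z1 z2" by (rule outside_only) (use z2 in blast)
    have oz: "only (range (rn J)) (range (rn J)) z z2" by (rule only_trans[OF o1 o2]) auto
    have I2: "inv J J R c i z2"
      by (rule inv_only[OF I oz]) (use J in \<open>auto simp: disjoint_iff\<close>)
    have cpz: "cp (ka (hs J k)) z2 = z0 \<and> cp (kb (hs J k)) z2 = z0" if "k < s" for k
    proof -
      have "hs J k < K" using that J1 by simp
      moreover have "\<forall>h<K. J * s \<le> h \<longrightarrow> cp (ka h) z2 = z0 \<and> cp (kb h) z2 = z0" using I2 unfolding inv_def by blast
      ultimately show ?thesis using le_add1 by blast
    qed
    have "runs F (PRS J s) z2 (\<lambda>z'. only (BR J s) (BA J s) z2 z' \<and> slots p F V (hs J s) z') (cPRS J s * E)"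
    proof (rule runs_PRS)
      show "env z2" "slots p F V (J * s) z2" using I2 by (simp_all add: inv_def)
      show "stored_lists n (cp J z2) = outcome S p F (bview V J)" using z2 co[OF J] by simp
    qed (use J cpz raw_length in auto)
    then show "runs F (PRS J s) z2 (inv J (Suc J) R c i) (cPRS J s * E)"
    proof (rule runs_mono)
      fix z3 assume z3: "only (BR J s) (BA J s) z2 z3 \<and> slots p F V (hs J s) z3"
      have o3: "only (BR J s) (BA J s) z2 z3" using z3 by blast
      have sl: "slots p F V (Suc J * s) z3" using z3 by (simp add: add.commute)
      have e3: "env z3" by (rule env_only[OF _ o3]) (use I2 in \<open>simp_all add: BR_def BA_def inv_def\<close>)
      have r3: "reg z3 13 = reg z2 13" "reg z3 14 = reg z2 14" "reg z3 15 = reg z2 15" "reg z3 17 = reg z2 17"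
        using only_reg[OF o3] by (simp_all add: BR_def)
      have a3: "arr z3 6 = arr z2 6" using only_arr[OF o3, of 6] by (simp add: BA_def)
      have k3: "cp k z3 = cp k z2" if "\<And>i. i < s \<Longrightarrow> k \<noteq> ka (hs J i) \<and> k \<noteq> kb (hs J i)" for k
        by (rule cp_BR[OF o3 that])
      have "cp (ka h) z3 = z0 \<and> cp (kb h) z3 = z0" if "h < K" "Suc J * s \<le> h" for h
      proof -
        have "cp (ka h) z3 = cp (ka h) z2" by (rule k3) (use that in \<open>auto; presburger\<close>)
        moreover have "cp (kb h) z3 = cp (kb h) z2" by (rule k3) (use that in \<open>auto; presburger\<close>)
        moreover have "J * s \<le> h" using that by simp
        ultimately show ?thesis using I2 that by (simp add: inv_def)
      qed
      moreover have "cp j z3 = z0" if "j < 6 * d" "J < j" for j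
      proof -
        have "cp j z3 = cp j z2" by (rule k3) (use that in auto)
        then show ?thesis using I2 that by (simp add: inv_def)
      qed
      ultimately show "inv J (Suc J) R c i z3" using I2 sl e3 r3 a3 by (simp add: inv_def)
    qed simp
  qed
qed

lemma runs_BEND:
  assumes I: "inv J J R c i z"
    and cpJ: "J < 6 * d \<Longrightarrow> set_reg 3 (reg z 16) (cp J z) = st J N"
  shows "runs F (BEND p) z (inv J (Suc J) R c i) (1 + Suc (2 * (6 * d) + (1 + (4 * TT + (\<Sum>j<6 * d. cPRS j s) * E))))"
  unfolding BEND_def
proof (rule runs_Seq)
  show "runs F (Const 20 (6 * d)) z (\<lambda>z1. z1 = set_reg 20 (6 * d) z) 1" by (rule runs_loop_free) simp_all
  fix z1 assume z1: "z1 = set_reg 20 (6 * d) z"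
  have I1: "inv J J R c i z1" using I unfolding z1 by (simp add: inv_def)
  have r1: "reg z1 13 = J" "reg z1 20 = 6 * d" using I unfolding z1 inv_def by simp_all
  let ?u = "1 + (4 * TT + (\<Sum>j<6 * d. cPRS j s) * E)"
  show "runs F (IfLess 13 20 (disp (BE p) (6 * d)) Skip) z1 (inv J (Suc J) R c i) (Suc (2 * (6 * d) + ?u))"
  proof (rule runs_If)
    assume "reg z1 13 < reg z1 20"
    then have J: "J < 6 * d" using r1 by simp
    show "runs F (disp (BE p) (6 * d)) z1 (inv J (Suc J) R c i) (2 * (6 * d) + ?u)"
    proof (rule runs_disp[OF r1(1) J])
      fix z2 assume o: "only {45} {} z1 z2"
      have I2: "inv J J R c i z2" by (rule inv_only[OF I1 o]) simp_all
      have "cp J z2 = cp J z1" by (rule only_cp[OF o]) simp_all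
      moreover have "cp J z1 = cp J z" unfolding z1 by simp
      moreover have "reg z2 16 = reg z 16" using only_reg[OF o, of 16] unfolding z1 by simp
      ultimately have k: "set_reg 3 (reg z2 16) (cp J z2) = st J N" using cpJ[OF J] by simp
      have "cPRS J s \<le> (\<Sum>j<6 * d. cPRS j s)" by (rule member_le_sum) (use J in auto)
      then have "cPRS J s * E \<le> (\<Sum>j<6 * d. cPRS j s) * E" by (rule mult_right_mono) simp
      moreover have "tf J \<le> TT" using ct[OF J] by simp
      ultimately have "1 + (4 * tf J + cPRS J s * E) \<le> ?u" by linarith
      then show "runs F (BE p J) z2 (inv J (Suc J) R c i) ?u" by (rule runs_time[OF runs_BE[OF I2 J k]])
    qed
  next
    assume "\<not> reg z1 13 < reg z1 20"
    then have J: "6 * d \<le> J" using r1 by simp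
    \<comment> \<open>Beyond block \<open>6 * d\<close> all slots are final, so raising the number
      of processed blocks changes nothing.\<close>
    then have Ks: "K \<le> J * s" by simp
    then have "K \<le> Suc J * s" unfolding mult_Suc by linarith
    then have "inv J (Suc J) R c i z1" using I1 slots_all[OF _ Ks, of p F V z1 "Suc J * s"] J unfolding inv_def by auto
    then show "runs F Skip z1 (inv J (Suc J) R c i) (2 * (6 * d) + ?u)" by (intro runs_loop_free) simp_all
  qed
qed

lemma runs_CERTQ:
  assumes I: "inv J J R (6 * d < J \<and> certain p F V) (J * N) z"
  shows "runs F CERTQ z (\<lambda>z'. inv J J R (6 * d \<le> J \<and> certain p F V) (J * N) z' \<and>
    reg z' 16 = reg z 16 \<and> (\<forall>k. cp k z' = cp k z)) (1 + Suc (Suc tCERT))"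
  unfolding CERTQ_def
proof (rule runs_Seq)
  let ?Q = "\<lambda>z'. inv J J R (6 * d \<le> J \<and> certain p F V) (J * N) z' \<and> reg z' 16 = reg z 16 \<and> (\<forall>k. cp k z' = cp k z)"
  show "runs F (Const 20 (6 * d)) z (\<lambda>z1. z1 = set_reg 20 (6 * d) z) 1" by (rule runs_loop_free) simp_all
  fix z1 assume z1: "z1 = set_reg 20 (6 * d) z"
  have I1: "inv J J R (6 * d < J \<and> certain p F V) (J * N) z1" using I unfolding z1 by (simp add: inv_def)
  have r1: "reg z1 13 = J" "reg z1 20 = 6 * d" "reg z1 16 = reg z 16" "\<And>k. cp k z1 = cp k z"
    using I unfolding z1 inv_def by simp_all
  have t1: "1 \<le> tCERT" by (simp add: tCERT_def)
  \<comment> \<open>\<open>6 * d < J\<close> and \<open>6 * d \<le> J\<close> differ only at the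
    block in which the flag is set.\<close>
  have same: "?Q z1" if "J \<noteq> 6 * d"
  proof -
    have "6 * d < J \<longleftrightarrow> 6 * d \<le> J" using that by auto
    then show ?thesis using I1 r1(3,4) by simp
  qed
  show "runs F (IfLess 13 20 Skip (IfLess 20 13 Skip CERTP)) z1 ?Q (Suc (Suc tCERT))"
  proof (rule runs_If)
    assume "reg z1 13 < reg z1 20"
    then have "?Q z1" using r1 by (intro same) simp
    then show "runs F Skip z1 ?Q (Suc tCERT)" by (intro runs_loop_free) simp_all
  next
    assume ge: "\<not> reg z1 13 < reg z1 20"
    show "runs F (IfLess 20 13 Skip CERTP) z1 ?Q (Suc tCERT)"
    proof (rule runs_If)
      assume "reg z1 20 < reg z1 13"
      then have "?Q z1" using r1 by (intro same) simp
      then show "runs F Skip z1 ?Q tCERT" using t1 by (intro runs_loop_free) simp_all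
    next
      assume "\<not> reg z1 20 < reg z1 13"
      then have J: "J = 6 * d" using ge r1 by simp
      have e1: "env z1" using I1 by (simp add: inv_def)
      show "runs F CERTP z1 ?Q tCERT"
      proof (rule runs_mono[OF runs_CERTP[OF e1]])
        fix z2 assume z2: "only ({15} \<union> {20..<65}) {} z1 z2 \<and>
          reg z2 15 = (if card {h. h < K \<and> d * N \<le> arr z1 6 h} = 1 then 1 else 0)"
        have o2: "only ({15} \<union> {20..<65}) {} z1 z2" using z2 by blast
        have e2: "env z2" by (rule env_only[OF e1 o2]) simp_all
        have a2: "arr z2 = arr z1" by (rule ext) (use only_arr[OF o2] in simp)
        have r2: "reg z2 13 = reg z1 13" "reg z2 14 = reg z1 14" "reg z2 17 = reg z1 17" "reg z2 16 = reg z1 16"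
          using only_reg[OF o2] by simp_all
        have k2: "cp k z2 = cp k z1" for k by (rule only_cp[OF o2]) simp_all
        have "{h. h < K \<and> d * N \<le> arr z1 6 h} = {h. h < K \<and> d * N \<le> cnt p F V (6 * d * N) h}"
          using I1 J by (auto simp: inv_def)
        then have r15: "reg z2 15 = (if certain p F V then 1 else 0)" using z2 by (simp add: certain_def)
        have sl: "slots p F V (J * s) z2" by (rule slots_cong[of _ _ _ _ z1]) (use I1 a2 in \<open>simp_all add: inv_def\<close>)
        have "inv J J R (6 * d \<le> J \<and> certain p F V) (J * N) z2"
          using I1 e2 r2 a2 k2 r15 sl J unfolding inv_def by simp
        then show "?Q z2" using r2(4) r1(3,4) k2 by simp
      qed simp
    qed
  qed
qed

lemma cnt_Suc:
  "cnt p F V (Suc i) h = cnt p F V i h + (if \<exists>y. V ! i = Some y \<and> supports y (entry p F V i h) then 1 else 0)"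
proof -
  let ?P = "\<lambda>i. \<exists>y. V ! i = Some y \<and> supports y (entry p F V i h)"
  have "{k. k < Suc i \<and> ?P k} = (if ?P i then insert i {k. k < i \<and> ?P k} else {k. k < i \<and> ?P k})"
    by (auto simp: less_Suc_eq)
  then show ?thesis unfolding cnt_def by simp
qed

text \<open>Only the last round of a block triggers the expensive work; all other receptions take
  constant time.\<close>

lemma runs_RECV:
  assumes M: "MC i z" and i: "i < 7 * d * N"
  shows "runs F (RECV p) (set_reg 3 (received_code (V ! i)) z) (MI (Suc i))
    (tGET + 3 + (if Suc i mod N = 0 then cBIG * E else 0))"
proof -
  let ?J = "i div N" and ?r = "i mod N" and ?z = "set_reg 3 (received_code (V ! i)) z"
  let ?x = "received_code (map_option (\<lambda>y. y div Zs) (V ! i))"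
  have r: "?r < N" using N_pos by simp
  have c: "cmn i ?z" by (rule cmn_own[of i z]) (use M in \<open>simp_all add: MC_def\<close>)
  then have I: "inv ?J ?J ?r (6 * d \<le> ?J \<and> certain p F V) i ?z" by (simp add: cmn_def)
  have r14: "reg ?z 14 = ?r" using I by (simp add: inv_def)
  have cpJ: "cp ?J ?z = st' ?J ?r" if "?J < 6 * d" using M that by (simp add: MC_def)
  have stS: "st ?J (Suc ?r) = set_reg 3 ?x (st' ?J ?r)" if "?J < 6 * d"
    using chain_step(2)[OF that r] by simp
  have yb: "y' < Zs * alphabet S" if "V ! i = Some y'" for y'
  proof (cases "action_at S' \<Pi> v p i")
    case Listen
    then show ?thesis using executionD(3)[OF exe, of i p] i that by auto
  next
    case (Transmit x)
    then show ?thesis using executionD(2)[OF exe, of i p] i that by auto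
  qed
  let ?c = "6 * d \<le> ?J \<and> certain p F V"
  let ?P = "\<lambda>z'. inv ?J ?J ?r ?c (Suc i) z' \<and> reg z' 16 = ?x \<and> cp ?J z' = cp ?J ?z"
  let ?T = "1 + Suc (2 * (6 * d) + (1 + (4 * TT + (\<Sum>j<6 * d. cPRS j s) * E)))"
  let ?B = "?T + (3 + (1 + Suc (Suc tCERT)))"
  have "runs F (RECV p) ?z (MI (Suc i)) (tGET + (1 + Suc (if Suc i mod N = 0 then ?B else 1)))"
    unfolding RECV_def
  proof (rule runs_Seq)
    have g: "runs F GET ?z (\<lambda>z'. only ({16} \<union> {20..<65}) {6, 18} ?z z' \<and> reg z' 16 = ?x \<and>
      (\<forall>h<K. arr z' 6 h = arr ?z 6 h + (if \<exists>y'. V ! i = Some y' \<and> supports y' (entry p F V i h) then 1 else 0))) tGET"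
    proof (rule runs_GET[OF cmn_env[OF c]])
      show "reg ?z 3 = received_code (V ! i)" by simp
      show "arr ?z 4 (h * N + reg ?z 14) = entry p F V i h" if "h < K" for h
        unfolding r14 by (rule inv_entry[OF I that])
    qed (rule yb)
    show "runs F GET ?z ?P tGET"
    proof (rule runs_mono[OF g])
      fix z1 assume z1: "only ({16} \<union> {20..<65}) {6, 18} ?z z1 \<and> reg z1 16 = ?x \<and>
      (\<forall>h<K. arr z1 6 h = arr ?z 6 h + (if \<exists>y'. V ! i = Some y' \<and> supports y' (entry p F V i h) then 1 else 0))"
      have o1: "only ({16} \<union> {20..<65}) {6, 18} ?z z1" using z1 by blast
      have e1: "env z1" by (rule env_only[OF cmn_env[OF c] o1]) simp_all
      have k1: "cp k z1 = cp k ?z" for k by (rule only_cp[OF o1]) simp_all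
      have r1: "reg z1 13 = reg ?z 13" "reg z1 14 = reg ?z 14" "reg z1 15 = reg ?z 15" "reg z1 17 = reg ?z 17"
        using only_reg[OF o1] by simp_all
      have a1: "arr z1 8 = arr ?z 8" "arr z1 2 = arr ?z 2" "arr z1 4 = arr ?z 4" using only_arr[OF o1] by simp_all
      have sl: "slots p F V (?J * s) z1" by (rule slots_cong[OF _ a1]) (use I in \<open>simp only: inv_def\<close>)
      have "arr z1 6 h = cnt p F V (Suc i) h" if "h < K" for h
        unfolding cnt_Suc using z1 that I by (simp add: inv_def)
      then have "inv ?J ?J ?r ?c (Suc i) z1"
        using I e1 r1 sl k1 unfolding inv_def by simp
      then show "?P z1" using z1 k1 by blast
    qed simp
    fix z1 assume z1: "?P z1"
    show "runs F (Seq (Add 14 14 6) (IfLess 14 8 Skip (Seq (BEND p) (Seq NEXT CERTQ)))) z1 (MI (Suc i))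
      (1 + Suc (if Suc i mod N = 0 then ?B else 1))"
    proof (rule runs_Seq)
      have e1: "env z1" and r1: "reg z1 14 = ?r" using z1 by (simp_all add: inv_def)
      show "runs F (Add 14 14 6) z1 (\<lambda>z2. z2 = set_reg 14 (Suc ?r) z1) 1"
        by (rule runs_loop_free) (use r1 envD(2)[OF e1] in simp_all)
      fix z2 assume z2: "z2 = set_reg 14 (Suc ?r) z1"
      have I2: "inv ?J ?J (Suc ?r) ?c (Suc i) z2" and x2: "reg z2 16 = ?x" and k2: "cp ?J z2 = cp ?J ?z"
        using z1 unfolding z2 inv_def by simp_all
      have r2: "reg z2 14 = Suc ?r" "reg z2 8 = N" using I2 by (simp_all add: inv_def env_def)
      have k3: "set_reg 3 (reg z2 16) (cp ?J z2) = st ?J (Suc ?r)" if "?J < 6 * d"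
        using stS[OF that] cpJ[OF that] x2 k2 by simp
      show "runs F (IfLess 14 8 Skip (Seq (BEND p) (Seq NEXT CERTQ))) z2 (MI (Suc i)) (Suc (if Suc i mod N = 0 then ?B else 1))"
      proof (rule runs_If)
        assume "reg z2 14 < reg z2 8"
        then have lt: "Suc ?r < N" using r2 by simp
        then have dm: "Suc i div N = ?J" "Suc i mod N = Suc ?r" by (simp_all add: div_Suc mod_Suc)
        have "MI (Suc i) z2" unfolding MI_def cmn_def dm using I2 k3 by simp
        then show "runs F Skip z2 (MI (Suc i)) (if Suc i mod N = 0 then ?B else 1)"
          by (intro runs_loop_free) simp_all
      next
        assume "\<not> reg z2 14 < reg z2 8"
        then have eq: "Suc ?r = N" using r2 r by simp
        then have dm: "Suc i div N = Suc ?J" "Suc i mod N = 0" by (simp_all add: div_Suc mod_Suc)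
        have "Suc i = ?J * N + Suc ?r" by simp
        then have iN: "Suc i = Suc ?J * N" unfolding eq by simp
        have "runs F (Seq (BEND p) (Seq NEXT CERTQ)) z2 (MI (Suc i)) ?B"
        proof (rule runs_Seq[OF runs_BEND[OF I2]])
          show "set_reg 3 (reg z2 16) (cp ?J z2) = st ?J N" if "?J < 6 * d" using k3[OF that] eq by simp
          fix z3 assume I3: "inv ?J (Suc ?J) (Suc ?r) ?c (Suc i) z3"
          show "runs F (Seq NEXT CERTQ) z3 (MI (Suc i)) (3 + (1 + Suc (Suc tCERT)))"
          proof (rule runs_Seq)
            have r3: "reg z3 13 = ?J" "reg z3 6 = 1" using I3 by (simp_all add: inv_def env_def)
            show "runs F NEXT z3 (\<lambda>z4. z4 = set_reg 13 (Suc ?J) (set_reg 14 0 (set_reg 16 0 z3))) 3"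
              by (rule runs_loop_free) (use r3 in \<open>simp_all add: NEXT_def\<close>)
            fix z4 assume z4: "z4 = set_reg 13 (Suc ?J) (set_reg 14 0 (set_reg 16 0 z3))"
            have I4: "inv (Suc ?J) (Suc ?J) 0 (6 * d < Suc ?J \<and> certain p F V) (Suc ?J * N) z4"
              using I3 unfolding z4 iN inv_def by (simp add: less_Suc_eq_le)
            have x4: "reg z4 16 = 0" unfolding z4 by simp
            show "runs F CERTQ z4 (MI (Suc i)) (1 + Suc (Suc tCERT))"
            proof (rule runs_mono[OF runs_CERTQ[OF I4]])
              fix z5 assume z5: "inv (Suc ?J) (Suc ?J) 0 (6 * d \<le> Suc ?J \<and> certain p F V) (Suc ?J * N) z5 \<and>
                reg z5 16 = reg z4 16 \<and> (\<forall>k. cp k z5 = cp k z4)"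
              \<comment> \<open>Register 16 was reset to 0, which is the value of register 3 in the
                initial memory of the fresh copy.\<close>
              have "set_reg 3 (reg z5 16) (cp (Suc ?J) z5) = st (Suc ?J) 0" if "Suc ?J < 6 * d"
              proof -
                have "cp (Suc ?J) z4 = z0"
                proof -
                  have "cp (Suc ?J) z3 = z0" using I3 that by (simp add: inv_def)
                  then show ?thesis unfolding z4 by simp
                qed
                then show ?thesis using z5 x4 chain_start[OF that] by (simp add: initial_state_def set_reg_def fun_upd_idem_iff)
              qed
              then show "MI (Suc i) z5" unfolding MI_def cmn_def dm using z5 iN by simp
            qed simp
          qed
        qed
        then show "runs F (Seq (BEND p) (Seq NEXT CERTQ)) z2 (MI (Suc i)) (if Suc i mod N = 0 then ?B else 1)"
          using dm by simp
      qed
    qed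
  qed
  moreover have "tGET + (1 + Suc (if Suc i mod N = 0 then ?B else 1)) \<le> tGET + 3 + (if Suc i mod N = 0 then cBIG * E else 0)"
  proof -
    have "12 * d \<le> 12 * d * E" "tCERT \<le> tCERT * E" by (rule time_const)+
    then have "?B \<le> cBIG * E" using E_ge(1,5) unfolding cBIG_def add_mult_distrib by linarith
    then show ?thesis by simp
  qed
  ultimately show ?thesis by (rule runs_time)
qed

lemma MI_start: "z = initial_state n S' \<Longrightarrow> runs F INIT z (MI 0) (cINIT * E)"
proof (rule runs_mono[OF runs_INIT])
  assume z: "z = initial_state n S'"
  fix z1 assume z1: "only (IR \<union> CR Kc) {10} z z1 \<and> env z1 \<and> reg z1 17 = 1 \<and> (\<forall>k<Kc. cp k z1 = z0)"
  have o1: "only (IR \<union> CR Kc) {10} z z1" using z1 by blast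
  have r1: "reg z1 13 = 0" "reg z1 14 = 0" "reg z1 15 = 0" "reg z1 16 = 0"
    using only_reg[OF o1] z by (simp_all add: IR_def initial_state_def)
  have a1: "arr z1 6 = (\<lambda>_. 0)" "arr z1 8 = (\<lambda>_. 0)" "arr z1 4 = (\<lambda>_. 0)"
    using only_arr[OF o1] z by (simp_all add: initial_state_def)
  have sl: "slots p F V 0 z1" using a1 by (simp add: slots_def)
  have cps: "cp (ka h) z1 = z0 \<and> cp (kb h) z1 = z0" if "h < K" for h using z1 that by simp
  have cp0: "cp j z1 = z0" if "j < 6 * d" for j using z1 that by simp
  have ct0: "cnt p F V 0 h = 0" for h by (simp add: cnt_def)
  have "inv 0 0 0 False 0 z1" unfolding inv_def using z1 r1 a1 sl cps cp0 ct0 by simp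
  moreover have "set_reg 3 0 z0 = z0" by (simp add: initial_state_def set_reg_def fun_upd_idem_iff)
  ultimately show "MI 0 z1" unfolding MI_def cmn_def using r1 cp0[of 0] chain_start[of 0] d_pos by simp
qed simp_all

lemma MI_outcome:
  assumes M: "MI (7 * d * N) z"
  shows "runs F OUT z (\<lambda>z'. stored_lists n z' = outcome' p F V) (cOUT * E)"
proof -
  define \<theta> where "\<theta> = (if certain p F V then d * N else 2 * d * N)"
  have dm: "7 * d * N div N = 7 * d" "7 * d * N mod N = 0" using N_pos by simp_all
  have I: "inv (7 * d) (7 * d) 0 (certain p F V) (7 * d * N) z" using M unfolding MI_def cmn_def dm by simp
  have ac: "arr z 6 h = cnt p F V (7 * d * N) h" if "h < K" for h using I that by (simp add: inv_def)
  have sl: "slots p F V (7 * d * s) z" using I by (simp add: inv_def)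
  have th: "0 < \<theta>" using d_pos N_pos by (simp add: \<theta>_def)
  have "runs F OUT z (\<lambda>z'. stored_lists n z' =
     (if \<exists>h. h < K \<and> \<theta> \<le> arr z 6 h then [the (raw p F V (LEAST h. h < K \<and> \<theta> \<le> arr z 6 h))] else [])) (cOUT * E)"
  proof (rule runs_OUT[where b = "certain p F V"])
    show "env z" "reg z 15 = (if certain p F V then 1 else 0)" using I by (simp_all add: inv_def)
    show "\<theta> = (if certain p F V then d * N else 2 * d * N)" by (rule \<theta>_def)
    fix h assume h: "h < K" "\<theta> \<le> arr z 6 h"
    \<comment> \<open>The threshold is positive, so a slot that reaches it has been supported and is
      therefore good, in particular occupied.\<close>
    then have "cnt p F V (7 * d * N) h \<noteq> 0" using ac th by simp
    then have "{i. i < 7 * d * N \<and> (\<exists>y. V ! i = Some y \<and> supports y (entry p F V i h))} \<noteq> {}"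
      unfolding cnt_def by (metis card.empty)
    then obtain i y where "supports y (entry p F V i h)" by blast
    then have "entry p F V i h \<noteq> 0" by (simp add: supports_def)
    then have "good p F V h" by (auto simp: entry_def slotc_def split: if_splits)
    then obtain x where x: "raw p F V h = Some x" by (auto simp: good_def)
    have "6 * d * s \<le> 7 * d * s" by (intro mult_right_mono) auto
    then have "h < 7 * d * s" using h by linarith
    then have "\<forall>i<n. arr z 2 (h * n + i) = x ! i" using sl h(1) x unfolding slots_def by blast
    then show "length (the (raw p F V h)) = n \<and> (\<forall>i<n. arr z 2 (h * n + i) = the (raw p F V h) ! i)"
      using raw_length[OF h(1) x] x by simp
  qed
  note run = this
  have eq: "(h < K \<and> \<theta> \<le> cnt p F V (7 * d * N) h) = (h < K \<and> \<theta> \<le> arr z 6 h)" for h using ac by auto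
  show ?thesis unfolding outcome'_def Let_def \<theta>_def[symmetric] eq by (rule run)
qed

section \<open>Total running time\<close>

abbreviation cRD :: nat where "cRD \<equiv> cCA + tGET + 4"

abbreviation step_time :: "nat \<Rightarrow> nat" where
  "step_time i \<equiv> cRD + (if i mod N = 0 then cBIG * E else 0) +
     (if i div N < 6 * d then 4 * tm (i div N) (i mod N) else 0)"

lemma runs_first: "runs F (RP p) (initial_state n S') (MC 0) (step_time 0)"
proof -
  have "runs F (RP p) (initial_state n S') (MC 0) (Suc (cINIT * E) + (cCA + (if 0 div N < 6 * d then 4 * tm (0 div N) (0 mod N) else 0)))"
    unfolding RP_def
  proof (rule runs_Seq)
    show "runs F (IfLess 7 17 (RECV p) INIT) (initial_state n S') (MI 0) (Suc (cINIT * E))"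
      by (rule runs_If) (use MI_start in \<open>simp_all add: initial_state_def\<close>)
    fix z1 assume "MI 0 z1"
    then show "runs F (CA p) z1 (MC 0) (cCA + (if 0 div N < 6 * d then 4 * tm (0 div N) (0 mod N) else 0))"
      by (rule runs_CA) (use d_pos N_pos in simp)
  qed
  moreover have "cINIT * E \<le> cBIG * E" by (rule mult_right_mono) (simp_all add: cBIG_def)
  then have "Suc (cINIT * E) + (cCA + (if 0 div N < 6 * d then 4 * tm (0 div N) (0 mod N) else 0)) \<le> step_time 0"
    by (simp only: mod_0 simp_thms if_True)
  ultimately show ?thesis by (rule runs_time)
qed

lemma runs_receive:
  assumes M: "MC i z" and i: "i < 7 * d * N"
  shows "runs F (IfLess 7 17 (RECV p) INIT) (set_reg 3 (received_code (V ! i)) z) (MI (Suc i))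
    (Suc (tGET + 3 + (if Suc i mod N = 0 then cBIG * E else 0)))"
proof (rule runs_If)
  let ?z = "set_reg 3 (received_code (V ! i)) z"
  show "runs F (RECV p) ?z (MI (Suc i)) (tGET + 3 + (if Suc i mod N = 0 then cBIG * E else 0))"
    by (rule runs_RECV[OF M i])
  have "reg ?z 7 < reg ?z 17" using M by (simp add: MC_def cmn_def inv_def env_def)
  then show "runs F INIT ?z (MI (Suc i)) (tGET + 3 + (if Suc i mod N = 0 then cBIG * E else 0))"
    if "\<not> reg ?z 7 < reg ?z 17" using that by blast
qed

lemma reaches_MC:
  "i < 7 * d * N \<Longrightarrow> \<exists>z u z' u'. reaches F (RP p) (initial_state n S') (take i V) z u \<and>
     exec F (RP p) z u' z' \<and> MC i z' \<and> u + u' \<le> (\<Sum>k<Suc i. step_time k)"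
proof (induction i)
  case 0
  from runs_first obtain u' z' where "exec F (RP p) (initial_state n S') u' z'" "MC 0 z'" "u' \<le> step_time 0"
    unfolding runs_def by blast
  then show ?case
    by (intro exI[of _ "initial_state n S'"] exI[of _ 0] exI[of _ z'] exI[of _ u'] conjI)
       (simp_all add: reaches.start)
next
  case (Suc i)
  then have i: "i < 7 * d * N" by simp
  from Suc.IH[OF i] obtain z u z' u' where h: "reaches F (RP p) (initial_state n S') (take i V) z u"
    "exec F (RP p) z u' z'" "MC i z'" "u + u' \<le> (\<Sum>k<Suc i. step_time k)" by blast
  let ?z = "set_reg 3 (received_code (V ! i)) z'"
  have "take i V @ [V ! i] = take (Suc i) V"
    using i executionD(1)[OF exe, of p] by (simp add: take_Suc_conv_app_nth)
  with reaches.round[OF h(1,2), of "V ! i"]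
  have R: "reaches F (RP p) (initial_state n S') (take (Suc i) V) ?z (u + u')" by simp
  have "runs F (RP p) ?z (MC (Suc i)) (Suc (tGET + 3 + (if Suc i mod N = 0 then cBIG * E else 0)) +
      (cCA + (if Suc i div N < 6 * d then 4 * tm (Suc i div N) (Suc i mod N) else 0)))"
    unfolding RP_def by (rule runs_Seq[OF runs_receive[OF h(3) i]]) (rule runs_CA, simp, rule Suc.prems)
  then have "runs F (RP p) ?z (MC (Suc i)) (step_time (Suc i))" by (rule runs_time) simp
  then obtain u2 z2 where "exec F (RP p) ?z u2 z2" "MC (Suc i) z2" "u2 \<le> step_time (Suc i)"
    unfolding runs_def by blast
  then show ?case using R h(4)
    by (intro exI[of _ ?z] exI[of _ "u + u'"] exI[of _ z2] exI[of _ u2] conjI) simp_all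
qed

lemma reaches_action:
  assumes "i < 7 * d * N"
  shows "\<exists>z u z' u'. reaches F (RP p) (initial_state n S') (take i V) z u \<and>
     exec F (RP p) z u' z' \<and> reg z' 4 = action_code (action_at S' \<Pi> v p i)"
  using reaches_MC[OF assms] unfolding MC_def by blast

text \<open>Amortization: a block costs a constant per round, the boundary work once, and at most
  four times the time of the copy of \<open>S\<close>.\<close>

lemma sum_step_time: "(\<Sum>k<J * N. step_time k) \<le> J * (cRD * N + cBIG * E + 4 * TT)"
proof (induction J)
  case (Suc J)
  have "(\<Sum>r<N. step_time (J * N + r)) = (\<Sum>r<N. cRD + (if r = 0 then cBIG * E else 0) + (if J < 6 * d then 4 * tm J r else 0))"
    by (rule sum.cong) auto
  also have "\<dots> = cRD * N + cBIG * E + (\<Sum>r<N. if J < 6 * d then 4 * tm J r else 0)"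
    using N_pos by (simp add: sum.distrib sum.delta')
  moreover have "(\<Sum>r<N. if J < 6 * d then 4 * tm J r else 0) \<le> 4 * TT"
    using ct[of J] by (cases "J < 6 * d") (simp_all add: sum_distrib_left[symmetric])
  ultimately have "(\<Sum>r<N. step_time (J * N + r)) \<le> cRD * N + cBIG * E + 4 * TT" by simp
  moreover have "(\<Sum>k<Suc J * N. step_time k) = (\<Sum>k<J * N. step_time k) + (\<Sum>r<N. step_time (J * N + r))"
    using sum_lessThan_add[of step_time "J * N" N] by (simp only: mult_Suc add.commute)
  ultimately show ?case using Suc by simp
qed simp

text \<open>It depends only on \<open>q\<close>, \<open>s\<close>, \<open>\<sigma>\<close>,
  \<open>d\<close> and \<open>t\<close>, so one constant serves all \<open>n\<close>, all schemes
  and all programs.\<close>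

definition cALL :: nat where
  "cALL = 7 * d * (cRD + cBIG * (cc + s + \<sigma> + 2) + 4) + cRD + (cBIG + cOUT) * (cc + s + \<sigma> + 2)"

text \<open>\<open>m_square_le\<close> and \<open>card_views_bound\<close> bound the sizes by
  multiples of \<open>N\<close>, and \<open>N\<close> is at most \<open>TT\<close>.\<close>

lemma E_le: "E \<le> (cc + s + \<sigma> + 2) * TT"
proof -
  have "m * m \<le> cc * TT" using m_square_le mult_left_mono[OF N_le_TT, of cc] by linarith
  moreover have "n \<le> (s + \<sigma>) * TT" using card_views_bound mult_left_mono[OF N_le_TT, of "s + \<sigma>"] by linarith
  moreover have "1 \<le> TT" using N_le_TT N_pos by linarith
  ultimately show ?thesis unfolding E_def by (simp add: add_mult_distrib)
qed

lemma reaches_outcome: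
  "\<exists>z u z' u'. reaches F (RP p) (initial_state n S') V z u \<and> exec F (OP p) z u' z' \<and>
     stored_lists n z' = outcome' p F V \<and> u + u' \<le> cALL * TT"
proof -
  \<comment> \<open>The last round: its action is chosen by the round program, but its symbol is
    digested by the output program.\<close>
  define i where "i = 7 * d * N - 1"
  have i: "Suc i = 7 * d * N" using d_pos N_pos by (simp add: i_def)
  from reaches_MC[of i] i obtain z u z' u' where h: "reaches F (RP p) (initial_state n S') (take i V) z u"
    "exec F (RP p) z u' z'" "MC i z'" "u + u' \<le> (\<Sum>k<Suc i. step_time k)" by auto
  let ?z = "set_reg 3 (received_code (V ! i)) z'"
  have len: "length V = Suc i" using executionD(1)[OF exe, of p] i by simp
  then have "take i V @ [V ! i] = V" by (metis lessI take_Suc_conv_app_nth take_all_iff le_refl)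
  with reaches.round[OF h(1,2), of "V ! i"]
  have R: "reaches F (RP p) (initial_state n S') V ?z (u + u')" by simp
  have il: "i < 7 * d * N" using i by simp
  have "runs F (OP p) ?z (\<lambda>z'. stored_lists n z' = outcome' p F V)
     (Suc (tGET + 3 + (if Suc i mod N = 0 then cBIG * E else 0)) + cOUT * E)"
    unfolding OP_def by (rule runs_Seq[OF runs_receive[OF h(3) il]]) (rule MI_outcome, simp add: i)
  then obtain u2 z2 where e: "exec F (OP p) ?z u2 z2" "stored_lists n z2 = outcome' p F V"
    "u2 \<le> Suc (tGET + 3 + (if Suc i mod N = 0 then cBIG * E else 0)) + cOUT * E" unfolding runs_def by blast
  have "u + u' + u2 \<le> cALL * TT"
  proof -
    let ?e = "cc + s + \<sigma> + 2"
    have u2: "u2 \<le> cRD + cBIG * E + cOUT * E" using e(3) by (auto split: if_splits)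
    have b: "cBIG * E \<le> cBIG * ?e * TT" "cOUT * E \<le> cOUT * ?e * TT"
      unfolding mult.assoc by (rule mult_left_mono[OF E_le], simp)+
    have a: "cRD * N \<le> cRD * TT" by (rule mult_left_mono[OF N_le_TT]) simp
    have "cRD * 1 \<le> cRD * TT" by (rule mult_left_mono) (use N_le_TT N_pos in simp_all)
    then have a1: "cRD \<le> cRD * TT" unfolding mult_1_right .
    have add: "x + y \<le> X + (a' + b' + c')" if "x \<le> X" "y \<le> a + b + c" "b \<le> b'" "c \<le> c'" "a \<le> a'"
      for x y X a b c a' b' c' :: nat using that by linarith
    have "u + u' \<le> 7 * d * (cRD * N + cBIG * E + 4 * TT)"
      using order_trans[OF h(4)[unfolded i] sum_step_time[of "7 * d"]] .
    also have "\<dots> \<le> 7 * d * (cRD * TT + cBIG * ?e * TT + 4 * TT)"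
      by (rule mult_left_mono) (use a b in linarith, simp)
    also have "\<dots> = 7 * d * (cRD + cBIG * ?e + 4) * TT" by (simp only: add_mult_distrib mult.assoc)
    finally have "u + u' + u2 \<le> 7 * d * (cRD + cBIG * ?e + 4) * TT + (cRD * TT + cBIG * ?e * TT + cOUT * ?e * TT)"
      by (rule add[OF _ u2 b a1])
    also have "\<dots> = cALL * TT" unfolding cALL_def by (simp only: add_mult_distrib add.assoc)
    finally show ?thesis .
  qed
  then show ?thesis using R e(1,2) by blast
qed

end


lemma computable_S':
  assumes pro: "protocol q n \<Pi>" and exe: "execution S' \<Pi> v"
  shows "(\<forall>r<rounds S'. \<exists>z u z' u'. reaches (\<Pi> p) (RP p) (initial_state n S') (take r (v p)) z u \<and>
           exec (\<Pi> p) (RP p) z u' z' \<and> reg z' 4 = action_code (action_at S' \<Pi> v p r)) \<and>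
    (\<exists>z u z' u'. reaches (\<Pi> p) (RP p) (initial_state n S') (v p) z u \<and>
           exec (\<Pi> p) (OP p) z u' z' \<and> stored_lists n z' = outcome S' p (\<Pi> p) (v p) \<and> u + u' \<le> cALL * TT)"
proof -
  let ?V = "\<lambda>j p. bview (v p) j"
  \<comment> \<open>The five components of the chain of a block are packed into one tuple, so that a
    single choice covers all blocks.\<close>
  define G where "G j X \<longleftrightarrow> run_chain (\<Pi> p) (rp p) z0 (?V j p) (fst X) (fst (snd X)) (fst (snd (snd X))) \<and>
    (\<forall>r<N. reg (fst (snd X) r) 4 = action_code (action_at S \<Pi> (?V j) p r)) \<and>
    exec (\<Pi> p) (ou p) (fst X N) (snd (snd (snd (snd X)))) (fst (snd (snd (snd X)))) \<and>
    stored_lists n (fst (snd (snd (snd X)))) = outcome S p (\<Pi> p) (?V j p) \<and>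
    (\<Sum>r<N. fst (snd (snd X)) r) + snd (snd (snd (snd X))) \<le> TT" for j X
  have exG: "\<exists>X. G j X" if j: "j < 6 * d" for j
  proof (rule chain[OF pro execution_block[OF exe j], of p])
    fix st st' tm fin tf
    assume "run_chain (\<Pi> p) (rp p) z0 (?V j p) st st' tm"
      "\<forall>r<N. reg (st' r) 4 = action_code (action_at S \<Pi> (?V j) p r)"
      "exec (\<Pi> p) (ou p) (st N) tf fin" "stored_lists n fin = outcome S p (\<Pi> p) (?V j p)" "(\<Sum>r<N. tm r) + tf \<le> TT"
    then have "G j (st, st', tm, fin, tf)" unfolding G_def fst_conv snd_conv by (intro conjI)
    then show "\<exists>X. G j X" by (rule exI)
  qed
  define X where "X j = (SOME X. G j X)" for j
  have ex: "G j (X j)" if "j < 6 * d" for j unfolding X_def by (rule someI_ex[OF exG[OF that]])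
  define st where "st j = fst (X j)" for j
  define st' where "st' j = fst (snd (X j))" for j
  define tm where "tm j = fst (snd (snd (X j)))" for j
  define fin where "fin j = fst (snd (snd (snd (X j))))" for j
  define tf where "tf j = snd (snd (snd (snd (X j))))" for j
  have ch: "run_chain (\<Pi> p) (rp p) z0 (bview (v p) j) (st j) (st' j) (tm j)" if "j < 6 * d" for j
    using ex[OF that] unfolding G_def st_def st'_def tm_def by (rule conjunct1)
  have X1: "(\<forall>r<N. reg (st' j r) 4 = action_code (action_at S \<Pi> (?V j) p r)) \<and>
    exec (\<Pi> p) (ou p) (st j N) (tf j) (fin j) \<and>
    stored_lists n (fin j) = outcome S p (\<Pi> p) (?V j p) \<and> (\<Sum>r<N. tm j r) + tf j \<le> TT" if "j < 6 * d" for j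
    using ex[OF that] unfolding G_def st_def st'_def tm_def fin_def tf_def by (rule conjunct2)
  have c4: "reg (st' j r) 4 = action_code (action_at S \<Pi> (\<lambda>p. bview (v p) j) p r)" if "j < 6 * d" "r < N" for j r
    using conjunct1[OF X1[OF that(1)]] that(2) by simp
  have cf: "exec (\<Pi> p) (ou p) (st j N) (tf j) (fin j)" if "j < 6 * d" for j
    using X1[OF that] by simp
  have co: "stored_lists n (fin j) = outcome S p (\<Pi> p) (bview (v p) j)" if "j < 6 * d" for j
    using X1[OF that] by simp
  have ct: "(\<Sum>r<N. tm j r) + tf j \<le> TT" if "j < 6 * d" for j
    using X1[OF that] by simp
  note context_facts = pro exe ch c4 cf co ct
  show ?thesis unfolding S'_simps
  proof (intro conjI allI impI)
    show "\<exists>z u z' u'. reaches (\<Pi> p) (RP p) (initial_state n S') (take r (v p)) z u \<and>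
           exec (\<Pi> p) (RP p) z u' z' \<and> reg z' 4 = action_code (action_at S' \<Pi> v p r)" if "r < 7 * d * N" for r
      by (rule reaches_action[OF context_facts that])
    show "\<exists>z u z' u'. reaches (\<Pi> p) (RP p) (initial_state n S') (v p) z u \<and>
           exec (\<Pi> p) (OP p) z u' z' \<and> stored_lists n z' = outcome' p (\<Pi> p) (v p) \<and> u + u' \<le> cALL * TT"
      by (rule reaches_outcome[OF context_facts])
  qed
qed

end

section \<open>Uniform choice of the constants\<close>

theorem theorem6:
  fixes \<epsilon> :: real and q s \<sigma> :: nat
  assumes "\<epsilon> > 0" and "q \<ge> 2"
  shows "\<exists>C :: nat. \<forall>(S :: nat \<Rightarrow> scheme) (T :: nat \<Rightarrow> nat).
    (\<forall>n. coding_scheme q n (S n) \<and> alphabet (S n) \<le> \<sigma> \<and> balanced q n (S n) \<and>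
         list_decodes q n s (1 / 2 - \<epsilon>) (S n)) \<and>
    computable_within q S T \<longrightarrow>
    (\<exists>S' :: nat \<Rightarrow> scheme.
       (\<forall>n. coding_scheme q n (S' n) \<and>
            uniquely_decodes q n (2 / 7 - 2 * \<epsilon>) (S' n) \<and>
            rounds (S' n) \<le> C * rounds (S n) \<and> rounds (S n) \<le> C * rounds (S' n) \<and>
            alphabet (S' n) \<le> C * alphabet (S n) \<and> alphabet (S n) \<le> C * alphabet (S' n)) \<and>
       computable_within q S' (\<lambda>n. C * T n))"
proof (cases "\<epsilon> \<le> 1 / 7")
  case False
  \<comment> \<open>The tolerated error rate is negative, so unique decoding is vacuous.\<close>
  show ?thesis
  proof (intro exI[of _ 1] allI impI)
    fix S :: "nat \<Rightarrow> scheme" and T :: "nat \<Rightarrow> nat"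
    assume H: "(\<forall>n. coding_scheme q n (S n) \<and> alphabet (S n) \<le> \<sigma> \<and> balanced q n (S n) \<and>
         list_decodes q n s (1 / 2 - \<epsilon>) (S n)) \<and> computable_within q S T"
    have "uniquely_decodes q n (2 / 7 - 2 * \<epsilon>) (S n)" for n
    proof -
      have "0 < rounds (S n)" using H by (simp add: coding_scheme_def)
      then have "(2 / 7 - 2 * \<epsilon>) * real (rounds (S n)) < 0" using False by (intro mult_neg_pos) auto
      then show ?thesis unfolding uniquely_decodes_def using of_nat_0_le_iff order_less_le_trans by (metis not_less)
    qed
    then show "\<exists>S' :: nat \<Rightarrow> scheme.
       (\<forall>n. coding_scheme q n (S' n) \<and>
            uniquely_decodes q n (2 / 7 - 2 * \<epsilon>) (S' n) \<and>
            rounds (S' n) \<le> 1 * rounds (S n) \<and> rounds (S n) \<le> 1 * rounds (S' n) \<and>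
            alphabet (S' n) \<le> 1 * alphabet (S n) \<and> alphabet (S n) \<le> 1 * alphabet (S' n)) \<and>
       computable_within q S' (\<lambda>n. 1 * T n)"
      using H by (intro exI[of _ S]) simp
  qed
next
  case True
  \<comment> \<open>\<open>cc\<close> depends only on \<open>q\<close>, \<open>s\<close> and
    \<open>\<sigma>\<close>, so \<open>d\<close>, \<open>t\<close> and with them \<open>C\<close>
    are fixed before the scheme is given.\<close>
  define k where "k = list_scheme.cc q s \<sigma>"
  obtain d :: nat where "1 < real d * (16 * \<epsilon>)" using ex_less_of_nat_mult[of "16 * \<epsilon>" 1] assms(1) by auto
  then have d: "1 \<le> 16 * \<epsilon> * real d" by (simp add: mult.commute)
  have d0: "1 \<le> d" using d by (cases d) auto
  have "\<exists>t. real (6 * d * s) * ((1 - 1 / (240 * real k)) ^ t * real k) < \<epsilon>"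
  proof (cases "k = 0")
    case False
    let ?K = "real (6 * d * s) * real k"
    have K: "0 \<le> ?K" by simp
    \<comment> \<open>Dividing by \<open>?K + 1\<close> avoids a case distinction on whether
      \<open>?K\<close> is 0.\<close>
    have "0 < \<epsilon> / (?K + 1)" by (rule divide_pos_pos) (use assms(1) K in linarith)+
    moreover have "1 - 1 / (240 * real k) < 1" using False by simp
    ultimately obtain t where t: "(1 - 1 / (240 * real k)) ^ t < \<epsilon> / (?K + 1)"
      using real_arch_pow_inv by blast
    have lt: "x * (\<epsilon> / (x + 1)) < \<epsilon>" if "0 \<le> x" for x :: real
    proof -
      have "0 < x + 1" using that by linarith
      then show ?thesis using assms(1) by (simp add: field_simps)
    qed
    have "?K * (1 - 1 / (240 * real k)) ^ t \<le> ?K * (\<epsilon> / (?K + 1))"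
      by (rule mult_left_mono) (use t K in auto)
    also have "\<dots> < \<epsilon>" by (rule lt[OF K])
    finally have "real (6 * d * s) * ((1 - 1 / (240 * real k)) ^ t * real k) < \<epsilon>"
      by (simp only: mult.assoc mult.commute mult.left_commute)
    then show ?thesis by blast
  qed (use assms(1) in simp)
  then obtain t where t: "real (6 * d * s) * ((1 - 1 / (240 * real k)) ^ t * real k) < \<epsilon>" by blast
  define Z where "Z = (2 :: nat) ^ (boosted.g s \<sigma> t * (6 * d * s))"
  \<comment> \<open>The summands bound the growth of rounds, alphabet and time in this order; the
    converse inequalities hold because \<open>d\<close> and \<open>Z\<close> are at least 1.\<close>
  define C where "C = 7 * d + Z + machine.cALL q s \<sigma> d t"
  have Z: "1 \<le> Z" by (simp add: Z_def)
  have C: "7 * d \<le> C" "Z \<le> C" "machine.cALL q s \<sigma> d t \<le> C" "1 \<le> C * (7 * d)" "1 \<le> C * Z"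
    using d0 Z by (simp_all add: C_def)
  show ?thesis
  proof (intro exI[of _ C] allI impI)
    fix S :: "nat \<Rightarrow> scheme" and T :: "nat \<Rightarrow> nat"
    assume H: "(\<forall>n. coding_scheme q n (S n) \<and> alphabet (S n) \<le> \<sigma> \<and> balanced q n (S n) \<and>
         list_decodes q n s (1 / 2 - \<epsilon>) (S n)) \<and> computable_within q S T"
    then obtain rp ou where cw: "\<forall>n \<Pi> v p. protocol q n \<Pi> \<and> execution (S n) \<Pi> v \<longrightarrow>
        (\<forall>r<rounds (S n). \<exists>s t s' t'.
           reaches (\<Pi> p) (rp p) (initial_state n (S n)) (take r (v p)) s t \<and>
           exec (\<Pi> p) (rp p) s t' s' \<and> reg s' 4 = action_code (action_at (S n) \<Pi> v p r)) \<and>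
        (\<exists>s t s' t'.
           reaches (\<Pi> p) (rp p) (initial_state n (S n)) (v p) s t \<and>
           exec (\<Pi> p) (ou p) s t' s' \<and>
           stored_lists n s' = outcome (S n) p (\<Pi> p) (v p) \<and> t + t' \<le> T n)"
      unfolding computable_within_def by (elim conjE exE) (rule that)
    have b: "boosted q n s \<sigma> \<epsilon> (S n) d t" for n
    proof (rule boosted.intro)
      show "list_scheme q n s \<sigma> \<epsilon> (S n)"
        by (rule list_scheme.intro) (use H assms True in simp_all)
      show "boosted_axioms q s \<sigma> \<epsilon> d t"
        by (rule boosted_axioms.intro) (use d t in \<open>simp_all only: k_def\<close>)
    qed
    have mach: "machine q n s \<sigma> \<epsilon> (S n) d t rp ou (T n)" for n
      by (rule machine.intro[OF b], rule machine_axioms.intro, rule cw[rule_format], rule conjI)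
    let ?S' = "\<lambda>n. boosted.S' q n s \<sigma> (S n) d t"
    let ?RP = "machine.RP q s \<sigma> d t rp ou" and ?OP = "machine.OP q s \<sigma> d t rp ou"
    have "computable_within q ?S' (\<lambda>n. C * T n)"
      unfolding computable_within_def
    proof (rule exI[of _ ?RP], rule exI[of _ ?OP], intro allI impI)
      fix n \<Pi> v p
      assume "protocol q n \<Pi> \<and> execution (?S' n) \<Pi> v"
      then have pe: "protocol q n \<Pi>" "execution (?S' n) \<Pi> v" by blast+
      note cm = machine.computable_S'[OF mach pe, of p]
      have "machine.cALL q s \<sigma> d t * T n \<le> C * T n" by (rule mult_right_mono[OF C(3)]) simp
      then have le: "u \<le> machine.cALL q s \<sigma> d t * T n \<Longrightarrow> u \<le> C * T n" for u by (rule order_trans[rotated])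
      from cm le show "(\<forall>r<rounds (?S' n). \<exists>z u z' u'.
           reaches (\<Pi> p) (?RP p) (initial_state n (?S' n)) (take r (v p)) z u \<and>
           exec (\<Pi> p) (?RP p) z u' z' \<and> reg z' 4 = action_code (action_at (?S' n) \<Pi> v p r)) \<and>
        (\<exists>z u z' u'.
           reaches (\<Pi> p) (?RP p) (initial_state n (?S' n)) (v p) z u \<and>
           exec (\<Pi> p) (?OP p) z u' z' \<and>
           stored_lists n z' = outcome (?S' n) p (\<Pi> p) (v p) \<and> u + u' \<le> C * T n)" by blast
    qed
    moreover have "coding_scheme q n (?S' n) \<and> uniquely_decodes q n (2 / 7 - 2 * \<epsilon>) (?S' n) \<and>
            rounds (?S' n) \<le> C * rounds (S n) \<and> rounds (S n) \<le> C * rounds (?S' n) \<and>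
            alphabet (?S' n) \<le> C * alphabet (S n) \<and> alphabet (S n) \<le> C * alphabet (?S' n)" for n
    proof -
      have "rounds (?S' n) = 7 * d * rounds (S n)" "alphabet (?S' n) = Z * alphabet (S n)"
        unfolding Z_def by (rule boosted.S'_simps[OF b])+
      moreover have "7 * d * rounds (S n) \<le> C * rounds (S n)" "Z * alphabet (S n) \<le> C * alphabet (S n)"
        by (rule mult_right_mono[OF C(1)], simp) (rule mult_right_mono[OF C(2)], simp)
      moreover have "1 * rounds (S n) \<le> C * (7 * d) * rounds (S n)" "1 * alphabet (S n) \<le> C * Z * alphabet (S n)"
        by (rule mult_right_mono[OF C(4)], simp) (rule mult_right_mono[OF C(5)], simp)
      ultimately show ?thesis
        using boosted.coding_scheme_S'[OF b] boosted.uniquely_decodes_S'[OF b] by (simp only: mult.assoc mult_1)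
    qed
    ultimately show "\<exists>S' :: nat \<Rightarrow> scheme.
       (\<forall>n. coding_scheme q n (S' n) \<and>
            uniquely_decodes q n (2 / 7 - 2 * \<epsilon>) (S' n) \<and>
            rounds (S' n) \<le> C * rounds (S n) \<and> rounds (S n) \<le> C * rounds (S' n) \<and>
            alphabet (S' n) \<le> C * alphabet (S n) \<and> alphabet (S n) \<le> C * alphabet (S' n)) \<and>
       computable_within q S' (\<lambda>n. C * T n)" by (intro exI[of _ ?S']) blast
  qed
qed

end
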